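(* Let $(R,\mathfrak m)$ be a commutative noetherian local ring, and let $(B,B_+,k)$ be a bounded local DG $R$-algebra. Set $A=B\ltimes\Sigma^nk$ for some $n\geq 1$. Let $X$ and $Y$ be non-zero homologically finite DG $A$-modules such that $\operatorname{Tor}^A_i(X,Y)=0$ for all $i\gg 0$. Then $\operatorname{pd}_A(X)<\infty$ or $\operatorname{pd}_A(Y)<\infty$.
   Context: DG algebras are indexed homologically, non-negatively graded, and graded commutative (with squares of odd-degree elements equal to zero). A DG algebra is bounded if it is zero in all sufficiently large degrees. A DG $R$-algebra $A$ is homologically degree-wise noetherian if $\operatorname{H}_0(A)$ is noetherian and each $\operatorname{H}_i(A)$ is a finitely generated $\operatorname{H}_0(A)$-module. Over the local ring $(R,\mathfrak m)$, $A$ is local if it is homologically degree-wise noetherian and $\operatorname{H}_0(A)$ is a local $R$-algebra (a local ring whose maximal ideal contains $\mathfrak m\operatorname{H}_0(A)$). The augmentation ideal $\mathfrak m_A$ of a local DG algebra $A$ is the kernel of the composite surjection from $A$ to $\operatorname{H}_0(A)$ and then to the residue field of $\operatorname{H}_0(A)$. The notation $(B,B_+,k)$ means that $B$ is local with augmentation ideal equal to $B_+=\bigoplus_{i>0}B_i$ and with $k=B/B_+$; in particular $B_0=k$ is a field. $\Sigma^n$ is the $n$th shift. For a DG $B$-module $M$, the trivial extension $B\ltimes M$ is the DG algebra with underlying complex $B\oplus M$ and product $(b,m)(b',m')=(bb',\,bm'+(-1)^{|m||b'|}b'm)$; here $k$ is a DG $B$-module via $B\to B/B_+=k$. A DG $A$-module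 $X$ is homologically finite if $\operatorname{H}_i(X)=0$ for all but finitely many $i$ and each $\operatorname{H}_i(X)$ is finitely generated over $\operatorname{H}_0(A)$. We set $\operatorname{Tor}^A_i(X,Y)=\operatorname{H}_i(X\otimes^{\mathbf L}_AY)$. We write $\operatorname{pd}_A(X)<\infty$ if $X$ has a bounded semi-free resolution, i.e., a quasiisomorphism $F\to X$ with $F$ a semi-free DG $A$-module that is bounded. *)

theory Defs
  imports
    "HOL-Algebra.Module"
    "HOL-Algebra.QuotRing"
    "HOL-Algebra.Ring_Divisibility"
    "HOL-Algebra.Generated_Groups"
    "HOL-Algebra.Free_Abelian_Groups"
begin

section \<open>Local rings and finitely generated modules\<close>

definition local_ring :: "('a, 'm) ring_scheme \<Rightarrow> 'a set \<Rightarrow> bool" where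
  "local_ring S M \<longleftrightarrow>
     cring S \<and> maximalideal M S \<and> (\<forall>J. maximalideal J S \<longrightarrow> J = M)"

definition max_ideal :: "('a, 'm) ring_scheme \<Rightarrow> 'a set" where
  "max_ideal S = (THE M. maximalideal M S)"

definition fin_gen_module :: "('a, 'm) ring_scheme \<Rightarrow> ('a, 'b, 'n) module_scheme \<Rightarrow> bool" where
  "fin_gen_module S M \<longleftrightarrow>
     module S M \<and>
     (\<exists>G \<subseteq> carrier M. finite G \<and>
        (\<forall>x \<in> carrier M. \<exists>c \<in> G \<rightarrow> carrier S. x = (\<Oplus>\<^bsub>M\<^esub>g\<in>G. c g \<odot>\<^bsub>M\<^esub> g)))"

definition zero_module :: "('b, 'n) ring_scheme \<Rightarrow> bool" where
  "zero_module M \<longleftrightarrow> carrier M = {\<zero>\<^bsub>M\<^esub>}"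

section \<open>DG algebras and DG modules\<close>

text \<open>
  A graded object is the family of its homogeneous components, indexed by \<open>int\<close>; the component
  \<open>gr X i\<close> is an \<open>R\<close>-module and \<open>dd X i\<close> maps degree \<open>i\<close> to degree \<open>i - 1\<close>.  Products and actions are
  given on homogeneous elements, with the degrees of the two arguments as first arguments.
  The fields \<^const>\<open>mult\<close> and \<^const>\<open>one\<close> which the type of modules inherits
  from rings carry no information for the components.
\<close>

record ('r, 'x) dg_cplx =
  gr :: "int \<Rightarrow> ('r, 'x) module"
  dd :: "int \<Rightarrow> 'x \<Rightarrow> 'x"

record ('r, 'a) dg_alg = "('r, 'a) dg_cplx" +
  mul :: "int \<Rightarrow> int \<Rightarrow> 'a \<Rightarrow> 'a \<Rightarrow> 'a"
  unt :: 'a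

record ('r, 'a, 'x) dg_mod = "('r, 'x) dg_cplx" +
  act :: "int \<Rightarrow> int \<Rightarrow> 'a \<Rightarrow> 'x \<Rightarrow> 'x"

text \<open>The sign \<open>(-1)\<^sup>i x\<close>.\<close>

definition ksign :: "('b, 'n) ring_scheme \<Rightarrow> int \<Rightarrow> 'b \<Rightarrow> 'b" where
  "ksign M i x = (if even i then x else \<ominus>\<^bsub>M\<^esub> x)"

locale dg_complex = cring R for R :: "('r, 's) ring_scheme" (structure) +
  fixes X :: "('r, 'x, 'm) dg_cplx_scheme"
  assumes component: "module R (gr X i)"
    and d_closed: "x \<in> carrier (gr X i) \<Longrightarrow> dd X i x \<in> carrier (gr X (i - 1))"
    and d_add: "\<lbrakk>x \<in> carrier (gr X i); y \<in> carrier (gr X i)\<rbrakk> \<Longrightarrow>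
      dd X i (x \<oplus>\<^bsub>gr X i\<^esub> y) = dd X i x \<oplus>\<^bsub>gr X (i - 1)\<^esub> dd X i y"
    and d_smult: "\<lbrakk>r \<in> carrier R; x \<in> carrier (gr X i)\<rbrakk> \<Longrightarrow>
      dd X i (r \<odot>\<^bsub>gr X i\<^esub> x) = r \<odot>\<^bsub>gr X (i - 1)\<^esub> dd X i x"
    and d_d: "x \<in> carrier (gr X i) \<Longrightarrow> dd X (i - 1) (dd X i x) = \<zero>\<^bsub>gr X (i - 2)\<^esub>"

locale dg_algebra = dg_complex R A
  for R :: "('r, 's) ring_scheme" (structure) and A :: "('r, 'a, 'm) dg_alg_scheme" +
  assumes nonneg: "i < 0 \<Longrightarrow> zero_module (gr A i)"
    and mul_closed: "\<lbrakk>a \<in> carrier (gr A i); b \<in> carrier (gr A j)\<rbrakk> \<Longrightarrow>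
      mul A i j a b \<in> carrier (gr A (i + j))"
    and mul_add_left: "\<lbrakk>a \<in> carrier (gr A i); a' \<in> carrier (gr A i); b \<in> carrier (gr A j)\<rbrakk> \<Longrightarrow>
      mul A i j (a \<oplus>\<^bsub>gr A i\<^esub> a') b = mul A i j a b \<oplus>\<^bsub>gr A (i + j)\<^esub> mul A i j a' b"
    and mul_add_right: "\<lbrakk>a \<in> carrier (gr A i); b \<in> carrier (gr A j); b' \<in> carrier (gr A j)\<rbrakk> \<Longrightarrow>
      mul A i j a (b \<oplus>\<^bsub>gr A j\<^esub> b') = mul A i j a b \<oplus>\<^bsub>gr A (i + j)\<^esub> mul A i j a b'"
    and mul_smult_left: "\<lbrakk>r \<in> carrier R; a \<in> carrier (gr A i); b \<in> carrier (gr A j)\<rbrakk> \<Longrightarrow>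
      mul A i j (r \<odot>\<^bsub>gr A i\<^esub> a) b = r \<odot>\<^bsub>gr A (i + j)\<^esub> mul A i j a b"
    and mul_smult_right: "\<lbrakk>r \<in> carrier R; a \<in> carrier (gr A i); b \<in> carrier (gr A j)\<rbrakk> \<Longrightarrow>
      mul A i j a (r \<odot>\<^bsub>gr A j\<^esub> b) = r \<odot>\<^bsub>gr A (i + j)\<^esub> mul A i j a b"
    and mul_assoc: "\<lbrakk>a \<in> carrier (gr A i); b \<in> carrier (gr A j); c \<in> carrier (gr A k)\<rbrakk> \<Longrightarrow>
      mul A (i + j) k (mul A i j a b) c = mul A i (j + k) a (mul A j k b c)"
    and unt_closed: "unt A \<in> carrier (gr A 0)"
    and mul_unt_left: "a \<in> carrier (gr A i) \<Longrightarrow> mul A 0 i (unt A) a = a"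
    and mul_unt_right: "a \<in> carrier (gr A i) \<Longrightarrow> mul A i 0 a (unt A) = a"
    and graded_commutative: "\<lbrakk>a \<in> carrier (gr A i); b \<in> carrier (gr A j)\<rbrakk> \<Longrightarrow>
      mul A i j a b = ksign (gr A (i + j)) (i * j) (mul A j i b a)"
    and odd_square: "\<lbrakk>odd i; a \<in> carrier (gr A i)\<rbrakk> \<Longrightarrow> mul A i i a a = \<zero>\<^bsub>gr A (i + i)\<^esub>"
    and leibniz: "\<lbrakk>a \<in> carrier (gr A i); b \<in> carrier (gr A j)\<rbrakk> \<Longrightarrow>
      dd A (i + j) (mul A i j a b) =
        mul A (i - 1) j (dd A i a) b
          \<oplus>\<^bsub>gr A (i + j - 1)\<^esub> ksign (gr A (i + j - 1)) i (mul A i (j - 1) a (dd A j b))"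

locale dg_module = algebra?: dg_algebra R A + cplx?: dg_complex R X
  for R :: "('r, 's) ring_scheme" (structure) and A :: "('r, 'a, 'm) dg_alg_scheme"
    and X :: "('r, 'a, 'x, 'n) dg_mod_scheme" +
  assumes act_closed: "\<lbrakk>a \<in> carrier (gr A i); x \<in> carrier (gr X j)\<rbrakk> \<Longrightarrow>
      act X i j a x \<in> carrier (gr X (i + j))"
    and act_add_left: "\<lbrakk>a \<in> carrier (gr A i); a' \<in> carrier (gr A i); x \<in> carrier (gr X j)\<rbrakk> \<Longrightarrow>
      act X i j (a \<oplus>\<^bsub>gr A i\<^esub> a') x = act X i j a x \<oplus>\<^bsub>gr X (i + j)\<^esub> act X i j a' x"
    and act_add_right: "\<lbrakk>a \<in> carrier (gr A i); x \<in> carrier (gr X j); x' \<in> carrier (gr X j)\<rbrakk> \<Longrightarrow>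
      act X i j a (x \<oplus>\<^bsub>gr X j\<^esub> x') = act X i j a x \<oplus>\<^bsub>gr X (i + j)\<^esub> act X i j a x'"
    and act_smult_left: "\<lbrakk>r \<in> carrier R; a \<in> carrier (gr A i); x \<in> carrier (gr X j)\<rbrakk> \<Longrightarrow>
      act X i j (r \<odot>\<^bsub>gr A i\<^esub> a) x = r \<odot>\<^bsub>gr X (i + j)\<^esub> act X i j a x"
    and act_smult_right: "\<lbrakk>r \<in> carrier R; a \<in> carrier (gr A i); x \<in> carrier (gr X j)\<rbrakk> \<Longrightarrow>
      act X i j a (r \<odot>\<^bsub>gr X j\<^esub> x) = r \<odot>\<^bsub>gr X (i + j)\<^esub> act X i j a x"
    and act_assoc: "\<lbrakk>a \<in> carrier (gr A i); b \<in> carrier (gr A j); x \<in> carrier (gr X k)\<rbrakk> \<Longrightarrow>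
      act X (i + j) k (mul A i j a b) x = act X i (j + k) a (act X j k b x)"
    and act_unt: "x \<in> carrier (gr X j) \<Longrightarrow> act X 0 j (unt A) x = x"
    and act_leibniz: "\<lbrakk>a \<in> carrier (gr A i); x \<in> carrier (gr X j)\<rbrakk> \<Longrightarrow>
      dd X (i + j) (act X i j a x) =
        act X (i - 1) j (dd A i a) x
          \<oplus>\<^bsub>gr X (i + j - 1)\<^esub> ksign (gr X (i + j - 1)) i (act X i (j - 1) a (dd X j x))"

definition regular_dg_module :: "('r, 'a, 'm) dg_alg_scheme \<Rightarrow> ('r, 'a, 'a) dg_mod" where
  "regular_dg_module A = \<lparr>gr = gr A, dd = dd A, act = mul A\<rparr>"

definition bounded_dg_algebra :: "('r, 'a, 'm) dg_alg_scheme \<Rightarrow> bool" where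
  "bounded_dg_algebra A \<longleftrightarrow> (\<exists>N. \<forall>i > N. zero_module (gr A i))"

definition bounded_dg_module :: "('r, 'a, 'x, 'n) dg_mod_scheme \<Rightarrow> bool" where
  "bounded_dg_module X \<longleftrightarrow> (\<exists>N. \<forall>i. \<bar>i\<bar> > N \<longrightarrow> zero_module (gr X i))"

definition nonzero_dg_module :: "('r, 'a, 'x, 'n) dg_mod_scheme \<Rightarrow> bool" where
  "nonzero_dg_module X \<longleftrightarrow> (\<exists>i. \<not> zero_module (gr X i))"

section \<open>Homology\<close>

definition cycles :: "('r, 'x, 'm) dg_cplx_scheme \<Rightarrow> int \<Rightarrow> 'x set" where
  "cycles X i = {x \<in> carrier (gr X i). dd X i x = \<zero>\<^bsub>gr X (i - 1)\<^esub>}"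

definition boundaries :: "('r, 'x, 'm) dg_cplx_scheme \<Rightarrow> int \<Rightarrow> 'x set" where
  "boundaries X i = dd X (i + 1) ` carrier (gr X (i + 1))"

definition ring0 :: "('r, 'a, 'm) dg_alg_scheme \<Rightarrow> 'a ring" where
  "ring0 A = \<lparr>carrier = carrier (gr A 0), monoid.mult = mul A 0 0, one = unt A,
              ring.zero = \<zero>\<^bsub>gr A 0\<^esub>, add = add (gr A 0)\<rparr>"

text \<open>As \<open>A\<close> lives in non-negative degrees, every element of degree 0 is a cycle.\<close>

definition H0 :: "('r, 'a, 'm) dg_alg_scheme \<Rightarrow> 'a set ring" where
  "H0 A = ring0 A Quot boundaries A 0"

text \<open>\<open>H\<^sub>i(X)\<close> as a module over \<open>H\<^sub>0(A)\<close>.\<close>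

definition homology ::
    "('r, 'a, 'x, 'n) dg_mod_scheme \<Rightarrow> int \<Rightarrow> ('a set, 'x set) module" where
  "homology X i =
     \<lparr>carrier = (\<lambda>x. boundaries X i +>\<^bsub>gr X i\<^esub> x) ` cycles X i,
      monoid.mult = undefined, one = undefined,
      ring.zero = boundaries X i,
      ring.add = set_add (gr X i),
      smult = (\<lambda>a C. \<Union>b\<in>a. \<Union>x\<in>C. boundaries X i +>\<^bsub>gr X i\<^esub> act X 0 i b x)\<rparr>"

definition homologically_finite ::
    "('r, 'a, 'm) dg_alg_scheme \<Rightarrow> ('r, 'a, 'x, 'n) dg_mod_scheme \<Rightarrow> bool" where
  "homologically_finite A X \<longleftrightarrow>
     finite {i. \<not> zero_module (homology X i)} \<and>
     (\<forall>i. fin_gen_module (H0 A) (homology X i))"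

definition homologically_degreewise_noetherian :: "('r, 'a, 'm) dg_alg_scheme \<Rightarrow> bool" where
  "homologically_degreewise_noetherian A \<longleftrightarrow>
     noetherian_ring (H0 A) \<and>
     (\<forall>i. fin_gen_module (H0 A) (homology (regular_dg_module A) i))"

section \<open>Local DG algebras\<close>

text \<open>
  \<open>\<mm>\<close> is the maximal ideal of the base ring \<open>R\<close>; the last clause says that the maximal ideal of
  \<open>H\<^sub>0(A)\<close> contains \<open>\<mm> H\<^sub>0(A)\<close>.
\<close>

definition local_dg_algebra ::
    "('r, 's) ring_scheme \<Rightarrow> 'r set \<Rightarrow> ('r, 'a, 'm) dg_alg_scheme \<Rightarrow> bool" where
  "local_dg_algebra R \<mm> A \<longleftrightarrow>
     dg_algebra R A \<and>
     homologically_degreewise_noetherian A \<and>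
     local_ring (H0 A) (max_ideal (H0 A)) \<and>
     (\<forall>r \<in> \<mm>. boundaries A 0 +>\<^bsub>gr A 0\<^esub> (r \<odot>\<^bsub>gr A 0\<^esub> unt A) \<in> max_ideal (H0 A))"

text \<open>The degree \<open>i\<close> part of the kernel of \<open>A \<rightarrow> H\<^sub>0(A) \<rightarrow> H\<^sub>0(A) / max_ideal (H\<^sub>0(A))\<close>.\<close>

definition augmentation_ideal :: "('r, 'a, 'm) dg_alg_scheme \<Rightarrow> int \<Rightarrow> 'a set" where
  "augmentation_ideal A i =
     (if i = 0 then {a \<in> carrier (gr A 0). boundaries A 0 +>\<^bsub>gr A 0\<^esub> a \<in> max_ideal (H0 A)}
      else carrier (gr A i))"

definition positive_part :: "('r, 'a, 'm) dg_alg_scheme \<Rightarrow> int \<Rightarrow> 'a set" where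
  "positive_part A i = (if i > 0 then carrier (gr A i) else {\<zero>\<^bsub>gr A i\<^esub>})"

text \<open>The data \<open>(B, B\<^sub>+, k)\<close>: the augmentation ideal is \<open>B\<^sub>+\<close>, hence \<open>k = B / B\<^sub>+\<close> is \<open>B\<^sub>0\<close>.\<close>

definition local_dg_algebra_plus ::
    "('r, 's) ring_scheme \<Rightarrow> 'r set \<Rightarrow> ('r, 'a, 'm) dg_alg_scheme \<Rightarrow> bool" where
  "local_dg_algebra_plus R \<mm> B \<longleftrightarrow>
     local_dg_algebra R \<mm> B \<and> augmentation_ideal B = positive_part B"

text \<open>
  The DG \<open>B\<close>-module \<open>B / B\<^sub>+\<close> with \<open>B\<^sub>0 / 0\<close> identified with \<open>B\<^sub>0\<close>: it is \<open>B\<^sub>0\<close> in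
  degree 0 and zero in all other degrees, and \<open>B\<^sub>+\<close> acts as zero.
\<close>

definition residue_module :: "('r, 'a, 'm) dg_alg_scheme \<Rightarrow> ('r, 'a, 'a) dg_mod" where
  "residue_module B =
     \<lparr>gr = (\<lambda>i. if i = 0 then gr B 0 else (gr B i)\<lparr>carrier := {\<zero>\<^bsub>gr B i\<^esub>}\<rparr>),
      dd = (\<lambda>i x. \<zero>\<^bsub>gr B (i - 1)\<^esub>),
      act = (\<lambda>i j b x. if i = 0 \<and> j = 0 then mul B 0 0 b x else \<zero>\<^bsub>gr B (i + j)\<^esub>)\<rparr>"

section \<open>Shift and trivial extension\<close>

text \<open>
  \<open>(\<Sigma>\<^sup>n X)\<^sub>i = X\<^sub>i\<^sub>-\<^sub>n\<close>, with differential \<open>(-1)\<^sup>n d\<close> and action \<open>a \<cdot> \<Sigma>\<^sup>n x = (-1)\<^sup>n\<^sup>|\<^sup>a\<^sup>| \<Sigma>\<^sup>n (a x)\<close>.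
\<close>

definition shift :: "int \<Rightarrow> ('r, 'a, 'x, 'n) dg_mod_scheme \<Rightarrow> ('r, 'a, 'x) dg_mod" where
  "shift n X =
     \<lparr>gr = (\<lambda>i. gr X (i - n)),
      dd = (\<lambda>i x. ksign (gr X (i - n - 1)) n (dd X (i - n) x)),
      act = (\<lambda>i j a x. ksign (gr X (i + j - n)) (n * i) (act X i (j - n) a x))\<rparr>"

definition direct_sum_module ::
    "('r, 'x, 'm) module_scheme \<Rightarrow> ('r, 'y, 'n) module_scheme \<Rightarrow> ('r, 'x \<times> 'y) module" where
  "direct_sum_module M N =
     \<lparr>carrier = carrier M \<times> carrier N,
      monoid.mult = undefined, one = undefined,
      ring.zero = (\<zero>\<^bsub>M\<^esub>, \<zero>\<^bsub>N\<^esub>),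
      ring.add = (\<lambda>(x, y) (x', y'). (x \<oplus>\<^bsub>M\<^esub> x', y \<oplus>\<^bsub>N\<^esub> y')),
      smult = (\<lambda>r (x, y). (r \<odot>\<^bsub>M\<^esub> x, r \<odot>\<^bsub>N\<^esub> y))\<rparr>"

definition trivial_extension ::
    "('r, 'a, 'm) dg_alg_scheme \<Rightarrow> ('r, 'a, 'x, 'n) dg_mod_scheme \<Rightarrow> ('r, 'a \<times> 'x) dg_alg"
    (infixl \<open>\<ltimes>\<close> 65) where
  "B \<ltimes> M =
     \<lparr>gr = (\<lambda>i. direct_sum_module (gr B i) (gr M i)),
      dd = (\<lambda>i (b, m). (dd B i b, dd M i m)),
      mul = (\<lambda>i j (b, m) (b', m').
        (mul B i j b b',
         act M i j b m' \<oplus>\<^bsub>gr M (i + j)\<^esub> ksign (gr M (i + j)) (i * j) (act M j i b' m))),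
      unt = (unt B, \<zero>\<^bsub>gr M 0\<^esub>)\<rparr>"

section \<open>Semi-free resolutions\<close>

text \<open>
  A set of homogeneous elements is given by pairs (degree, element).  The coefficient families for
  elements of degree \<open>j\<close> have \<open>c (i, e)\<close> in degree \<open>j - i\<close> and finite support.
\<close>

definition coeff_support ::
    "('r, 'a, 'm) dg_alg_scheme \<Rightarrow> int \<Rightarrow> (int \<times> 'x) set \<Rightarrow> (int \<times> 'x \<Rightarrow> 'a) \<Rightarrow> (int \<times> 'x) set" where
  "coeff_support A j E c = {p \<in> E. c p \<noteq> \<zero>\<^bsub>gr A (j - fst p)\<^esub>}"

definition coeff_families ::
    "('r, 'a, 'm) dg_alg_scheme \<Rightarrow> int \<Rightarrow> (int \<times> 'x) set \<Rightarrow> (int \<times> 'x \<Rightarrow> 'a) set" where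
  "coeff_families A j E =
     {c \<in> (\<Pi>\<^sub>E p\<in>E. carrier (gr A (j - fst p))). finite (coeff_support A j E c)}"

definition lin_comb ::
    "('r, 'a, 'm) dg_alg_scheme \<Rightarrow> ('r, 'a, 'x, 'n) dg_mod_scheme \<Rightarrow> int \<Rightarrow>
     (int \<times> 'x) set \<Rightarrow> (int \<times> 'x \<Rightarrow> 'a) \<Rightarrow> 'x" where
  "lin_comb A X j E c =
     (\<Oplus>\<^bsub>gr X j\<^esub>p\<in>coeff_support A j E c. act X (j - fst p) (fst p) (c p) (snd p))"

text \<open>
  \<open>E\<close> is a basis of the underlying graded \<open>A\<close>-module of \<open>F\<close>, filtered by a level function \<open>l\<close> with
  values in the natural numbers such that the differential of a basis element is a combination of
  basis elements of smaller level.
\<close>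

definition semibasis ::
    "('r, 'a, 'm) dg_alg_scheme \<Rightarrow> ('r, 'a, 'x, 'n) dg_mod_scheme \<Rightarrow> (int \<times> 'x) set \<Rightarrow> bool" where
  "semibasis A F E \<longleftrightarrow>
     (\<forall>(i, e) \<in> E. e \<in> carrier (gr F i)) \<and>
     (\<forall>j. \<forall>x \<in> carrier (gr F j). \<exists>!c. c \<in> coeff_families A j E \<and> x = lin_comb A F j E c) \<and>
     (\<exists>l :: int \<times> 'x \<Rightarrow> nat. \<forall>(i, e) \<in> E. \<exists>c \<in> coeff_families A (i - 1) E.
        dd F i e = lin_comb A F (i - 1) E c \<and>
        (\<forall>p \<in> coeff_support A (i - 1) E c. l p < l (i, e)))"

definition semifree ::
    "('r, 's) ring_scheme \<Rightarrow> ('r, 'a, 'm) dg_alg_scheme \<Rightarrow> ('r, 'a, 'x, 'n) dg_mod_scheme \<Rightarrow> bool" where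
  "semifree R A F \<longleftrightarrow> dg_module R A F \<and> (\<exists>E. semibasis A F E)"

definition dg_hom ::
    "('r, 'a, 'm) dg_alg_scheme \<Rightarrow> ('r, 'a, 'x, 'n) dg_mod_scheme \<Rightarrow> ('r, 'a, 'y, 'p) dg_mod_scheme \<Rightarrow>
     (int \<Rightarrow> 'x \<Rightarrow> 'y) set" where
  "dg_hom A X Y = {f. \<forall>i. \<forall>x \<in> carrier (gr X i).
     f i x \<in> carrier (gr Y i) \<and>
     (\<forall>x' \<in> carrier (gr X i). f i (x \<oplus>\<^bsub>gr X i\<^esub> x') = f i x \<oplus>\<^bsub>gr Y i\<^esub> f i x') \<and>
     (\<forall>j. \<forall>a \<in> carrier (gr A j). f (j + i) (act X j i a x) = act Y j i a (f i x)) \<and>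
     f (i - 1) (dd X i x) = dd Y i (f i x)}"

definition homology_map ::
    "('r, 'a, 'y, 'p) dg_mod_scheme \<Rightarrow> (int \<Rightarrow> 'x \<Rightarrow> 'y) \<Rightarrow> int \<Rightarrow> 'x set \<Rightarrow> 'y set" where
  "homology_map Y f i C = (\<Union>x\<in>C. boundaries Y i +>\<^bsub>gr Y i\<^esub> f i x)"

definition quasi_iso ::
    "('r, 'a, 'm) dg_alg_scheme \<Rightarrow> ('r, 'a, 'x, 'n) dg_mod_scheme \<Rightarrow> ('r, 'a, 'y, 'p) dg_mod_scheme \<Rightarrow>
     (int \<Rightarrow> 'x \<Rightarrow> 'y) \<Rightarrow> bool" where
  "quasi_iso A X Y f \<longleftrightarrow>
     f \<in> dg_hom A X Y \<and>
     (\<forall>i. bij_betw (homology_map Y f i) (carrier (homology X i)) (carrier (homology Y i)))"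

definition semifree_resolution ::
    "('r, 's) ring_scheme \<Rightarrow> ('r, 'a, 'm) dg_alg_scheme \<Rightarrow> ('r, 'a, 'x, 'n) dg_mod_scheme \<Rightarrow>
     ('r, 'a, 'f, 'p) dg_mod_scheme \<Rightarrow> bool" where
  "semifree_resolution R A X F \<longleftrightarrow> semifree R A F \<and> (\<exists>f. quasi_iso A F X f)"

text \<open>
  HOL cannot quantify over the element type of a resolution inside a formula, so a type that is large
  enough is fixed.  With \<open>\<kappa> = max(|A|, |X|, \<aleph>\<^sub>0)\<close>, a semi-free module on at most \<open>\<kappa>\<close> generators has at
  most \<open>\<kappa>\<close> elements and therefore fits into the type below (even into \<open>nat \<times> 'a \<times> 'x\<close>; functions
  allow for coefficient families).  Every \<open>X\<close> has a semi-free resolution with at most \<open>\<kappa>\<close> generators,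
  and every semi-free resolution of \<open>X\<close> contains one whose semibasis is a subset of the given one of
  size at most \<open>\<kappa>\<close> (close a subset up under differentials and under bounding the cycles that become
  boundaries in \<open>X\<close>), which is bounded above and below if the given one is.
\<close>

type_synonym ('r, 'a, 'x) resolution = "('r, 'a, nat \<times> 'a \<times> 'x \<Rightarrow> 'a) dg_mod"

definition pd_finite ::
    "('r, 's) ring_scheme \<Rightarrow> ('r, 'a, 'm) dg_alg_scheme \<Rightarrow> ('r, 'a, 'x, 'n) dg_mod_scheme \<Rightarrow> bool" where
  "pd_finite R A X \<longleftrightarrow>
     (\<exists>F :: ('r, 'a, 'x) resolution. semifree_resolution R A X F \<and> bounded_dg_module F)"

section \<open>Tensor products and Tor\<close>

text \<open>
  \<open>(X \<otimes>\<^sub>A Y)\<^sub>n\<close> is the free abelian group on the symbols \<open>(i, x, y)\<close>, standing for \<open>x \<otimes> y\<close> with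
  \<open>|x| = i\<close> and \<open>|y| = n - i\<close>, modulo biadditivity and \<open>x a \<otimes> y = x \<otimes> a y\<close>, where
  \<open>x a = (-1)\<^sup>|\<^sup>x\<^sup>|\<^sup>|\<^sup>a\<^sup>| a x\<close>.
\<close>

definition tensor_gens ::
    "('r, 'a, 'x, 'n) dg_mod_scheme \<Rightarrow> ('r, 'a, 'y, 'p) dg_mod_scheme \<Rightarrow> int \<Rightarrow> (int \<times> 'x \<times> 'y) set" where
  "tensor_gens X Y n = {(i, x, y). x \<in> carrier (gr X i) \<and> y \<in> carrier (gr Y (n - i))}"

definition tensor_rels ::
    "('r, 'a, 'm) dg_alg_scheme \<Rightarrow> ('r, 'a, 'x, 'n) dg_mod_scheme \<Rightarrow> ('r, 'a, 'y, 'p) dg_mod_scheme \<Rightarrow>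
     int \<Rightarrow> ((int \<times> 'x \<times> 'y) \<Rightarrow>\<^sub>0 int) set" where
  "tensor_rels A X Y n =
     {frag_of (i, x \<oplus>\<^bsub>gr X i\<^esub> x', y) - frag_of (i, x, y) - frag_of (i, x', y) | i x x' y.
        x \<in> carrier (gr X i) \<and> x' \<in> carrier (gr X i) \<and> y \<in> carrier (gr Y (n - i))} \<union>
     {frag_of (i, x, y \<oplus>\<^bsub>gr Y (n - i)\<^esub> y') - frag_of (i, x, y) - frag_of (i, x, y') | i x y y'.
        x \<in> carrier (gr X i) \<and> y \<in> carrier (gr Y (n - i)) \<and> y' \<in> carrier (gr Y (n - i))} \<union>
     {frag_of (p + i, ksign (gr X (p + i)) (i * p) (act X p i a x), y)
        - frag_of (i, x, act Y p (n - i - p) a y) | p i a x y.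
        a \<in> carrier (gr A p) \<and> x \<in> carrier (gr X i) \<and> y \<in> carrier (gr Y (n - i - p))}"

definition tensor_free ::
    "('r, 'a, 'x, 'n) dg_mod_scheme \<Rightarrow> ('r, 'a, 'y, 'p) dg_mod_scheme \<Rightarrow> int \<Rightarrow>
     ((int \<times> 'x \<times> 'y) \<Rightarrow>\<^sub>0 int) monoid" where
  "tensor_free X Y n = free_Abelian_group (tensor_gens X Y n)"

definition tensor_null ::
    "('r, 'a, 'm) dg_alg_scheme \<Rightarrow> ('r, 'a, 'x, 'n) dg_mod_scheme \<Rightarrow> ('r, 'a, 'y, 'p) dg_mod_scheme \<Rightarrow>
     int \<Rightarrow> ((int \<times> 'x \<times> 'y) \<Rightarrow>\<^sub>0 int) set" where
  "tensor_null A X Y n = generate (tensor_free X Y n) (tensor_rels A X Y n)"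

text \<open>The map from classes in degree \<open>m\<close> to classes in degree \<open>n\<close> induced by \<open>h\<close> on symbols.\<close>

definition tensor_map ::
    "('r, 'a, 'm) dg_alg_scheme \<Rightarrow> ('r, 'a, 'x, 'n) dg_mod_scheme \<Rightarrow> ('r, 'a, 'y, 'p) dg_mod_scheme \<Rightarrow>
     int \<Rightarrow> (int \<times> 'x \<times> 'y \<Rightarrow> (int \<times> 'x \<times> 'y) \<Rightarrow>\<^sub>0 int) \<Rightarrow>
     ((int \<times> 'x \<times> 'y) \<Rightarrow>\<^sub>0 int) set \<Rightarrow> ((int \<times> 'x \<times> 'y) \<Rightarrow>\<^sub>0 int) set" where
  "tensor_map A X Y n h C =
     (\<Union>c\<in>C. tensor_null A X Y n #>\<^bsub>tensor_free X Y n\<^esub> frag_extend h c)"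

definition tensor_product ::
    "('r, 'a, 'm) dg_alg_scheme \<Rightarrow> ('r, 'a, 'x, 'n) dg_mod_scheme \<Rightarrow> ('r, 'a, 'y, 'p) dg_mod_scheme \<Rightarrow>
     ('r, 'a, ((int \<times> 'x \<times> 'y) \<Rightarrow>\<^sub>0 int) set) dg_mod" where
  "tensor_product A X Y =
     \<lparr>gr = (\<lambda>n. let Q = tensor_free X Y n Mod tensor_null A X Y n in
        \<lparr>carrier = carrier Q,
         monoid.mult = undefined, one = undefined,
         ring.zero = \<one>\<^bsub>Q\<^esub>,
         ring.add = monoid.mult Q,
         smult = (\<lambda>r. tensor_map A X Y n (\<lambda>(i, x, y). frag_of (i, r \<odot>\<^bsub>gr X i\<^esub> x, y)))\<rparr>),
      dd = (\<lambda>n. tensor_map A X Y (n - 1) (\<lambda>(i, x, y).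
        frag_of (i - 1, dd X i x, y)
          + frag_cmul (if even i then 1 else -1) (frag_of (i, x, dd Y (n - i) y)))),
      act = (\<lambda>p n a. tensor_map A X Y (p + n) (\<lambda>(i, x, y). frag_of (p + i, act X p i a x, y)))\<rparr>"

text \<open>
  Up to quasi-isomorphism the derived tensor product does not depend on the semi-free resolution
  that is chosen.
\<close>

definition derived_tensor_product ::
    "('r, 's) ring_scheme \<Rightarrow> ('r, 'a, 'm) dg_alg_scheme \<Rightarrow>
     ('r, 'a, 'x, 'n) dg_mod_scheme \<Rightarrow> ('r, 'a, 'y, 'p) dg_mod_scheme \<Rightarrow>
     ('r, 'a, ((int \<times> (nat \<times> 'a \<times> 'x \<Rightarrow> 'a) \<times> 'y) \<Rightarrow>\<^sub>0 int) set) dg_mod" where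
  "derived_tensor_product R A X Y =
     tensor_product A (SOME F :: ('r, 'a, 'x) resolution. semifree_resolution R A X F) Y"

definition Tor ::
    "('r, 's) ring_scheme \<Rightarrow> ('r, 'a, 'm) dg_alg_scheme \<Rightarrow> int \<Rightarrow>
     ('r, 'a, 'x, 'n) dg_mod_scheme \<Rightarrow> ('r, 'a, 'y, 'p) dg_mod_scheme \<Rightarrow>
     ('a set, ((int \<times> (nat \<times> 'a \<times> 'x \<Rightarrow> 'a) \<times> 'y) \<Rightarrow>\<^sub>0 int) set set) module" where
  "Tor R A i X Y = homology (derived_tensor_product R A X Y) i"

end

theory Submission
  imports Defs
begin

text \<open>
  Write \<open>k = B\<^sub>0\<close>. The algebra \<open>A = B \<ltimes> \<Sigma>\<^sup>n k\<close> is bounded, its degree zero part is the field \<open>k\<close>, and \<open>\<Sigma>\<^sup>n k\<close> is a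
  direct summand of its augmentation ideal \<open>A\<^sub>+\<close>, spanned by an element \<open>j0\<close> that \<open>A\<^sub>+\<close> annihilates.

  Let \<open>F \<rightarrow> X\<close> and \<open>G \<rightarrow> Y\<close> be minimal semi-free resolutions, that is, resolutions with \<open>d F \<subseteq> A\<^sub>+ F\<close> and
  \<open>d G \<subseteq> A\<^sub>+ G\<close> (\<open>ex_minimal_resolution\<close>). If the basis of \<open>F\<close> has bounded degrees then \<open>F\<close> is bounded, and \<open>X\<close> has
  finite projective dimension. Otherwise there is a basis element \<open>v\<close> of some degree \<open>i\<close> above the homology of \<open>X\<close>. Cut
  \<open>F\<close> above \<open>v\<close>: let \<open>L\<close> be the submodule on the basis elements of degree at most \<open>i + 1\<close>, and let \<open>K\<close> be the kernel of its
  surjection onto a truncation of \<open>F\<close> that is quasi-isomorphic to \<open>X\<close>. In high degrees both \<open>Tor(Y, X)\<close> and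
  \<open>Tor(Y, L)\<close> vanish, the latter because the basis of \<open>L\<close> has bounded degrees; hence so does \<open>Tor(Y, K)\<close>. But \<open>K\<close>
  contains \<open>j0 v\<close>, which spans a direct summand \<open>\<Sigma>\<^sup>n\<^sup>+\<^sup>i k\<close> of \<open>K\<close>. Therefore \<open>Tor(Y, k)\<close> vanishes in high degrees. By
  minimality \<open>Tor(Y, k)\<close> has a basis in bijection with that of \<open>G\<close>, so \<open>G\<close> is bounded (\<open>cells_bounded\<close>).

  Quotients such as tensor products are avoided by duality. Since \<open>\<rat>/\<int>\<close> is an injective abelian group
  (\<open>extends_to_character\<close>), vanishing of \<open>H\<^sub>t(P \<otimes>\<^sub>A U)\<close> implies that the complex of balanced forms on \<open>P \<times> U\<close> with values in
  \<open>\<rat>/\<int>\<close> is exact in degree \<open>t\<close> (\<open>perp_if_tensor_zero\<close>), and all further arguments concern forms. They are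
  symmetric in \<open>P\<close> and \<open>U\<close> (\<open>perp_swap\<close>). If \<open>P\<close> is semi-free, then forms on it are families of characters of \<open>U\<close>, one
  for each basis element; this gives exactness when \<open>U\<close> is exact (\<open>perp_if_exact\<close>) and, with mapping cones, invariance
  under quasi-isomorphisms of \<open>U\<close> (\<open>perp_quasi_iso\<close>).
\<close>

section \<open>Characters with values in the rationals modulo the integers\<close>

quotient_type qz = rat / "\<lambda>x y :: rat. x - y \<in> \<int>"
proof (rule equivpI)
  show "symp (\<lambda>x y :: rat. x - y \<in> \<int>)"
    by (rule sympI) (metis Ints_minus minus_diff_eq)
  show "transp (\<lambda>x y :: rat. x - y \<in> \<int>)"
    by (rule transpI) (metis Ints_add diff_add_cancel add_diff_eq)
qed (simp add: reflp_def)

instantiation qz :: ab_group_add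
begin
lift_definition zero_qz :: qz is 0 .
lift_definition plus_qz :: "qz \<Rightarrow> qz \<Rightarrow> qz" is "(+)"
  by (metis Ints_add add_diff_add)
lift_definition minus_qz :: "qz \<Rightarrow> qz \<Rightarrow> qz" is "(-)"
  by (metis Ints_diff diff_diff_eq2 add_diff_eq diff_add_eq diff_diff_eq add.commute)
lift_definition uminus_qz :: "qz \<Rightarrow> qz" is uminus
  by (metis Ints_minus minus_diff_minus)
instance
  by standard (transfer; simp add: algebra_simps)+
end

lift_definition zmul :: "int \<Rightarrow> qz \<Rightarrow> qz" is "\<lambda>n r. of_int n * r"
  by (metis Ints_mult Ints_of_int right_diff_distrib)

lemma zmul_simps [simp]: "zmul 0 d = 0" "zmul 1 d = d" "zmul n 0 = 0"
  by (transfer; simp)+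

lemma zmul_add: "zmul (m + n) d = zmul m d + zmul n d"
  by transfer (simp add: algebra_simps)

lemma zmul_diff: "zmul (m - n) d = zmul m d - zmul n d"
  by transfer (simp add: algebra_simps)

lemma zmul_zmul: "zmul m (zmul n d) = zmul (m * n) d"
  by transfer (simp add: algebra_simps)

lemma qz_divisible: "m \<noteq> 0 \<Longrightarrow> \<exists>e. zmul m e = d"
proof (transfer)
  fix m :: int and d :: rat assume "m \<noteq> 0"
  then show "\<exists>e. of_int m * e - d \<in> \<int>" by (intro exI[of _ "d / of_int m"]) simp
qed

text \<open>
  Non-trivial cyclic groups have non-zero characters: the value \<open>e\<close> at a generator of order \<open>m\<close> is admissible
  when \<open>m e = 0\<close>, and infinite order is \<open>m = 0\<close>.
\<close>

lemma qz_torsion: "m \<noteq> 1 \<Longrightarrow> m \<ge> 0 \<Longrightarrow> \<exists>e. e \<noteq> 0 \<and> zmul m e = 0"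
proof (transfer)
  fix m :: int assume m: "m \<noteq> 1" "m \<ge> 0"
  have ni: "1 / of_int k \<notin> (\<int> :: rat set)" if k: "k \<ge> 2" for k :: int
  proof
    assume "1 / of_int k \<in> (\<int> :: rat set)"
    then obtain z where "1 / of_int k = (of_int z :: rat)" by (auto elim: Ints_cases)
    then have "(1 :: rat) = of_int (z * k)" using k by (simp add: field_simps)
    then have "z * k = 1" using of_int_eq_1_iff by metis
    then have "k dvd 1" by (metis dvd_triv_right)
    then show False using k by simp
  qed
  \<comment> \<open>for \<open>m = 0\<close> the equation holds for every \<open>e\<close>, for example for the class of \<open>1/2\<close>, which is not zero\<close>
  define k where "k = (if m = 0 then 2 else m)"
  have k: "k \<ge> 2" using m by (auto simp: k_def)
  have "of_int m * (1 / of_int k) \<in> (\<int> :: rat set)" using m by (auto simp: k_def)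
  then show "\<exists>e :: rat. \<not> e - 0 \<in> \<int> \<and> of_int m * e - 0 \<in> \<int>"
    using ni[OF k] by (intro exI[of _ "1 / of_int k"]) simp
qed

lemma int_subgroup_cyclic:
  fixes J :: "int set"
  assumes 0: "0 \<in> J" and d: "\<And>a b. a \<in> J \<Longrightarrow> b \<in> J \<Longrightarrow> a - b \<in> J"
  obtains m where "m \<ge> 0" "J = {n. m dvd n}"
proof (cases "J = {0}")
  case True
  then show ?thesis using that[of 0] by auto
next
  case False
  have neg: "- a \<in> J" if "a \<in> J" for a using d[OF 0 that] by simp
  have add: "a + b \<in> J" if "a \<in> J" "b \<in> J" for a b using d[OF that(1) neg[OF that(2)]] by simp
  have mul: "q * a \<in> J" if "a \<in> J" for q a
    by (induction q rule: int_induct[of _ 0]) (use 0 that add d in \<open>auto simp: algebra_simps\<close>)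
  obtain a where a: "a \<in> J" "a > 0"
  proof -
    obtain a where "a \<in> J" "a \<noteq> 0" using False 0 by blast
    then show thesis using that[of a] that[of "-a"] neg by (cases "a > 0") auto
  qed
  define m where "m = (LEAST m :: nat. m > 0 \<and> int m \<in> J)"
  have m: "m > 0 \<and> int m \<in> J" unfolding m_def
    by (rule LeastI[of _ "nat a"]) (use a in auto)
  have least: "int m \<le> b" if "b \<in> J" "b > 0" for b
  proof -
    have "m \<le> nat b" unfolding m_def by (rule Least_le) (use that in auto)
    then show ?thesis using that by simp
  qed
  have "int m dvd n" if "n \<in> J" for n
  proof -
    have "n mod int m = n - (n div int m) * int m" by (simp add: minus_div_mult_eq_mod)
    then have "n mod int m \<in> J" using d[OF that mul] m by auto
    moreover have "n mod int m < int m" "n mod int m \<ge> 0" using m by auto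
    ultimately have "n mod int m = 0" using least[of "n mod int m"] by force
    then show ?thesis by auto
  qed
  moreover have "n \<in> J" if "int m dvd n" for n
    using mul[of "int m"] m that by (auto simp: mult.commute dvd_def)
  ultimately show ?thesis using that[of "int m"] by auto
qed

text \<open>
  The graph of a homomorphism from a subgroup of \<open>G\<close> to \<open>\<rat>/\<int>\<close>. Working with graphs turns the extension of
  homomorphisms into an inclusion of sets, to which Zorn's lemma applies.
\<close>

locale char_graph = comm_group G for G (structure) +
  fixes M :: "('a \<times> qz) set"
  assumes M_carrier: "(x, d) \<in> M \<Longrightarrow> x \<in> carrier G"
    and M_one: "(\<one>, 0) \<in> M"
    and M_diff: "(x, d) \<in> M \<Longrightarrow> (y, e) \<in> M \<Longrightarrow> (x \<otimes> inv y, d - e) \<in> M"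
    and M_single: "(\<one>, d) \<in> M \<Longrightarrow> d = 0"
begin

lemma M_unique: "(x, d) \<in> M \<Longrightarrow> (x, e) \<in> M \<Longrightarrow> d = e"
  using M_diff[of x d x e] M_single[of "d - e"] M_carrier[of x d] by simp

lemma M_inv: "(x, d) \<in> M \<Longrightarrow> (inv x, - d) \<in> M"
  using M_diff[OF M_one, of x d] M_carrier[of x d] by simp

lemma M_mult: "(x, d) \<in> M \<Longrightarrow> (y, e) \<in> M \<Longrightarrow> (x \<otimes> y, d + e) \<in> M"
  using M_diff[OF _ M_inv, of x d y e] M_carrier[of y e] by simp

lemma M_pow: "(x, d) \<in> M \<Longrightarrow> (x [^] (k :: int), zmul k d) \<in> M"
proof (induction k rule: int_induct[of _ 0])
  case base then show ?case by (simp add: M_one)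
next
  case (step1 i)
  then show ?case using M_mult[of "x [^] i" "zmul i d" x d] M_carrier[of x d]
    by (simp add: int_pow_mult zmul_add)
next
  case (step2 i)
  then show ?case using M_diff[of "x [^] i" "zmul i d" x d] M_carrier[of x d]
    by (simp add: int_pow_diff zmul_diff)
qed

text \<open>
  The exponents \<open>n\<close> with \<open>x\<^sup>n\<close> in the domain are the multiples of some \<open>m\<close>. The value at \<open>x\<^sup>m\<close> is
  prescribed, and divisibility of \<open>\<rat>/\<int>\<close> provides an \<open>m\<close>-th part of it, which is a consistent value at \<open>x\<close>.
\<close>

lemma extend_one:
  assumes x: "x \<in> carrier G"
  obtains M' where "char_graph G M'" "M \<subseteq> M'" "\<exists>d. (x, d) \<in> M'"
proof -
  define J where "J = {n :: int. \<exists>e. (x [^] n, e) \<in> M}"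
  have "0 \<in> J" using M_one by (auto simp: J_def)
  moreover have "a - b \<in> J" if "a \<in> J" "b \<in> J" for a b
    using that M_diff x by (fastforce simp: J_def int_pow_diff)
  ultimately obtain m where m: "m \<ge> 0" "J = {n. m dvd n}" by (rule int_subgroup_cyclic)
  then have "m \<in> J" by simp
  then obtain e0 where e0: "(x [^] m, e0) \<in> M" by (auto simp: J_def)
  obtain d where d: "zmul m d = e0"
  proof (cases "m = 0")
    case True then show thesis using that[of 0] e0 M_single by simp
  next
    case False then show thesis using qz_divisible that by blast
  qed
  have key: "e = zmul n d" if "(x [^] n, e) \<in> M" for n e
  proof -
    have "n \<in> J" using that by (auto simp: J_def)
    then obtain q where q: "n = m * q" using m by auto
    have "(x [^] n, zmul q e0) \<in> M" using M_pow[OF e0, of q] x by (simp add: q int_pow_pow mult.commute)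
    then have "e = zmul q e0" by (rule M_unique[OF that])
    then show ?thesis by (simp add: q zmul_zmul mult.commute flip: d)
  qed
  define M' where "M' = {(y \<otimes> x [^] (n :: int), e + zmul n d) | y e n. (y, e) \<in> M}"
  have M'I: "z = y \<otimes> x [^] n \<Longrightarrow> f = e + zmul n d \<Longrightarrow> (y, e) \<in> M \<Longrightarrow> (z, f) \<in> M'" for z f y e n
    by (auto simp: M'_def)
  have "char_graph G M'"
  proof
    fix z f assume "(z, f) \<in> M'" then show "z \<in> carrier G" using M_carrier x by (auto simp: M'_def)
  next
    show "(\<one>, 0) \<in> M'" by (rule M'I[of _ \<one> 0 _ 0]) (auto simp: M_one)
  next
    fix z f w g assume "(z, f) \<in> M'" "(w, g) \<in> M'"
    then obtain y e n y' e' n' where *: "z = y \<otimes> x [^] n" "f = e + zmul n d" "(y, e) \<in> M"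
      "w = y' \<otimes> x [^] n'" "g = e' + zmul n' d" "(y', e') \<in> M" by (auto simp: M'_def)
    have c: "y \<in> carrier G" "y' \<in> carrier G" using * M_carrier by auto
    show "(z \<otimes> inv w, f - g) \<in> M'"
      by (rule M'I[of _ "y \<otimes> inv y'" "n - n'" _ "e - e'"])
        (use * c x in \<open>auto simp: inv_mult int_pow_diff zmul_diff m_ac M_diff\<close>)
  next
    fix f assume "(\<one>, f) \<in> M'"
    then obtain y e n where *: "\<one> = y \<otimes> x [^] n" "f = e + zmul n d" "(y, e) \<in> M" by (auto simp: M'_def)
    have "inv y = x [^] n" using * M_carrier[of y e] x
      by (metis inv_equality int_pow_closed m_comm)
    then have "- e = zmul n d" using M_inv[OF *(3)] key by simp
    then show "f = 0" using * by (metis add.right_inverse)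
  qed
  moreover have "M \<subseteq> M'"
    using M_carrier by (auto intro!: M'I[of _ _ 0])
  moreover have "(x, d) \<in> M'" by (rule M'I[of _ \<one> 1 _ 0]) (use x M_one in auto)
  ultimately show ?thesis using that by blast
qed

text \<open>\<open>\<rat>/\<int>\<close> is an injective abelian group: a maximal extension is total because each element can be adjoined.\<close>

theorem extends_to_character:
  "\<exists>g :: 'a \<Rightarrow> qz. (\<forall>x\<in>carrier G. \<forall>y\<in>carrier G. g (x \<otimes> y) = g x + g y) \<and> (\<forall>x d. (x, d) \<in> M \<longrightarrow> g x = d)"
proof -
  let ?A = "{M'. char_graph G M' \<and> M \<subseteq> M'}"
  have "\<exists>N\<in>?A. \<forall>X\<in>?A. N \<subseteq> X \<longrightarrow> X = N"
  proof (rule subset_Zorn_nonempty)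
    show "?A \<noteq> {}" using char_graph_axioms by auto
  next
    fix C assume C: "C \<noteq> {}" "subset.chain ?A C"
    have two: "\<exists>N\<in>C. p \<in> N \<and> q \<in> N" if "p \<in> \<Union>C" "q \<in> \<Union>C" for p q
    proof -
      obtain P Q where PQ: "P \<in> C" "p \<in> P" "Q \<in> C" "q \<in> Q" using \<open>p \<in> \<Union>C\<close> \<open>q \<in> \<Union>C\<close> by blast
      then have "P \<subseteq> Q \<or> Q \<subseteq> P" using C(2) by (simp add: subset_chain_def)
      then show ?thesis using PQ by blast
    qed
    have N: "char_graph G N" "M \<subseteq> N" if "N \<in> C" for N using C(2) that by (auto simp: subset_chain_def)
    have "char_graph G (\<Union>C)"
    proof
      show "(\<one>, 0) \<in> \<Union>C" using C(1) N M_one by blast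
    next
      fix x d y e assume "(x, d) \<in> \<Union>C" "(y, e) \<in> \<Union>C"
      then show "(x \<otimes> inv y, d - e) \<in> \<Union>C" using two N char_graph.M_diff by (metis UnionI)
    next
      fix x d assume "(x, d) \<in> \<Union>C" then show "x \<in> carrier G" using N char_graph.M_carrier by (metis UnionE)
    next
      fix d assume "(\<one>, d) \<in> \<Union>C" then show "d = 0" using N char_graph.M_single by (metis UnionE)
    qed
    then show "\<Union>C \<in> ?A" using C(1) N by blast
  qed
  then obtain N where N: "char_graph G N" "M \<subseteq> N" and max: "\<And>X. char_graph G X \<Longrightarrow> M \<subseteq> X \<Longrightarrow> N \<subseteq> X \<Longrightarrow> X = N"
    by auto
  interpret N: char_graph G N by (rule N)
  have tot: "\<exists>d. (x, d) \<in> N" if "x \<in> carrier G" for x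
    using N.extend_one[OF that] max N by (metis subset_trans)
  define g where "g x = (SOME d. (x, d) \<in> N)" for x
  have g: "(x, g x) \<in> N" if "x \<in> carrier G" for x
    unfolding g_def by (rule someI_ex[OF tot[OF that]])
  show ?thesis
  proof (intro exI[of _ g] conjI allI impI ballI)
    fix x y assume xy: "x \<in> carrier G" "y \<in> carrier G"
    show "g (x \<otimes> y) = g x + g y"
      using N.M_unique[OF g N.M_mult[OF g g], of "x" "y"] xy by simp
  next
    fix x d assume "(x, d) \<in> M" then show "g x = d"
      using N N.M_unique g N.M_carrier by blast
  qed
qed

end

text \<open>
  Modulo \<open>N\<close>, the element \<open>x\<close> generates a non-zero cyclic group. That group has a character that does not
  vanish at \<open>x\<close>, and injectivity extends it to \<open>G\<close>.
\<close>

theorem character_separates: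
  assumes "comm_group G" "subgroup N G" and x: "x \<in> carrier G" "x \<notin> N"
  shows "\<exists>g :: 'a \<Rightarrow> qz. (\<forall>x\<in>carrier G. \<forall>y\<in>carrier G. g (x \<otimes>\<^bsub>G\<^esub> y) = g x + g y) \<and>
    (\<forall>y\<in>N. g y = 0) \<and> g x \<noteq> 0"
proof -
  interpret comm_group G by fact
  interpret N: subgroup N G by fact
  define J where "J = {n :: int. x [^]\<^bsub>G\<^esub> n \<in> N}"
  have "0 \<in> J" by (auto simp: J_def)
  moreover have "a - b \<in> J" if "a \<in> J" "b \<in> J" for a b
    using that x by (auto simp: J_def int_pow_diff)
  ultimately obtain m where m: "m \<ge> 0" "J = {n. m dvd n}" by (rule int_subgroup_cyclic)
  have "1 \<notin> J" using x by (simp add: J_def)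
  then have "m \<noteq> 1" using m by auto
  then obtain d where d: "d \<noteq> 0" "zmul m d = 0" using qz_torsion m by blast
  have key: "zmul n d = 0" if "x [^]\<^bsub>G\<^esub> n \<in> N" for n :: int
  proof -
    have "n \<in> J" using that by (simp add: J_def)
    then obtain q where q: "n = m * q" using m by auto
    show ?thesis using zmul_zmul[of q m d] d by (simp add: q mult.commute)
  qed
  \<comment> \<open>the homomorphism on the subgroup generated by \<open>N\<close> and \<open>x\<close> that kills \<open>N\<close> and maps \<open>x\<close> to \<open>d\<close>\<close>
  define M where "M = {(y \<otimes>\<^bsub>G\<^esub> x [^]\<^bsub>G\<^esub> (n :: int), zmul n d) | y n. y \<in> N}"
  have MI: "z = y \<otimes>\<^bsub>G\<^esub> x [^]\<^bsub>G\<^esub> n \<Longrightarrow> f = zmul n d \<Longrightarrow> y \<in> N \<Longrightarrow> (z, f) \<in> M" for z f y n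
    by (auto simp: M_def)
  interpret char_graph G M
  proof
    show "z \<in> carrier G" if "(z, f) \<in> M" for z f using that x by (auto simp: M_def)
    show "(\<one>\<^bsub>G\<^esub>, 0) \<in> M" by (rule MI[of _ "\<one>\<^bsub>G\<^esub>" 0]) auto
    fix z f w g assume zw: "(z, f) \<in> M" "(w, g) \<in> M"
    show "(z \<otimes>\<^bsub>G\<^esub> inv\<^bsub>G\<^esub> w, f - g) \<in> M"
    proof -
      obtain y n y' n' where *: "z = y \<otimes>\<^bsub>G\<^esub> x [^]\<^bsub>G\<^esub> n" "f = zmul n d" "y \<in> N"
        "w = y' \<otimes>\<^bsub>G\<^esub> x [^]\<^bsub>G\<^esub> n'" "g = zmul n' d" "y' \<in> N" using zw by (auto simp: M_def)
      show ?thesis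
        by (rule MI[of _ "y \<otimes>\<^bsub>G\<^esub> inv\<^bsub>G\<^esub> y'" "n - n'"])
          (use *(3,6) x in \<open>simp_all add: *(1,2,4,5) inv_mult int_pow_diff zmul_diff m_ac\<close>)
    qed
  next
    fix f assume oneM: "(\<one>\<^bsub>G\<^esub>, f) \<in> M"
    show "f = 0"
    proof -
      obtain y n where *: "\<one>\<^bsub>G\<^esub> = y \<otimes>\<^bsub>G\<^esub> x [^]\<^bsub>G\<^esub> n" "f = zmul n d" "y \<in> N" using oneM by (auto simp: M_def)
      have "inv\<^bsub>G\<^esub> y = x [^]\<^bsub>G\<^esub> n" using * x
        by (metis inv_equality int_pow_closed m_comm N.mem_carrier)
      then show ?thesis using key * by (metis (no_types) N.m_inv_closed)
    qed
  qed
  obtain g :: "'a \<Rightarrow> qz" where g: "\<forall>x\<in>carrier G. \<forall>y\<in>carrier G. g (x \<otimes>\<^bsub>G\<^esub> y) = g x + g y"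
    "\<And>x d. (x, d) \<in> M \<Longrightarrow> g x = d" using extends_to_character by blast
  have "g y = 0" if "y \<in> N" for y
    by (rule g(2)) (rule MI[of _ y 0], use that in auto)
  moreover have "g x = d" by (rule g(2)) (rule MI[of _ "\<one>\<^bsub>G\<^esub>" 1], use x in auto)
  ultimately show ?thesis using g(1) d(1) by blast
qed

definition psign :: "int \<Rightarrow> 'a::ab_group_add \<Rightarrow> 'a" where
  "psign i d = (if even i then d else - d)"

lemma psign_simps [simp]:
  "psign i 0 = 0" "psign 0 d = d" "psign i (d + e) = psign i d + psign i e" "psign i (- d) = - psign i d"
  "psign i (d - e) = psign i d - psign i e" "psign i (psign j d) = psign (i + j) d"
  by (auto simp: psign_def)

definition character :: "('a, 'm) ring_scheme \<Rightarrow> ('a \<Rightarrow> qz) \<Rightarrow> bool" where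
  "character G g \<longleftrightarrow> (\<forall>x\<in>carrier G. \<forall>y\<in>carrier G. g (x \<oplus>\<^bsub>G\<^esub> y) = g x + g y)"

context abelian_group
begin

lemma neg_zero [simp]: "\<ominus> \<zero> = \<zero>"
  using minus_equality[of \<zero> \<zero>] by simp

lemma minus_zero_right [simp]: "x \<in> carrier G \<Longrightarrow> x \<ominus> \<zero> = x"
  by (simp add: a_minus_def)

lemma character_add: "character G g \<Longrightarrow> x \<in> carrier G \<Longrightarrow> y \<in> carrier G \<Longrightarrow> g (x \<oplus> y) = g x + g y"
  by (simp add: character_def)

lemma character_zero: "character G g \<Longrightarrow> g \<zero> = 0"
  using character_add[of g \<zero> \<zero>] by simp

lemma character_neg: "character G g \<Longrightarrow> x \<in> carrier G \<Longrightarrow> g (\<ominus> x) = - g x"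
  using character_add[of g x "\<ominus> x"] character_zero[of g] by (simp add: r_neg eq_neg_iff_add_eq_0 add.commute)

lemma ksign_closed: "x \<in> carrier G \<Longrightarrow> ksign G i x \<in> carrier G"
  by (simp add: ksign_def)

lemma character_ksign: "character G g \<Longrightarrow> x \<in> carrier G \<Longrightarrow> g (ksign G i x) = psign i (g x)"
  by (simp add: ksign_def psign_def character_neg)

lemma character_minus: "character G g \<Longrightarrow> x \<in> carrier G \<Longrightarrow> y \<in> carrier G \<Longrightarrow> g (x \<ominus> y) = g x - g y"
  by (simp add: a_minus_def character_add character_neg)

lemmas character_simps = character_add character_zero character_neg character_ksign character_minus

lemma character_neq_zero:
  assumes "subgroup N (add_monoid G)" "x \<in> carrier G" "x \<notin> N"
  obtains g where "character G g" "\<And>y. y \<in> N \<Longrightarrow> g y = 0" "g x \<noteq> 0"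
proof -
  have "\<exists>g :: 'a \<Rightarrow> qz. (\<forall>x\<in>carrier (add_monoid G). \<forall>y\<in>carrier (add_monoid G). g (x \<otimes>\<^bsub>add_monoid G\<^esub> y) = g x + g y) \<and>
    (\<forall>y\<in>N. g y = 0) \<and> g x \<noteq> 0"
    by (rule character_separates[OF a_comm_group assms(1)]) (use assms in auto)
  then show ?thesis using that by (auto simp: character_def)
qed

text \<open>
  As characters separate points, an identity in a group given by a carrier can be checked on the values of characters,
  which lie in a type that is an additive group.
\<close>

lemma character_eqI:
  assumes "x \<in> carrier G" "y \<in> carrier G" "\<And>g. character G g \<Longrightarrow> g x = g y"
  shows "x = y"
proof (rule ccontr)
  assume "x \<noteq> y"
  have "x \<ominus> y \<notin> {\<zero>}"
    using \<open>x \<noteq> y\<close> assms minus_equality[of x "\<ominus> y"] by (auto simp: a_minus_def)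
  moreover have "subgroup {\<zero>} (add_monoid G)"
    using add.triv_subgroup by simp
  ultimately obtain g where "character G g" "g (x \<ominus> y) \<noteq> 0"
    using character_neq_zero[of "{\<zero>}" "x \<ominus> y"] assms by (metis minus_closed)
  then show False using assms by (simp add: character_minus)
qed

lemma ksign_ksign: "x \<in> carrier G \<Longrightarrow> ksign G i (ksign G j x) = ksign G (i + j) x"
  by (auto simp: ksign_def)

lemma ksign_add: "x \<in> carrier G \<Longrightarrow> y \<in> carrier G \<Longrightarrow> ksign G i (x \<oplus> y) = ksign G i x \<oplus> ksign G i y"
  by (auto simp: ksign_def minus_add)

lemma ksign_zero [simp]: "ksign G i \<zero> = \<zero>"
  by (auto simp: ksign_def)

lemma ksign_neg: "x \<in> carrier G \<Longrightarrow> ksign G i (\<ominus> x) = \<ominus> ksign G i x"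
  by (auto simp: ksign_def)

end

text \<open>
  Injectivity in the form in which it is used: a character that vanishes on the kernel of \<open>T\<close> is the
  composite of \<open>T\<close> with a character of the target.
\<close>

lemma character_factors:
  assumes S: "abelian_group S" and S': "abelian_group S'"
    and T: "\<And>s. s \<in> carrier S \<Longrightarrow> T s \<in> carrier S'"
    and T_add: "\<And>s t. s \<in> carrier S \<Longrightarrow> t \<in> carrier S \<Longrightarrow> T (s \<oplus>\<^bsub>S\<^esub> t) = T s \<oplus>\<^bsub>S'\<^esub> T t"
    and \<Phi>: "character S \<Phi>" and ker: "\<And>s. s \<in> carrier S \<Longrightarrow> T s = \<zero>\<^bsub>S'\<^esub> \<Longrightarrow> \<Phi> s = 0"
  obtains \<Gamma> where "character S' \<Gamma>" "\<And>s. s \<in> carrier S \<Longrightarrow> \<Gamma> (T s) = \<Phi> s"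
proof -
  interpret S: abelian_group S by fact
  interpret S': abelian_group S' by fact
  have T0: "T \<zero>\<^bsub>S\<^esub> = \<zero>\<^bsub>S'\<^esub>" using T_add[of "\<zero>\<^bsub>S\<^esub>" "\<zero>\<^bsub>S\<^esub>"] T[of "\<zero>\<^bsub>S\<^esub>"]
    by simp
  have T_minus: "T (\<ominus>\<^bsub>S\<^esub> s) = \<ominus>\<^bsub>S'\<^esub> T s" if "s \<in> carrier S" for s
    using T_add[of "\<ominus>\<^bsub>S\<^esub> s" s] that T0 T by (simp add: S.l_neg S'.minus_equality)
  define M where "M = {(T s, \<Phi> s) | s. s \<in> carrier S}"
  interpret char_graph "add_monoid S'" M
  proof (unfold_locales)
    show "x \<in> carrier (add_monoid S')" if "(x, d) \<in> M" for x d using that T by (auto simp: M_def)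
    show "(\<one>\<^bsub>add_monoid S'\<^esub>, 0) \<in> M"
      using T0 S.character_zero[OF \<Phi>] by (auto simp: M_def intro!: exI[of _ "\<zero>\<^bsub>S\<^esub>"])
    show "d = 0" if "(\<one>\<^bsub>add_monoid S'\<^esub>, d) \<in> M" for d
      using that ker by (auto simp: M_def)
  next
    fix x d y e assume "(x, d) \<in> M" "(y, e) \<in> M"
    then obtain s t where st: "s \<in> carrier S" "t \<in> carrier S" "x = T s" "d = \<Phi> s" "y = T t" "e = \<Phi> t"
      by (auto simp: M_def)
    have "x \<oplus>\<^bsub>S'\<^esub> (\<ominus>\<^bsub>S'\<^esub> y) = T (s \<oplus>\<^bsub>S\<^esub> \<ominus>\<^bsub>S\<^esub> t)" "d - e = \<Phi> (s \<oplus>\<^bsub>S\<^esub> \<ominus>\<^bsub>S\<^esub> t)"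
      using st by (auto simp: T_add T_minus S.character_simps[OF \<Phi>])
    then show "(x \<otimes>\<^bsub>add_monoid S'\<^esub> inv\<^bsub>add_monoid S'\<^esub> y, d - e) \<in> M"
      using st by (auto simp: M_def a_inv_def intro!: exI[of _ "s \<oplus>\<^bsub>S\<^esub> \<ominus>\<^bsub>S\<^esub> t"])
  qed
  obtain g where "character S' g" "\<And>x d. (x, d) \<in> M \<Longrightarrow> g x = d"
    using extends_to_character by (auto simp: character_def)
  then show ?thesis using that[of g] by (auto simp: M_def)
qed

section \<open>Complexes, homology and morphisms\<close>

lemma additive_map_zero:
  assumes "abelian_group G" "abelian_group H" "\<And>x. x \<in> carrier G \<Longrightarrow> h x \<in> carrier H"
    "\<And>x y. x \<in> carrier G \<Longrightarrow> y \<in> carrier G \<Longrightarrow> h (x \<oplus>\<^bsub>G\<^esub> y) = h x \<oplus>\<^bsub>H\<^esub> h y"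
  shows "h \<zero>\<^bsub>G\<^esub> = \<zero>\<^bsub>H\<^esub>"
proof -
  interpret G: abelian_group G by fact
  interpret H: abelian_group H by fact
  show ?thesis using assms(4)[of "\<zero>\<^bsub>G\<^esub>" "\<zero>\<^bsub>G\<^esub>"] assms(3)[of "\<zero>\<^bsub>G\<^esub>"]
    by simp
qed

lemma additive_map_neg:
  assumes "abelian_group G" "abelian_group H" "\<And>x. x \<in> carrier G \<Longrightarrow> h x \<in> carrier H"
    "\<And>x y. x \<in> carrier G \<Longrightarrow> y \<in> carrier G \<Longrightarrow> h (x \<oplus>\<^bsub>G\<^esub> y) = h x \<oplus>\<^bsub>H\<^esub> h y"
    and x: "x \<in> carrier G"
  shows "h (\<ominus>\<^bsub>G\<^esub> x) = \<ominus>\<^bsub>H\<^esub> h x"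
proof -
  interpret G: abelian_group G by fact
  interpret H: abelian_group H by fact
  show ?thesis using assms(4)[of "\<ominus>\<^bsub>G\<^esub> x" x] additive_map_zero[of G H h] assms
    by (simp add: G.l_neg H.minus_equality)
qed

sublocale dg_complex \<subseteq> grp: abelian_group "gr X i" for i
  using component by (rule module.axioms(2))

context dg_complex
begin

lemma d_cl: "x \<in> carrier (gr X i) \<Longrightarrow> m = i - 1 \<Longrightarrow> dd X i x \<in> carrier (gr X m)"
  using d_closed by simp

lemma d_zero [simp]: "dd X i \<zero>\<^bsub>gr X i\<^esub> = \<zero>\<^bsub>gr X (i - 1)\<^esub>"
  by (rule additive_map_zero[OF grp.abelian_group_axioms grp.abelian_group_axioms]) (auto simp: d_closed d_add)

lemma d_neg: "x \<in> carrier (gr X i) \<Longrightarrow> dd X i (\<ominus>\<^bsub>gr X i\<^esub> x) = \<ominus>\<^bsub>gr X (i - 1)\<^esub> dd X i x"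
  by (rule additive_map_neg[OF grp.abelian_group_axioms grp.abelian_group_axioms]) (auto simp: d_closed d_add)

lemma d_ksign: "x \<in> carrier (gr X i) \<Longrightarrow> dd X i (ksign (gr X i) j x) = ksign (gr X (i - 1)) j (dd X i x)"
  by (simp add: ksign_def d_neg)

lemma dd_dd: "x \<in> carrier (gr X i) \<Longrightarrow> m = i - 1 \<Longrightarrow> dd X m (dd X i x) = \<zero>\<^bsub>gr X (m - 1)\<^esub>"
  using d_d[of x i] by simp

lemma boundaries_subgroup: "subgroup (boundaries X i) (add_monoid (gr X i))"
proof (rule grp.add.subgroupI)
  show "boundaries X i \<subseteq> carrier (gr X i)" by (auto simp: boundaries_def intro: d_cl)
  show "boundaries X i \<noteq> {}" by (auto simp: boundaries_def intro: grp.zero_closed)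
  fix a assume "a \<in> boundaries X i"
  then obtain x where x: "x \<in> carrier (gr X (i + 1))" "a = dd X (i + 1) x" by (auto simp: boundaries_def)
  then have "\<ominus>\<^bsub>gr X i\<^esub> a = dd X (i + 1) (\<ominus>\<^bsub>gr X (i + 1)\<^esub> x)" by (simp add: d_neg)
  then show "\<ominus>\<^bsub>gr X i\<^esub> a \<in> boundaries X i" using x by (auto simp: boundaries_def)
  fix b assume "b \<in> boundaries X i"
  then obtain y where y: "y \<in> carrier (gr X (i + 1))" "b = dd X (i + 1) y" by (auto simp: boundaries_def)
  then have "a \<oplus>\<^bsub>gr X i\<^esub> b = dd X (i + 1) (x \<oplus>\<^bsub>gr X (i + 1)\<^esub> y)" using x by (simp add: d_add)
  then show "a \<oplus>\<^bsub>gr X i\<^esub> b \<in> boundaries X i" using x y by (auto simp: boundaries_def)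
qed

lemma boundaries_closed: "x \<in> boundaries X i \<Longrightarrow> x \<in> carrier (gr X i)"
  using subgroup.mem_carrier[OF boundaries_subgroup] by simp

lemma boundaries_zero: "\<zero>\<^bsub>gr X i\<^esub> \<in> boundaries X i"
  using subgroup.one_closed[OF boundaries_subgroup] by simp

lemma boundaries_add: "x \<in> boundaries X i \<Longrightarrow> y \<in> boundaries X i \<Longrightarrow> x \<oplus>\<^bsub>gr X i\<^esub> y \<in> boundaries X i"
  using subgroup.m_closed[OF boundaries_subgroup] by simp

lemma boundaries_neg: "x \<in> boundaries X i \<Longrightarrow> \<ominus>\<^bsub>gr X i\<^esub> x \<in> boundaries X i"
  using subgroup.m_inv_closed[OF boundaries_subgroup] by (simp add: a_inv_def)

lemma cycles_zero: "\<zero>\<^bsub>gr X i\<^esub> \<in> cycles X i" by (simp add: cycles_def)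

end

lemma (in abelian_group) coset_eq_iff:
  assumes H: "subgroup H (add_monoid G)" and "x \<in> carrier G" "y \<in> carrier G"
  shows "H +> x = H +> y \<longleftrightarrow> x \<ominus> y \<in> H"
proof -
  have "H +> x = H +> y \<longleftrightarrow> x \<in> H +> y"
    using add.rcos_self[OF _ H] add.repr_independence[OF _ _ H] assms
    unfolding a_r_coset_def by auto
  also have "\<dots> \<longleftrightarrow> x \<ominus> y \<in> H"
    using subgroup.rcos_module[OF H, of y x] add.is_group assms
    unfolding a_r_coset_def a_minus_def a_inv_def by simp
  finally show ?thesis .
qed

context dg_complex
begin

lemmas boundary_coset_eq_iff = grp.coset_eq_iff[OF boundaries_subgroup]

lemma boundaries_coset_zero: "boundaries X i +>\<^bsub>gr X i\<^esub> \<zero>\<^bsub>gr X i\<^esub> = boundaries X i"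
  using boundaries_closed by (intro grp.a_coset_add_zero) auto

end

definition exact_at :: "('r, 'x, 'm) dg_cplx_scheme \<Rightarrow> int \<Rightarrow> bool" where
  "exact_at X i \<longleftrightarrow> cycles X i \<subseteq> boundaries X i"

lemma exact_atD: "exact_at X i \<Longrightarrow> x \<in> carrier (gr X i) \<Longrightarrow> dd X i x = \<zero>\<^bsub>gr X (i - 1)\<^esub> \<Longrightarrow>
  \<exists>y\<in>carrier (gr X (i + 1)). x = dd X (i + 1) y"
  by (auto simp: exact_at_def cycles_def boundaries_def)

text \<open>Homology is formed from cosets; from here on its vanishing is expressed by elements.\<close>

lemma zero_homology_iff:
  assumes "dg_complex R X"
  shows "zero_module (homology X i) \<longleftrightarrow> exact_at X i"
proof -
  interpret dg_complex R X by fact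
  have *: "boundaries X i +>\<^bsub>gr X i\<^esub> x = boundaries X i \<longleftrightarrow> x \<in> boundaries X i" if "x \<in> carrier (gr X i)" for x
    using boundary_coset_eq_iff[of x i "\<zero>\<^bsub>gr X i\<^esub>"] that by (simp add: boundaries_coset_zero)
  have "zero_module (homology X i) \<longleftrightarrow> (\<lambda>x. boundaries X i +>\<^bsub>gr X i\<^esub> x) ` cycles X i = {boundaries X i}"
    by (simp add: zero_module_def homology_def)
  also have "\<dots> \<longleftrightarrow> (\<forall>x\<in>cycles X i. boundaries X i +>\<^bsub>gr X i\<^esub> x = boundaries X i)"
    using cycles_zero[of i] by auto
  also have "\<dots> \<longleftrightarrow> exact_at X i"
    using * by (auto simp: exact_at_def cycles_def)
  finally show ?thesis .
qed

context dg_algebra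
begin

lemma mul_cl: "a \<in> carrier (gr A i) \<Longrightarrow> b \<in> carrier (gr A j) \<Longrightarrow> m = i + j \<Longrightarrow> mul A i j a b \<in> carrier (gr A m)"
  using mul_closed by simp

lemma regular_dg_module: "dg_module R A (regular_dg_module A)"
proof -
  have "dg_complex R (regular_dg_module A)"
    unfolding regular_dg_module_def
    by (intro dg_complex.intro is_cring dg_complex_axioms.intro; simp only: dg_cplx.simps)
      (assumption | rule component d_closed d_add d_smult d_d)+
  moreover have "dg_module_axioms R A (regular_dg_module A)"
    unfolding regular_dg_module_def
    by (intro dg_module_axioms.intro; simp only: dg_cplx.simps dg_mod.simps)
      (assumption | rule mul_closed mul_add_left mul_add_right mul_smult_left mul_smult_right
        mul_assoc mul_unt_left leibniz)+
  ultimately show ?thesis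
    by (intro dg_module.intro dg_algebra_axioms)
qed

lemma neg_degree: "i < 0 \<Longrightarrow> a \<in> carrier (gr A i) \<Longrightarrow> a = \<zero>\<^bsub>gr A i\<^esub>"
  using nonneg[of i] by (simp add: zero_module_def)

end

context dg_module
begin

lemma act_cl: "a \<in> carrier (gr A i) \<Longrightarrow> x \<in> carrier (gr X j) \<Longrightarrow> m = i + j \<Longrightarrow> act X i j a x \<in> carrier (gr X m)"
  using act_closed by simp

lemma act_zero_right [simp]: "a \<in> carrier (gr A i) \<Longrightarrow> act X i j a \<zero>\<^bsub>gr X j\<^esub> = \<zero>\<^bsub>gr X (i + j)\<^esub>"
  by (rule additive_map_zero[where h = "act X i j a", OF cplx.grp.abelian_group_axioms cplx.grp.abelian_group_axioms])
    (auto simp: act_closed act_add_right)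

lemma act_zero_left [simp]: "x \<in> carrier (gr X j) \<Longrightarrow> act X i j \<zero>\<^bsub>gr A i\<^esub> x = \<zero>\<^bsub>gr X (i + j)\<^esub>"
  by (rule additive_map_zero[where h = "\<lambda>a. act X i j a x", OF algebra.grp.abelian_group_axioms cplx.grp.abelian_group_axioms])
    (auto simp: act_closed act_add_left)

lemma act_neg_right: "a \<in> carrier (gr A i) \<Longrightarrow> x \<in> carrier (gr X j) \<Longrightarrow>
    act X i j a (\<ominus>\<^bsub>gr X j\<^esub> x) = \<ominus>\<^bsub>gr X (i + j)\<^esub> act X i j a x"
  by (rule additive_map_neg[where h = "act X i j a", OF cplx.grp.abelian_group_axioms cplx.grp.abelian_group_axioms])
    (auto simp: act_closed act_add_right)

lemma act_neg_left: "a \<in> carrier (gr A i) \<Longrightarrow> x \<in> carrier (gr X j) \<Longrightarrow>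
    act X i j (\<ominus>\<^bsub>gr A i\<^esub> a) x = \<ominus>\<^bsub>gr X (i + j)\<^esub> act X i j a x"
  by (rule additive_map_neg[where h = "\<lambda>a. act X i j a x", OF algebra.grp.abelian_group_axioms cplx.grp.abelian_group_axioms])
    (auto simp: act_closed act_add_left)

lemma act_ksign_right: "a \<in> carrier (gr A i) \<Longrightarrow> x \<in> carrier (gr X j) \<Longrightarrow>
    act X i j a (ksign (gr X j) k x) = ksign (gr X (i + j)) k (act X i j a x)"
  by (simp add: ksign_def act_neg_right)

lemma act_ksign_left: "a \<in> carrier (gr A i) \<Longrightarrow> x \<in> carrier (gr X j) \<Longrightarrow>
    act X i j (ksign (gr A i) k a) x = ksign (gr X (i + j)) k (act X i j a x)"
  by (simp add: ksign_def act_neg_left)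

end

context dg_algebra
begin
lemma mul_zero_right [simp]: "a \<in> carrier (gr A i) \<Longrightarrow> mul A i j a \<zero>\<^bsub>gr A j\<^esub> = \<zero>\<^bsub>gr A (i + j)\<^esub>"
  using dg_module.act_zero_right[OF regular_dg_module] by (simp add: regular_dg_module_def)
lemma mul_zero_left [simp]: "x \<in> carrier (gr A j) \<Longrightarrow> mul A i j \<zero>\<^bsub>gr A i\<^esub> x = \<zero>\<^bsub>gr A (i + j)\<^esub>"
  using dg_module.act_zero_left[OF regular_dg_module] by (simp add: regular_dg_module_def)
lemma mul_neg_right: "a \<in> carrier (gr A i) \<Longrightarrow> x \<in> carrier (gr A j) \<Longrightarrow>
    mul A i j a (\<ominus>\<^bsub>gr A j\<^esub> x) = \<ominus>\<^bsub>gr A (i + j)\<^esub> mul A i j a x"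
  using dg_module.act_neg_right[OF regular_dg_module] by (simp add: regular_dg_module_def)
lemma mul_ksign_right: "a \<in> carrier (gr A i) \<Longrightarrow> x \<in> carrier (gr A j) \<Longrightarrow>
    mul A i j a (ksign (gr A j) k x) = ksign (gr A (i + j)) k (mul A i j a x)"
  by (simp add: ksign_def mul_neg_right)
end

lemma dg_homD:
  assumes "f \<in> dg_hom A X Y" "x \<in> carrier (gr X i)"
  shows "f i x \<in> carrier (gr Y i)"
    "x' \<in> carrier (gr X i) \<Longrightarrow> f i (x \<oplus>\<^bsub>gr X i\<^esub> x') = f i x \<oplus>\<^bsub>gr Y i\<^esub> f i x'"
    "a \<in> carrier (gr A j) \<Longrightarrow> m = j + i \<Longrightarrow> f m (act X j i a x) = act Y j i a (f i x)"
    "m = i - 1 \<Longrightarrow> f m (dd X i x) = dd Y i (f i x)"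
  using assms by (auto simp: dg_hom_def)

locale dg_morphism = U: dg_module R A U + V: dg_module R A V
  for R :: "('r, 's) ring_scheme" and A :: "('r, 'a, 'm) dg_alg_scheme"
    and U :: "('r, 'a, 'x, 'n) dg_mod_scheme" and V :: "('r, 'a, 'y, 'p) dg_mod_scheme" +
  fixes f assumes hom: "f \<in> dg_hom A U V"
begin

lemma f_cl: "x \<in> carrier (gr U i) \<Longrightarrow> f i x \<in> carrier (gr V i)"
  and f_add: "x \<in> carrier (gr U i) \<Longrightarrow> x' \<in> carrier (gr U i) \<Longrightarrow> f i (x \<oplus>\<^bsub>gr U i\<^esub> x') = f i x \<oplus>\<^bsub>gr V i\<^esub> f i x'"
  and f_act: "x \<in> carrier (gr U i) \<Longrightarrow> a \<in> carrier (gr A j) \<Longrightarrow> m = j + i \<Longrightarrow> f m (act U j i a x) = act V j i a (f i x)"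
  and f_d: "x \<in> carrier (gr U i) \<Longrightarrow> m = i - 1 \<Longrightarrow> f m (dd U i x) = dd V i (f i x)"
  using dg_homD[OF hom] by auto

lemma f_zero [simp]: "f i \<zero>\<^bsub>gr U i\<^esub> = \<zero>\<^bsub>gr V i\<^esub>"
  by (rule additive_map_zero[OF U.cplx.grp.abelian_group_axioms V.cplx.grp.abelian_group_axioms]) (auto simp: f_cl f_add)

lemma f_neg: "x \<in> carrier (gr U i) \<Longrightarrow> f i (\<ominus>\<^bsub>gr U i\<^esub> x) = \<ominus>\<^bsub>gr V i\<^esub> f i x"
  by (rule additive_map_neg[OF U.cplx.grp.abelian_group_axioms V.cplx.grp.abelian_group_axioms]) (auto simp: f_cl f_add)

lemma f_boundary: "b \<in> boundaries U i \<Longrightarrow> f i b \<in> boundaries V i"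
  by (auto simp: boundaries_def f_d f_cl)

lemma homology_map_coset:
  assumes "x \<in> carrier (gr U i)"
  shows "homology_map V f i (boundaries U i +>\<^bsub>gr U i\<^esub> x) = boundaries V i +>\<^bsub>gr V i\<^esub> f i x"
proof -
  have "boundaries V i +>\<^bsub>gr V i\<^esub> f i y = boundaries V i +>\<^bsub>gr V i\<^esub> f i x"
    if y: "y \<in> boundaries U i +>\<^bsub>gr U i\<^esub> x" for y
  proof -
    obtain b where b: "b \<in> boundaries U i" "y = b \<oplus>\<^bsub>gr U i\<^esub> x"
      using y by (auto simp: a_r_coset_def' )
    have bc: "b \<in> carrier (gr U i)" using b U.cplx.boundaries_closed by auto
    have "f i y \<ominus>\<^bsub>gr V i\<^esub> f i x = f i b"
      by (rule V.cplx.grp.character_eqI)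
        (use b bc assms in \<open>auto simp: f_add f_cl V.cplx.grp.character_simps\<close>)
    then show ?thesis using b bc assms f_boundary[of b i]
      by (subst V.cplx.boundary_coset_eq_iff) (auto simp: f_cl)
  qed
  moreover have "x \<in> boundaries U i +>\<^bsub>gr U i\<^esub> x"
    using assms U.cplx.boundaries_zero[of i] by (auto simp: a_r_coset_def' intro!: bexI[of _ "\<zero>\<^bsub>gr U i\<^esub>"])
  ultimately show ?thesis unfolding homology_map_def by blast
qed

definition elementwise_qi where
  "elementwise_qi \<longleftrightarrow>
    (\<forall>i. \<forall>z\<in>cycles U i. f i z \<in> boundaries V i \<longrightarrow> z \<in> boundaries U i) \<and>
    (\<forall>i. \<forall>z\<in>cycles V i. \<exists>z'\<in>cycles U i. z \<ominus>\<^bsub>gr V i\<^esub> f i z' \<in> boundaries V i)"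

lemma quasi_iso_iff: "quasi_iso A U V f \<longleftrightarrow> elementwise_qi"
proof -
  let ?cU = "\<lambda>i x. boundaries U i +>\<^bsub>gr U i\<^esub> x" and ?cV = "\<lambda>i x. boundaries V i +>\<^bsub>gr V i\<^esub> x"
  have cyc: "x \<in> carrier (gr U i)" if "x \<in> cycles U i" for x i using that by (simp add: cycles_def)
  have cycV: "x \<in> carrier (gr V i)" if "x \<in> cycles V i" for x i using that by (simp add: cycles_def)
  have fcyc: "f i x \<in> cycles V i" if "x \<in> cycles U i" for x i
    using that f_d[of x i "i - 1"] by (auto simp: cycles_def f_cl)
  have inj: "inj_on (homology_map V f i) (carrier (homology U i)) \<longleftrightarrow>
     (\<forall>z\<in>cycles U i. f i z \<in> boundaries V i \<longrightarrow> z \<in> boundaries U i)" (is "?L \<longleftrightarrow> ?R") for i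
  proof
    assume L: ?L
    show ?R
    proof (intro ballI impI)
      fix z assume z: "z \<in> cycles U i" "f i z \<in> boundaries V i"
      have "homology_map V f i (?cU i z) = homology_map V f i (?cU i \<zero>\<^bsub>gr U i\<^esub>)"
        using z V.cplx.boundary_coset_eq_iff[OF f_cl[OF cyc[OF z(1)]] V.cplx.grp.zero_closed]
        by (simp only: homology_map_coset[OF cyc[OF z(1)]] homology_map_coset[OF U.cplx.grp.zero_closed] f_zero
            V.cplx.grp.minus_zero_right[OF f_cl[OF cyc[OF z(1)]]])
      then have "?cU i z = ?cU i \<zero>\<^bsub>gr U i\<^esub>"
        by (rule inj_onD[OF L]) (use z(1) U.cplx.cycles_zero[of i] in \<open>simp_all add: homology_def\<close>)
      then show "z \<in> boundaries U i"
        using U.cplx.boundary_coset_eq_iff[OF cyc[OF z(1)] U.cplx.grp.zero_closed]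
        by (simp only: U.cplx.grp.minus_zero_right[OF cyc[OF z(1)]])
    qed
  next
    assume R: ?R
    show ?L
    proof (rule inj_onI)
      fix C D assume "C \<in> carrier (homology U i)" "D \<in> carrier (homology U i)"
        and eq: "homology_map V f i C = homology_map V f i D"
      then obtain x y where xy: "x \<in> cycles U i" "y \<in> cycles U i" "C = ?cU i x" "D = ?cU i y"
        by (auto simp: homology_def)
      have c: "x \<in> carrier (gr U i)" "y \<in> carrier (gr U i)" using xy cyc by auto
      have "f i x \<ominus>\<^bsub>gr V i\<^esub> f i y \<in> boundaries V i"
        using eq xy c by (simp add: homology_map_coset V.cplx.boundary_coset_eq_iff f_cl)
      then have "f i (x \<ominus>\<^bsub>gr U i\<^esub> y) \<in> boundaries V i" using c by (simp add: a_minus_def f_add f_neg)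
      moreover have "x \<ominus>\<^bsub>gr U i\<^esub> y \<in> cycles U i" using xy by (simp add: cycles_def a_minus_def U.cplx.d_add U.cplx.d_neg)
      ultimately have "x \<ominus>\<^bsub>gr U i\<^esub> y \<in> boundaries U i" using R by blast
      then show "C = D" using xy c by (simp add: U.cplx.boundary_coset_eq_iff)
    qed
  qed
  have img: "homology_map V f i ` carrier (homology U i) = carrier (homology V i) \<longleftrightarrow>
     (\<forall>z\<in>cycles V i. \<exists>z'\<in>cycles U i. z \<ominus>\<^bsub>gr V i\<^esub> f i z' \<in> boundaries V i)" for i
  proof -
    have im: "homology_map V f i ` carrier (homology U i) = (\<lambda>x. ?cV i (f i x)) ` cycles U i"
      by (auto simp: homology_def homology_map_coset cyc image_image intro!: image_cong)
    have "homology_map V f i ` carrier (homology U i) = carrier (homology V i) \<longleftrightarrow> ?cV i ` cycles V i \<subseteq> (\<lambda>x. ?cV i (f i x)) ` cycles U i"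
      using fcyc unfolding im by (auto simp: homology_def)
    also have "\<dots> \<longleftrightarrow> (\<forall>z\<in>cycles V i. \<exists>z'\<in>cycles U i. ?cV i z = ?cV i (f i z'))" by auto
    finally show ?thesis by (simp add: V.cplx.boundary_coset_eq_iff f_cl cyc cycV)
  qed
  show ?thesis unfolding quasi_iso_def elementwise_qi_def bij_betw_def inj img using hom by blast
qed

end

section \<open>Mapping cones\<close>

lemma direct_sum_simps [simp]:
  "carrier (direct_sum_module M N) = carrier M \<times> carrier N"
  "\<zero>\<^bsub>direct_sum_module M N\<^esub> = (\<zero>\<^bsub>M\<^esub>, \<zero>\<^bsub>N\<^esub>)"
  "(x, y) \<oplus>\<^bsub>direct_sum_module M N\<^esub> (x', y') = (x \<oplus>\<^bsub>M\<^esub> x', y \<oplus>\<^bsub>N\<^esub> y')"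
  "r \<odot>\<^bsub>direct_sum_module M N\<^esub> (x, y) = (r \<odot>\<^bsub>M\<^esub> x, r \<odot>\<^bsub>N\<^esub> y)"
  by (simp_all add: direct_sum_module_def)

lemma direct_sum_abelian_group:
  assumes "abelian_group M" "abelian_group N"
  shows "abelian_group (direct_sum_module M N)"
proof -
  interpret M: abelian_group M by fact
  interpret N: abelian_group N by fact
  show ?thesis
  proof (rule abelian_groupI)
    fix p assume "p \<in> carrier (direct_sum_module M N)"
    then show "\<exists>q\<in>carrier (direct_sum_module M N). q \<oplus>\<^bsub>direct_sum_module M N\<^esub> p = \<zero>\<^bsub>direct_sum_module M N\<^esub>"
      by (intro bexI[of _ "(\<ominus>\<^bsub>M\<^esub> fst p, \<ominus>\<^bsub>N\<^esub> snd p)"]) (auto simp: M.l_neg N.l_neg)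
  qed (auto simp: M.a_ac N.a_ac)
qed

lemma direct_sum_neg:
  assumes "abelian_group M" "abelian_group N" "x \<in> carrier M" "y \<in> carrier N"
  shows "\<ominus>\<^bsub>direct_sum_module M N\<^esub> (x, y) = (\<ominus>\<^bsub>M\<^esub> x, \<ominus>\<^bsub>N\<^esub> y)"
proof -
  interpret M: abelian_group M by fact
  interpret N: abelian_group N by fact
  interpret abelian_group "direct_sum_module M N" by (rule direct_sum_abelian_group) fact+
  show ?thesis using assms by (intro minus_equality) (auto simp: M.l_neg N.l_neg)
qed

lemma direct_sum_ksign:
  assumes "abelian_group M" "abelian_group N" "x \<in> carrier M" "y \<in> carrier N"
  shows "ksign (direct_sum_module M N) i (x, y) = (ksign M i x, ksign N i y)"
  using assms by (simp add: ksign_def direct_sum_neg)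

lemma direct_sum_is_module:
  assumes "module R M" "module R N"
  shows "module R (direct_sum_module M N)"
proof -
  interpret M: module R M by fact
  interpret N: module R N by fact
  show ?thesis
    by (rule moduleI[OF M.is_cring direct_sum_abelian_group[OF M.abelian_group_axioms N.abelian_group_axioms]])
      (auto simp: M.smult_l_distr N.smult_l_distr M.smult_r_distr N.smult_r_distr M.smult_assoc1 N.smult_assoc1)
qed

lemma module_smult_ksign:
  assumes "module R M" "r \<in> carrier R" "x \<in> carrier M"
  shows "r \<odot>\<^bsub>M\<^esub> ksign M i x = ksign M i (r \<odot>\<^bsub>M\<^esub> x)"
  using assms by (simp add: ksign_def module.smult_r_minus)

text \<open>The mapping cone \<open>V \<oplus> \<Sigma>U\<close>. The signs in the second component are those of the shift.\<close>

definition cone_mod ::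
    "('r, 'a, 'x, 'n) dg_mod_scheme \<Rightarrow> ('r, 'a, 'y, 'p) dg_mod_scheme \<Rightarrow> (int \<Rightarrow> 'x \<Rightarrow> 'y) \<Rightarrow> ('r, 'a, 'y \<times> 'x) dg_mod" where
  "cone_mod U V f =
     \<lparr>gr = (\<lambda>i. direct_sum_module (gr V i) (gr U (i - 1))),
      dd = (\<lambda>i (v, u). (dd V i v \<oplus>\<^bsub>gr V (i - 1)\<^esub> f (i - 1) u, \<ominus>\<^bsub>gr U (i - 1 - 1)\<^esub> dd U (i - 1) u)),
      act = (\<lambda>p i a (v, u). (act V p i a v, ksign (gr U (p + i - 1)) p (act U p (i - 1) a u)))\<rparr>"

lemma cone_simps [simp]:
  "gr (cone_mod U V f) i = direct_sum_module (gr V i) (gr U (i - 1))"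
  "dd (cone_mod U V f) i (v, u) = (dd V i v \<oplus>\<^bsub>gr V (i - 1)\<^esub> f (i - 1) u, \<ominus>\<^bsub>gr U (i - 1 - 1)\<^esub> dd U (i - 1) u)"
  "act (cone_mod U V f) p i a (v, u) = (act V p i a v, ksign (gr U (p + i - 1)) p (act U p (i - 1) a u))"
  by (simp_all add: cone_mod_def)

context dg_module
begin

lemma act_leibniz':
  "a \<in> carrier (gr A i) \<Longrightarrow> x \<in> carrier (gr X j) \<Longrightarrow> m = i + j \<Longrightarrow> k = m - 1 \<Longrightarrow>
    dd X m (act X i j a x) =
        act X (i - 1) j (dd A i a) x
          \<oplus>\<^bsub>gr X k\<^esub> ksign (gr X k) i (act X i (j - 1) a (dd X j x))"
  by (simp only: act_leibniz)

lemma act_assoc': "\<lbrakk>a \<in> carrier (gr A i); b \<in> carrier (gr A j); x \<in> carrier (gr X k); m = i + j; l = j + k\<rbrakk> \<Longrightarrow>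
      act X m k (mul A i j a b) x = act X i l a (act X j k b x)"
  using act_assoc by simp

lemma act_neg_right': "a \<in> carrier (gr A i) \<Longrightarrow> x \<in> carrier (gr X j) \<Longrightarrow> m = i + j \<Longrightarrow>
    act X i j a (\<ominus>\<^bsub>gr X j\<^esub> x) = \<ominus>\<^bsub>gr X m\<^esub> act X i j a x"
  using act_neg_right by simp

lemma act_ksign_right': "a \<in> carrier (gr A i) \<Longrightarrow> x \<in> carrier (gr X j) \<Longrightarrow> m = i + j \<Longrightarrow>
    act X i j a (ksign (gr X j) k x) = ksign (gr X m) k (act X i j a x)"
  using act_ksign_right by simp

lemma act_add_right': "a \<in> carrier (gr A i) \<Longrightarrow> x \<in> carrier (gr X j) \<Longrightarrow> x' \<in> carrier (gr X j) \<Longrightarrow> m = i + j \<Longrightarrow>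
      act X i j a (x \<oplus>\<^bsub>gr X j\<^esub> x') = act X i j a x \<oplus>\<^bsub>gr X m\<^esub> act X i j a x'"
  using act_add_right by simp

lemma act_add_left': "a \<in> carrier (gr A i) \<Longrightarrow> a' \<in> carrier (gr A i) \<Longrightarrow> x \<in> carrier (gr X j) \<Longrightarrow> m = i + j \<Longrightarrow>
      act X i j (a \<oplus>\<^bsub>gr A i\<^esub> a') x = act X i j a x \<oplus>\<^bsub>gr X m\<^esub> act X i j a' x"
  using act_add_left by simp

end

context dg_morphism
begin

lemma cone_is_dg_module: "dg_module R A (cone_mod U V f)"
proof -
  have C: "dg_complex R (cone_mod U V f)"
  proof (intro dg_complex.intro U.is_cring dg_complex_axioms.intro)
    show "module R (gr (cone_mod U V f) i)" for i
      by (simp add: direct_sum_is_module U.cplx.component V.cplx.component)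
  next
    fix p i assume "p \<in> carrier (gr (cone_mod U V f) i)"
    then obtain v u where p: "p = (v, u)" "v \<in> carrier (gr V i)" "u \<in> carrier (gr U (i - 1))" by auto
    show "dd (cone_mod U V f) i p \<in> carrier (gr (cone_mod U V f) (i - 1))"
      using p by (simp add: U.cplx.d_cl V.cplx.d_cl f_cl)
    have e: "i - 1 - 1 = i - 2" by simp
    show "dd (cone_mod U V f) (i - 1) (dd (cone_mod U V f) i p) = \<zero>\<^bsub>gr (cone_mod U V f) (i - 2)\<^esub>"
    proof -
      have 1: "dd V (i - 1) (dd V i v \<oplus>\<^bsub>gr V (i - 1)\<^esub> f (i - 1) u) \<oplus>\<^bsub>gr V (i - 1 - 1)\<^esub>
          f (i - 1 - 1) (\<ominus>\<^bsub>gr U (i - 1 - 1)\<^esub> dd U (i - 1) u) = \<zero>\<^bsub>gr V (i - 1 - 1)\<^esub>"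
        using p by (subst V.cplx.d_add)
          (simp_all add: V.cplx.dd_dd f_cl V.cplx.d_cl U.cplx.d_cl f_neg f_d V.cplx.grp.r_neg)
      have 2: "\<ominus>\<^bsub>gr U (i - 1 - 1 - 1)\<^esub> dd U (i - 1 - 1) (\<ominus>\<^bsub>gr U (i - 1 - 1)\<^esub> dd U (i - 1) u) = \<zero>\<^bsub>gr U (i - 1 - 1 - 1)\<^esub>"
        using p by (simp add: U.cplx.d_neg U.cplx.d_cl U.cplx.dd_dd)
      show ?thesis unfolding p cone_simps prod.case 1 2 by (simp add: e)
    qed
    fix q assume "q \<in> carrier (gr (cone_mod U V f) i)"
    then obtain v' u' where q: "q = (v', u')" "v' \<in> carrier (gr V i)" "u' \<in> carrier (gr U (i - 1))" by auto
    show "dd (cone_mod U V f) i (p \<oplus>\<^bsub>gr (cone_mod U V f) i\<^esub> q) =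
        dd (cone_mod U V f) i p \<oplus>\<^bsub>gr (cone_mod U V f) (i - 1)\<^esub> dd (cone_mod U V f) i q"
      unfolding p q cone_simps direct_sum_simps prod.inject
    proof
      show "dd V i (v \<oplus>\<^bsub>gr V i\<^esub> v') \<oplus>\<^bsub>gr V (i - 1)\<^esub> f (i - 1) (u \<oplus>\<^bsub>gr U (i - 1)\<^esub> u') =
         dd V i v \<oplus>\<^bsub>gr V (i - 1)\<^esub> f (i - 1) u \<oplus>\<^bsub>gr V (i - 1)\<^esub> (dd V i v' \<oplus>\<^bsub>gr V (i - 1)\<^esub> f (i - 1) u')"
        using p(2,3) q(2,3) by (simp add: V.cplx.d_add f_add f_cl V.cplx.d_cl V.cplx.grp.a_ac)
      show "\<ominus>\<^bsub>gr U (i - 1 - 1)\<^esub> dd U (i - 1) (u \<oplus>\<^bsub>gr U (i - 1)\<^esub> u') =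
         \<ominus>\<^bsub>gr U (i - 1 - 1)\<^esub> dd U (i - 1) u \<oplus>\<^bsub>gr U (i - 1 - 1)\<^esub> \<ominus>\<^bsub>gr U (i - 1 - 1)\<^esub> dd U (i - 1) u'"
        using p(2,3) q(2,3) by (simp add: U.cplx.d_add U.cplx.d_cl U.cplx.grp.minus_add)
    qed
  next
    fix r p i assume r: "r \<in> carrier R" and "p \<in> carrier (gr (cone_mod U V f) i)"
    then obtain v u where p: "p = (v, u)" "v \<in> carrier (gr V i)" "u \<in> carrier (gr U (i - 1))" by auto
    have "f (i - 1) (r \<odot>\<^bsub>gr U (i - 1)\<^esub> u) = r \<odot>\<^bsub>gr V (i - 1)\<^esub> f (i - 1) u" if "u \<in> carrier (gr U (i - 1))" for u
    proof -
      have "r \<odot>\<^bsub>gr U (i - 1)\<^esub> u = act U 0 (i - 1) (r \<odot>\<^bsub>gr A 0\<^esub> unt A) u"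
        using that r U.act_smult_left[OF r U.unt_closed that] U.act_unt by simp
      also have "f (i - 1) \<dots> = act V 0 (i - 1) (r \<odot>\<^bsub>gr A 0\<^esub> unt A) (f (i - 1) u)"
        using that r module.smult_closed[OF U.algebra.component r U.unt_closed] by (intro f_act) auto
      also have "\<dots> = r \<odot>\<^bsub>gr V (i - 1)\<^esub> f (i - 1) u"
        using that r V.act_smult_left[OF r U.unt_closed f_cl[OF that]] V.act_unt[OF f_cl[OF that]] by simp
      finally show ?thesis .
    qed
    then show "dd (cone_mod U V f) i (r \<odot>\<^bsub>gr (cone_mod U V f) i\<^esub> p) =
       r \<odot>\<^bsub>gr (cone_mod U V f) (i - 1)\<^esub> dd (cone_mod U V f) i p"
      using p r by (simp add: V.cplx.d_smult U.cplx.d_smult V.cplx.d_cl U.cplx.d_cl f_cl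
        module.smult_r_minus[OF U.cplx.component] module.smult_r_distr[OF V.cplx.component])
  qed
  have "dg_module_axioms R A (cone_mod U V f)"
  proof
    fix a i p j assume a: "a \<in> carrier (gr A i)" and "p \<in> carrier (gr (cone_mod U V f) j)"
    then obtain v u where p: "p = (v, u)" "v \<in> carrier (gr V j)" "u \<in> carrier (gr U (j - 1))" by auto
    show "act (cone_mod U V f) i j a p \<in> carrier (gr (cone_mod U V f) (i + j))"
      using a p by (simp add: V.act_cl U.act_cl U.cplx.grp.ksign_closed)
    fix a' assume a': "a' \<in> carrier (gr A i)"
    show "act (cone_mod U V f) i j (a \<oplus>\<^bsub>gr A i\<^esub> a') p =
       act (cone_mod U V f) i j a p \<oplus>\<^bsub>gr (cone_mod U V f) (i + j)\<^esub> act (cone_mod U V f) i j a' p"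
      using a a' p by (simp add: V.act_add_left U.act_cl U.act_add_left'[of _ _ _ _ _ "i + j - 1"] U.cplx.grp.ksign_add)
  next
    fix a i p q j assume a: "a \<in> carrier (gr A i)" and "p \<in> carrier (gr (cone_mod U V f) j)"
      "q \<in> carrier (gr (cone_mod U V f) j)"
    then obtain v u v' u' where p: "p = (v, u)" "v \<in> carrier (gr V j)" "u \<in> carrier (gr U (j - 1))"
        "q = (v', u')" "v' \<in> carrier (gr V j)" "u' \<in> carrier (gr U (j - 1))" by auto
    show "act (cone_mod U V f) i j a (p \<oplus>\<^bsub>gr (cone_mod U V f) j\<^esub> q) =
       act (cone_mod U V f) i j a p \<oplus>\<^bsub>gr (cone_mod U V f) (i + j)\<^esub> act (cone_mod U V f) i j a q"
      using a p by (simp add: V.act_add_right U.act_cl U.act_add_right'[of _ _ _ _ _ "i + j - 1"] U.cplx.grp.ksign_add)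
  next
    fix r a i p j assume r: "r \<in> carrier R" and a: "a \<in> carrier (gr A i)" and "p \<in> carrier (gr (cone_mod U V f) j)"
    then obtain v u where p: "p = (v, u)" "v \<in> carrier (gr V j)" "u \<in> carrier (gr U (j - 1))" by auto
    have e: "i + (j - 1) = i + j - 1" by simp
    show "act (cone_mod U V f) i j (r \<odot>\<^bsub>gr A i\<^esub> a) p = r \<odot>\<^bsub>gr (cone_mod U V f) (i + j)\<^esub> act (cone_mod U V f) i j a p"
      using V.act_smult_left[OF r a p(2)] U.act_smult_left[OF r a p(3)] a p r
      by (simp add: e module_smult_ksign[OF U.cplx.component r] U.act_cl)
    show "act (cone_mod U V f) i j a (r \<odot>\<^bsub>gr (cone_mod U V f) j\<^esub> p) = r \<odot>\<^bsub>gr (cone_mod U V f) (i + j)\<^esub> act (cone_mod U V f) i j a p"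
      using V.act_smult_right[OF r a p(2)] U.act_smult_right[OF r a p(3)] a p r
      by (simp add: e module_smult_ksign[OF U.cplx.component r] U.act_cl)
  next
    fix a i b j p k assume a: "a \<in> carrier (gr A i)" "b \<in> carrier (gr A j)" and "p \<in> carrier (gr (cone_mod U V f) k)"
    then obtain v u where p: "p = (v, u)" "v \<in> carrier (gr V k)" "u \<in> carrier (gr U (k - 1))" by auto
    have "act U (i + j) (k - 1) (mul A i j a b) u = act U i (j + k - 1) a (act U j (k - 1) b u)"
      using a p by (intro U.act_assoc') auto
    moreover have "act U i (j + k - 1) a (ksign (gr U (j + k - 1)) j (act U j (k - 1) b u))
        = ksign (gr U (i + (j + k) - 1)) j (act U i (j + k - 1) a (act U j (k - 1) b u))"
      using a p by (intro U.act_ksign_right') (auto simp: U.act_cl)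
    moreover have "act U i (j + k - 1) a (act U j (k - 1) b u) \<in> carrier (gr U (i + (j + k) - 1))"
      using a p by (auto intro!: U.act_cl)
    ultimately show "act (cone_mod U V f) (i + j) k (mul A i j a b) p =
        act (cone_mod U V f) i (j + k) a (act (cone_mod U V f) j k b p)"
      using a p by (simp add: V.act_assoc U.cplx.grp.ksign_ksign add.assoc)
  next
    fix p j assume "p \<in> carrier (gr (cone_mod U V f) j)"
    then show "act (cone_mod U V f) 0 j (unt A) p = p"
      by (auto simp: V.act_unt U.act_unt ksign_def)
  next
    fix a i p j assume a: "a \<in> carrier (gr A i)" and "p \<in> carrier (gr (cone_mod U V f) j)"
    then obtain v u where p: "p = (v, u)" "v \<in> carrier (gr V j)" "u \<in> carrier (gr U (j - 1))" by auto
    have da: "dd A i a \<in> carrier (gr A (i - 1))" using a by (rule U.algebra.d_closed)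
    have Uc: "act U (i - 1) (j - 1) (dd A i a) u \<in> carrier (gr U (i + j - 1 - 1))"
      "act U i (j - 1) a u \<in> carrier (gr U (i + j - 1))"
      "act U i (j - 1 - 1) a (dd U (j - 1) u) \<in> carrier (gr U (i + j - 1 - 1))"
      "dd U (j - 1) u \<in> carrier (gr U (j - 1 - 1))"
      using a da p by (auto intro!: U.act_cl U.cplx.d_cl)
    have Vc: "act V (i - 1) j (dd A i a) v \<in> carrier (gr V (i + j - 1))"
      "act V i (j - 1) a (dd V j v) \<in> carrier (gr V (i + j - 1))"
      "act V i (j - 1) a (f (j - 1) u) \<in> carrier (gr V (i + j - 1))"
      "dd V j v \<in> carrier (gr V (j - 1))" "f (j - 1) u \<in> carrier (gr V (j - 1))"
      using a da p by (auto intro!: V.act_cl V.cplx.d_cl f_cl)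
    have fk: "f (i + j - 1) (ksign (gr U (i + j - 1)) i (act U i (j - 1) a u))
       = ksign (gr V (i + j - 1)) i (act V i (j - 1) a (f (j - 1) u))"
      using a p Uc by (simp add: ksign_def f_neg f_act)
    have g1: "dd V (i + j) (act V i j a v) \<oplus>\<^bsub>gr V (i + j - 1)\<^esub> f (i + j - 1) (ksign (gr U (i + j - 1)) i (act U i (j - 1) a u))
       = act V (i - 1) j (dd A i a) v \<oplus>\<^bsub>gr V (i + j - 1)\<^esub>
         ksign (gr V (i + j - 1)) i (act V i (j - 1) a (dd V j v \<oplus>\<^bsub>gr V (j - 1)\<^esub> f (j - 1) u))"
      unfolding fk V.act_leibniz[OF a p(2)] V.act_add_right'[OF a Vc(4,5), of "i + j - 1", simplified]
      using Vc by (simp add: V.cplx.grp.ksign_add V.cplx.grp.ksign_closed V.cplx.grp.a_assoc)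
    have g2: "\<ominus>\<^bsub>gr U (i + j - 1 - 1)\<^esub> dd U (i + j - 1) (ksign (gr U (i + j - 1)) i (act U i (j - 1) a u)) =
         ksign (gr U (i + j - 1 - 1)) (i - 1) (act U (i - 1) (j - 1) (dd A i a) u) \<oplus>\<^bsub>gr U (i + j - 1 - 1)\<^esub>
         ksign (gr U (i + j - 1 - 1)) i (ksign (gr U (i + j - 1 - 1)) i (act U i (j - 1 - 1) a (\<ominus>\<^bsub>gr U (j - 1 - 1)\<^esub> dd U (j - 1) u)))"
    proof -
      have l: "dd U (i + j - 1) (act U i (j - 1) a u) = act U (i - 1) (j - 1) (dd A i a) u
          \<oplus>\<^bsub>gr U (i + j - 1 - 1)\<^esub> ksign (gr U (i + j - 1 - 1)) i (act U i (j - 1 - 1) a (dd U (j - 1) u))"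
        by (rule U.act_leibniz'[OF a p(3)]) auto
      have n: "act U i (j - 1 - 1) a (\<ominus>\<^bsub>gr U (j - 1 - 1)\<^esub> dd U (j - 1) u) =
          \<ominus>\<^bsub>gr U (i + j - 1 - 1)\<^esub> act U i (j - 1 - 1) a (dd U (j - 1) u)"
        by (rule U.act_neg_right'[OF a Uc(4)]) auto
      show ?thesis unfolding U.cplx.d_ksign[OF Uc(2)] l n
        by (rule U.cplx.grp.character_eqI)
          (use Uc in \<open>auto simp: U.cplx.grp.character_simps U.cplx.grp.ksign_closed psign_def\<close>)
    qed
    have e: "i - 1 + j = i + j - 1" "i + (j - 1) = i + j - 1" "i - 1 + j - 1 = i + j - 1 - 1" "i + (j - 1) - 1 = i + j - 1 - 1" by auto
    show "dd (cone_mod U V f) (i + j) (act (cone_mod U V f) i j a p) =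
       act (cone_mod U V f) (i - 1) j (dd A i a) p \<oplus>\<^bsub>gr (cone_mod U V f) (i + j - 1)\<^esub>
       ksign (gr (cone_mod U V f) (i + j - 1)) i (act (cone_mod U V f) i (j - 1) a (dd (cone_mod U V f) j p))"
      unfolding p cone_simps e
      apply (subst direct_sum_ksign)
      using Uc Vc g1 g2
      by (auto simp: U.cplx.grp.abelian_group_axioms V.cplx.grp.abelian_group_axioms e
          intro!: U.cplx.grp.ksign_closed U.act_cl V.act_cl a)
  qed
  then show ?thesis using C by (intro dg_module.intro U.dg_algebra_axioms)
qed

lemma cone_exact_if_qi:
  assumes elementwise_qi
  shows "exact_at (cone_mod U V f) i"
proof -
  have "p \<in> boundaries (cone_mod U V f) i" if p: "p \<in> cycles (cone_mod U V f) i" for p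
  proof -
    obtain v u where vu: "p = (v, u)" "v \<in> carrier (gr V i)" "u \<in> carrier (gr U (i - 1))"
      "dd V i v \<oplus>\<^bsub>gr V (i - 1)\<^esub> f (i - 1) u = \<zero>\<^bsub>gr V (i - 1)\<^esub>" "\<ominus>\<^bsub>gr U (i - 1 - 1)\<^esub> dd U (i - 1) u = \<zero>\<^bsub>gr U (i - 1 - 1)\<^esub>"
      using p by (auto simp: cycles_def)
    have du: "dd U (i - 1) u = \<zero>\<^bsub>gr U (i - 1 - 1)\<^esub>"
      using vu U.cplx.grp.minus_minus[OF U.cplx.d_closed[OF vu(3)]] by simp
    have "f (i - 1) u = \<ominus>\<^bsub>gr V (i - 1)\<^esub> dd V i v"
      using vu by (metis V.cplx.grp.minus_equality V.cplx.grp.a_comm V.cplx.d_closed f_cl)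
    then have "f (i - 1) u \<in> boundaries V (i - 1)"
      using vu by (auto simp: boundaries_def V.cplx.d_neg intro!: image_eqI[of _ _ "\<ominus>\<^bsub>gr V i\<^esub> v"])
    then have "u \<in> boundaries U (i - 1)"
      using assms vu du by (auto simp: elementwise_qi_def cycles_def)
    then obtain w where w: "w \<in> carrier (gr U i)" "u = dd U i w" by (auto simp: boundaries_def)
    let ?z = "v \<oplus>\<^bsub>gr V i\<^esub> f i w"
    have "?z \<in> cycles V i" using vu w by (simp add: cycles_def V.cplx.d_add f_cl f_d[symmetric])
    then obtain z' where z': "z' \<in> cycles U i" "?z \<ominus>\<^bsub>gr V i\<^esub> f i z' \<in> boundaries V i"
      using assms unfolding elementwise_qi_def by blast
    then obtain v' where v': "v' \<in> carrier (gr V (i + 1))" "?z \<ominus>\<^bsub>gr V i\<^esub> f i z' = dd V (i + 1) v'"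
      by (auto simp: boundaries_def)
    have zc: "z' \<in> carrier (gr U i)" "dd U i z' = \<zero>\<^bsub>gr U (i - 1)\<^esub>" using z' by (auto simp: cycles_def)
    let ?u = "z' \<ominus>\<^bsub>gr U i\<^esub> w"
    have "dd V (i + 1) v' \<oplus>\<^bsub>gr V i\<^esub> f i ?u = v"
      unfolding v'(2)[symmetric]
      by (rule V.cplx.grp.character_eqI)
        (use vu w zc in \<open>auto simp: V.cplx.grp.character_simps f_cl f_add f_neg a_minus_def\<close>)
    moreover have "\<ominus>\<^bsub>gr U (i - 1)\<^esub> dd U i ?u = u"
      using w zc by (simp add: a_minus_def U.cplx.d_add U.cplx.d_neg U.cplx.d_cl)
    ultimately have "dd (cone_mod U V f) (i + 1) (v', ?u) = p" by (simp add: vu)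
    then show ?thesis using v' w zc by (auto simp: boundaries_def intro!: image_eqI[of _ _ "(v', ?u)"])
  qed
  then show ?thesis by (auto simp: exact_at_def)
qed

lemma qi_if_cone_exact:
  assumes ex: "\<And>i. exact_at (cone_mod U V f) i"
  shows elementwise_qi
  unfolding elementwise_qi_def
proof (intro conjI allI ballI impI)
  fix i z assume z: "z \<in> cycles U i" "f i z \<in> boundaries V i"
  then obtain v where v: "v \<in> carrier (gr V (i + 1))" "f i z = dd V (i + 1) v" by (auto simp: boundaries_def)
  have zc: "z \<in> carrier (gr U i)" "dd U i z = \<zero>\<^bsub>gr U (i - 1)\<^esub>" using z by (auto simp: cycles_def)
  have "(\<ominus>\<^bsub>gr V (i + 1)\<^esub> v, z) \<in> cycles (cone_mod U V f) (i + 1)"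
    using v zc by (simp add: cycles_def V.cplx.d_neg f_cl V.cplx.grp.l_neg V.cplx.d_cl)
  then have "(\<ominus>\<^bsub>gr V (i + 1)\<^esub> v, z) \<in> boundaries (cone_mod U V f) (i + 1)" using ex by (auto simp: exact_at_def)
  then obtain w where "w \<in> carrier (gr U (1 + i))" "z = \<ominus>\<^bsub>gr U i\<^esub> dd U (1 + i) w"
    by (auto simp: boundaries_def)
  then have w: "w \<in> carrier (gr U (i + 1))" "z = \<ominus>\<^bsub>gr U i\<^esub> dd U (i + 1) w" by (simp_all only: add.commute)
  then show "z \<in> boundaries U i"
    by (auto simp: boundaries_def U.cplx.d_neg intro!: image_eqI[of _ _ "\<ominus>\<^bsub>gr U (i + 1)\<^esub> w"])
next
  fix i z assume z: "z \<in> cycles V i"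
  then have "(z, \<zero>\<^bsub>gr U (i - 1)\<^esub>) \<in> cycles (cone_mod U V f) i"
    by (simp add: cycles_def)
  then have "(z, \<zero>\<^bsub>gr U (i - 1)\<^esub>) \<in> boundaries (cone_mod U V f) i" using ex by (auto simp: exact_at_def)
  then obtain v w where w: "w \<in> carrier (gr U i)" "v \<in> carrier (gr V (i + 1))" "z = dd V (i + 1) v \<oplus>\<^bsub>gr V i\<^esub> f i w"
    "\<zero>\<^bsub>gr U (i - 1)\<^esub> = \<ominus>\<^bsub>gr U (i - 1)\<^esub> dd U i w"
    by (auto simp: boundaries_def)
  have "dd U i w = \<zero>\<^bsub>gr U (i - 1)\<^esub>"
    using w(4) U.cplx.grp.minus_minus[OF U.cplx.d_closed[OF w(1)]] by (metis U.cplx.grp.neg_zero)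
  then have "w \<in> cycles U i" using w by (simp add: cycles_def)
  moreover have "z \<ominus>\<^bsub>gr V i\<^esub> f i w = dd V (i + 1) v"
    unfolding w(3) by (rule V.cplx.grp.character_eqI)
      (use w(1,2) in \<open>auto simp: V.cplx.grp.character_simps f_cl V.cplx.d_cl a_minus_def\<close>)
  ultimately show "\<exists>z'\<in>cycles U i. z \<ominus>\<^bsub>gr V i\<^esub> f i z' \<in> boundaries V i"
    using w(2) by (auto simp: boundaries_def)
qed

end

section \<open>Balanced forms\<close>

type_synonym ('x, 'y) pairing = "int \<Rightarrow> int \<Rightarrow> 'x \<Rightarrow> 'y \<Rightarrow> qz"

text \<open>
  A form of degree \<open>t\<close> is an additive map \<open>(P \<otimes>\<^sub>A U)\<^sub>t \<rightarrow> \<rat>/\<int>\<close>, given by its values on the symbols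
  \<open>x \<otimes> u\<close>. Forms thus are the cochains of the character dual of the tensor product, for which no quotient need be
  taken.
\<close>

definition form :: "('r, 'a, 'm) dg_alg_scheme \<Rightarrow> ('r, 'a, 'x, 'n) dg_mod_scheme \<Rightarrow> ('r, 'a, 'y, 'p) dg_mod_scheme \<Rightarrow>
    int \<Rightarrow> ('x, 'y) pairing \<Rightarrow> bool" where
  "form A P U t \<beta> \<longleftrightarrow>
     (\<forall>i j. i + j = t \<longrightarrow>
       (\<forall>x\<in>carrier (gr P i). \<forall>x'\<in>carrier (gr P i). \<forall>u\<in>carrier (gr U j).
          \<beta> i j (x \<oplus>\<^bsub>gr P i\<^esub> x') u = \<beta> i j x u + \<beta> i j x' u) \<and>
       (\<forall>x\<in>carrier (gr P i). \<forall>u\<in>carrier (gr U j). \<forall>u'\<in>carrier (gr U j).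
          \<beta> i j x (u \<oplus>\<^bsub>gr U j\<^esub> u') = \<beta> i j x u + \<beta> i j x u')) \<and>
     (\<forall>p i j. p + i + j = t \<longrightarrow>
       (\<forall>a\<in>carrier (gr A p). \<forall>x\<in>carrier (gr P i). \<forall>u\<in>carrier (gr U j).
          psign (i * p) (\<beta> (p + i) j (act P p i a x) u) = \<beta> i (p + j) x (act U p j a u)))"

text \<open>The composite of a form with the differential of \<open>P \<otimes>\<^sub>A U\<close>.\<close>

definition cobd :: "('r, 'a, 'x, 'n) dg_mod_scheme \<Rightarrow> ('r, 'a, 'y, 'p) dg_mod_scheme \<Rightarrow>
    ('x, 'y) pairing \<Rightarrow> ('x, 'y) pairing" where
  "cobd P U \<beta> i j x u = \<beta> (i - 1) j (dd P i x) u + psign i (\<beta> i (j - 1) x (dd U j u))"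

text \<open>Forms are total functions, so equality of forms is equality on the components that matter.\<close>

definition agree :: "('r, 'a, 'x, 'n) dg_mod_scheme \<Rightarrow> ('r, 'a, 'y, 'p) dg_mod_scheme \<Rightarrow>
    int \<Rightarrow> ('x, 'y) pairing \<Rightarrow> ('x, 'y) pairing \<Rightarrow> bool" where
  "agree P U t \<beta> \<gamma> \<longleftrightarrow> (\<forall>i j. i + j = t \<longrightarrow>
     (\<forall>x\<in>carrier (gr P i). \<forall>u\<in>carrier (gr U j). \<beta> i j x u = \<gamma> i j x u))"

definition cocycle_form :: "('r, 'a, 'm) dg_alg_scheme \<Rightarrow> ('r, 'a, 'x, 'n) dg_mod_scheme \<Rightarrow> ('r, 'a, 'y, 'p) dg_mod_scheme \<Rightarrow>
    int \<Rightarrow> ('x, 'y) pairing \<Rightarrow> bool" where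
  "cocycle_form A P U t \<beta> \<longleftrightarrow> form A P U t \<beta> \<and> agree P U (t + 1) (cobd P U \<beta>) (\<lambda>i j x u. 0)"

text \<open>
  The vanishing of the cohomology in degree \<open>t\<close> of the character dual of \<open>P \<otimes>\<^sub>A U\<close>. As \<open>\<rat>/\<int>\<close> is an
  injective cogenerator, this amounts to \<open>H\<^sub>t(P \<otimes>\<^sub>A U) = 0\<close>; when \<open>P\<close> or \<open>U\<close> is semi-free it says
  \<open>Tor\<^sup>A\<^sub>t(P, U) = 0\<close>.
\<close>

definition perp :: "('r, 'a, 'm) dg_alg_scheme \<Rightarrow> ('r, 'a, 'x, 'n) dg_mod_scheme \<Rightarrow> ('r, 'a, 'y, 'p) dg_mod_scheme \<Rightarrow>
    int \<Rightarrow> bool" where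
  "perp A P U t \<longleftrightarrow> (\<forall>\<beta>. cocycle_form A P U t \<beta> \<longrightarrow>
     (\<exists>\<gamma>. form A P U (t - 1) \<gamma> \<and> agree P U t \<beta> (cobd P U \<gamma>)))"

lemma agreeD: "agree P U t \<beta> \<gamma> \<Longrightarrow> i + j = t \<Longrightarrow> x \<in> carrier (gr P i) \<Longrightarrow> u \<in> carrier (gr U j) \<Longrightarrow> \<beta> i j x u = \<gamma> i j x u"
  by (simp add: agree_def)

lemma agreeI: "(\<And>i j x u. i + j = t \<Longrightarrow> x \<in> carrier (gr P i) \<Longrightarrow> u \<in> carrier (gr U j) \<Longrightarrow> \<beta> i j x u = \<gamma> i j x u) \<Longrightarrow> agree P U t \<beta> \<gamma>"
  by (simp add: agree_def)

lemma formI: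
  assumes "\<And>i j x x' u. i + j = t \<Longrightarrow> x \<in> carrier (gr P i) \<Longrightarrow> x' \<in> carrier (gr P i) \<Longrightarrow> u \<in> carrier (gr U j) \<Longrightarrow>
      \<beta> i j (x \<oplus>\<^bsub>gr P i\<^esub> x') u = \<beta> i j x u + \<beta> i j x' u"
    and "\<And>i j x u u'. i + j = t \<Longrightarrow> x \<in> carrier (gr P i) \<Longrightarrow> u \<in> carrier (gr U j) \<Longrightarrow> u' \<in> carrier (gr U j) \<Longrightarrow>
      \<beta> i j x (u \<oplus>\<^bsub>gr U j\<^esub> u') = \<beta> i j x u + \<beta> i j x u'"
    and "\<And>p i j m q a x u. i + q = t \<Longrightarrow> m + j = t \<Longrightarrow> m = p + i \<Longrightarrow> q = p + j \<Longrightarrow> a \<in> carrier (gr A p) \<Longrightarrow> x \<in> carrier (gr P i) \<Longrightarrow> u \<in> carrier (gr U j) \<Longrightarrow>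
      psign (i * p) (\<beta> m j (act P p i a x) u) = \<beta> i q x (act U p j a u)"
  shows "form A P U t \<beta>"
  unfolding form_def
proof (intro conjI allI impI ballI)
  fix p i j a x u assume "p + i + j = t" "a \<in> carrier (gr A p)" "x \<in> carrier (gr P i)" "u \<in> carrier (gr U j)"
  then show "psign (i * p) (\<beta> (p + i) j (act P p i a x) u) = \<beta> i (p + j) x (act U p j a u)"
    by (intro assms(3)) auto
qed (use assms in auto)

lemma form_add_left: "form A P U t \<beta> \<Longrightarrow> i + j = t \<Longrightarrow> x \<in> carrier (gr P i) \<Longrightarrow> x' \<in> carrier (gr P i) \<Longrightarrow> u \<in> carrier (gr U j) \<Longrightarrow>
      \<beta> i j (x \<oplus>\<^bsub>gr P i\<^esub> x') u = \<beta> i j x u + \<beta> i j x' u"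
  and form_add_right: "form A P U t \<beta> \<Longrightarrow> i + j = t \<Longrightarrow> x \<in> carrier (gr P i) \<Longrightarrow> u \<in> carrier (gr U j) \<Longrightarrow> u' \<in> carrier (gr U j) \<Longrightarrow>
      \<beta> i j x (u \<oplus>\<^bsub>gr U j\<^esub> u') = \<beta> i j x u + \<beta> i j x u'"
  by (simp_all add: form_def)

lemma form_balanced: "form A P U t \<beta> \<Longrightarrow> a \<in> carrier (gr A p) \<Longrightarrow> x \<in> carrier (gr P i) \<Longrightarrow> u \<in> carrier (gr U j) \<Longrightarrow>
      m = p + i \<Longrightarrow> q = p + j \<Longrightarrow> i + q = t \<Longrightarrow>
      \<beta> m j (act P p i a x) u = psign (i * p) (\<beta> i q x (act U p j a u))"
proof -
  assume *: "form A P U t \<beta>" "a \<in> carrier (gr A p)" "x \<in> carrier (gr P i)" "u \<in> carrier (gr U j)" "m = p + i" "q = p + j" "i + q = t"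
  then have "psign (i * p) (\<beta> m j (act P p i a x) u) = \<beta> i q x (act U p j a u)"
    using *(1)[unfolded form_def, THEN conjunct2, rule_format, of p i j a x u] by simp
  then show ?thesis by (metis psign_def minus_minus)
qed

locale dg_pair = P: dg_module R A P + U: dg_module R A U
  for R :: "('r, 's) ring_scheme" and A :: "('r, 'a, 'm) dg_alg_scheme"
    and P :: "('r, 'a, 'x, 'n) dg_mod_scheme" and U :: "('r, 'a, 'y, 'p) dg_mod_scheme"
begin

lemma form_char_left: "form A P U t \<beta> \<Longrightarrow> i + j = t \<Longrightarrow> u \<in> carrier (gr U j) \<Longrightarrow> character (gr P i) (\<lambda>x. \<beta> i j x u)"
  by (simp add: character_def form_add_left)

lemma form_char_right: "form A P U t \<beta> \<Longrightarrow> i + j = t \<Longrightarrow> x \<in> carrier (gr P i) \<Longrightarrow> character (gr U j) (\<lambda>u. \<beta> i j x u)"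
  by (simp add: character_def form_add_right)

lemma form_zero_left: "form A P U t \<beta> \<Longrightarrow> i + j = t \<Longrightarrow> u \<in> carrier (gr U j) \<Longrightarrow> \<beta> i j \<zero>\<^bsub>gr P i\<^esub> u = 0"
  using P.cplx.grp.character_zero[OF form_char_left] .

lemma form_zero_right: "form A P U t \<beta> \<Longrightarrow> i + j = t \<Longrightarrow> x \<in> carrier (gr P i) \<Longrightarrow> \<beta> i j x \<zero>\<^bsub>gr U j\<^esub> = 0"
  using U.cplx.grp.character_zero[OF form_char_right] .

lemma form_neg_right: "form A P U t \<beta> \<Longrightarrow> i + j = t \<Longrightarrow> u \<in> carrier (gr U j) \<Longrightarrow> x \<in> carrier (gr P i) \<Longrightarrow>
    \<beta> i j x (\<ominus>\<^bsub>gr U j\<^esub> u) = - \<beta> i j x u"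
  using U.cplx.grp.character_neg[OF form_char_right] .

lemma form_ksign_left: "form A P U t \<beta> \<Longrightarrow> i + j = t \<Longrightarrow> u \<in> carrier (gr U j) \<Longrightarrow> x \<in> carrier (gr P i) \<Longrightarrow>
    \<beta> i j (ksign (gr P i) k x) u = psign k (\<beta> i j x u)"
  using P.cplx.grp.character_ksign[OF form_char_left] .

lemma form_ksign_right: "form A P U t \<beta> \<Longrightarrow> i + j = t \<Longrightarrow> u \<in> carrier (gr U j) \<Longrightarrow> x \<in> carrier (gr P i) \<Longrightarrow>
    \<beta> i j x (ksign (gr U j) k u) = psign k (\<beta> i j x u)"
  using U.cplx.grp.character_ksign[OF form_char_right] .

text \<open>Balance of the coboundary is the compatibility of the Leibniz rules of \<open>P\<close> and \<open>U\<close>.\<close>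

lemma cobd_form:
  assumes \<gamma>: "form A P U t \<gamma>"
  shows "form A P U (t + 1) (cobd P U \<gamma>)"
proof (rule formI)
  fix i j x x' u assume "i + j = t + 1" and x: "x \<in> carrier (gr P i)" "x' \<in> carrier (gr P i)" "u \<in> carrier (gr U j)"
  then have t: "i - 1 + j = t" "i + (j - 1) = t" by auto
  show "cobd P U \<gamma> i j (x \<oplus>\<^bsub>gr P i\<^esub> x') u = cobd P U \<gamma> i j x u + cobd P U \<gamma> i j x' u"
    using x by (simp add: cobd_def P.cplx.d_add P.cplx.d_closed U.cplx.d_closed form_add_left[OF \<gamma> t(1)] form_add_left[OF \<gamma> t(2)])
next
  fix i j x u u' assume "i + j = t + 1" and x: "x \<in> carrier (gr P i)" "u \<in> carrier (gr U j)" "u' \<in> carrier (gr U j)"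
  then have t: "i - 1 + j = t" "i + (j - 1) = t" by auto
  show "cobd P U \<gamma> i j x (u \<oplus>\<^bsub>gr U j\<^esub> u') = cobd P U \<gamma> i j x u + cobd P U \<gamma> i j x u'"
    using x by (simp add: cobd_def U.cplx.d_add P.cplx.d_closed U.cplx.d_closed form_add_right[OF \<gamma> t(1)] form_add_right[OF \<gamma> t(2)])
next
  fix p i j m q a x u assume t: "i + q = t + 1" "m + j = t + 1" "m = p + i" "q = p + j"
    and a: "a \<in> carrier (gr A p)" and x: "x \<in> carrier (gr P i)" and u: "u \<in> carrier (gr U j)"
  have da: "dd A p a \<in> carrier (gr A (p - 1))" using a by (rule P.algebra.d_closed)
  have dx: "dd P i x \<in> carrier (gr P (i - 1))" using x by (rule P.cplx.d_closed)
  have du: "dd U j u \<in> carrier (gr U (j - 1))" using u by (rule U.cplx.d_closed)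
  have c: "act P (p - 1) i (dd A p a) x \<in> carrier (gr P (m - 1))" "act P p (i - 1) a (dd P i x) \<in> carrier (gr P (m - 1))"
    "act U (p - 1) j (dd A p a) u \<in> carrier (gr U (q - 1))" "act U p (j - 1) a (dd U j u) \<in> carrier (gr U (q - 1))"
    using a x u da dx du t by (auto intro!: P.act_cl U.act_cl)
  have 1: "dd P m (act P p i a x) = act P (p - 1) i (dd A p a) x \<oplus>\<^bsub>gr P (m - 1)\<^esub> ksign (gr P (m - 1)) p (act P p (i - 1) a (dd P i x))"
    by (rule P.act_leibniz'[OF a x]) (use t in auto)
  have 2: "dd U q (act U p j a u) = act U (p - 1) j (dd A p a) u \<oplus>\<^bsub>gr U (q - 1)\<^esub> ksign (gr U (q - 1)) p (act U p (j - 1) a (dd U j u))"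
    by (rule U.act_leibniz'[OF a u]) (use t in auto)
  have L: "\<gamma> (m - 1) j (dd P m (act P p i a x)) u = \<gamma> (m - 1) j (act P (p - 1) i (dd A p a) x) u + psign p (\<gamma> (m - 1) j (act P p (i - 1) a (dd P i x)) u)"
    unfolding 1 using c u t by (subst form_add_left[OF \<gamma>]) (auto simp: P.cplx.grp.ksign_closed form_ksign_left[OF \<gamma>])
  have Rr: "\<gamma> i (q - 1) x (dd U q (act U p j a u)) = \<gamma> i (q - 1) x (act U (p - 1) j (dd A p a) u) + psign p (\<gamma> i (q - 1) x (act U p (j - 1) a (dd U j u)))"
    unfolding 2 using c x t by (subst form_add_right[OF \<gamma>]) (auto simp: U.cplx.grp.ksign_closed form_ksign_right[OF \<gamma>])
  have b1: "\<gamma> (m - 1) j (act P (p - 1) i (dd A p a) x) u = psign (i * (p - 1)) (\<gamma> i (q - 1) x (act U (p - 1) j (dd A p a) u))"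
    by (rule form_balanced[OF \<gamma> da x u]) (use t in auto)
  have b2: "\<gamma> (m - 1) j (act P p (i - 1) a (dd P i x)) u = psign ((i - 1) * p) (\<gamma> (i - 1) q (dd P i x) (act U p j a u))"
    by (rule form_balanced[OF \<gamma> a dx u]) (use t in auto)
  have b3: "\<gamma> m (j - 1) (act P p i a x) (dd U j u) = psign (i * p) (\<gamma> i (q - 1) x (act U p (j - 1) a (dd U j u)))"
    by (rule form_balanced[OF \<gamma> a x du]) (use t in auto)
  show "psign (i * p) (cobd P U \<gamma> m j (act P p i a x) u) = cobd P U \<gamma> i q x (act U p j a u)"
    unfolding cobd_def L Rr b1 b2 b3 using t
    by (simp add: psign_def)
qed

lemma cobd_cobd: "form A P U t \<gamma> \<Longrightarrow> i + j = t + 2 \<Longrightarrow> x \<in> carrier (gr P i) \<Longrightarrow> u \<in> carrier (gr U j) \<Longrightarrow>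
  cobd P U (cobd P U \<gamma>) i j x u = 0"
  by (simp add: cobd_def P.cplx.dd_dd U.cplx.dd_dd P.cplx.d_closed U.cplx.d_closed form_zero_left form_zero_right psign_def)

lemma form_add: "form A P U t \<beta> \<Longrightarrow> form A P U t \<gamma> \<Longrightarrow> form A P U t (\<lambda>i j x u. \<beta> i j x u + \<gamma> i j x u)"
  by (rule formI) (simp_all add: form_add_left form_add_right form_balanced psign_def)

lemma form_diff: "form A P U t \<beta> \<Longrightarrow> form A P U t \<gamma> \<Longrightarrow> form A P U t (\<lambda>i j x u. \<beta> i j x u - \<gamma> i j x u)"
  by (rule formI) (simp_all add: form_add_left form_add_right form_balanced psign_def)

definition swap :: "('x, 'y) pairing \<Rightarrow> ('y, 'x) pairing" where
  "swap \<beta> j i u x = psign (i * j) (\<beta> i j x u)"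

lemma swap_form:
  assumes \<beta>: "form A P U t \<beta>"
  shows "form A U P t (swap \<beta>)"
proof (rule formI)
  fix j i u u' x assume "j + i = t" "u \<in> carrier (gr U j)" "u' \<in> carrier (gr U j)" "x \<in> carrier (gr P i)"
  then show "swap \<beta> j i (u \<oplus>\<^bsub>gr U j\<^esub> u') x = swap \<beta> j i u x + swap \<beta> j i u' x"
    by (simp add: swap_def form_add_right[OF \<beta>] add.commute)
next
  fix j i u x x' assume "j + i = t" "u \<in> carrier (gr U j)" "x \<in> carrier (gr P i)" "x' \<in> carrier (gr P i)"
  then show "swap \<beta> j i u (x \<oplus>\<^bsub>gr P i\<^esub> x') = swap \<beta> j i u x + swap \<beta> j i u x'"
    by (simp add: swap_def form_add_left[OF \<beta>] add.commute)
next
  fix p j i m q a u x assume t: "j + q = t" "m + i = t" "m = p + j" "q = p + i"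
    and a: "a \<in> carrier (gr A p)" and u: "u \<in> carrier (gr U j)" and x: "x \<in> carrier (gr P i)"
  have "\<beta> q j (act P p i a x) u = psign (i * p) (\<beta> i m x (act U p j a u))"
    by (rule form_balanced[OF \<beta> a x u]) (use t in auto)
  then show "psign (j * p) (swap \<beta> m i (act U p j a u) x) = swap \<beta> j q u (act P p i a x)"
    using t by (simp add: swap_def psign_def)
qed

lemma swap_cobd: "cobd U P (swap \<beta>) j i u x = psign (i * j) (cobd P U \<beta> i j x u)"
  by (simp add: cobd_def swap_def psign_def)

lemma swap_cocycle: "cocycle_form A P U t \<beta> \<Longrightarrow> cocycle_form A U P t (swap \<beta>)"
  by (auto simp: cocycle_form_def swap_form swap_cobd agree_def)

end

text \<open>The symmetry \<open>P \<otimes>\<^sub>A U \<cong> U \<otimes>\<^sub>A P\<close>, with the usual sign, carries cocycles to cocycles and coboundaries to coboundaries.\<close>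

lemma perp_swap:
  assumes "dg_module R A P" "dg_module R A U" and perp: "perp A P U t"
  shows "perp A U P t"
  unfolding perp_def
proof (intro allI impI)
  fix \<beta> assume \<beta>: "cocycle_form A U P t \<beta>"
  interpret UP: dg_pair R A U P using assms by (simp add: dg_pair_def)
  interpret PU: dg_pair R A P U using assms by (simp add: dg_pair_def)
  obtain \<gamma> where \<gamma>: "form A P U (t - 1) \<gamma>" "agree P U t (UP.swap \<beta>) (cobd P U \<gamma>)"
    using perp UP.swap_cocycle[OF \<beta>] by (auto simp: perp_def)
  have "agree U P t \<beta> (cobd U P (PU.swap \<gamma>))"
  proof (rule agreeI)
    fix j i u x assume "j + i = t" "u \<in> carrier (gr U j)" "x \<in> carrier (gr P i)"
    then have "UP.swap \<beta> i j x u = cobd P U \<gamma> i j x u" by (intro agreeD[OF \<gamma>(2)]) auto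
    then have "psign (i * j) (psign (j * i) (\<beta> j i u x)) = cobd U P (PU.swap \<gamma>) j i u x"
      unfolding PU.swap_cobd UP.swap_def by simp
    then show "\<beta> j i u x = cobd U P (PU.swap \<gamma>) j i u x" by (simp add: psign_def mult.commute split: if_splits)
  qed
  then show "\<exists>\<gamma>. form A U P (t - 1) \<gamma> \<and> agree U P t \<beta> (cobd U P \<gamma>)"
    using PU.swap_form[OF \<gamma>(1)] by blast
qed

section \<open>The long exact sequence of a cone\<close>

locale pair_with_hom = P: dg_module R A P + dg_morphism R A U V f
  for R :: "('r, 's) ring_scheme" and A :: "('r, 'a, 'm) dg_alg_scheme"
    and P :: "('r, 'a, 'z, 'q) dg_mod_scheme"
    and U :: "('r, 'a, 'x, 'n) dg_mod_scheme" and V :: "('r, 'a, 'y, 'p) dg_mod_scheme" and f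
begin

abbreviation "C \<equiv> cone_mod U V f"

sublocale C: dg_module R A C by (rule cone_is_dg_module)
sublocale PU: dg_pair R A P U by unfold_locales
sublocale PV: dg_pair R A P V by unfold_locales
sublocale PC: dg_pair R A P C by unfold_locales

lemma pullback_form:
  assumes "form A P V t \<beta>" shows "form A P U t (\<lambda>i j x u. \<beta> i j x (f j u))"
proof (rule formI)
  fix p i j m q a x u assume t: "i + q = t" "m + j = t" "m = p + i" "q = p + j"
    and a: "a \<in> carrier (gr A p)" and x: "x \<in> carrier (gr P i)" and u: "u \<in> carrier (gr U j)"
  show "psign (i * p) (\<beta> m j (act P p i a x) (f j u)) = \<beta> i q x (f q (act U p j a u))"
    using form_balanced[OF assms a x f_cl[OF u] t(3,4,1)] f_act[OF u a t(4)] by (simp add: psign_def)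
qed (simp_all add: form_add_left[OF assms] form_add_right[OF assms] f_add f_cl)

lemma pullback_cobd:
  assumes "x \<in> carrier (gr P i)" "u \<in> carrier (gr U j)"
  shows "cobd P U (\<lambda>i j x u. \<beta> i j x (f j u)) i j x u = cobd P V \<beta> i j x (f j u)"
  using assms by (simp add: cobd_def f_d)

text \<open>As a graded module the cone is a direct sum, so a pair of forms is a form on it; the sign accounts for the shift.\<close>

lemma cone_form:
  assumes \<beta>: "form A P V t \<beta>" and \<delta>: "form A P U (t - 1) \<delta>"
  shows "form A P C t (\<lambda>i j x (v, u). \<beta> i j x v + psign i (\<delta> i (j - 1) x u))"
proof (rule formI)
  fix i j x x' w assume "i + j = t" and w: "x \<in> carrier (gr P i)" "x' \<in> carrier (gr P i)" "w \<in> carrier (gr C j)"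
  then have t: "i + j = t" "i + (j - 1) = t - 1" by auto
  show "(case w of (v, u) \<Rightarrow> \<beta> i j (x \<oplus>\<^bsub>gr P i\<^esub> x') v + psign i (\<delta> i (j - 1) (x \<oplus>\<^bsub>gr P i\<^esub> x') u)) =
    (case w of (v, u) \<Rightarrow> \<beta> i j x v + psign i (\<delta> i (j - 1) x u)) +
    (case w of (v, u) \<Rightarrow> \<beta> i j x' v + psign i (\<delta> i (j - 1) x' u))"
    using w by (auto simp: form_add_left[OF \<beta> t(1)] form_add_left[OF \<delta> t(2)])
next
  fix i j x w w' assume "i + j = t" and w: "x \<in> carrier (gr P i)" "w \<in> carrier (gr C j)" "w' \<in> carrier (gr C j)"
  then have t: "i + j = t" "i + (j - 1) = t - 1" by auto
  show "(case w \<oplus>\<^bsub>gr C j\<^esub> w' of (v, u) \<Rightarrow> \<beta> i j x v + psign i (\<delta> i (j - 1) x u)) =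
    (case w of (v, u) \<Rightarrow> \<beta> i j x v + psign i (\<delta> i (j - 1) x u)) +
    (case w' of (v, u) \<Rightarrow> \<beta> i j x v + psign i (\<delta> i (j - 1) x u))"
    using w by (auto simp: form_add_right[OF \<beta> t(1)] form_add_right[OF \<delta> t(2)])
next
  fix p i j m q a x w assume t: "i + q = t" "m + j = t" "m = p + i" "q = p + j"
    and a: "a \<in> carrier (gr A p)" and x: "x \<in> carrier (gr P i)" and w: "w \<in> carrier (gr C j)"
  obtain v u where w': "w = (v, u)" "v \<in> carrier (gr V j)" "u \<in> carrier (gr U (j - 1))" using w by auto
  have 1: "\<beta> m j (act P p i a x) v = psign (i * p) (\<beta> i q x (act V p j a v))"
    by (rule form_balanced[OF \<beta> a x w'(2)]) (use t in auto)
  have 2: "\<delta> m (j - 1) (act P p i a x) u = psign (i * p) (\<delta> i (q - 1) x (act U p (j - 1) a u))"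
    by (rule form_balanced[OF \<delta> a x w'(3)]) (use t in auto)
  have c: "act U p (j - 1) a u \<in> carrier (gr U (q - 1))" using t by (intro U.act_cl[OF a w'(3)]) auto
  have 3: "\<delta> i (q - 1) x (ksign (gr U (q - 1)) p (act U p (j - 1) a u)) = psign p (\<delta> i (q - 1) x (act U p (j - 1) a u))"
    by (rule PU.form_ksign_right[OF \<delta> _ c x]) (use t in auto)
  have q: "p + j - 1 = q - 1" using t by simp
  show "psign (i * p) (case w of (v, u) \<Rightarrow> \<beta> m j (act P p i a x) v + psign m (\<delta> m (j - 1) (act P p i a x) u)) =
    (case act C p j a w of (v, u) \<Rightarrow> \<beta> i q x v + psign i (\<delta> i (q - 1) x u))"
    unfolding w' cone_simps prod.case 1 2 q 3 using t by (simp add: psign_def)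
qed

lemma restrict_form: assumes "form A P C t \<Psi>" shows "form A P V t (\<lambda>i j x v. \<Psi> i j x (v, \<zero>\<^bsub>gr U (j - 1)\<^esub>))"
proof (rule formI)
  fix p i j m q a x v assume t: "i + q = t" "m + j = t" "m = p + i" "q = p + j"
    and a: "a \<in> carrier (gr A p)" and x: "x \<in> carrier (gr P i)" and v: "v \<in> carrier (gr V j)"
  have "act U p (j - 1) a \<zero>\<^bsub>gr U (j - 1)\<^esub> = \<zero>\<^bsub>gr U (p + j - 1)\<^esub>" using U.act_zero_right[OF a, of "j - 1"]
    by (simp add: add_diff_eq)
  then show "psign (i * p) (\<Psi> m j (act P p i a x) (v, \<zero>\<^bsub>gr U (j - 1)\<^esub>)) = \<Psi> i q x (act V p j a v, \<zero>\<^bsub>gr U (q - 1)\<^esub>)"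
    using form_balanced[OF assms a x, of "(v, \<zero>\<^bsub>gr U (j - 1)\<^esub>)" j m q] t v by (simp add: psign_def)
next
  fix i j x v v' assume *: "i + j = t" "x \<in> carrier (gr P i)" "v \<in> carrier (gr V j)" "v' \<in> carrier (gr V j)"
  show "\<Psi> i j x (v \<oplus>\<^bsub>gr V j\<^esub> v', \<zero>\<^bsub>gr U (j - 1)\<^esub>) = \<Psi> i j x (v, \<zero>\<^bsub>gr U (j - 1)\<^esub>) + \<Psi> i j x (v', \<zero>\<^bsub>gr U (j - 1)\<^esub>)"
    using form_add_right[OF assms *(1,2), of "(v, \<zero>\<^bsub>gr U (j - 1)\<^esub>)" "(v', \<zero>\<^bsub>gr U (j - 1)\<^esub>)"] * by simp
next
  fix i j x x' v assume *: "i + j = t" "x \<in> carrier (gr P i)" "x' \<in> carrier (gr P i)" "v \<in> carrier (gr V j)"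
  show "\<Psi> i j (x \<oplus>\<^bsub>gr P i\<^esub> x') (v, \<zero>\<^bsub>gr U (j - 1)\<^esub>) = \<Psi> i j x (v, \<zero>\<^bsub>gr U (j - 1)\<^esub>) + \<Psi> i j x' (v, \<zero>\<^bsub>gr U (j - 1)\<^esub>)"
    using form_add_left[OF assms *(1,2,3), of "(v, \<zero>\<^bsub>gr U (j - 1)\<^esub>)"] * by simp
qed

lemma restrict_cobd:
  assumes "v \<in> carrier (gr V j)"
  shows "cobd P V (\<lambda>i j x v. \<Psi> i j x (v, \<zero>\<^bsub>gr U (j - 1)\<^esub>)) i j x v = cobd P C \<Psi> i j x (v, \<zero>\<^bsub>gr U (j - 1)\<^esub>)"
  using assms by (simp add: cobd_def V.cplx.d_closed)

text \<open>
  Half of the long exact sequence of \<open>U \<rightarrow> V \<rightarrow> cone\<close>: a cocycle on \<open>V\<close> becomes a coboundary on \<open>U\<close>, the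
  bounding form turns it into a cocycle on the cone, and a form that bounds this cocycle is restricted to \<open>V\<close>.
\<close>

theorem perp_target:
  assumes ex: "\<And>s. perp A P C s" and perp: "perp A P U t"
  shows "perp A P V t"
  unfolding perp_def
proof (intro allI impI)
  fix \<beta> assume "cocycle_form A P V t \<beta>"
  then have \<beta>: "form A P V t \<beta>" and co: "agree P V (t + 1) (cobd P V \<beta>) (\<lambda>i j x u. 0)"
    by (auto simp: cocycle_form_def)
  have "cocycle_form A P U t (\<lambda>i j x u. \<beta> i j x (f j u))"
    using pullback_form[OF \<beta>] by (auto simp: cocycle_form_def pullback_cobd agreeD[OF co] f_cl intro!: agreeI)
  then obtain \<delta> where \<delta>: "form A P U (t - 1) \<delta>" "agree P U t (\<lambda>i j x u. \<beta> i j x (f j u)) (cobd P U \<delta>)"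
    using perp by (auto simp: perp_def)
  define \<Phi> where "\<Phi> = (\<lambda>i j x (v, u). \<beta> i j x v + psign i (\<delta> i (j - 1) x u))"
  have "form A P C t \<Phi>" unfolding \<Phi>_def by (rule cone_form[OF \<beta> \<delta>(1)])
  moreover have "agree P C (t + 1) (cobd P C \<Phi>) (\<lambda>i j x u. 0)"
  proof (rule agreeI)
    fix i j x w assume t: "i + j = t + 1" and x: "x \<in> carrier (gr P i)" and w: "w \<in> carrier (gr C j)"
    obtain v u where w': "w = (v, u)" "v \<in> carrier (gr V j)" "u \<in> carrier (gr U (j - 1))" using w by auto
    have c: "dd V j v \<in> carrier (gr V (j - 1))" "f (j - 1) u \<in> carrier (gr V (j - 1))"
      "dd U (j - 1) u \<in> carrier (gr U (j - 1 - 1))" "dd P i x \<in> carrier (gr P (i - 1))"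
      using w' x by (auto intro: V.cplx.d_cl f_cl U.cplx.d_cl P.cplx.d_cl)
    have 1: "\<beta> i (j - 1) x (dd V j v \<oplus>\<^bsub>gr V (j - 1)\<^esub> f (j - 1) u) = \<beta> i (j - 1) x (dd V j v) + \<beta> i (j - 1) x (f (j - 1) u)"
      by (rule form_add_right[OF \<beta>]) (use c x t in auto)
    have 2: "\<delta> i (j - 1 - 1) x (\<ominus>\<^bsub>gr U (j - 1 - 1)\<^esub> dd U (j - 1) u) = - \<delta> i (j - 1 - 1) x (dd U (j - 1) u)"
      by (rule PU.form_neg_right[OF \<delta>(1)]) (use c x t in auto)
    have 3: "\<beta> i (j - 1) x (f (j - 1) u) = cobd P U \<delta> i (j - 1) x u"
      by (rule agreeD[OF \<delta>(2)]) (use w' x t in auto)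
    have 4: "cobd P V \<beta> i j x v = 0" using agreeD[OF co t x w'(2)] .
    have "cobd P C \<Phi> i j x w = cobd P V \<beta> i j x v + psign i (\<beta> i (j - 1) x (f (j - 1) u)) - psign i (cobd P U \<delta> i (j - 1) x u)"
      unfolding w' cobd_def \<Phi>_def prod.case cone_simps 1 2 by (simp add: psign_def)
    then show "cobd P C \<Phi> i j x w = 0" using 3 4 by simp
  qed
  ultimately obtain \<Psi> where \<Psi>: "form A P C (t - 1) \<Psi>" "agree P C t \<Phi> (cobd P C \<Psi>)"
    using ex[of t] by (auto simp: perp_def cocycle_form_def)
  let ?\<gamma> = "\<lambda>i j x v. \<Psi> i j x (v, \<zero>\<^bsub>gr U (j - 1)\<^esub>)"
  have "agree P V t \<beta> (cobd P V ?\<gamma>)"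
  proof (rule agreeI)
    fix i j x v assume t: "i + j = t" and x: "x \<in> carrier (gr P i)" and v: "v \<in> carrier (gr V j)"
    have "\<delta> i (j - 1) x \<zero>\<^bsub>gr U (j - 1)\<^esub> = 0" by (rule PU.form_zero_right[OF \<delta>(1)]) (use t x in auto)
    then have "\<beta> i j x v = \<Phi> i j x (v, \<zero>\<^bsub>gr U (j - 1)\<^esub>)" by (simp add: \<Phi>_def)
    also have "\<dots> = cobd P C \<Psi> i j x (v, \<zero>\<^bsub>gr U (j - 1)\<^esub>)" by (rule agreeD[OF \<Psi>(2) t x]) (use v in simp)
    finally show "\<beta> i j x v = cobd P V ?\<gamma> i j x v" using restrict_cobd[OF v] by simp
  qed
  then show "\<exists>\<gamma>. form A P V (t - 1) \<gamma> \<and> agree P V t \<beta> (cobd P V \<gamma>)"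
    using restrict_form[OF \<Psi>(1)] by blast
qed

text \<open>
  The other half: a cocycle on \<open>U\<close> is a cocycle on the cone that vanishes on \<open>V\<close>. A form \<open>\<Psi>\<close> that bounds it restricts
  to a cocycle on \<open>V\<close>, which bounds some \<open>\<eta>\<close>; the pullback of \<open>\<eta>\<close> and the \<open>\<Sigma>U\<close>-component of \<open>\<Psi>\<close> together bound the
  original cocycle.
\<close>

theorem perp_source:
  assumes ex: "\<And>s. perp A P C s" and perp: "perp A P V t"
  shows "perp A P U t"
  unfolding perp_def
proof (intro allI impI)
  fix \<beta> assume "cocycle_form A P U t \<beta>"
  then have \<beta>: "form A P U t \<beta>" and co: "agree P U (t + 1) (cobd P U \<beta>) (\<lambda>i j x u. 0)"
    by (auto simp: cocycle_form_def)
  define \<Phi> where "\<Phi> = (\<lambda>i j x (v :: 'y, u). 0 + psign i (\<beta> i (j - 1) x u))"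
  have "form A P V (t + 1) (\<lambda>i j x v. 0)" by (rule formI) auto
  moreover have \<beta>': "form A P U (t + 1 - 1) \<beta>" using \<beta> by simp
  ultimately have "form A P C (t + 1) \<Phi>" unfolding \<Phi>_def by (rule cone_form)
  moreover have "agree P C (t + 1 + 1) (cobd P C \<Phi>) (\<lambda>i j x u. 0)"
  proof (rule agreeI)
    fix i j x w assume t: "i + j = t + 1 + 1" and x: "x \<in> carrier (gr P i)" and w: "w \<in> carrier (gr C j)"
    obtain v u where w': "w = (v, u)" "v \<in> carrier (gr V j)" "u \<in> carrier (gr U (j - 1))" using w by auto
    have c: "dd U (j - 1) u \<in> carrier (gr U (j - 1 - 1))" using w' by (auto intro: U.cplx.d_cl)
    have 2: "\<beta> i (j - 1 - 1) x (\<ominus>\<^bsub>gr U (j - 1 - 1)\<^esub> dd U (j - 1) u) = - \<beta> i (j - 1 - 1) x (dd U (j - 1) u)"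
      by (rule PU.form_neg_right[OF \<beta>]) (use c x t in auto)
    have 3: "cobd P U \<beta> i (j - 1) x u = 0"
      by (rule agreeD[OF co]) (use w' x t in auto)
    have "cobd P C \<Phi> i j x w = - psign i (cobd P U \<beta> i (j - 1) x u)"
      unfolding w' cobd_def \<Phi>_def prod.case cone_simps 2 by (simp add: psign_def)
    then show "cobd P C \<Phi> i j x w = 0" using 3 by simp
  qed
  ultimately obtain \<Psi> where \<Psi>: "form A P C t \<Psi>" "agree P C (t + 1) \<Phi> (cobd P C \<Psi>)"
    using ex[of "t + 1"] by (auto simp: perp_def cocycle_form_def)
  let ?\<gamma> = "\<lambda>i j x v. \<Psi> i j x (v, \<zero>\<^bsub>gr U (j - 1)\<^esub>)"
  have \<gamma>: "form A P V t ?\<gamma>" by (rule restrict_form[OF \<Psi>(1)])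
  moreover have "agree P V (t + 1) (cobd P V ?\<gamma>) (\<lambda>i j x u. 0)"
  proof (rule agreeI)
    fix i j x v assume t: "i + j = t + 1" and x: "x \<in> carrier (gr P i)" and v: "v \<in> carrier (gr V j)"
    have "\<beta> i (j - 1) x \<zero>\<^bsub>gr U (j - 1)\<^esub> = 0" by (rule PU.form_zero_right[OF \<beta>]) (use t x in auto)
    then have "0 = \<Phi> i j x (v, \<zero>\<^bsub>gr U (j - 1)\<^esub>)" by (simp add: \<Phi>_def)
    also have "\<dots> = cobd P C \<Psi> i j x (v, \<zero>\<^bsub>gr U (j - 1)\<^esub>)" by (rule agreeD[OF \<Psi>(2) t x]) (use v in simp)
    finally show "cobd P V ?\<gamma> i j x v = 0" using restrict_cobd[OF v] by simp
  qed
  ultimately obtain \<eta> where \<eta>: "form A P V (t - 1) \<eta>" "agree P V t ?\<gamma> (cobd P V \<eta>)"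
    using perp by (auto simp: perp_def cocycle_form_def)
  define \<epsilon> where "\<epsilon> = (\<lambda>i j x u. - psign i (\<Psi> i (j + 1) x (\<zero>\<^bsub>gr V (j + 1)\<^esub>, u)))"
  have \<epsilon>: "form A P U (t - 1) \<epsilon>"
  proof (rule formI)
    fix p i j m q a x u assume t: "i + q = t - 1" "m + j = t - 1" "m = p + i" "q = p + j"
      and a: "a \<in> carrier (gr A p)" and x: "x \<in> carrier (gr P i)" and u: "u \<in> carrier (gr U j)"
    have z: "act V p (j + 1) a \<zero>\<^bsub>gr V (j + 1)\<^esub> = \<zero>\<^bsub>gr V (q + 1)\<^esub>" using V.act_zero_right[OF a, of "j + 1"] t
      by (simp add: add.assoc)
    have c: "act U p j a u \<in> carrier (gr U q)" using t by (intro U.act_cl[OF a u]) auto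
    have "\<Psi> m (j + 1) (act P p i a x) (\<zero>\<^bsub>gr V (j + 1)\<^esub>, u) = psign (i * p) (\<Psi> i (q + 1) x (act C p (j + 1) a (\<zero>\<^bsub>gr V (j + 1)\<^esub>, u)))"
      by (rule form_balanced[OF \<Psi>(1) a x]) (use t u in auto)
    also have "act C p (j + 1) a (\<zero>\<^bsub>gr V (j + 1)\<^esub>, u) = ksign (gr C (q + 1)) p (\<zero>\<^bsub>gr V (q + 1)\<^esub>, act U p j a u)"
      using z c t by (simp add: direct_sum_ksign U.cplx.grp.abelian_group_axioms V.cplx.grp.abelian_group_axioms)
    also have "\<Psi> i (q + 1) x \<dots> = psign p (\<Psi> i (q + 1) x (\<zero>\<^bsub>gr V (q + 1)\<^esub>, act U p j a u))"
      by (rule PC.form_ksign_right[OF \<Psi>(1)]) (use t x c in auto)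
    finally show "psign (i * p) (\<epsilon> m j (act P p i a x) u) = \<epsilon> i q x (act U p j a u)"
      using t by (simp add: \<epsilon>_def psign_def)
  next
    fix i j x u u' assume *: "i + j = t - 1" "x \<in> carrier (gr P i)" "u \<in> carrier (gr U j)" "u' \<in> carrier (gr U j)"
    have "\<Psi> i (j + 1) x ((\<zero>\<^bsub>gr V (j + 1)\<^esub>, u) \<oplus>\<^bsub>gr C (j + 1)\<^esub> (\<zero>\<^bsub>gr V (j + 1)\<^esub>, u')) =
        \<Psi> i (j + 1) x (\<zero>\<^bsub>gr V (j + 1)\<^esub>, u) + \<Psi> i (j + 1) x (\<zero>\<^bsub>gr V (j + 1)\<^esub>, u')"
      by (rule form_add_right[OF \<Psi>(1)]) (use * in auto)
    then show "\<epsilon> i j x (u \<oplus>\<^bsub>gr U j\<^esub> u') = \<epsilon> i j x u + \<epsilon> i j x u'" by (simp add: \<epsilon>_def)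
  next
    fix i j x x' u assume *: "i + j = t - 1" "x \<in> carrier (gr P i)" "x' \<in> carrier (gr P i)" "u \<in> carrier (gr U j)"
    have "\<Psi> i (j + 1) (x \<oplus>\<^bsub>gr P i\<^esub> x') (\<zero>\<^bsub>gr V (j + 1)\<^esub>, u) =
        \<Psi> i (j + 1) x (\<zero>\<^bsub>gr V (j + 1)\<^esub>, u) + \<Psi> i (j + 1) x' (\<zero>\<^bsub>gr V (j + 1)\<^esub>, u)"
      by (rule form_add_left[OF \<Psi>(1)]) (use * in auto)
    then show "\<epsilon> i j (x \<oplus>\<^bsub>gr P i\<^esub> x') u = \<epsilon> i j x u + \<epsilon> i j x' u" by (simp add: \<epsilon>_def)
  qed
  have fin: "agree P U t \<beta> (cobd P U (\<lambda>i j x u. \<eta> i j x (f j u) + \<epsilon> i j x u))"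
  proof (rule agreeI)
    fix i j x u assume t: "i + j = t" and x: "x \<in> carrier (gr P i)" and u: "u \<in> carrier (gr U j)"
    have du: "dd U j u \<in> carrier (gr U (j - 1))" using u by (rule U.cplx.d_closed)
    have "psign i (\<beta> i j x u) = \<Phi> i (j + 1) x (\<zero>\<^bsub>gr V (j + 1)\<^esub>, u)" by (simp add: \<Phi>_def)
    also have "\<dots> = cobd P C \<Psi> i (j + 1) x (\<zero>\<^bsub>gr V (j + 1)\<^esub>, u)"
      by (rule agreeD[OF \<Psi>(2)]) (use t x u in auto)
    also have "\<dots> = \<Psi> (i - 1) (j + 1) (dd P i x) (\<zero>\<^bsub>gr V (j + 1)\<^esub>, u) + psign i (\<Psi> i j x (f j u, \<ominus>\<^bsub>gr U (j - 1)\<^esub> dd U j u))"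
      using u V.cplx.d_zero[of "j + 1"] by (simp add: cobd_def f_cl)
    also have "(f j u, \<ominus>\<^bsub>gr U (j - 1)\<^esub> dd U j u) = (f j u, \<zero>\<^bsub>gr U (j - 1)\<^esub>) \<oplus>\<^bsub>gr C j\<^esub> (\<ominus>\<^bsub>gr C j\<^esub> (\<zero>\<^bsub>gr V j\<^esub>, dd U j u))"
      using u du by (simp add: direct_sum_neg U.cplx.grp.abelian_group_axioms V.cplx.grp.abelian_group_axioms f_cl)
    also have "\<Psi> i j x \<dots> = \<Psi> i j x (f j u, \<zero>\<^bsub>gr U (j - 1)\<^esub>) - \<Psi> i j x (\<zero>\<^bsub>gr V j\<^esub>, dd U j u)"
      using form_add_right[OF \<Psi>(1) t x, of "(f j u, \<zero>\<^bsub>gr U (j - 1)\<^esub>)" "\<ominus>\<^bsub>gr C j\<^esub> (\<zero>\<^bsub>gr V j\<^esub>, dd U j u)"]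
        PC.form_neg_right[OF \<Psi>(1) t _ x, of "(\<zero>\<^bsub>gr V j\<^esub>, dd U j u)"] u du
        C.cplx.grp.a_inv_closed[of "(\<zero>\<^bsub>gr V j\<^esub>, dd U j u)" j]
      by (simp add: f_cl)
    also have "\<Psi> i j x (f j u, \<zero>\<^bsub>gr U (j - 1)\<^esub>) = cobd P V \<eta> i j x (f j u)"
      using agreeD[OF \<eta>(2) t x f_cl[OF u]] .
    finally have "\<beta> i j x u = psign i (\<Psi> (i - 1) (j + 1) (dd P i x) (\<zero>\<^bsub>gr V (j + 1)\<^esub>, u)) +
        cobd P V \<eta> i j x (f j u) - \<Psi> i j x (\<zero>\<^bsub>gr V j\<^esub>, dd U j u)"
      by (simp add: psign_def algebra_simps split: if_splits)
    then show "\<beta> i j x u = cobd P U (\<lambda>i j x u. \<eta> i j x (f j u) + \<epsilon> i j x u) i j x u"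
      using f_d[OF u, of "j - 1"] by (simp add: cobd_def \<epsilon>_def psign_def)
  qed
  show "\<exists>\<gamma>. form A P U (t - 1) \<gamma> \<and> agree P U t \<beta> (cobd P U \<gamma>)"
    using fin PU.form_add[OF pullback_form[OF \<eta>(1)] \<epsilon>] by blast
qed

end

section \<open>Coefficient families\<close>

definition supp :: "('r, 'a, 'm) dg_alg_scheme \<Rightarrow> ('i \<Rightarrow> int) \<Rightarrow> int \<Rightarrow> ('i \<Rightarrow> 'a) \<Rightarrow> 'i set" where
  "supp A dg j c = {p. c p \<noteq> \<zero>\<^bsub>gr A (j - dg p)\<^esub>}"

text \<open>
  The families of coefficients of degree \<open>j\<close> elements in a free graded module with basis elements \<open>p\<close> of degree
  \<open>dg p\<close>. Families are total functions with value zero outside \<open>I\<close>, so that enlarging the index set is an inclusion of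
  sets of families.
\<close>

definition fam :: "('r, 'a, 'm) dg_alg_scheme \<Rightarrow> ('i \<Rightarrow> int) \<Rightarrow> 'i set \<Rightarrow> int \<Rightarrow> ('i \<Rightarrow> 'a) set" where
  "fam A dg I j = {c. (\<forall>p. c p \<in> carrier (gr A (j - dg p))) \<and> finite (supp A dg j c) \<and> supp A dg j c \<subseteq> I}"

definition mon :: "('r, 'a, 'm) dg_alg_scheme \<Rightarrow> ('i \<Rightarrow> int) \<Rightarrow> int \<Rightarrow> 'i \<Rightarrow> 'a \<Rightarrow> ('i \<Rightarrow> 'a)" where
  "mon A dg j q a = (\<lambda>p. if p = q then a else \<zero>\<^bsub>gr A (j - dg p)\<^esub>)"

definition fadd :: "('r, 'a, 'm) dg_alg_scheme \<Rightarrow> ('i \<Rightarrow> int) \<Rightarrow> int \<Rightarrow> ('i \<Rightarrow> 'a) \<Rightarrow> ('i \<Rightarrow> 'a) \<Rightarrow> ('i \<Rightarrow> 'a)" where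
  "fadd A dg j c c' = (\<lambda>p. c p \<oplus>\<^bsub>gr A (j - dg p)\<^esub> c' p)"

definition fzero :: "('r, 'a, 'm) dg_alg_scheme \<Rightarrow> ('i \<Rightarrow> int) \<Rightarrow> int \<Rightarrow> ('i \<Rightarrow> 'a)" where
  "fzero A dg j = (\<lambda>p. \<zero>\<^bsub>gr A (j - dg p)\<^esub>)"

text \<open>The additive extension of a map that is given on the families with one non-zero entry.\<close>

definition sumext :: "('b, 'k) ring_scheme \<Rightarrow> ('r, 'a, 'm) dg_alg_scheme \<Rightarrow> ('i \<Rightarrow> int) \<Rightarrow> int \<Rightarrow>
    ('i \<Rightarrow> 'a \<Rightarrow> 'b) \<Rightarrow> ('i \<Rightarrow> 'a) \<Rightarrow> 'b" where
  "sumext M A dg j h c = (\<Oplus>\<^bsub>M\<^esub>p\<in>supp A dg j c. h p (c p))"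

lemma famD: "c \<in> fam A dg I j \<Longrightarrow> c p \<in> carrier (gr A (j - dg p))"
  and fam_fin: "c \<in> fam A dg I j \<Longrightarrow> finite (supp A dg j c)"
  and fam_supp: "c \<in> fam A dg I j \<Longrightarrow> supp A dg j c \<subseteq> I"
  and fam_zero_outside: "c \<in> fam A dg I j \<Longrightarrow> p \<notin> I \<Longrightarrow> c p = \<zero>\<^bsub>gr A (j - dg p)\<^esub>"
  by (auto simp: fam_def supp_def)

lemma fam_mono: "I \<subseteq> J \<Longrightarrow> fam A dg I j \<subseteq> fam A dg J j"
  by (auto simp: fam_def)

lemma fam_restrict: "c \<in> fam A dg J j \<Longrightarrow> supp A dg j c \<subseteq> I \<Longrightarrow> c \<in> fam A dg I j"
  by (auto simp: fam_def)

context dg_algebra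
begin

lemma mon_fam: "q \<in> I \<Longrightarrow> a \<in> carrier (gr A (j - dg q)) \<Longrightarrow> mon A dg j q a \<in> fam A dg I j"
  by (auto simp: fam_def mon_def supp_def intro: finite_subset[of _ "{q}"] split: if_splits)

lemma fzero_fam: "fzero A dg j \<in> fam A dg I j"
  by (auto simp: fam_def fzero_def supp_def)

lemma mon_zero: "mon A dg j q \<zero>\<^bsub>gr A (j - dg q)\<^esub> = fzero A dg j"
  by (auto simp: mon_def fzero_def)

lemma fadd_fam: "c \<in> fam A dg I j \<Longrightarrow> c' \<in> fam A dg I j \<Longrightarrow> fadd A dg j c c' \<in> fam A dg I j"
proof -
  assume c: "c \<in> fam A dg I j" "c' \<in> fam A dg I j"
  have "supp A dg j (fadd A dg j c c') \<subseteq> supp A dg j c \<union> supp A dg j c'"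
    by (auto simp: supp_def fadd_def)
  then show ?thesis using c by (auto simp: fam_def fadd_def dest: finite_subset)
qed

lemma mon_add: "a \<in> carrier (gr A (j - dg q)) \<Longrightarrow> b \<in> carrier (gr A (j - dg q)) \<Longrightarrow>
  mon A dg j q (a \<oplus>\<^bsub>gr A (j - dg q)\<^esub> b) = fadd A dg j (mon A dg j q a) (mon A dg j q b)"
  by (auto simp: mon_def fadd_def)

lemma fam_induct [consumes 1, case_names zero mon add]:
  assumes c: "c \<in> fam A dg I j"
    and zero: "Q (fzero A dg j)"
    and mon: "\<And>q a. q \<in> I \<Longrightarrow> a \<in> carrier (gr A (j - dg q)) \<Longrightarrow> Q (mon A dg j q a)"
    and add: "\<And>c c'. c \<in> fam A dg I j \<Longrightarrow> c' \<in> fam A dg I j \<Longrightarrow> Q c \<Longrightarrow> Q c' \<Longrightarrow> Q (fadd A dg j c c')"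
  shows "Q c"
proof -
  have "supp A dg j c \<subseteq> S \<Longrightarrow> Q c" if "finite S" "c \<in> fam A dg I j" for S c
    using that
  proof (induction S arbitrary: c rule: finite_induct)
    case empty
    then have "c = fzero A dg j" by (auto simp: supp_def fzero_def)
    then show ?case using zero by simp
  next
    case (insert x S)
    show ?case
    proof (cases "x \<in> supp A dg j c")
      case False
      then show ?thesis using insert by blast
    next
      case True
      then have x: "x \<in> I" "c x \<in> carrier (gr A (j - dg x))" using insert by (auto simp: fam_def)
      let ?c = "c(x := \<zero>\<^bsub>gr A (j - dg x)\<^esub>)"
      have s: "supp A dg j ?c = supp A dg j c - {x}" by (auto simp: supp_def)
      have c': "?c \<in> fam A dg I j"
      proof -
        have "supp A dg j ?c \<subseteq> supp A dg j c" using s by blast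
        then show ?thesis using insert.prems(2) by (auto simp: fam_def intro: finite_subset)
      qed
      have "c = fadd A dg j (mon A dg j x (c x)) ?c"
        using famD[OF insert.prems(2)] by (auto simp: fadd_def mon_def fun_eq_iff)
      moreover have "Q ?c" using insert.IH[OF _ c'] insert.prems s by blast
      moreover have "mon A dg j x (c x) \<in> fam A dg I j" by (rule mon_fam) (use x in auto)
      ultimately show ?thesis using add[OF _ c' mon[OF x]] by simp
    qed
  qed
  then show ?thesis using c fam_fin[OF c] by blast
qed

context
  fixes M :: "('b, 'k) ring_scheme" and dg :: "'i \<Rightarrow> int" and I and j and h :: "'i \<Rightarrow> 'a \<Rightarrow> 'b"
  assumes M: "abelian_group M"
    and h: "\<And>p a. p \<in> I \<Longrightarrow> a \<in> carrier (gr A (j - dg p)) \<Longrightarrow> h p a \<in> carrier M"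
    and h_add: "\<And>p a b. p \<in> I \<Longrightarrow> a \<in> carrier (gr A (j - dg p)) \<Longrightarrow> b \<in> carrier (gr A (j - dg p)) \<Longrightarrow>
      h p (a \<oplus>\<^bsub>gr A (j - dg p)\<^esub> b) = h p a \<oplus>\<^bsub>M\<^esub> h p b"
begin

interpretation M: abelian_group M by (rule M)

lemma sumext_h_zero: "p \<in> I \<Longrightarrow> h p \<zero>\<^bsub>gr A (j - dg p)\<^esub> = \<zero>\<^bsub>M\<^esub>"
  by (rule additive_map_zero[OF grp.abelian_group_axioms M, where h = "h p"]) (auto simp: h h_add)

lemma sumext_closed: "c \<in> fam A dg I j \<Longrightarrow> sumext M A dg j h c \<in> carrier M"
  unfolding sumext_def by (rule M.finsum_closed) (auto dest: famD fam_supp intro!: h)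

lemma sumext_superset:
  assumes "c \<in> fam A dg I j" "finite S" "supp A dg j c \<subseteq> S" "S \<subseteq> I"
  shows "sumext M A dg j h c = (\<Oplus>\<^bsub>M\<^esub>p\<in>S. h p (c p))"
  unfolding sumext_def
proof (rule M.add.finprod_mono_neutral_cong_left)
  show "h p (c p) = \<zero>\<^bsub>M\<^esub>" if "p \<in> S - supp A dg j c" for p
    using that assms sumext_h_zero[of p] by (auto simp: supp_def)
  show "(\<lambda>p. h p (c p)) \<in> S \<rightarrow> carrier M"
    using assms famD[OF assms(1)] by (auto intro!: h)
qed (use assms in auto)

lemma sumext_add:
  assumes c: "c \<in> fam A dg I j" "c' \<in> fam A dg I j"
  shows "sumext M A dg j h (fadd A dg j c c') = sumext M A dg j h c \<oplus>\<^bsub>M\<^esub> sumext M A dg j h c'"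
proof -
  let ?S = "supp A dg j c \<union> supp A dg j c'"
  have S: "finite ?S" "?S \<subseteq> I" using c by (auto simp: fam_def)
  have "supp A dg j (fadd A dg j c c') \<subseteq> ?S"
    by (auto simp: supp_def fadd_def)
  then have "sumext M A dg j h (fadd A dg j c c') = (\<Oplus>\<^bsub>M\<^esub>p\<in>?S. h p (fadd A dg j c c' p))"
    using S by (intro sumext_superset fadd_fam c)
  also have "\<dots> = (\<Oplus>\<^bsub>M\<^esub>p\<in>?S. h p (c p) \<oplus>\<^bsub>M\<^esub> h p (c' p))"
    by (rule M.finsum_cong') (use S famD[OF c(1)] famD[OF c(2)] in \<open>auto simp: fadd_def intro!: h_add h\<close>)
  also have "\<dots> = (\<Oplus>\<^bsub>M\<^esub>p\<in>?S. h p (c p)) \<oplus>\<^bsub>M\<^esub> (\<Oplus>\<^bsub>M\<^esub>p\<in>?S. h p (c' p))"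
    by (rule M.finsum_addf) (use S famD[OF c(1)] famD[OF c(2)] in \<open>auto intro!: h\<close>)
  also have "\<dots> = sumext M A dg j h c \<oplus>\<^bsub>M\<^esub> sumext M A dg j h c'"
    using S sumext_superset[OF c(1) S(1) _ S(2)] sumext_superset[OF c(2) S(1) _ S(2)] by auto
  finally show ?thesis .
qed

lemma sumext_mon:
  assumes "q \<in> I" "a \<in> carrier (gr A (j - dg q))"
  shows "sumext M A dg j h (mon A dg j q a) = h q a"
proof -
  have "sumext M A dg j h (mon A dg j q a) = (\<Oplus>\<^bsub>M\<^esub>p\<in>{q}. h p (mon A dg j q a p))"
    by (rule sumext_superset) (use assms mon_fam[of q I a j dg] in \<open>auto simp: supp_def mon_def\<close>)
  also have "\<dots> = h q a" using h assms by (simp add: mon_def)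
  finally show ?thesis .
qed

end

end

definition qz_group :: "qz ring" where
  "qz_group = \<lparr>carrier = UNIV, monoid.mult = undefined, one = undefined, ring.zero = 0, add = (+)\<rparr>"

lemma qz_group_simps [simp]: "carrier qz_group = UNIV" "\<zero>\<^bsub>qz_group\<^esub> = 0" "d \<oplus>\<^bsub>qz_group\<^esub> e = d + e"
  by (simp_all add: qz_group_def)

lemma qz_abelian_group: "abelian_group qz_group"
  by (rule abelian_groupI) (auto simp: add_ac intro: exI[of _ "- _"] left_minus)

section \<open>Forms on semi-free modules\<close>

locale semifree_module = dg_module R A P
  for R :: "('r, 's) ring_scheme" (structure) and A :: "('r, 'a, 'm) dg_alg_scheme"
    and P :: "('r, 'a, 'x, 'n) dg_mod_scheme" +
  fixes E assumes sb: "semibasis A P E"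
begin

lemma basis_cl: "(k, e) \<in> E \<Longrightarrow> e \<in> carrier (gr P k)"
  using sb by (auto simp: semibasis_def)

definition comb :: "int \<Rightarrow> (int \<times> 'x \<Rightarrow> 'a) \<Rightarrow> 'x" where
  "comb j = sumext (gr P j) A fst j (\<lambda>p a. act P (j - fst p) (fst p) a (snd p))"

abbreviation "fm \<equiv> fam A fst E"

lemma act_basis_cl: "p \<in> E \<Longrightarrow> a \<in> carrier (gr A (j - fst p)) \<Longrightarrow> act P (j - fst p) (fst p) a (snd p) \<in> carrier (gr P j)"
  using basis_cl[of "fst p" "snd p"] by (auto intro!: act_cl)

lemma act_basis_add: "p \<in> E \<Longrightarrow> a \<in> carrier (gr A (j - fst p)) \<Longrightarrow> b \<in> carrier (gr A (j - fst p)) \<Longrightarrow>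
   act P (j - fst p) (fst p) (a \<oplus>\<^bsub>gr A (j - fst p)\<^esub> b) (snd p) =
   act P (j - fst p) (fst p) a (snd p) \<oplus>\<^bsub>gr P j\<^esub> act P (j - fst p) (fst p) b (snd p)"
  using basis_cl[of "fst p" "snd p"] by (intro act_add_left') auto

lemma comb_closed: "c \<in> fm j \<Longrightarrow> comb j c \<in> carrier (gr P j)"
  unfolding comb_def
  by (rule sumext_closed[where I = E, OF cplx.grp.abelian_group_axioms]) (assumption | rule act_basis_cl act_basis_add)+

lemma comb_add: "c \<in> fm j \<Longrightarrow> c' \<in> fm j \<Longrightarrow> comb j (fadd A fst j c c') = comb j c \<oplus>\<^bsub>gr P j\<^esub> comb j c'"
  unfolding comb_def
  by (rule sumext_add[where I = E, OF cplx.grp.abelian_group_axioms]) (assumption | rule act_basis_cl act_basis_add)+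

lemma comb_mon: "p \<in> E \<Longrightarrow> a \<in> carrier (gr A (j - fst p)) \<Longrightarrow> comb j (mon A fst j p a) = act P (j - fst p) (fst p) a (snd p)"
  unfolding comb_def
  by (rule sumext_mon[where I = E, OF cplx.grp.abelian_group_axioms]) (assumption | rule act_basis_cl act_basis_add)+

lemma comb_zero: "comb j (fzero A fst j) = \<zero>\<^bsub>gr P j\<^esub>"
  by (simp add: comb_def sumext_def supp_def fzero_def)

lemma comb_restrict:
  assumes "c \<in> fm j"
  shows "restrict c E \<in> coeff_families A j E" "lin_comb A P j E (restrict c E) = comb j c"
    "coeff_support A j E (restrict c E) = supp A fst j c"
proof -
  show s: "coeff_support A j E (restrict c E) = supp A fst j c"
    using fam_supp[OF assms] by (auto simp: coeff_support_def supp_def)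
  show "restrict c E \<in> coeff_families A j E"
    using assms s by (auto simp: coeff_families_def famD fam_fin)
  show "lin_comb A P j E (restrict c E) = comb j c"
    unfolding lin_comb_def s comb_def sumext_def
    by (rule cplx.grp.finsum_cong') (use fam_supp[OF assms] famD[OF assms] in \<open>auto intro!: act_basis_cl\<close>)
qed

lemma coeff_family_is_restrict:
  assumes "c \<in> coeff_families A j E"
  obtains c' where "c' \<in> fm j" "c = restrict c' E"
proof -
  define c' where "c' = (\<lambda>p. if p \<in> E then c p else \<zero>\<^bsub>gr A (j - fst p)\<^esub>)"
  have "supp A fst j c' = coeff_support A j E c" by (auto simp: supp_def c'_def coeff_support_def)
  moreover have "c p \<in> carrier (gr A (j - fst p))" if "p \<in> E" for p
    using PiE_mem[of c E "\<lambda>p. carrier (gr A (j - fst p))" p] assms that by (simp add: coeff_families_def)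
  ultimately have "c' \<in> fm j"
    using assms by (auto simp: fam_def coeff_families_def c'_def coeff_support_def)
  moreover have "c = restrict c' E"
    using assms by (auto simp: coeff_families_def c'_def PiE_def extensional_def restrict_def fun_eq_iff)
  ultimately show ?thesis using that by blast
qed

text \<open>
  The total families with support in \<open>E\<close> are another form of the coefficient families in the definition of a
  semi-basis, and avoid the default value of extensional functions.
\<close>

lemma comb_bij: "bij_betw (comb j) (fm j) (carrier (gr P j))"
proof (rule bij_betwI')
  fix c c' assume c: "c \<in> fm j" "c' \<in> fm j"
  show "comb j c = comb j c' \<longleftrightarrow> c = c'"
  proof
    assume eq: "comb j c = comb j c'"
    have "\<exists>!d. d \<in> coeff_families A j E \<and> comb j c = lin_comb A P j E d"
      using sb comb_closed[OF c(1)] by (auto simp: semibasis_def)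
    then have "restrict c E = restrict c' E"
      using comb_restrict(1,2)[OF c(1)] comb_restrict(1,2)[OF c(2)] eq by metis
    then show "c = c'"
      using fam_zero_outside[OF c(1)] fam_zero_outside[OF c(2)] by (metis ext restrict_apply')
  qed simp
next
  fix x assume "x \<in> carrier (gr P j)"
  then have "\<exists>!d. d \<in> coeff_families A j E \<and> x = lin_comb A P j E d" using sb by (auto simp: semibasis_def)
  then obtain d where d: "d \<in> coeff_families A j E" "x = lin_comb A P j E d" by blast
  obtain c where "c \<in> fm j" "d = restrict c E" by (rule coeff_family_is_restrict[OF d(1)])
  then show "\<exists>c\<in>fm j. x = comb j c" using d comb_restrict(2) by auto
qed (auto intro: comb_closed)

definition coords :: "int \<Rightarrow> 'x \<Rightarrow> (int \<times> 'x \<Rightarrow> 'a)" where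
  "coords j x = inv_into (fm j) (comb j) x"

lemma coords_fam: "x \<in> carrier (gr P j) \<Longrightarrow> coords j x \<in> fm j"
  and comb_coords: "x \<in> carrier (gr P j) \<Longrightarrow> comb j (coords j x) = x"
  and coords_comb: "c \<in> fm j \<Longrightarrow> coords j (comb j c) = c"
  unfolding coords_def using comb_bij[of j]
  by (auto simp: bij_betw_def inv_into_into f_inv_into_f)

lemma coords_add: "x \<in> carrier (gr P j) \<Longrightarrow> y \<in> carrier (gr P j) \<Longrightarrow>
    coords j (x \<oplus>\<^bsub>gr P j\<^esub> y) = fadd A fst j (coords j x) (coords j y)"
  using coords_comb[OF fadd_fam[OF coords_fam coords_fam], of x j y]
  by (simp add: comb_add coords_fam comb_coords)

lemma coords_act_basis: "(k, e) \<in> E \<Longrightarrow> a \<in> carrier (gr A (j - k)) \<Longrightarrow>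
    coords j (act P (j - k) k a e) = mon A fst j (k, e) a"
  using coords_comb[OF mon_fam[where q = "(k, e)" and a = a and dg = fst and I = E and j = j]]
    comb_mon[of "(k, e)" a j] by simp

lemma coords_zero: "coords j \<zero>\<^bsub>gr P j\<^esub> = fzero A fst j"
  using coords_comb[OF fzero_fam, of j] by (simp add: comb_zero)

lemma P_induct [consumes 1, case_names zero basis add]:
  assumes x: "x \<in> carrier (gr P j)"
    and zero: "Q \<zero>\<^bsub>gr P j\<^esub>"
    and basis: "\<And>k e a. (k, e) \<in> E \<Longrightarrow> a \<in> carrier (gr A (j - k)) \<Longrightarrow> Q (act P (j - k) k a e)"
    and add: "\<And>x y. x \<in> carrier (gr P j) \<Longrightarrow> y \<in> carrier (gr P j) \<Longrightarrow> Q x \<Longrightarrow> Q y \<Longrightarrow> Q (x \<oplus>\<^bsub>gr P j\<^esub> y)"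
  shows "Q x"
proof -
  have "Q (comb j c)" if "c \<in> fm j" for c
    using that
  proof (induction rule: fam_induct)
    case zero then show ?case using assms(2) by (simp add: comb_zero)
  next
    case (mon q a)
    then show ?case using basis[of "fst q" "snd q" a] by (simp add: comb_mon)
  next
    case (add c c')
    then show ?case using assms(4)[OF comb_closed comb_closed] by (simp add: comb_add)
  qed
  then show ?thesis using comb_coords[OF x] coords_fam[OF x] by metis
qed

lemma level_function:
  obtains l :: "int \<times> 'x \<Rightarrow> nat"
  where "\<And>k e q. (k, e) \<in> E \<Longrightarrow> q \<in> supp A fst (k - 1) (coords (k - 1) (dd P k e)) \<Longrightarrow> l q < l (k, e)"
proof -
  obtain l :: "int \<times> 'x \<Rightarrow> nat" where l: "\<forall>(i, e)\<in>E. \<exists>c\<in>coeff_families A (i - 1) E.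
        dd P i e = lin_comb A P (i - 1) E c \<and> (\<forall>p\<in>coeff_support A (i - 1) E c. l p < l (i, e))"
    using sb by (auto simp: semibasis_def)
  have "l q < l (k, e)" if ke: "(k, e) \<in> E" and q: "q \<in> supp A fst (k - 1) (coords (k - 1) (dd P k e))" for k e q
  proof -
    obtain c where c: "c \<in> coeff_families A (k - 1) E" "dd P k e = lin_comb A P (k - 1) E c"
      "\<forall>p\<in>coeff_support A (k - 1) E c. l p < l (k, e)"
      using l ke by blast
    obtain c' where c': "c' \<in> fm (k - 1)" "c = restrict c' E" by (rule coeff_family_is_restrict[OF c(1)])
    then have "coords (k - 1) (dd P k e) = c'" using c comb_restrict(2)[OF c'(1)] coords_comb[OF c'(1)] by simp
    then show ?thesis using c c' comb_restrict(3)[OF c'(1)] q by simp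
  qed
  then show ?thesis using that by blast
qed

end

locale semifree_pair = semifree_module R A P E + U: dg_module R A U
  for R :: "('r, 's) ring_scheme" and A :: "('r, 'a, 'm) dg_alg_scheme"
    and P :: "('r, 'a, 'x, 'n) dg_mod_scheme" and E and U :: "('r, 'a, 'y, 'p) dg_mod_scheme"
begin

sublocale PU: dg_pair R A P U by unfold_locales

text \<open>
  The only form with the values \<open>g p\<close> on the basis elements \<open>p\<close>: balance forces the value at \<open>a p \<otimes> u\<close> to be
  \<open>\<plusminus> g p (a u)\<close>.
\<close>

definition ext_form :: "(int \<times> 'x \<Rightarrow> 'y \<Rightarrow> qz) \<Rightarrow> ('x, 'y) pairing" where
  "ext_form g i j x u =
     sumext qz_group A fst i (\<lambda>p a. psign ((i - fst p) * fst p) (g p (act U (i - fst p) j a u))) (coords i x)"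

lemma ext_form_cong:
  assumes "\<And>p. p \<in> supp A fst i (coords i x) \<Longrightarrow> g p = g' p"
  shows "ext_form g i j x u = ext_form g' i j x u"
  unfolding ext_form_def sumext_def
  by (rule abelian_monoid.finsum_cong') (use assms qz_abelian_group in \<open>auto simp: abelian_group_def\<close>)

context
  fixes g t assumes g: "\<And>p. p \<in> E \<Longrightarrow> character (gr U (t - fst p)) (g p)"
begin

lemma ext_form_summand_add:
  assumes "i + j = t" "u \<in> carrier (gr U j)" "p \<in> E" "a \<in> carrier (gr A (i - fst p))" "b \<in> carrier (gr A (i - fst p))"
  shows "psign ((i - fst p) * fst p) (g p (act U (i - fst p) j (a \<oplus>\<^bsub>gr A (i - fst p)\<^esub> b) u)) =
    psign ((i - fst p) * fst p) (g p (act U (i - fst p) j a u)) \<oplus>\<^bsub>qz_group\<^esub>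
    psign ((i - fst p) * fst p) (g p (act U (i - fst p) j b u))"
proof -
  have t: "t - fst p = i - fst p + j" using assms by simp
  show ?thesis
    using g[OF assms(3)] assms unfolding t
    by (simp add: U.act_add_left U.act_closed U.cplx.grp.character_add)
qed

lemma ext_form_add_left:
  assumes "i + j = t" "u \<in> carrier (gr U j)" "x \<in> carrier (gr P i)" "x' \<in> carrier (gr P i)"
  shows "ext_form g i j (x \<oplus>\<^bsub>gr P i\<^esub> x') u = ext_form g i j x u + ext_form g i j x' u"
  unfolding ext_form_def coords_add[OF assms(3,4)]
  by (subst sumext_add[OF qz_abelian_group _ ext_form_summand_add[OF assms(1,2)] coords_fam coords_fam])
    (use assms in auto)

lemma ext_form_basis_act:
  assumes "i + j = t" "u \<in> carrier (gr U j)" "(k, e) \<in> E" "a \<in> carrier (gr A (i - k))"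
  shows "ext_form g i j (act P (i - k) k a e) u = psign ((i - k) * k) (g (k, e) (act U (i - k) j a u))"
  unfolding ext_form_def coords_act_basis[OF assms(3,4)]
  by (subst sumext_mon[OF qz_abelian_group _ ext_form_summand_add[OF assms(1,2)] assms(3)])
    (use assms in auto)

lemma ext_form_zero_left:
  "ext_form g i j \<zero>\<^bsub>gr P i\<^esub> u = 0"
  by (simp add: ext_form_def coords_zero sumext_def supp_def)
    (simp add: fzero_def abelian_monoid.finsum_empty abelian_group.axioms(1)[OF qz_abelian_group])

lemma ext_form_basis:
  assumes "k + j = t" "u \<in> carrier (gr U j)" "(k, e) \<in> E"
  shows "ext_form g k j e u = g (k, e) u"
  using ext_form_basis_act[OF assms, of "unt A"] basis_cl[OF assms(3)] assms
  by (simp add: unt_closed act_unt U.act_unt)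

lemma ext_form_form: "form A P U t (ext_form g)"
proof (rule formI)
  fix i j x x' u assume "i + j = t" "x \<in> carrier (gr P i)" "x' \<in> carrier (gr P i)" "u \<in> carrier (gr U j)"
  then show "ext_form g i j (x \<oplus>\<^bsub>gr P i\<^esub> x') u = ext_form g i j x u + ext_form g i j x' u"
    by (rule_tac ext_form_add_left)
next
  fix i j x u u' assume t: "i + j = t" and x: "x \<in> carrier (gr P i)" and u: "u \<in> carrier (gr U j)" "u' \<in> carrier (gr U j)"
  show "ext_form g i j x (u \<oplus>\<^bsub>gr U j\<^esub> u') = ext_form g i j x u + ext_form g i j x u'"
    using x
  proof (induction rule: P_induct)
    case zero show ?case by (simp add: ext_form_zero_left)
  next
    case (basis k e a)
    have t': "t - k = i - k + j" using t by simp
    show ?case using g[OF basis(1)] basis u unfolding fst_conv t'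
      by (simp add: ext_form_basis_act t U.act_add_right U.act_closed U.cplx.grp.character_add)
  next
    case (add x y)
    then show ?case using t u by (simp add: ext_form_add_left)
  qed
next
  fix p i j m q a x u assume t: "i + q = t" "m + j = t" "m = p + i" "q = p + j"
    and a: "a \<in> carrier (gr A p)" and x: "x \<in> carrier (gr P i)" and u: "u \<in> carrier (gr U j)"
  have au: "act U p j a u \<in> carrier (gr U q)" using a u t by (auto intro: U.act_cl)
  show "psign (i * p) (ext_form g m j (act P p i a x) u) = ext_form g i q x (act U p j a u)"
    using x
  proof (induction rule: P_induct)
    case zero show ?case using a t by (simp add: ext_form_zero_left)
  next
    case (basis k e b)
    have ab: "mul A p (i - k) a b \<in> carrier (gr A (m - k))" using a basis t by (auto intro!: mul_cl)
    have c: "act U (m - k) j (mul A p (i - k) a b) u \<in> carrier (gr U (t - k))"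
      using ab u t by (auto intro!: U.act_cl)
    have e: "m - k = p + (i - k)" using t by simp
    have 1: "act P p i a (act P (i - k) k b e) = act P (m - k) k (mul A p (i - k) a b) e"
      using a basis t basis_cl[OF basis(1)] by (intro act_assoc'[symmetric]) auto
    have "act U (i - k) q b (act U p j a u) = act U (m - k) j (mul A (i - k) p b a) u"
      using a basis u t by (intro U.act_assoc'[symmetric]) auto
    also have "mul A (i - k) p b a = ksign (gr A (m - k)) ((i - k) * p) (mul A p (i - k) a b)"
      using graded_commutative[OF basis(2) a] t by (simp add: algebra_simps)
    also have "act U (m - k) j \<dots> u = ksign (gr U (t - k)) ((i - k) * p) (act U (m - k) j (mul A p (i - k) a b) u)"
      using U.act_ksign_left[OF ab u] t by (simp add: algebra_simps)
    finally have 2: "act U (i - k) q b (act U p j a u) = ksign (gr U (t - k)) ((i - k) * p) (act U (m - k) j (mul A p (i - k) a b) u)" .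
    have 3: "ext_form g m j (act P (m - k) k (mul A p (i - k) a b) e) u = psign ((m - k) * k) (g (k, e) (act U (m - k) j (mul A p (i - k) a b) u))"
      by (rule ext_form_basis_act[OF t(2) u basis(1) ab])
    have 4: "ext_form g i q (act P (i - k) k b e) (act U p j a u) = psign ((i - k) * k) (g (k, e) (act U (i - k) q b (act U p j a u)))"
      by (rule ext_form_basis_act[OF t(1) au basis(1,2)])
    have 5: "g (k, e) (ksign (gr U (t - k)) ((i - k) * p) (act U (m - k) j (mul A p (i - k) a b) u)) =
        psign ((i - k) * p) (g (k, e) (act U (m - k) j (mul A p (i - k) a b) u))"
      using g[OF basis(1)] c by (simp add: U.cplx.grp.character_ksign)
    show ?case unfolding 1 3 4 2 5 using t by (simp add: psign_def)
  next
    case (add x y)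
    have "act P p i a (x \<oplus>\<^bsub>gr P i\<^esub> y) = act P p i a x \<oplus>\<^bsub>gr P m\<^esub> act P p i a y"
      using a add t by (intro act_add_right') auto
    moreover have "act P p i a x \<in> carrier (gr P m)" "act P p i a y \<in> carrier (gr P m)"
      using a add t by (auto intro: act_cl)
    ultimately show ?case using add t u au by (simp add: ext_form_add_left)
  qed
qed

end

lemma form_eq_on_basis:
  assumes \<beta>: "form A P U t \<beta>" and \<gamma>: "form A P U t \<gamma>"
    and eq: "\<And>k e u. (k, e) \<in> E \<Longrightarrow> u \<in> carrier (gr U (t - k)) \<Longrightarrow> \<beta> k (t - k) e u = \<gamma> k (t - k) e u"
  shows "agree P U t \<beta> \<gamma>"
proof (rule agreeI)
  fix i j x u assume t: "i + j = t" and x: "x \<in> carrier (gr P i)" and u: "u \<in> carrier (gr U j)"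
  show "\<beta> i j x u = \<gamma> i j x u" using x
  proof (induction rule: P_induct)
    case zero then show ?case using PU.form_zero_left[OF \<beta> t u] PU.form_zero_left[OF \<gamma> t u] by simp
  next
    case (basis k e a)
    have "\<beta> i j (act P (i - k) k a e) u = psign (k * (i - k)) (\<beta> k (t - k) e (act U (i - k) j a u))"
      by (rule form_balanced[OF \<beta> basis(2) basis_cl[OF basis(1)] u]) (use t in auto)
    moreover have "\<gamma> i j (act P (i - k) k a e) u = psign (k * (i - k)) (\<gamma> k (t - k) e (act U (i - k) j a u))"
      by (rule form_balanced[OF \<gamma> basis(2) basis_cl[OF basis(1)] u]) (use t in auto)
    moreover have "act U (i - k) j a u \<in> carrier (gr U (t - k))" using basis u t by (auto intro: U.act_cl)
    ultimately show ?case using eq[OF basis(1)] by simp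
  next
    case (add x y)
    then show ?case using form_add_left[OF \<beta> t _ _ u] form_add_left[OF \<gamma> t _ _ u] by simp
  qed
qed

text \<open>
  A bounding form is a family of values on the basis, chosen by recursion on the level. At a basis element \<open>e\<close> the
  values at smaller levels determine the form at \<open>d e\<close>, and what is needed is a character \<open>r\<close> with prescribed composite
  \<open>\<Phi>\<close> with the differential of \<open>U\<close>. By the cocycle condition \<open>\<Phi>\<close> vanishes on boundaries, hence on cycles because \<open>U\<close>
  is exact there, and so it factors through the differential.
\<close>

theorem perp_if_exact:
  assumes ex: "\<And>k e. (k, e) \<in> E \<Longrightarrow> exact_at U (t - k)"
  shows "perp A P U t"
  unfolding perp_def
proof (intro allI impI)
  fix \<beta> assume "cocycle_form A P U t \<beta>"
  then have \<beta>: "form A P U t \<beta>" and co: "agree P U (t + 1) (cobd P U \<beta>) (\<lambda>i j x u. 0)"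
    by (auto simp: cocycle_form_def)
  obtain l :: "int \<times> 'x \<Rightarrow> nat"
    where l: "\<And>k e q. (k, e) \<in> E \<Longrightarrow> q \<in> supp A fst (k - 1) (coords (k - 1) (dd P k e)) \<Longrightarrow> l q < l (k, e)"
    using level_function by blast
  \<comment> \<open>the condition on the value \<open>r\<close> at the basis element \<open>p\<close>, given the values \<open>f\<close> at smaller levels\<close>
  define Q where "Q f p r \<longleftrightarrow> (p \<in> E \<longrightarrow> character (gr U (t - fst p - 1)) r \<and>
    (\<forall>u\<in>carrier (gr U (t - fst p)). \<beta> (fst p) (t - fst p) (snd p) u =
       ext_form f (fst p - 1) (t - fst p) (dd P (fst p) (snd p)) u + psign (fst p) (r (dd U (t - fst p) u))))"
    for f :: "int \<times> 'x \<Rightarrow> 'y \<Rightarrow> qz" and p r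
  have "\<exists>f. \<forall>p. Q f p (f p)"
  proof (rule dependent_wf_choice)
    show "wf (measure l)" by simp
  next
    fix f g :: "int \<times> 'x \<Rightarrow> 'y \<Rightarrow> qz" and p r assume fg: "\<And>z. (z, p) \<in> measure l \<Longrightarrow> f z = g z"
    have "ext_form f (fst p - 1) (t - fst p) (dd P (fst p) (snd p)) u = ext_form g (fst p - 1) (t - fst p) (dd P (fst p) (snd p)) u"
      if "p \<in> E" for u
      by (rule ext_form_cong) (use fg l[of "fst p" "snd p"] that in auto)
    then show "Q f p r = Q g p r" by (auto simp: Q_def)
  next
    fix p f assume IH: "\<And>y. (y, p) \<in> measure l \<Longrightarrow> Q f y (f y)"
    show "\<exists>r. Q f p r"
    proof (cases "p \<in> E")
      case False
      then show ?thesis by (auto simp: Q_def)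
    next
      case True
      obtain k e where p: "p = (k, e)" by (cases p)
      then have ke: "(k, e) \<in> E" using True by simp
      have e: "e \<in> carrier (gr P k)" using basis_cl[OF ke] .
      \<comment> \<open>Values of \<open>f\<close> that are not known to be characters are replaced by zero, so that \<open>g\<close> defines a form.\<close>
      define E' where "E' = {y \<in> E. l y < l p}"
      define g where "g y = (if y \<in> E' then f y else (\<lambda>_. 0))" for y
      have g: "character (gr U (t - 1 - fst y)) (g y)" if "y \<in> E" for y
        using IH[of y] that by (auto simp: g_def E'_def Q_def character_def diff_diff_eq add.commute[of 1])
      note G = ext_form_form[OF g]
      have fg: "ext_form f (fst y - 1) j (dd P (fst y) (snd y)) u = ext_form g (fst y - 1) j (dd P (fst y) (snd y)) u"
        if "y \<in> E" "l y \<le> l p" for y j u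
      proof (rule ext_form_cong)
        fix q assume q: "q \<in> supp A fst (fst y - 1) (coords (fst y - 1) (dd P (fst y) (snd y)))"
        have "l q < l y" using l[of "fst y" "snd y" q] that q by auto
        moreover have "q \<in> E" using q fam_supp[OF coords_fam[OF d_closed]] basis_cl[of "fst y" "snd y"] that by auto
        ultimately show "f q = g q" using that by (auto simp: g_def E'_def)
      qed
      have low: "cobd P U (ext_form g) i j (comb i c) u = \<beta> i j (comb i c) u"
        if c: "c \<in> fam A fst E' i" and t: "i + j = t" and u: "u \<in> carrier (gr U j)" for i j c u
        using c
      proof (induction rule: fam_induct)
        case zero
        then show ?case unfolding comb_zero
          using PU.form_zero_left[OF PU.cobd_form[OF G], of i j u] PU.form_zero_left[OF \<beta> t u] t u by simp
      next
        case (mon q a)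
        obtain k' e' where q: "q = (k', e')" by (cases q)
        have qE: "(k', e') \<in> E" "l (k', e') < l p" "(k', e') \<in> E'" using mon q by (auto simp: E'_def)
        have a: "a \<in> carrier (gr A (i - k'))" using mon q by simp
        have e': "e' \<in> carrier (gr P k')" using basis_cl[OF qE(1)] .
        have cb: "comb i (mon A fst i q a) = act P (i - k') k' a e'"
          using comb_mon[of q a i] q qE a by simp
        have au: "act U (i - k') j a u \<in> carrier (gr U (t - k'))" using a u t by (auto intro: U.act_cl)
        have "cobd P U (ext_form g) k' (t - k') e' w = \<beta> k' (t - k') e' w" if w: "w \<in> carrier (gr U (t - k'))" for w
        proof -
          have "Q f (k', e') (f (k', e'))" using IH qE by simp
          then have "\<beta> k' (t - k') e' w = ext_form f (k' - 1) (t - k') (dd P k' e') w + psign k' (f (k', e') (dd U (t - k') w))"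
            using qE w by (simp add: Q_def)
          moreover have "ext_form f (k' - 1) (t - k') (dd P k' e') w = ext_form g (k' - 1) (t - k') (dd P k' e') w"
            using fg[of "(k', e')"] qE by simp
          moreover have "ext_form g k' (t - k' - 1) e' (dd U (t - k') w) = g (k', e') (dd U (t - k') w)"
            by (rule ext_form_basis[OF g _ _ qE(1)]) (use w in \<open>auto intro: U.cplx.d_closed\<close>)
          ultimately show ?thesis using qE by (simp add: cobd_def g_def)
        qed
        moreover have "cobd P U (ext_form g) i j (act P (i - k') k' a e') u =
            psign (k' * (i - k')) (cobd P U (ext_form g) k' (t - k') e' (act U (i - k') j a u))"
          by (rule form_balanced[OF PU.cobd_form[OF G] a e' u]) (use t in auto)
        moreover have "\<beta> i j (act P (i - k') k' a e') u = psign (k' * (i - k')) (\<beta> k' (t - k') e' (act U (i - k') j a u))"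
          by (rule form_balanced[OF \<beta> a e' u]) (use t in auto)
        ultimately show ?case unfolding cb using au by simp
      next
        case (add c c')
        have E': "E' \<subseteq> E" by (auto simp: E'_def)
        have cc: "c \<in> fm i" "c' \<in> fm i" using add(1,2) fam_mono[OF E'] by auto
        note cl = comb_closed[OF cc(1)] comb_closed[OF cc(2)]
        have "form A P U t (cobd P U (ext_form g))" using PU.cobd_form[OF G] by simp
        then show ?case unfolding comb_add[OF cc]
          using form_add_left[OF _ t cl u] add \<beta> by metis
      qed
      define \<Phi> where "\<Phi> u = \<beta> k (t - k) e u - ext_form g (k - 1) (t - k) (dd P k e) u" for u
      have de: "dd P k e \<in> carrier (gr P (k - 1))" using e by (rule d_closed)
      have "character (gr U (t - k)) \<Phi>"
        unfolding character_def \<Phi>_def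
        using form_add_right[OF \<beta> _ e] form_add_right[OF G _ de] by simp
      moreover have "\<Phi> u = 0" if u: "u \<in> carrier (gr U (t - k))" "dd U (t - k) u = \<zero>\<^bsub>gr U (t - k - 1)\<^esub>" for u
      proof -
        obtain w where w: "w \<in> carrier (gr U (t - k + 1))" "u = dd U (t - k + 1) w"
          using exact_atD[OF ex[OF ke] u] by blast
        have "cobd P U \<beta> k (t - k + 1) e w = 0"
          by (rule agreeD[OF co _ e w(1)]) simp
        then have 1: "\<beta> (k - 1) (t - k + 1) (dd P k e) w + psign k (\<beta> k (t - k) e u) = 0"
          by (simp add: cobd_def w(2))
        have "supp A fst (k - 1) (coords (k - 1) (dd P k e)) \<subseteq> E'"
          using l[OF ke] fam_supp[OF coords_fam[OF de]] by (auto simp: E'_def p)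
        then have "coords (k - 1) (dd P k e) \<in> fam A fst E' (k - 1)"
          using fam_restrict[OF coords_fam[OF de]] by blast
        then have "cobd P U (ext_form g) (k - 1) (t - k + 1) (dd P k e) w = \<beta> (k - 1) (t - k + 1) (dd P k e) w"
          using low[of "coords (k - 1) (dd P k e)" "k - 1" "t - k + 1" w] w comb_coords[OF de] by simp
        moreover have "ext_form g (k - 1 - 1) (t - k + 1) (dd P (k - 1) (dd P k e)) w = 0"
          unfolding dd_dd[OF e refl] by (rule PU.form_zero_left[OF G]) (use w in auto)
        ultimately have "\<beta> (k - 1) (t - k + 1) (dd P k e) w = psign (k - 1) (ext_form g (k - 1) (t - k) (dd P k e) u)"
          by (simp add: cobd_def w(2))
        then show ?thesis using 1 by (simp add: \<Phi>_def psign_def split: if_splits)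
      qed
      ultimately obtain r where r: "character (gr U (t - k - 1)) r" "\<And>u. u \<in> carrier (gr U (t - k)) \<Longrightarrow> r (dd U (t - k) u) = \<Phi> u"
        using character_factors[OF U.cplx.grp.abelian_group_axioms U.cplx.grp.abelian_group_axioms, of "t - k" "dd U (t - k)" "t - k - 1" \<Phi>]
          U.cplx.d_closed U.cplx.d_add by metis
      have "Q f p (\<lambda>u. psign k (r u))"
        using r fg[of p] ke by (auto simp: Q_def p character_def \<Phi>_def psign_def)
      then show ?thesis by blast
    qed
  qed
  then obtain f where f: "\<And>p. Q f p (f p)" by blast
  have ch: "character (gr U (t - 1 - fst p)) (f p)" if "p \<in> E" for p
    using f[of p] that by (simp add: Q_def diff_diff_eq add.commute[of 1])
  note F = ext_form_form[OF ch]
  have "agree P U t \<beta> (cobd P U (ext_form f))"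
  proof (rule form_eq_on_basis[OF \<beta>])
    show "form A P U t (cobd P U (ext_form f))" using PU.cobd_form[OF F] by simp
    fix k e u assume ke: "(k, e) \<in> E" and u: "u \<in> carrier (gr U (t - k))"
    have "ext_form f k (t - k - 1) e (dd U (t - k) u) = f (k, e) (dd U (t - k) u)"
      by (rule ext_form_basis[OF ch _ _ ke]) (use u in \<open>auto intro: U.cplx.d_closed\<close>)
    then show "\<beta> k (t - k) e u = cobd P U (ext_form f) k (t - k) e u"
      using f[of "(k, e)"] ke u by (simp add: Q_def cobd_def)
  qed
  then show "\<exists>\<gamma>. form A P U (t - 1) \<gamma> \<and> agree P U t \<beta> (cobd P U \<gamma>)" using F by blast
qed

end

text \<open>The cone of a quasi-isomorphism is exact, so the two halves of the long exact sequence apply.\<close>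

lemma perp_quasi_iso:
  assumes "semifree_module R A P E" "dg_morphism R A U V f" "dg_morphism.elementwise_qi U V f"
  shows "perp A P U t \<longleftrightarrow> perp A P V t"
proof -
  interpret P: semifree_module R A P E by fact
  interpret f: dg_morphism R A U V f by fact
  interpret pair_with_hom R A P U V f by unfold_locales
  interpret PC: semifree_pair R A P E C by unfold_locales
  have "perp A P C s" for s
    by (rule PC.perp_if_exact) (rule f.cone_exact_if_qi[OF assms(3)])
  then show ?thesis using perp_source perp_target by blast
qed

section \<open>Forms and the homology of the tensor product\<close>

definition qz_mult_group :: "qz monoid" where
  "qz_mult_group = \<lparr>carrier = UNIV, monoid.mult = (+), one = 0\<rparr>"

lemma qz_mult_group_comm: "comm_group qz_mult_group"
  by (rule comm_groupI) (auto simp: qz_mult_group_def add_ac intro: exI[of _ "- _"] left_minus)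

context dg_pair
begin

abbreviation "gens n \<equiv> tensor_gens P U n"
abbreviation "Fr n \<equiv> tensor_free P U n"
abbreviation "Nul n \<equiv> tensor_null A P U n"
abbreviation "T \<equiv> tensor_product A P U"

text \<open>The differential of the tensor product, lifted to the free groups on symbols.\<close>

definition bd :: "int \<Rightarrow> (int \<times> 'x \<times> 'y \<Rightarrow>\<^sub>0 int) \<Rightarrow> (int \<times> 'x \<times> 'y \<Rightarrow>\<^sub>0 int)" where
  "bd n = frag_extend (\<lambda>(i, x, y). frag_of (i - 1, dd P i x, y)
          + frag_cmul (if even i then 1 else -1) (frag_of (i, x, dd U (n - i) y)))"

lemma Fr_carrier: "c \<in> carrier (Fr n) \<longleftrightarrow> Poly_Mapping.keys c \<subseteq> gens n"
  by (simp add: tensor_free_def)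

lemma Fr_mult [simp]: "c \<otimes>\<^bsub>Fr n\<^esub> c' = c + c'" and Fr_one [simp]: "\<one>\<^bsub>Fr n\<^esub> = 0"
  by (simp_all add: tensor_free_def)

lemma Fr_inv: "c \<in> carrier (Fr n) \<Longrightarrow> inv\<^bsub>Fr n\<^esub> c = - c"
  by (simp add: tensor_free_def)

lemma Fr_comm: "comm_group (Fr n)"
  by (simp add: tensor_free_def abelian_free_Abelian_group)

lemma frag_of_Fr: "g \<in> gens n \<Longrightarrow> frag_of g \<in> carrier (Fr n)"
  by (simp add: Fr_carrier)

interpretation Fr: comm_group "Fr n" for n by (rule Fr_comm)

lemma Fr_add: "c \<in> carrier (Fr n) \<Longrightarrow> c' \<in> carrier (Fr n) \<Longrightarrow> c + c' \<in> carrier (Fr n)"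
  using Fr.m_closed[of c n c'] by simp

lemma Fr_neg: "c \<in> carrier (Fr n) \<Longrightarrow> - c \<in> carrier (Fr n)"
  using Fr.inv_closed[of c n] by (simp add: Fr_inv)

lemma Fr_diff: "c \<in> carrier (Fr n) \<Longrightarrow> c' \<in> carrier (Fr n) \<Longrightarrow> c - c' \<in> carrier (Fr n)"
  using Fr_add[OF _ Fr_neg, of c n c'] by simp

lemma Fr_zero: "0 \<in> carrier (Fr n)" by (simp add: Fr_carrier)

lemma gens_iff: "(i, x, y) \<in> gens n \<longleftrightarrow> x \<in> carrier (gr P i) \<and> y \<in> carrier (gr U (n - i))"
  by (simp add: tensor_gens_def)

lemma gensI: "x \<in> carrier (gr P i) \<Longrightarrow> y \<in> carrier (gr U j) \<Longrightarrow> i + j = n \<Longrightarrow> (i, x, y) \<in> gens n"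
  by (auto simp: gens_iff)

lemma rels_Fr: "tensor_rels A P U n \<subseteq> carrier (Fr n)"
proof
  fix r assume "r \<in> tensor_rels A P U n"
  then consider
    (l) i x x' y where "r = frag_of (i, x \<oplus>\<^bsub>gr P i\<^esub> x', y) - frag_of (i, x, y) - frag_of (i, x', y)"
      "x \<in> carrier (gr P i)" "x' \<in> carrier (gr P i)" "y \<in> carrier (gr U (n - i))"
  | (r) i x y y' where "r = frag_of (i, x, y \<oplus>\<^bsub>gr U (n - i)\<^esub> y') - frag_of (i, x, y) - frag_of (i, x, y')"
      "x \<in> carrier (gr P i)" "y \<in> carrier (gr U (n - i))" "y' \<in> carrier (gr U (n - i))"
  | (b) p i a x y where "r = frag_of (p + i, ksign (gr P (p + i)) (i * p) (act P p i a x), y)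
        - frag_of (i, x, act U p (n - i - p) a y)"
      "a \<in> carrier (gr A p)" "x \<in> carrier (gr P i)" "y \<in> carrier (gr U (n - i - p))"
    unfolding tensor_rels_def by blast
  then show "r \<in> carrier (Fr n)"
  proof cases
    case l then show ?thesis by (auto intro!: Fr_diff frag_of_Fr simp: gens_iff)
  next
    case r then show ?thesis by (auto intro!: Fr_diff frag_of_Fr simp: gens_iff)
  next
    case b
    have 1: "act U p (n - i - p) a y \<in> carrier (gr U (n - i))" using b by (intro U.act_cl) auto
    have 2: "ksign (gr P (p + i)) (i * p) (act P p i a x) \<in> carrier (gr P (p + i))"
      using b by (intro P.cplx.grp.ksign_closed P.act_closed)
    show ?thesis unfolding b(1)
      by (intro Fr_diff frag_of_Fr gensI[OF 2 b(4)] gensI[OF b(3) 1]) auto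
  qed
qed

lemma Nul_subgroup: "subgroup (Nul n) (Fr n)"
  unfolding tensor_null_def by (rule Fr.generate_is_subgroup[OF rels_Fr])

lemma Nul_Fr: "c \<in> Nul n \<Longrightarrow> c \<in> carrier (Fr n)"
  using subgroup.mem_carrier[OF Nul_subgroup] .

lemma Nul_zero: "0 \<in> Nul n"
  using subgroup.one_closed[OF Nul_subgroup[of n]] by simp

lemma Nul_add: "c \<in> Nul n \<Longrightarrow> c' \<in> Nul n \<Longrightarrow> c + c' \<in> Nul n"
  using subgroup.m_closed[OF Nul_subgroup[of n]] by simp

lemma Nul_neg: "c \<in> Nul n \<Longrightarrow> - c \<in> Nul n"
  using subgroup.m_inv_closed[OF Nul_subgroup[of n]] Fr_inv[OF Nul_Fr] by metis

definition addv :: "int \<Rightarrow> ((int \<times> 'x \<times> 'y \<Rightarrow>\<^sub>0 int) \<Rightarrow> qz) \<Rightarrow> bool" where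
  "addv n h \<longleftrightarrow> (\<forall>c\<in>carrier (Fr n). \<forall>c'\<in>carrier (Fr n). h (c + c') = h c + h c')"

lemma addv_add: "addv n h \<Longrightarrow> c \<in> carrier (Fr n) \<Longrightarrow> c' \<in> carrier (Fr n) \<Longrightarrow> h (c + c') = h c + h c'"
  by (simp add: addv_def)

lemma addv_zero: "addv n h \<Longrightarrow> h 0 = 0"
  using addv_add[of n h 0 0] by (simp add: Fr_zero)

lemma addv_neg: "addv n h \<Longrightarrow> c \<in> carrier (Fr n) \<Longrightarrow> h (- c) = - h c"
  using addv_add[of n h c "- c"] addv_zero[of n h] by (simp add: Fr_neg eq_neg_iff_add_eq_0 add.commute)

lemma addv_diff: "addv n h \<Longrightarrow> c \<in> carrier (Fr n) \<Longrightarrow> c' \<in> carrier (Fr n) \<Longrightarrow> h (c - c') = h c - h c'"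
  using addv_add[of n h c "- c'"] by (simp add: Fr_neg addv_neg)

lemma addv_eq:
  assumes "addv n h" "addv n h'" "\<And>g. g \<in> gens n \<Longrightarrow> h (frag_of g) = h' (frag_of g)" "c \<in> carrier (Fr n)"
  shows "h c = h' c"
proof -
  have "Poly_Mapping.keys c \<subseteq> gens n" using assms(4) by (simp add: Fr_carrier)
  then have "h c = h' c \<and> c \<in> carrier (Fr n)"
  proof (induction rule: frag_induction)
    case zero then show ?case using addv_zero[OF assms(1)] addv_zero[OF assms(2)] Fr_zero by simp
  next
    case (one x) then show ?case using assms(3) frag_of_Fr by blast
  next
    case (diff a b) then show ?case using addv_diff[OF assms(1)] addv_diff[OF assms(2)] Fr_diff by simp
  qed
  then show ?thesis by simp
qed

text \<open>
  Forms of degree \<open>n\<close> are the same as additive maps on the free group on symbols that kill the relations; this is one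
  direction, the next lemma the other.
\<close>

lemma form_linear:
  assumes "form A P U n \<gamma>"
  obtains h where "addv n h" "\<And>i x y. (i, x, y) \<in> gens n \<Longrightarrow> h (frag_of (i, x, y)) = \<gamma> i (n - i) x y"
    "\<And>c. c \<in> Nul n \<Longrightarrow> h c = 0"
proof -
  interpret Q: comm_group qz_mult_group by (rule qz_mult_group_comm)
  obtain h where h: "h \<in> hom (Fr n) qz_mult_group" "\<And>g. g \<in> gens n \<Longrightarrow> h (frag_of g) = (case g of (i, x, y) \<Rightarrow> \<gamma> i (n - i) x y)"
    using Q.free_Abelian_group_universal[of "\<lambda>(i, x, y). \<gamma> i (n - i) x y" "gens n"]
    unfolding tensor_free_def by (auto simp: qz_mult_group_def)
  have ad: "addv n h" using h(1) by (auto simp: addv_def hom_def qz_mult_group_def)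
  have hg: "h (frag_of (i, x, y)) = \<gamma> i (n - i) x y" if "x \<in> carrier (gr P i)" "y \<in> carrier (gr U (n - i))" for i x y
    using h(2)[of "(i, x, y)"] that by (simp add: gens_iff)
  have rel: "h r = 0" if rr: "r \<in> tensor_rels A P U n" for r
  proof -
    have gF: "frag_of (i, x, y) \<in> carrier (Fr n)" if "x \<in> carrier (gr P i)" "y \<in> carrier (gr U (n - i))" for i x y
      using that by (auto intro!: frag_of_Fr simp: gens_iff)
    consider
      (l) i x x' y where "r = frag_of (i, x \<oplus>\<^bsub>gr P i\<^esub> x', y) - frag_of (i, x, y) - frag_of (i, x', y)"
        "x \<in> carrier (gr P i)" "x' \<in> carrier (gr P i)" "y \<in> carrier (gr U (n - i))"
    | (r) i x y y' where "r = frag_of (i, x, y \<oplus>\<^bsub>gr U (n - i)\<^esub> y') - frag_of (i, x, y) - frag_of (i, x, y')"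
        "x \<in> carrier (gr P i)" "y \<in> carrier (gr U (n - i))" "y' \<in> carrier (gr U (n - i))"
    | (b) p i a x y where "r = frag_of (p + i, ksign (gr P (p + i)) (i * p) (act P p i a x), y)
          - frag_of (i, x, act U p (n - i - p) a y)"
        "a \<in> carrier (gr A p)" "x \<in> carrier (gr P i)" "y \<in> carrier (gr U (n - i - p))"
      using rr unfolding tensor_rels_def by blast
    then show ?thesis
    proof cases
      case l
      have "x \<oplus>\<^bsub>gr P i\<^esub> x' \<in> carrier (gr P i)" using l by simp
      then show ?thesis using l gF
        by (simp add: addv_diff[OF ad] Fr_diff hg form_add_left[OF assms])
    next
      case r
      have "y \<oplus>\<^bsub>gr U (n - i)\<^esub> y' \<in> carrier (gr U (n - i))" using r by simp
      then show ?thesis using r gF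
        by (simp add: addv_diff[OF ad] Fr_diff hg form_add_right[OF assms])
    next
      case b
      have 1: "act U p (n - i - p) a y \<in> carrier (gr U (n - i))" using b by (intro U.act_cl) auto
      have 2: "act P p i a x \<in> carrier (gr P (p + i))" using b by (intro P.act_closed)
      have e: "n - (p + i) = n - i - p" by simp
      have y': "y \<in> carrier (gr U (n - (p + i)))" unfolding e by (rule b(4))
      have 3: "\<gamma> (p + i) (n - i - p) (act P p i a x) y = psign (i * p) (\<gamma> i (n - i) x (act U p (n - i - p) a y))"
        by (rule form_balanced[OF assms b(2,3,4)]) auto
      have "h r = h (frag_of (p + i, ksign (gr P (p + i)) (i * p) (act P p i a x), y)) - h (frag_of (i, x, act U p (n - i - p) a y))"
        unfolding b(1) by (rule addv_diff[OF ad gF gF]) (use b(3) 1 2 y' in \<open>auto intro: P.cplx.grp.ksign_closed\<close>)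
      also have "\<dots> = \<gamma> (p + i) (n - i - p) (ksign (gr P (p + i)) (i * p) (act P p i a x)) y - \<gamma> i (n - i) x (act U p (n - i - p) a y)"
        using hg[of "ksign (gr P (p + i)) (i * p) (act P p i a x)" "p + i" y] hg[OF b(3) 1] y' 2
        unfolding e by (simp add: P.cplx.grp.ksign_closed)
      also have "\<gamma> (p + i) (n - i - p) (ksign (gr P (p + i)) (i * p) (act P p i a x)) y = psign (i * p) (\<gamma> (p + i) (n - i - p) (act P p i a x) y)"
        by (rule form_ksign_left[OF assms]) (use b 2 in auto)
      finally show ?thesis unfolding 3 by (simp add: psign_def split: if_splits)
    qed
  qed
  have "h c = 0" if "c \<in> Nul n" for c
    using that unfolding tensor_null_def
  proof (induction rule: generate.induct)
    case one then show ?case using addv_zero[OF ad] by simp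
  next
    case (incl c) then show ?case using rel by simp
  next
    case (inv c)
    then have "c \<in> carrier (Fr n)" "h c = 0" using rel rels_Fr by auto
    then show ?case using addv_neg[OF ad, of c] by (simp add: Fr_inv)
  next
    case (eng c c')
    then have "c \<in> carrier (Fr n)" "c' \<in> carrier (Fr n)" using Nul_Fr by (simp_all add: tensor_null_def)
    then show ?case using eng addv_add[OF ad] by simp
  qed
  then show ?thesis using that ad hg by (auto simp: gens_iff)
qed

lemma linear_form:
  assumes ad: "addv n h" and N: "\<And>c. c \<in> Nul n \<Longrightarrow> h c = 0"
  shows "form A P U n (\<lambda>i j x y. h (frag_of (i, x, y)))"
proof (rule formI)
  have rel: "h r = 0" if "r \<in> tensor_rels A P U n" for r
    using N that by (simp add: tensor_null_def generate.incl)
  have gF: "frag_of (i, x, y) \<in> carrier (Fr n)" if "x \<in> carrier (gr P i)" "y \<in> carrier (gr U j)" "i + j = n" for i x y j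
    using that by (auto intro!: frag_of_Fr simp: gens_iff)
  have L: "h (frag_of (i, x \<oplus>\<^bsub>gr P i\<^esub> x', y)) = h (frag_of (i, x, y)) + h (frag_of (i, x', y))"
    if *: "i + j = n" "x \<in> carrier (gr P i)" "x' \<in> carrier (gr P i)" "y \<in> carrier (gr U j)" for i j x x' y
  proof -
    have j: "n - i = j" using * by simp
    have "frag_of (i, x \<oplus>\<^bsub>gr P i\<^esub> x', y) - frag_of (i, x, y) - frag_of (i, x', y) \<in> tensor_rels A P U n"
      using * unfolding tensor_rels_def j[symmetric] by blast
    then have "h (frag_of (i, x \<oplus>\<^bsub>gr P i\<^esub> x', y) - frag_of (i, x, y) - frag_of (i, x', y)) = 0" by (rule rel)
    moreover have "h (frag_of (i, x \<oplus>\<^bsub>gr P i\<^esub> x', y) - frag_of (i, x, y) - frag_of (i, x', y)) =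
      h (frag_of (i, x \<oplus>\<^bsub>gr P i\<^esub> x', y)) - h (frag_of (i, x, y)) - h (frag_of (i, x', y))"
      using * gF[of _ i _ j] by (simp add: addv_diff[OF ad] Fr_diff)
    ultimately show ?thesis by (simp add: algebra_simps)
  qed
  show "\<And>i j x x' u. i + j = n \<Longrightarrow> x \<in> carrier (gr P i) \<Longrightarrow> x' \<in> carrier (gr P i) \<Longrightarrow> u \<in> carrier (gr U j) \<Longrightarrow>
      h (frag_of (i, x \<oplus>\<^bsub>gr P i\<^esub> x', u)) = h (frag_of (i, x, u)) + h (frag_of (i, x', u))"
    by (rule L)
  show "h (frag_of (i, x, y \<oplus>\<^bsub>gr U j\<^esub> y')) = h (frag_of (i, x, y)) + h (frag_of (i, x, y'))"
    if *: "i + j = n" "x \<in> carrier (gr P i)" "y \<in> carrier (gr U j)" "y' \<in> carrier (gr U j)" for i j x y y'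
  proof -
    have j: "n - i = j" using * by simp
    have "frag_of (i, x, y \<oplus>\<^bsub>gr U (n - i)\<^esub> y') - frag_of (i, x, y) - frag_of (i, x, y') \<in> tensor_rels A P U n"
      using * unfolding tensor_rels_def j[symmetric] by blast
    then have "h (frag_of (i, x, y \<oplus>\<^bsub>gr U j\<^esub> y') - frag_of (i, x, y) - frag_of (i, x, y')) = 0" unfolding j by (rule rel)
    moreover have "h (frag_of (i, x, y \<oplus>\<^bsub>gr U j\<^esub> y') - frag_of (i, x, y) - frag_of (i, x, y')) =
      h (frag_of (i, x, y \<oplus>\<^bsub>gr U j\<^esub> y')) - h (frag_of (i, x, y)) - h (frag_of (i, x, y'))"
      using * gF[of _ i _ j] by (simp add: addv_diff[OF ad] Fr_diff)
    ultimately show ?thesis by (simp add: algebra_simps)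
  qed
  show "psign (i * p) (h (frag_of (m, act P p i a x, y))) = h (frag_of (i, x, act U p j a y))"
    if *: "i + q = n" "m + j = n" "m = p + i" "q = p + j" "a \<in> carrier (gr A p)" "x \<in> carrier (gr P i)" "y \<in> carrier (gr U j)"
    for p i j m q a x y
  proof -
    have j: "n - i - p = j" using * by simp
    have 1: "act U p j a y \<in> carrier (gr U q)" using * by (intro U.act_cl) auto
    have 2: "act P p i a x \<in> carrier (gr P m)" using * by (intro P.act_cl) auto
    have "frag_of (p + i, ksign (gr P (p + i)) (i * p) (act P p i a x), y) - frag_of (i, x, act U p (n - i - p) a y) \<in> tensor_rels A P U n"
      using * unfolding tensor_rels_def j[symmetric] by blast
    then have "h (frag_of (m, ksign (gr P m) (i * p) (act P p i a x), y) - frag_of (i, x, act U p j a y)) = 0"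
      unfolding j *(3) by (rule rel)
    moreover have "h (frag_of (m, ksign (gr P m) (i * p) (act P p i a x), y) - frag_of (i, x, act U p j a y))
      = h (frag_of (m, ksign (gr P m) (i * p) (act P p i a x), y)) - h (frag_of (i, x, act U p j a y))"
      by (rule addv_diff[OF ad gF gF]) (use * 1 2 in \<open>auto intro: P.cplx.grp.ksign_closed\<close>)
    moreover have "character (gr P m) (\<lambda>x. h (frag_of (m, x, y)))"
      using L[OF *(2)] * by (simp add: character_def)
    ultimately show ?thesis using P.cplx.grp.character_ksign[OF _ 2, of "\<lambda>x. h (frag_of (m, x, y))" "i * p"] by simp
  qed
qed

lemma bd_Fr: "c \<in> carrier (Fr n) \<Longrightarrow> bd n c \<in> carrier (Fr (n - 1))"
proof -
  assume "c \<in> carrier (Fr n)"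
  then have "Poly_Mapping.keys c \<subseteq> gens n" by (simp add: Fr_carrier)
  then show ?thesis
  proof (induction rule: frag_induction)
    case zero show ?case by (simp add: bd_def Fr_zero)
  next
    case (one g)
    obtain i x y where g: "g = (i, x, y)" by (cases g)
    have "dd P i x \<in> carrier (gr P (i - 1))" "dd U (n - i) y \<in> carrier (gr U (n - i - 1))"
      using one g by (auto simp: gens_iff P.cplx.d_closed U.cplx.d_closed)
    moreover have "n - i - 1 = n - 1 - i" by simp
    ultimately have "frag_of (i - 1, dd P i x, y) \<in> carrier (Fr (n - 1))" "frag_of (i, x, dd U (n - i) y) \<in> carrier (Fr (n - 1))"
      using one g by (auto intro!: frag_of_Fr simp: gens_iff)
    then show ?case using g by (simp add: bd_def Fr_add Fr_neg minus_frag_cmul[symmetric])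
  next
    case (diff a b)
    then show ?case by (simp add: bd_def frag_extend_diff Fr_diff)
  qed
qed

lemma bd_add: "bd n (c + c') = bd n c + bd n c'"
  by (simp add: bd_def frag_extend_add)

lemma bd_diff: "bd n (c - c') = bd n c - bd n c'"
  by (simp add: bd_def frag_extend_diff)

lemma linear_bd:
  assumes ad: "addv (n - 1) h" and g: "(i, x, y) \<in> gens n"
  shows "h (bd n (frag_of (i, x, y))) = cobd P U (\<lambda>i j x y. h (frag_of (i, x, y))) i (n - i) x y"
proof -
  have "dd P i x \<in> carrier (gr P (i - 1))" "dd U (n - i) y \<in> carrier (gr U (n - i - 1))"
    using g by (auto simp: gens_iff P.cplx.d_closed U.cplx.d_closed)
  moreover have "n - i - 1 = n - 1 - i" by simp
  ultimately have "frag_of (i - 1, dd P i x, y) \<in> carrier (Fr (n - 1))" "frag_of (i, x, dd U (n - i) y) \<in> carrier (Fr (n - 1))"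
    using g by (auto intro!: frag_of_Fr simp: gens_iff)
  then show ?thesis
    by (simp add: bd_def cobd_def psign_def addv_add[OF ad] addv_neg[OF ad] addv_diff[OF ad] Fr_neg minus_frag_cmul[symmetric])
qed

lemma addv_bd: "addv (n - 1) h \<Longrightarrow> addv n (\<lambda>c. h (bd n c))"
  by (simp add: addv_def bd_add bd_Fr)

lemma bd_Nul:
  assumes c: "c \<in> Nul n"
  shows "bd n c \<in> Nul (n - 1)"
proof (rule ccontr)
  assume "bd n c \<notin> Nul (n - 1)"
  then obtain h where h: "\<forall>x\<in>carrier (Fr (n - 1)). \<forall>y\<in>carrier (Fr (n - 1)). h (x \<otimes>\<^bsub>Fr (n - 1)\<^esub> y) = h x + (h y :: qz)"
    "\<forall>y\<in>Nul (n - 1). h y = 0" "h (bd n c) \<noteq> 0"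
    using character_separates[OF Fr_comm Nul_subgroup bd_Fr[OF Nul_Fr[OF c]]] by blast
  have ad: "addv (n - 1) h" using h(1) by (simp add: addv_def)
  have "form A P U (n - 1) (\<lambda>i j x y. h (frag_of (i, x, y)))" by (rule linear_form[OF ad]) (use h in auto)
  then have "form A P U n (cobd P U (\<lambda>i j x y. h (frag_of (i, x, y))))" using cobd_form by fastforce
  then obtain h' where h': "addv n h'"
    "\<And>i x y. (i, x, y) \<in> gens n \<Longrightarrow> h' (frag_of (i, x, y)) = cobd P U (\<lambda>i j x y. h (frag_of (i, x, y))) i (n - i) x y"
    "\<And>c. c \<in> Nul n \<Longrightarrow> h' c = 0" by (rule form_linear) blast
  have "h (bd n c) = h' c"
    by (rule addv_eq[OF addv_bd[OF ad] h'(1)]) (use linear_bd[OF ad] h'(2) Nul_Fr[OF c] in auto)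
  then show False using h(3) h'(3)[OF c] by simp
qed

lemma T_simps:
  "carrier (gr T n) = {Nul n #>\<^bsub>Fr n\<^esub> c | c. c \<in> carrier (Fr n)}" "\<zero>\<^bsub>gr T n\<^esub> = Nul n"
  "C \<oplus>\<^bsub>gr T n\<^esub> C' = C <#>\<^bsub>Fr n\<^esub> C'" "dd T n C = (\<Union>c\<in>C. Nul (n - 1) #>\<^bsub>Fr (n - 1)\<^esub> bd n c)"
  by (auto simp: tensor_product_def Let_def FactGroup_def RCOSETS_def tensor_map_def bd_def)

lemma coset_iff: "c' \<in> Nul n #>\<^bsub>Fr n\<^esub> c \<longleftrightarrow> c' - c \<in> Nul n"
  by (force simp: r_coset_def intro: bexI[of _ "c' - c"])

lemma coset_Nul: "c \<in> Nul n \<Longrightarrow> Nul n #>\<^bsub>Fr n\<^esub> c = Nul n"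
  using Nul_add[of _ n c] Nul_add[OF _ Nul_neg, of _ n c] by (auto simp: coset_iff) (metis diff_add_cancel)

text \<open>
  Seen as an additive map \<open>h\<close> on symbols, a cocycle vanishes on boundaries. If the homology of the tensor product
  vanishes, then \<open>h\<close> vanishes on every chain whose boundary is a relation, so \<open>bd c \<mapsto> h c\<close> is a well-defined
  homomorphism on a subgroup that contains the relations, on which it is zero. Injectivity of \<open>\<rat>/\<int>\<close> extends it.
\<close>

theorem perp_if_tensor_zero:
  assumes "zero_module (homology T t)"
  shows "perp A P U t"
  unfolding perp_def
proof (intro allI impI)
  fix \<beta> assume "cocycle_form A P U t \<beta>"
  then have \<beta>: "form A P U t \<beta>" and co: "agree P U (t + 1) (cobd P U \<beta>) (\<lambda>i j x u. 0)"
    by (auto simp: cocycle_form_def)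
  obtain h where h: "addv t h" "\<And>i x y. (i, x, y) \<in> gens t \<Longrightarrow> h (frag_of (i, x, y)) = \<beta> i (t - i) x y"
    "\<And>c. c \<in> Nul t \<Longrightarrow> h c = 0" by (rule form_linear[OF \<beta>]) blast
  have h_bd: "h (bd (t + 1) c) = 0" if "c \<in> carrier (Fr (t + 1))" for c
  proof (rule addv_eq[OF _ _ _ that])
    have h1: "addv (t + 1 - 1) h" using h(1) by simp
    show "addv (t + 1) (\<lambda>c. h (bd (t + 1) c))" by (rule addv_bd[OF h1])
    show "addv (t + 1) (\<lambda>c. 0)" by (simp add: addv_def)
    fix g assume g: "g \<in> gens (t + 1)"
    obtain i x y where gg: "g = (i, x, y)" by (cases g)
    have x: "x \<in> carrier (gr P i)" "y \<in> carrier (gr U (t + 1 - i))" using g gg by (auto simp: gens_iff)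
    have "h (bd (t + 1) (frag_of (i, x, y))) = cobd P U (\<lambda>i j x y. h (frag_of (i, x, y))) i (t + 1 - i) x y"
      by (rule linear_bd[OF h1]) (use g gg in simp)
    also have "\<dots> = cobd P U \<beta> i (t + 1 - i) x y"
    proof -
      have "(i - 1, dd P i x, y) \<in> gens t" "(i, x, dd U (t + 1 - i) y) \<in> gens t"
        using x U.cplx.d_cl[OF x(2), of "t - i"] P.cplx.d_closed[OF x(1)]
        by (auto intro: gensI[where j = "t + 1 - i"] gensI[where j = "t - i"])
      then show ?thesis by (simp add: cobd_def h(2)) (simp add: algebra_simps)
    qed
    also have "\<dots> = 0" by (rule agreeD[OF co]) (use x in auto)
    finally show "h (bd (t + 1) (frag_of g)) = 0" using gg by simp
  qed
  have ker: "h c = 0" if c: "c \<in> carrier (Fr t)" "bd t c \<in> Nul (t - 1)" for c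
  proof -
    let ?C = "Nul t #>\<^bsub>Fr t\<^esub> c"
    have "bd t c' \<in> Nul (t - 1)" if "c' \<in> ?C" for c'
      using bd_Nul[of "c' - c" t] that Nul_add[OF _ c(2), of "bd t (c' - c)"] by (simp add: coset_iff bd_diff)
    moreover have "?C \<noteq> {}" using Nul_zero[of t] by (auto simp: r_coset_def)
    ultimately have "dd T t ?C = Nul (t - 1)" by (auto simp: T_simps coset_Nul)
    then have "?C \<in> cycles T t" using c by (auto simp: cycles_def T_simps)
    then have *: "boundaries T t +>\<^bsub>gr T t\<^esub> ?C = boundaries T t"
      using assms by (auto simp: zero_module_def homology_def)
    have "Nul t \<in> boundaries T t"
    proof -
      have "dd T (t + 1) (Nul (t + 1)) = Nul t"
        using bd_Nul[of _ "t + 1"] Nul_zero[of "t + 1"] by (auto simp: T_simps coset_Nul)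
      moreover have "Nul (t + 1) \<in> carrier (gr T (t + 1))"
        using coset_Nul[OF Nul_zero, of "t + 1"] Fr_zero[of "t + 1"] by (auto simp: T_simps(1) intro!: exI[of _ 0])
      ultimately show ?thesis by (auto simp: boundaries_def intro!: image_eqI[of _ _ "Nul (t + 1)"])
    qed
    then have "Nul t <#>\<^bsub>Fr t\<^esub> ?C \<in> boundaries T t"
      using * by (force simp: a_r_coset_def' T_simps)
    moreover have "Nul t <#>\<^bsub>Fr t\<^esub> ?C = ?C"
    proof -
      have "Nul t <#>\<^bsub>Fr t\<^esub> ?C \<subseteq> ?C"
        using Nul_add[of _ t] by (force simp: set_mult_def coset_iff add_diff_eq[symmetric])
      moreover have "?C \<subseteq> Nul t <#>\<^bsub>Fr t\<^esub> ?C" using Nul_zero[of t] by (force simp: set_mult_def)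
      ultimately show ?thesis by blast
    qed
    ultimately have "?C \<in> boundaries T t" by simp
    then obtain c' where c': "c' \<in> carrier (Fr (t + 1))" "?C = dd T (t + 1) (Nul (t + 1) #>\<^bsub>Fr (t + 1)\<^esub> c')"
      by (auto simp: boundaries_def T_simps(1))
    have "c \<in> ?C" using Nul_zero[of t] by (simp add: coset_iff)
    then obtain d where d: "d \<in> Nul (t + 1) #>\<^bsub>Fr (t + 1)\<^esub> c'" "c \<in> Nul t #>\<^bsub>Fr t\<^esub> bd (t + 1) d"
      using c'(2) by (auto simp: T_simps(4))
    have dF: "d \<in> carrier (Fr (t + 1))"
      using d(1) Fr_add[OF Nul_Fr c'(1), of "d - c'"] by (simp add: coset_iff)
    have "h (c - bd (t + 1) d) = 0" using d(2) h(3) by (simp add: coset_iff)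
    then show ?thesis using addv_diff[OF h(1) c(1), of "bd (t + 1) d"] bd_Fr[OF dF] h_bd[OF dF] by simp
  qed
  define M where "M = {(m + bd t c, h c) | m c. m \<in> Nul (t - 1) \<and> c \<in> carrier (Fr t)}"
  interpret char_graph "Fr (t - 1)" M
  proof
    show "x \<in> carrier (Fr (t - 1))" if "(x, d) \<in> M" for x d
      using that by (auto simp: M_def intro: Fr_add Nul_Fr bd_Fr)
    show "(\<one>\<^bsub>Fr (t - 1)\<^esub>, 0) \<in> M"
      using Nul_zero Fr_zero[of t] addv_zero[OF h(1)] by (force simp: M_def bd_def)
  next
    fix x d y e assume xy: "(x, d) \<in> M" "(y, e) \<in> M"
    then obtain m c m' c' where *: "x = m + bd t c" "d = h c" "m \<in> Nul (t - 1)" "c \<in> carrier (Fr t)"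
      "y = m' + bd t c'" "e = h c'" "m' \<in> Nul (t - 1)" "c' \<in> carrier (Fr t)" by (auto simp: M_def)
    have "y \<in> carrier (Fr (t - 1))" using * by (auto intro: Fr_add Nul_Fr bd_Fr)
    then have "x \<otimes>\<^bsub>Fr (t - 1)\<^esub> inv\<^bsub>Fr (t - 1)\<^esub> y = (m + - m') + bd t (c - c')"
      using * by (simp add: Fr_inv bd_diff)
    moreover have "d - e = h (c - c')" using * by (simp add: addv_diff[OF h(1)])
    ultimately show "(x \<otimes>\<^bsub>Fr (t - 1)\<^esub> inv\<^bsub>Fr (t - 1)\<^esub> y, d - e) \<in> M"
      unfolding M_def using Nul_add[OF *(3) Nul_neg[OF *(7)]] Fr_diff[OF *(4,8)] by blast
  next
    fix d assume "(\<one>\<^bsub>Fr (t - 1)\<^esub>, d) \<in> M"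
    then obtain m c where *: "0 = m + bd t c" "d = h c" "m \<in> Nul (t - 1)" "c \<in> carrier (Fr t)" by (auto simp: M_def)
    have "bd t c = - m" using *(1) by (simp add: eq_neg_iff_add_eq_0 add.commute)
    then show "d = 0" using ker[OF *(4)] Nul_neg[OF *(3)] * by simp
  qed
  obtain g where g: "\<forall>x\<in>carrier (Fr (t - 1)). \<forall>y\<in>carrier (Fr (t - 1)). g (x \<otimes>\<^bsub>Fr (t - 1)\<^esub> y) = g x + (g y :: qz)"
    "\<forall>x d. (x, d) \<in> M \<longrightarrow> g x = d" using extends_to_character by blast
  have ad: "addv (t - 1) g" using g(1) by (simp add: addv_def)
  have gN: "g m = 0" if "m \<in> Nul (t - 1)" for m
  proof -
    have "(m + bd t 0, h 0) \<in> M" using that Fr_zero by (auto simp: M_def)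
    then show ?thesis using g(2) addv_zero[OF h(1)] by (simp add: bd_def)
  qed
  have gb: "g (bd t c) = h c" if "c \<in> carrier (Fr t)" for c
  proof -
    have "(0 + bd t c, h c) \<in> M" unfolding M_def using that Nul_zero by blast
    then show ?thesis using g(2) by simp
  qed
  let ?\<gamma> = "\<lambda>i (j :: int) x y. g (frag_of (i, x, y))"
  have "form A P U (t - 1) ?\<gamma>" by (rule linear_form[OF ad gN])
  moreover have "agree P U t \<beta> (cobd P U ?\<gamma>)"
  proof (rule agreeI)
    fix i j x u assume t: "i + j = t" and x: "x \<in> carrier (gr P i)" and u: "u \<in> carrier (gr U j)"
    have j: "t - i = j" using t by simp
    have gen: "(i, x, u) \<in> gens t" using x u j by (simp add: gens_iff)
    have "\<beta> i j x u = h (frag_of (i, x, u))" using h(2)[OF gen] j by simp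
    also have "\<dots> = g (bd t (frag_of (i, x, u)))" using gb[OF frag_of_Fr[OF gen]] by simp
    also have "\<dots> = cobd P U ?\<gamma> i j x u" using linear_bd[OF ad gen] j by simp
    finally show "\<beta> i j x u = cobd P U ?\<gamma> i j x u" .
  qed
  ultimately show "\<exists>\<gamma>. form A P U (t - 1) \<gamma> \<and> agree P U t \<beta> (cobd P U \<gamma>)" by blast
qed

end

context dg_algebra
begin

lemma mul_add_right': "a \<in> carrier (gr A i) \<Longrightarrow> b \<in> carrier (gr A j) \<Longrightarrow> b' \<in> carrier (gr A j) \<Longrightarrow> m = i + j \<Longrightarrow>
      mul A i j a (b \<oplus>\<^bsub>gr A j\<^esub> b') = mul A i j a b \<oplus>\<^bsub>gr A m\<^esub> mul A i j a b'"
  using mul_add_right by simp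

lemma mul_add_left': "a \<in> carrier (gr A i) \<Longrightarrow> a' \<in> carrier (gr A i) \<Longrightarrow> b \<in> carrier (gr A j) \<Longrightarrow> m = i + j \<Longrightarrow>
      mul A i j (a \<oplus>\<^bsub>gr A i\<^esub> a') b = mul A i j a b \<oplus>\<^bsub>gr A m\<^esub> mul A i j a' b"
  using mul_add_left by simp

lemma mul_assoc': "a \<in> carrier (gr A i) \<Longrightarrow> b \<in> carrier (gr A j) \<Longrightarrow> c \<in> carrier (gr A k) \<Longrightarrow> m = i + j \<Longrightarrow> l = j + k \<Longrightarrow>
      mul A m k (mul A i j a b) c = mul A i l a (mul A j k b c)"
  using mul_assoc by simp

lemma mul_zero_right': "a \<in> carrier (gr A i) \<Longrightarrow> m = i + j \<Longrightarrow> mul A i j a \<zero>\<^bsub>gr A j\<^esub> = \<zero>\<^bsub>gr A m\<^esub>"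
  using mul_zero_right by simp

lemma mul_zero_at: "a \<in> carrier (gr A l) \<Longrightarrow> m = l + j \<Longrightarrow> mul A l (j - k) a \<zero>\<^bsub>gr A (j - k)\<^esub> = \<zero>\<^bsub>gr A (m - k)\<^esub>"
  by (rule mul_zero_right') auto

lemma mul_zero_left': "b \<in> carrier (gr A j) \<Longrightarrow> m = i + j \<Longrightarrow> mul A i j \<zero>\<^bsub>gr A i\<^esub> b = \<zero>\<^bsub>gr A m\<^esub>"
  using mul_zero_left by simp

lemma mul_ksign_right': "a \<in> carrier (gr A i) \<Longrightarrow> b \<in> carrier (gr A j) \<Longrightarrow> m = i + j \<Longrightarrow>
    mul A i j a (ksign (gr A j) k b) = ksign (gr A m) k (mul A i j a b)"
  using mul_ksign_right by simp

lemma leibniz': "a \<in> carrier (gr A i) \<Longrightarrow> b \<in> carrier (gr A j) \<Longrightarrow> m = i + j \<Longrightarrow> k = m - 1 \<Longrightarrow>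
    dd A m (mul A i j a b) = mul A (i - 1) j (dd A i a) b \<oplus>\<^bsub>gr A k\<^esub> ksign (gr A k) i (mul A i (j - 1) a (dd A j b))"
  by (simp only: leibniz)

lemma d_unt: "dd A 0 (unt A) = \<zero>\<^bsub>gr A (- 1)\<^esub>"
  using neg_degree[of "-1" "dd A 0 (unt A)"] d_closed[OF unt_closed] by simp

end

section \<open>Modules with cells\<close>

definition fsmult :: "('r, 'a, 'm) dg_alg_scheme \<Rightarrow> ('i \<Rightarrow> int) \<Rightarrow> int \<Rightarrow> 'r \<Rightarrow> ('i \<Rightarrow> 'a) \<Rightarrow> ('i \<Rightarrow> 'a)" where
  "fsmult A dg j r c = (\<lambda>p. r \<odot>\<^bsub>gr A (j - dg p)\<^esub> c p)"

definition fsign :: "('r, 'a, 'm) dg_alg_scheme \<Rightarrow> ('i \<Rightarrow> int) \<Rightarrow> int \<Rightarrow> int \<Rightarrow> ('i \<Rightarrow> 'a) \<Rightarrow> ('i \<Rightarrow> 'a)" where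
  "fsign A dg j k c = (\<lambda>p. ksign (gr A (j - dg p)) k (c p))"

definition famact :: "('r, 'a, 'm) dg_alg_scheme \<Rightarrow> ('i \<Rightarrow> int) \<Rightarrow> int \<Rightarrow> int \<Rightarrow> 'a \<Rightarrow> ('i \<Rightarrow> 'a) \<Rightarrow> ('i \<Rightarrow> 'a)" where
  "famact A dg l j a c = (\<lambda>p. mul A l (j - dg p) a (c p))"

definition fmod :: "('r, 'a, 'm) dg_alg_scheme \<Rightarrow> ('i \<Rightarrow> int) \<Rightarrow> 'i set \<Rightarrow> int \<Rightarrow> ('r, 'i \<Rightarrow> 'a) module" where
  "fmod A dg I j = \<lparr>carrier = fam A dg I j, monoid.mult = undefined, one = undefined,
     ring.zero = fzero A dg j, add = fadd A dg j, smult = fsmult A dg j\<rparr>"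

text \<open>The Leibniz rule \<open>d(a e\<^sub>q) = (d a) e\<^sub>q + (-1)\<^sup>|\<^sup>a\<^sup>| a (d e\<^sub>q)\<close>, where \<open>d e\<^sub>q\<close> is the family \<open>del q\<close>.\<close>

definition dmon :: "('r, 'a, 'm) dg_alg_scheme \<Rightarrow> ('i \<Rightarrow> int) \<Rightarrow> ('i \<Rightarrow> 'i \<Rightarrow> 'a) \<Rightarrow> int \<Rightarrow> 'i \<Rightarrow> 'a \<Rightarrow> ('i \<Rightarrow> 'a)" where
  "dmon A dg del j q a = fadd A dg (j - 1) (mon A dg (j - 1) q (dd A (j - dg q) a))
     (fsign A dg (j - 1) (j - dg q) (famact A dg (j - dg q) (dg q - 1) a (del q)))"

definition celld :: "('r, 'a, 'm) dg_alg_scheme \<Rightarrow> ('i \<Rightarrow> int) \<Rightarrow> ('i \<Rightarrow> 'i \<Rightarrow> 'a) \<Rightarrow> int \<Rightarrow> ('i \<Rightarrow> 'a) \<Rightarrow> ('i \<Rightarrow> 'a)" where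
  "celld A dg del j c = sumext (fmod A dg UNIV (j - 1)) A dg j (dmon A dg del j) c"

text \<open>
  The free graded module on cells \<open>q \<in> I\<close> of degree \<open>dg q\<close> with \<open>d e\<^sub>q = del q\<close>. The operations do not mention \<open>I\<close>,
  so a set of cells that is closed under \<open>del\<close> spans a submodule with literally the same operations.
\<close>

definition cell_mod :: "('r, 'a, 'm) dg_alg_scheme \<Rightarrow> ('i \<Rightarrow> int) \<Rightarrow> ('i \<Rightarrow> 'i \<Rightarrow> 'a) \<Rightarrow> 'i set \<Rightarrow> ('r, 'a, 'i \<Rightarrow> 'a) dg_mod" where
  "cell_mod A dg del I = \<lparr>gr = fmod A dg I, dd = celld A dg del, act = famact A dg\<rparr>"

lemma fmod_simps [simp]:
  "carrier (fmod A dg I j) = fam A dg I j" "\<zero>\<^bsub>fmod A dg I j\<^esub> = fzero A dg j"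
  "c \<oplus>\<^bsub>fmod A dg I j\<^esub> c' = fadd A dg j c c'" "r \<odot>\<^bsub>fmod A dg I j\<^esub> c = fsmult A dg j r c"
  by (simp_all add: fmod_def)

lemma cell_mod_simps [simp]:
  "gr (cell_mod A dg del I) = fmod A dg I" "dd (cell_mod A dg del I) = celld A dg del" "act (cell_mod A dg del I) = famact A dg"
  by (simp_all add: cell_mod_def)

context dg_algebra
begin

lemma supp_hom_subset:
  assumes "\<And>p. c p = \<zero>\<^bsub>gr A (j - dg p)\<^esub> \<Longrightarrow> c' p = \<zero>\<^bsub>gr A (j' - dg p)\<^esub>"
  shows "supp A dg j' c' \<subseteq> supp A dg j c"
  using assms by (auto simp: supp_def)

lemma fsign_fam: "c \<in> fam A dg I j \<Longrightarrow> fsign A dg j k c \<in> fam A dg I j"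
  using supp_hom_subset[of c j dg "fsign A dg j k c" j]
  by (auto simp: fam_def fsign_def grp.ksign_closed intro: finite_subset)

lemma famact_fam:
  assumes a: "a \<in> carrier (gr A l)" and c: "c \<in> fam A dg I j" and m: "m = l + j"
  shows "famact A dg l j a c \<in> fam A dg I m"
proof -
  have "supp A dg m (famact A dg l j a c) \<subseteq> supp A dg j c"
    by (rule supp_hom_subset) (use a m in \<open>simp add: famact_def mul_zero_at del: mul_zero_right\<close>)
  moreover have "famact A dg l j a c p \<in> carrier (gr A (m - dg p))" for p
    unfolding famact_def by (rule mul_cl[OF a famD[OF c]]) (use m in auto)
  ultimately show ?thesis using c by (auto simp: fam_def intro: finite_subset)
qed

lemma fsmult_fam: "r \<in> carrier R \<Longrightarrow> c \<in> fam A dg I j \<Longrightarrow> fsmult A dg j r c \<in> fam A dg I j"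
  using supp_hom_subset[of c j dg "fsmult A dg j r c" j]
  by (auto simp: fam_def fsmult_def module.smult_closed[OF component] module.smult_r_null[OF component] intro: finite_subset)

lemma fmod_abelian_group: "abelian_group (fmod A dg I j)"
proof (rule abelian_groupI)
  fix c assume c: "c \<in> carrier (fmod A dg I j)"
  then have "fadd A dg j (fsign A dg j 1 c) c = fzero A dg j"
    by (auto simp: fadd_def fsign_def ksign_def fzero_def grp.l_neg famD)
  then show "\<exists>c'\<in>carrier (fmod A dg I j). c' \<oplus>\<^bsub>fmod A dg I j\<^esub> c = \<zero>\<^bsub>fmod A dg I j\<^esub>"
    using fsign_fam c by (intro bexI[of _ "fsign A dg j 1 c"]) auto
  show "\<zero>\<^bsub>fmod A dg I j\<^esub> \<oplus>\<^bsub>fmod A dg I j\<^esub> c = c"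
    using c by (auto simp: fadd_def fzero_def famD)
next
  fix c c' assume "c \<in> carrier (fmod A dg I j)" "c' \<in> carrier (fmod A dg I j)"
  then show "c \<oplus>\<^bsub>fmod A dg I j\<^esub> c' = c' \<oplus>\<^bsub>fmod A dg I j\<^esub> c"
    by (auto simp: fadd_def famD grp.a_comm)
next
  fix c c' c'' assume "c \<in> carrier (fmod A dg I j)" "c' \<in> carrier (fmod A dg I j)" "c'' \<in> carrier (fmod A dg I j)"
  then show "c \<oplus>\<^bsub>fmod A dg I j\<^esub> c' \<oplus>\<^bsub>fmod A dg I j\<^esub> c'' = c \<oplus>\<^bsub>fmod A dg I j\<^esub> (c' \<oplus>\<^bsub>fmod A dg I j\<^esub> c'')"
    by (auto simp: fadd_def famD grp.a_assoc)
qed (auto simp: fadd_fam fzero_fam)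

lemma fmod_module: "module R (fmod A dg I j)"
proof (rule moduleI[OF is_cring fmod_abelian_group])
  fix r c assume "r \<in> carrier R" "c \<in> carrier (fmod A dg I j)"
  then show "r \<odot>\<^bsub>fmod A dg I j\<^esub> c \<in> carrier (fmod A dg I j)" by (simp add: fsmult_fam)
next
  fix r s c assume "r \<in> carrier R" "s \<in> carrier R" "c \<in> carrier (fmod A dg I j)"
  then show "(r \<oplus> s) \<odot>\<^bsub>fmod A dg I j\<^esub> c = r \<odot>\<^bsub>fmod A dg I j\<^esub> c \<oplus>\<^bsub>fmod A dg I j\<^esub> s \<odot>\<^bsub>fmod A dg I j\<^esub> c"
    "r \<otimes> s \<odot>\<^bsub>fmod A dg I j\<^esub> c = r \<odot>\<^bsub>fmod A dg I j\<^esub> (s \<odot>\<^bsub>fmod A dg I j\<^esub> c)"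
    by (auto simp: fsmult_def fadd_def famD module.smult_l_distr[OF component] module.smult_assoc1[OF component])
next
  fix r c c' assume "r \<in> carrier R" "c \<in> carrier (fmod A dg I j)" "c' \<in> carrier (fmod A dg I j)"
  then show "r \<odot>\<^bsub>fmod A dg I j\<^esub> (c \<oplus>\<^bsub>fmod A dg I j\<^esub> c') = r \<odot>\<^bsub>fmod A dg I j\<^esub> c \<oplus>\<^bsub>fmod A dg I j\<^esub> r \<odot>\<^bsub>fmod A dg I j\<^esub> c'"
    by (auto simp: fsmult_def fadd_def famD module.smult_r_distr[OF component])
next
  fix c assume "c \<in> carrier (fmod A dg I j)"
  then show "\<one> \<odot>\<^bsub>fmod A dg I j\<^esub> c = c"
    by (auto simp: fsmult_def famD module.smult_one[OF component])
qed

lemma fmod_neg: "c \<in> fam A dg I j \<Longrightarrow> \<ominus>\<^bsub>fmod A dg I j\<^esub> c = fsign A dg j 1 c"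
proof -
  assume c: "c \<in> fam A dg I j"
  interpret M: abelian_group "fmod A dg I j" by (rule fmod_abelian_group)
  have "fadd A dg j (fsign A dg j 1 c) c = fzero A dg j"
    using c by (auto simp: fadd_def fsign_def ksign_def fzero_def grp.l_neg famD)
  then show ?thesis
    by (intro M.minus_equality) (use c fsign_fam[OF c] in auto)
qed

lemma fmod_ksign: "c \<in> fam A dg I j \<Longrightarrow> ksign (fmod A dg I j) k c = fsign A dg j k c"
  by (auto simp: ksign_def fmod_neg fsign_def)

lemma famact_mon:
  assumes "a \<in> carrier (gr A l)" "b \<in> carrier (gr A (j - dg q))" "m = l + j"
  shows "famact A dg l j a (mon A dg j q b) = mon A dg m q (mul A l (j - dg q) a b)"
  using assms(1,3) by (rule_tac ext) (simp add: famact_def mon_def mul_zero_at del: mul_zero_right)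

lemma famact_add:
  assumes "a \<in> carrier (gr A l)" "c \<in> fam A dg I j" "c' \<in> fam A dg I' j" "m = l + j"
  shows "famact A dg l j a (fadd A dg j c c') = fadd A dg m (famact A dg l j a c) (famact A dg l j a c')"
  unfolding famact_def fadd_def by (rule ext, rule mul_add_right') (use assms in \<open>auto intro: famD\<close>)

lemma famact_zero: "a \<in> carrier (gr A l) \<Longrightarrow> m = l + j \<Longrightarrow> famact A dg l j a (fzero A dg j) = fzero A dg m"
  by (rule ext) (simp add: famact_def fzero_def mul_zero_at del: mul_zero_right)

lemma famact_zero_left: "c \<in> fam A dg I j \<Longrightarrow> m = l + j \<Longrightarrow> famact A dg l j \<zero>\<^bsub>gr A l\<^esub> c = fzero A dg m"
  unfolding famact_def fzero_def by (rule ext, rule mul_zero_left') (auto dest: famD)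

lemma fsign_add: "c \<in> fam A dg I j \<Longrightarrow> c' \<in> fam A dg I' j \<Longrightarrow>
   fsign A dg j k (fadd A dg j c c') = fadd A dg j (fsign A dg j k c) (fsign A dg j k c')"
  by (auto simp: fsign_def fadd_def famD grp.ksign_add)

lemma fadd_interchange:
  assumes "c1 \<in> fam A dg I j" "c2 \<in> fam A dg I2 j" "c3 \<in> fam A dg I3 j" "c4 \<in> fam A dg I4 j"
  shows "fadd A dg j (fadd A dg j c1 c2) (fadd A dg j c3 c4) = fadd A dg j (fadd A dg j c1 c3) (fadd A dg j c2 c4)"
  using famD[OF assms(1)] famD[OF assms(2)] famD[OF assms(3)] famD[OF assms(4)]
  by (simp add: fadd_def grp.a_ac)

lemma fadd_zero: "fadd A dg j (fzero A dg j) (fzero A dg j) = fzero A dg j"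
  by (simp add: fadd_def fzero_def)

lemma fsign_zero: "fsign A dg j k (fzero A dg j) = fzero A dg j"
  by (simp add: fsign_def fzero_def)

end

locale cells = dg_algebra R A
  for R :: "('r, 's) ring_scheme" (structure) and A :: "('r, 'a, 'm) dg_alg_scheme" +
  fixes dg :: "'i \<Rightarrow> int" and del :: "'i \<Rightarrow> 'i \<Rightarrow> 'a" and I :: "'i set"
  assumes del_fam: "q \<in> I \<Longrightarrow> del q \<in> fam A dg I (dg q - 1)"
    and del_cycle: "q \<in> I \<Longrightarrow> celld A dg del (dg q - 1) (del q) = fzero A dg (dg q - 1 - 1)"
begin

abbreviation "F \<equiv> cell_mod A dg del I"
abbreviation "cd \<equiv> celld A dg del"
abbreviation "fm \<equiv> fam A dg I"

lemma dmon_fam: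
  assumes "q \<in> I" "a \<in> carrier (gr A (j - dg q))"
  shows "dmon A dg del j q a \<in> fam A dg I (j - 1)"
  unfolding dmon_def
proof (intro fadd_fam mon_fam fsign_fam famact_fam)
  show "dd A (j - dg q) a \<in> carrier (gr A (j - 1 - dg q))" using assms by (intro d_cl) auto
qed (use assms del_fam in auto)

lemma dmon_add:
  assumes q: "q \<in> I" and a: "a \<in> carrier (gr A (j - dg q))" and b: "b \<in> carrier (gr A (j - dg q))"
  shows "dmon A dg del j q (a \<oplus>\<^bsub>gr A (j - dg q)\<^esub> b) = fadd A dg (j - 1) (dmon A dg del j q a) (dmon A dg del j q b)"
proof -
  have e: "j - dg q - 1 = j - 1 - dg q" by simp
  have da: "dd A (j - dg q) a \<in> carrier (gr A (j - 1 - dg q))" "dd A (j - dg q) b \<in> carrier (gr A (j - 1 - dg q))"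
    using a b by (auto intro: d_cl)
  have 1: "mon A dg (j - 1) q (dd A (j - dg q) (a \<oplus>\<^bsub>gr A (j - dg q)\<^esub> b)) =
     fadd A dg (j - 1) (mon A dg (j - 1) q (dd A (j - dg q) a)) (mon A dg (j - 1) q (dd A (j - dg q) b))"
    using mon_add[where j = "j - 1" and dg = dg and q = q, OF da] d_add[OF a b] by (simp add: e)
  have f: "famact A dg (j - dg q) (dg q - 1) a (del q) \<in> fam A dg I (j - 1)"
    "famact A dg (j - dg q) (dg q - 1) b (del q) \<in> fam A dg I (j - 1)"
    using a b del_fam[OF q] by (auto intro: famact_fam)
  have 2: "famact A dg (j - dg q) (dg q - 1) (a \<oplus>\<^bsub>gr A (j - dg q)\<^esub> b) (del q) =
     fadd A dg (j - 1) (famact A dg (j - dg q) (dg q - 1) a (del q)) (famact A dg (j - dg q) (dg q - 1) b (del q))"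
    unfolding famact_def fadd_def by (rule ext, rule mul_add_left') (use a b famD[OF del_fam[OF q]] in auto)
  show ?thesis
    unfolding dmon_def 1 2 fsign_add[OF f]
    by (rule fadd_interchange) (use mon_fam[where j = "j - 1" and dg = dg, OF q da(1)] mon_fam[where j = "j - 1" and dg = dg, OF q da(2)] fsign_fam[OF f(1)] fsign_fam[OF f(2)] in auto)
qed

lemma fm_UNIV: "c \<in> fm j \<Longrightarrow> c \<in> fam A dg UNIV j"
  using fam_mono[of I UNIV A dg j] by auto

lemma cd_add:
  assumes "c \<in> fm j" "c' \<in> fm j"
  shows "cd j (fadd A dg j c c') = fadd A dg (j - 1) (cd j c) (cd j c')"
  unfolding celld_def
  by (subst sumext_add[where I = I, OF fmod_abelian_group])
    (use assms dmon_fam fm_UNIV in \<open>auto simp: dmon_add\<close>)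

lemma cd_mon:
  assumes "q \<in> I" "a \<in> carrier (gr A (j - dg q))"
  shows "cd j (mon A dg j q a) = dmon A dg del j q a"
  unfolding celld_def
  by (subst sumext_mon[where I = I, OF fmod_abelian_group])
    (use assms dmon_fam fm_UNIV in \<open>auto simp: dmon_add\<close>)

lemma cd_zero: "cd j (fzero A dg j) = fzero A dg (j - 1)"
proof -
  interpret M: abelian_group "fmod A dg UNIV (j - 1)" by (rule fmod_abelian_group)
  have "supp A dg j (fzero A dg j) = {}" by (simp add: supp_def fzero_def)
  then show ?thesis using M.finsum_empty by (simp add: celld_def sumext_def)
qed

lemma cd_fam: "c \<in> fm j \<Longrightarrow> cd j c \<in> fm (j - 1)"
  by (induction rule: fam_induct) (auto simp: cd_zero cd_mon cd_add fzero_fam dmon_fam fadd_fam)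

lemma cd_fam': "c \<in> fm j \<Longrightarrow> m = j - 1 \<Longrightarrow> cd j c \<in> fm m"
  using cd_fam by simp

lemma cd_famact:
  assumes a: "a \<in> carrier (gr A l)" and c: "c \<in> fm j" and m: "m = l + j"
  shows "cd m (famact A dg l j a c) =
    fadd A dg (m - 1) (famact A dg (l - 1) j (dd A l a) c) (fsign A dg (m - 1) l (famact A dg l (j - 1) a (cd j c)))"
  using c
proof (induction rule: fam_induct)
  case zero
  show ?case using famact_zero[OF a m, of dg] famact_zero[OF d_closed[OF a], of "m - 1" j dg] famact_zero[OF a, of "m - 1" "j - 1" dg] m
    by (simp add: cd_zero fsign_zero fadd_zero)
next
  case (add c c')
  have da: "dd A l a \<in> carrier (gr A (l - 1))" using a by (rule d_closed)
  note f = famact_fam[OF a add(1) m] famact_fam[OF a add(2) m]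
  have g: "famact A dg (l - 1) j (dd A l a) c \<in> fm (m - 1)" "famact A dg (l - 1) j (dd A l a) c' \<in> fm (m - 1)"
    "famact A dg l (j - 1) a (cd j c) \<in> fm (m - 1)" "famact A dg l (j - 1) a (cd j c') \<in> fm (m - 1)"
    using add(1,2) m by (auto intro!: famact_fam[OF da] famact_fam[OF a] cd_fam)
  have "cd m (famact A dg l j a (fadd A dg j c c')) = fadd A dg (m - 1) (cd m (famact A dg l j a c)) (cd m (famact A dg l j a c'))"
    unfolding famact_add[OF a add(1,2) m] by (rule cd_add[OF f])
  also have "\<dots> = fadd A dg (m - 1)
     (fadd A dg (m - 1) (famact A dg (l - 1) j (dd A l a) c) (famact A dg (l - 1) j (dd A l a) c'))
     (fadd A dg (m - 1) (fsign A dg (m - 1) l (famact A dg l (j - 1) a (cd j c))) (fsign A dg (m - 1) l (famact A dg l (j - 1) a (cd j c'))))"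
    unfolding add by (rule fadd_interchange) (use g fsign_fam in auto)
  also have "fadd A dg (m - 1) (famact A dg (l - 1) j (dd A l a) c) (famact A dg (l - 1) j (dd A l a) c') = famact A dg (l - 1) j (dd A l a) (fadd A dg j c c')"
    by (rule famact_add[OF da add(1,2), symmetric]) (use m in auto)
  also have "fadd A dg (m - 1) (fsign A dg (m - 1) l (famact A dg l (j - 1) a (cd j c))) (fsign A dg (m - 1) l (famact A dg l (j - 1) a (cd j c')))
     = fsign A dg (m - 1) l (famact A dg l (j - 1) a (cd j (fadd A dg j c c')))"
    unfolding cd_add[OF add(1,2)] using famact_add[OF a cd_fam[OF add(1)] cd_fam[OF add(2)], of "m - 1"] m fsign_add[OF g(3,4)] by simp
  finally show ?case .
next
  case (mon q b)
  have ab: "mul A l (j - dg q) a b \<in> carrier (gr A (m - dg q))" using a mon m by (intro mul_cl) auto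
  have da: "dd A l a \<in> carrier (gr A (l - 1))" using a by (rule d_closed)
  have db: "dd A (j - dg q) b \<in> carrier (gr A (j - 1 - dg q))" using mon by (intro d_cl) auto
  have del: "del q p \<in> carrier (gr A (dg q - 1 - dg p))" for p using famD[OF del_fam[OF mon(1)]] .
  have bdel: "mul A (j - dg q) (dg q - 1 - dg p) b (del q p) \<in> carrier (gr A (j - 1 - dg p))" for p
    using mon del by (intro mul_cl) auto
  have abdel: "mul A l (j - 1 - dg p) a (mul A (j - dg q) (dg q - 1 - dg p) b (del q p)) \<in> carrier (gr A (m - 1 - dg p))" for p
    by (rule mul_cl[OF a bdel]) (use m in simp)
  have dab: "mul A (l - 1) (j - dg q) (dd A l a) b \<in> carrier (gr A (m - 1 - dg q))" "mul A l (j - 1 - dg q) a (dd A (j - dg q) b) \<in> carrier (gr A (m - 1 - dg q))"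
    using a da db mon m by (auto intro!: mul_cl)
  have L: "cd m (famact A dg l j a (mon A dg j q b)) = dmon A dg del m q (mul A l (j - dg q) a b)"
    unfolding famact_mon[where dg = dg and j = j and q = q, OF a mon(2) m] using mon ab by (intro cd_mon)
  have assoc: "mul A (m - dg q) (dg q - 1 - dg p) (mul A l (j - dg q) a b) (del q p) =
      mul A l (j - 1 - dg p) a (mul A (j - dg q) (dg q - 1 - dg p) b (del q p))" for p
    using a mon del m by (intro mul_assoc') auto
  have lb: "dd A (m - dg q) (mul A l (j - dg q) a b) = mul A (l - 1) (j - dg q) (dd A l a) b \<oplus>\<^bsub>gr A (m - 1 - dg q)\<^esub>
      ksign (gr A (m - 1 - dg q)) l (mul A l (j - 1 - dg q) a (dd A (j - dg q) b))"
    using leibniz'[OF a mon(2), of "m - dg q" "m - 1 - dg q"] m by (simp add: algebra_simps)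
  have z: "mul A (l - 1) (j - dg p) (dd A l a) \<zero>\<^bsub>gr A (j - dg p)\<^esub> = \<zero>\<^bsub>gr A (m - 1 - dg p)\<^esub>" for p
    using da m by (intro mul_zero_right') auto
  have dist: "mul A l (j - 1 - dg p) a (x \<oplus>\<^bsub>gr A (j - 1 - dg p)\<^esub> ksign (gr A (j - 1 - dg p)) (j - dg q) (mul A (j - dg q) (dg q - 1 - dg p) b (del q p)))
     = mul A l (j - 1 - dg p) a x \<oplus>\<^bsub>gr A (m - 1 - dg p)\<^esub> ksign (gr A (m - 1 - dg p)) (j - dg q) (mul A l (j - 1 - dg p) a (mul A (j - dg q) (dg q - 1 - dg p) b (del q p)))"
    if "x \<in> carrier (gr A (j - 1 - dg p))" for p x
    using mul_add_right'[OF a that grp.ksign_closed[OF bdel], of "m - 1 - dg p"] mul_ksign_right'[OF a bdel, of "m - 1 - dg p"] m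
    by (simp add: algebra_simps)
  have z2: "mul A l (j - 1 - dg p) a \<zero>\<^bsub>gr A (j - 1 - dg p)\<^esub> = \<zero>\<^bsub>gr A (m - 1 - dg p)\<^esub>" for p
    using a m by (intro mul_zero_right') auto
  have m': "m - dg q = l + (j - dg q)" using m by simp
  show ?case unfolding L cd_mon[OF mon]
  proof (rule ext)
    fix p
    show "dmon A dg del m q (mul A l (j - dg q) a b) p =
      fadd A dg (m - 1) (famact A dg (l - 1) j (dd A l a) (mon A dg j q b))
            (fsign A dg (m - 1) l (famact A dg l (j - 1) a (dmon A dg del j q b))) p"
    proof (cases "p = q")
      case True
      have "dd A (m - dg q) (mul A l (j - dg q) a b) \<oplus>\<^bsub>gr A (m - 1 - dg q)\<^esub>
        ksign (gr A (m - 1 - dg q)) (m - dg q) (mul A l (j - 1 - dg q) a (mul A (j - dg q) (dg q - 1 - dg q) b (del q q))) =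
        mul A (l - 1) (j - dg q) (dd A l a) b \<oplus>\<^bsub>gr A (m - 1 - dg q)\<^esub>
        ksign (gr A (m - 1 - dg q)) l (mul A l (j - 1 - dg q) a (dd A (j - dg q) b) \<oplus>\<^bsub>gr A (m - 1 - dg q)\<^esub>
          ksign (gr A (m - 1 - dg q)) (j - dg q) (mul A l (j - 1 - dg q) a (mul A (j - dg q) (dg q - 1 - dg q) b (del q q))))"
        unfolding lb using dab abdel[of q]
        by (simp add: m' grp.ksign_add grp.ksign_closed grp.ksign_ksign grp.a_assoc)
      then show ?thesis by (simp only: True dmon_def fadd_def mon_def famact_def fsign_def assoc dist[OF db] if_True simp_thms)
    next
      case False
      then show ?thesis using abdel[of p]
        by (simp add: dmon_def fadd_def mon_def famact_def fsign_def assoc[unfolded m'] dist z z2 grp.ksign_closed grp.ksign_ksign m')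
    qed
  qed
qed

text \<open>By the Leibniz rule it is enough that the differential of each \<open>del q\<close> is zero.\<close>

lemma cd_cd: "c \<in> fm j \<Longrightarrow> cd (j - 1) (cd j c) = fzero A dg (j - 1 - 1)"
proof (induction rule: fam_induct)
  case zero show ?case by (simp add: cd_zero)
next
  case (add c c')
  then show ?case by (simp add: cd_add cd_fam fadd_zero)
next
  case (mon q a)
  let ?k = "j - dg q"
  have da: "dd A ?k a \<in> carrier (gr A (?k - 1))" using mon by (intro d_closed)
  have e: "j - 1 - dg q = ?k - 1" by simp
  have da': "dd A ?k a \<in> carrier (gr A (j - 1 - dg q))" unfolding e by (rule da)
  have dda: "dd A (?k - 1) (dd A ?k a) = \<zero>\<^bsub>gr A (j - 1 - 1 - dg q)\<^esub>"
    using dd_dd[OF mon(2), of "?k - 1"] by (simp add: algebra_simps)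
  have f: "famact A dg ?k (dg q - 1) a (del q) \<in> fm (j - 1)"
    using mon del_fam[OF mon(1)] by (intro famact_fam) auto
  have g: "famact A dg (?k - 1) (dg q - 1) (dd A ?k a) (del q) \<in> fm (j - 1 - 1)"
    using da del_fam[OF mon(1)] by (intro famact_fam) auto
  have 1: "cd (j - 1) (mon A dg (j - 1) q (dd A ?k a)) = fsign A dg (j - 1 - 1) (?k - 1) (famact A dg (?k - 1) (dg q - 1) (dd A ?k a) (del q))"
    unfolding cd_mon[OF mon(1) da'] dmon_def e dda mon_zero
    using famD[OF fsign_fam[OF g]] by (auto simp: fadd_def fzero_def)
  have 2: "cd (j - 1) (famact A dg ?k (dg q - 1) a (del q)) = famact A dg (?k - 1) (dg q - 1) (dd A ?k a) (del q)"
  proof -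
    have "cd (j - 1) (famact A dg ?k (dg q - 1) a (del q)) = fadd A dg (j - 1 - 1) (famact A dg (?k - 1) (dg q - 1) (dd A ?k a) (del q))
      (fsign A dg (j - 1 - 1) ?k (famact A dg ?k (dg q - 1 - 1) a (cd (dg q - 1) (del q))))"
      by (rule cd_famact[OF mon(2) del_fam[OF mon(1)]]) simp
    also have "famact A dg ?k (dg q - 1 - 1) a (cd (dg q - 1) (del q)) = fzero A dg (j - 1 - 1)"
      unfolding del_cycle[OF mon(1)] by (rule famact_zero[OF mon(2)]) simp
    finally show ?thesis using famD[OF g] by (simp add: fsign_zero) (simp add: fadd_def fzero_def)
  qed
  have 3: "cd (j - 1) (fsign A dg (j - 1) k c) = fsign A dg (j - 1 - 1) k (cd (j - 1) c)" if "c \<in> fm (j - 1)" for k c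
  proof -
    interpret M: abelian_group "fmod A dg I (j - 1)" by (rule fmod_abelian_group)
    interpret M': abelian_group "fmod A dg I (j - 1 - 1)" by (rule fmod_abelian_group)
    have "cd (j - 1) (\<ominus>\<^bsub>fmod A dg I (j - 1)\<^esub> c) = \<ominus>\<^bsub>fmod A dg I (j - 1 - 1)\<^esub> cd (j - 1) c"
      by (rule additive_map_neg[OF M.abelian_group_axioms M'.abelian_group_axioms]) (use that in \<open>auto simp: cd_fam' cd_add\<close>)
    then show ?thesis
      unfolding fmod_ksign[where dg = dg and I = I and j = "j - 1" and k = k, OF that, symmetric]
        fmod_ksign[where dg = dg and I = I and j = "j - 1 - 1" and k = k, OF cd_fam[OF that], symmetric]
      by (simp add: ksign_def)
  qed
  have "cd (j - 1) (cd j (mon A dg j q a)) = fadd A dg (j - 1 - 1)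
    (fsign A dg (j - 1 - 1) (?k - 1) (famact A dg (?k - 1) (dg q - 1) (dd A ?k a) (del q)))
    (fsign A dg (j - 1 - 1) ?k (famact A dg (?k - 1) (dg q - 1) (dd A ?k a) (del q)))"
    unfolding cd_mon[OF mon] dmon_def
    by (subst cd_add) (use mon_fam[where j = "j - 1" and dg = dg, OF mon(1) da'] fsign_fam[OF f] in \<open>auto simp: 1 3[OF f] 2\<close>)
  also have "\<dots> = fzero A dg (j - 1 - 1)"
    using famD[OF g] by (auto simp: fadd_def fzero_def fsign_def ksign_def grp.l_neg grp.r_neg)
  finally show ?case .
qed

lemma cell_mod_dg_module: "dg_module R A F"
proof -
  have C: "dg_complex R F"
  proof (intro dg_complex.intro is_cring dg_complex_axioms.intro; unfold cell_mod_simps fmod_simps)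
    fix r j c assume r: "r \<in> carrier R" and c: "c \<in> fm j"
    have ru: "r \<odot>\<^bsub>gr A 0\<^esub> unt A \<in> carrier (gr A 0)" using module.smult_closed[OF component r unt_closed] .
    have fs: "fsmult A dg j' r c' = famact A dg 0 j' (r \<odot>\<^bsub>gr A 0\<^esub> unt A) c'" if "c' \<in> fm j'" for j' c'
      using mul_smult_left[OF r unt_closed famD[OF that]] mul_unt_left[OF famD[OF that]] by (auto simp: fsmult_def famact_def)
    have dru: "dd A 0 (r \<odot>\<^bsub>gr A 0\<^esub> unt A) = \<zero>\<^bsub>gr A (0 - 1)\<^esub>"
      using d_smult[OF r unt_closed] d_unt module.smult_r_null[OF component r, of "-1"] by simp
    have "cd j (fsmult A dg j r c) = fadd A dg (j - 1) (famact A dg (0 - 1) j (dd A 0 (r \<odot>\<^bsub>gr A 0\<^esub> unt A)) c)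
        (fsign A dg (j - 1) 0 (famact A dg 0 (j - 1) (r \<odot>\<^bsub>gr A 0\<^esub> unt A) (cd j c)))"
      unfolding fs[OF c] by (rule cd_famact[OF ru c]) simp
    also have "famact A dg (0 - 1) j (dd A 0 (r \<odot>\<^bsub>gr A 0\<^esub> unt A)) c = fzero A dg (j - 1)"
      unfolding dru by (rule famact_zero_left[OF c]) simp
    finally show "cd j (fsmult A dg j r c) = fsmult A dg (j - 1) r (cd j c)"
      unfolding fs[OF cd_fam[OF c]] using famD[OF famact_fam[OF ru cd_fam[OF c], of "j - 1"]]
      by (simp add: fadd_def fsign_def ksign_def fzero_def)
  next
    fix c j assume "c \<in> fm j"
    then show "cd (j - 1) (cd j c) = fzero A dg (j - 2)" using cd_cd by simp
  qed (auto simp: fmod_module cd_fam cd_add)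
  have "dg_module_axioms R A F"
  proof (intro dg_module_axioms.intro; unfold cell_mod_simps fmod_simps)
    fix a a' l c j assume "a \<in> carrier (gr A l)" "a' \<in> carrier (gr A l)" "c \<in> fm j"
    then show "famact A dg l j (a \<oplus>\<^bsub>gr A l\<^esub> a') c = fadd A dg (l + j) (famact A dg l j a c) (famact A dg l j a' c)"
      unfolding famact_def fadd_def by (intro ext mul_add_left') (auto dest: famD)
  next
    fix r a l c j assume "r \<in> carrier R" "a \<in> carrier (gr A l)" "c \<in> fm j"
    then show "famact A dg l j (r \<odot>\<^bsub>gr A l\<^esub> a) c = fsmult A dg (l + j) r (famact A dg l j a c)"
      "famact A dg l j a (fsmult A dg j r c) = fsmult A dg (l + j) r (famact A dg l j a c)"
      using mul_smult_left[of r a l "c _" "j - dg _"] mul_smult_right[of r a l "c _" "j - dg _"]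
      by (auto simp: famact_def fsmult_def famD add_diff_eq)
  next
    fix a l b k c j assume "a \<in> carrier (gr A l)" "b \<in> carrier (gr A k)" "c \<in> fm j"
    then show "famact A dg (l + k) j (mul A l k a b) c = famact A dg l (k + j) a (famact A dg k j b c)"
      unfolding famact_def by (intro ext mul_assoc') (auto dest: famD)
  next
    fix a l c j assume "a \<in> carrier (gr A l)" "c \<in> fm j"
    then show "cd (l + j) (famact A dg l j a c) = fadd A dg (l + j - 1) (famact A dg (l - 1) j (dd A l a) c)
           (ksign (fmod A dg I (l + j - 1)) l (famact A dg l (j - 1) a (cd j c)))"
      using cd_famact[of a l c j "l + j"] fmod_ksign[OF famact_fam[OF _ cd_fam, of a l c j "l + j - 1"], of l]
      by (simp add: add_diff_eq)
  next
    fix a l c j assume "a \<in> carrier (gr A l)" "c \<in> fm j"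
    then show "famact A dg l j a c \<in> fm (l + j)" by (intro famact_fam) auto
  next
    fix a l c c' j assume "a \<in> carrier (gr A l)" "c \<in> fm j" "c' \<in> fm j"
    then show "famact A dg l j a (fadd A dg j c c') = fadd A dg (l + j) (famact A dg l j a c) (famact A dg l j a c')"
      by (intro famact_add) auto
  next
    fix c j assume "c \<in> fm j"
    then show "famact A dg 0 j (unt A) c = c"
      unfolding famact_def by (intro ext mul_unt_left) (rule famD)
  qed
  then show ?thesis using C by (intro dg_module.intro dg_algebra_axioms)
qed

end

context cells
begin

sublocale F: dg_module R A F by (rule cell_mod_dg_module)

definition gen :: "'i \<Rightarrow> ('i \<Rightarrow> 'a)" where
  "gen q = mon A dg (dg q) q (unt A)"

definition gens where "gens = (\<lambda>q. (dg q, gen q)) ` I"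

lemma gen_fam: "q \<in> I \<Longrightarrow> gen q \<in> fm (dg q)"
  unfolding gen_def by (rule mon_fam) (simp_all add: unt_closed)

lemma act_gen: "a \<in> carrier (gr A l) \<Longrightarrow> m = l + dg q \<Longrightarrow> famact A dg l (dg q) a (gen q) = mon A dg m q a"
  unfolding gen_def by (subst famact_mon) (auto simp: unt_closed mul_unt_right)

lemma d_gen: "q \<in> I \<Longrightarrow> cd (dg q) (gen q) = del q"
proof -
  assume q: "q \<in> I"
  have u: "unt A \<in> carrier (gr A (dg q - dg q))" by (simp add: unt_closed)
  have z: "mon A dg (dg q - 1) q (dd A 0 (unt A)) = fzero A dg (dg q - 1)"
    using mon_zero[of dg "dg q - 1" q] by (simp add: d_unt)
  have f: "famact A dg 0 (dg q - 1) (unt A) (del q) = del q"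
    unfolding famact_def by (intro ext mul_unt_left famD[OF del_fam[OF q]])
  show ?thesis unfolding gen_def cd_mon[OF q u] dmon_def
    using famD[OF del_fam[OF q]] by (simp add: z f) (simp add: fadd_def fzero_def fsign_def ksign_def)
qed

lemma mon_sum: "c \<in> fm j \<Longrightarrow> sumext (fmod A dg I j) A dg j (mon A dg j) c = c"
proof (induction rule: fam_induct)
  case zero
  interpret M: abelian_group "fmod A dg I j" by (rule fmod_abelian_group)
  have "supp A dg j (fzero A dg j) = {}" by (simp add: supp_def fzero_def)
  then show ?case using M.finsum_empty by (simp add: sumext_def)
next
  case (mon q a)
  show ?case
    by (rule sumext_mon[where I = I, OF fmod_abelian_group]) (use mon in \<open>auto simp: mon_fam mon_add\<close>)
next
  case (add c c')
  have "sumext (fmod A dg I j) A dg j (mon A dg j) (fadd A dg j c c') =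
    sumext (fmod A dg I j) A dg j (mon A dg j) c \<oplus>\<^bsub>fmod A dg I j\<^esub> sumext (fmod A dg I j) A dg j (mon A dg j) c'"
    by (rule sumext_add[where I = I, OF fmod_abelian_group]) (use add in \<open>auto simp: mon_fam mon_add\<close>)
  then show ?case using add by simp
qed

lemma degree_supp:
  assumes "c \<in> fam A dg J j" "q \<in> supp A dg j c" shows "dg q \<le> j"
  using neg_degree[of "j - dg q" "c q"] famD[OF assms(1), of q] assms(2) by (force simp: supp_def)

context
  fixes s0 :: int
  assumes nontrivial: "unt A \<noteq> \<zero>\<^bsub>gr A 0\<^esub>" and s0: "\<And>q. q \<in> I \<Longrightarrow> s0 \<le> dg q"
begin

lemma gen_inj: "inj_on (\<lambda>q. (dg q, gen q)) I"
proof (rule inj_onI)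
  fix q r assume "q \<in> I" "r \<in> I" "(dg q, gen q) = (dg r, gen r)"
  then have "dg q = dg r" "gen q q = gen r q" by auto
  then show "q = r" using nontrivial by (auto simp: gen_def mon_def split: if_splits)
qed

lemma lin_comb_gens:
  assumes c: "c \<in> coeff_families A j gens"
  shows "(\<lambda>q. if q \<in> I then c (dg q, gen q) else \<zero>\<^bsub>gr A (j - dg q)\<^esub>) \<in> fm j" (is "?c \<in> _")
    and "lin_comb A F j gens c = (\<lambda>q. if q \<in> I then c (dg q, gen q) else \<zero>\<^bsub>gr A (j - dg q)\<^esub>)"
    and "coeff_support A j gens c = (\<lambda>q. (dg q, gen q)) ` supp A dg j (\<lambda>q. if q \<in> I then c (dg q, gen q) else \<zero>\<^bsub>gr A (j - dg q)\<^esub>)"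
proof -
  interpret M: abelian_group "fmod A dg I j" by (rule fmod_abelian_group)
  show s: "coeff_support A j gens c = (\<lambda>q. (dg q, gen q)) ` supp A dg j ?c"
    by (auto simp: coeff_support_def supp_def gens_def)
  have sI: "supp A dg j ?c \<subseteq> I" by (auto simp: supp_def)
  then have inj: "inj_on (\<lambda>q. (dg q, gen q)) (supp A dg j ?c)" using gen_inj inj_on_subset by blast
  have cl: "c (dg q, gen q) \<in> carrier (gr A (j - dg q))" if "q \<in> I" for q
    using PiE_mem[of c gens "\<lambda>p. carrier (gr A (j - fst p))" "(dg q, gen q)"] c that
    by (simp add: coeff_families_def gens_def)
  have "finite (supp A dg j ?c)"
    using c finite_imageD[OF _ inj] by (simp add: coeff_families_def s)
  then show c': "?c \<in> fm j" using cl sI by (auto simp: fam_def)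
  have sm: "act F (j - dg q) (dg q) (c (dg q, gen q)) (gen q) = mon A dg j q (?c q)" if "q \<in> supp A dg j ?c" for q
    using act_gen[OF cl, of q j] that sI by auto
  have mm: "mon A dg j q (?c q) \<in> fm j" if "q \<in> supp A dg j ?c" for q
    by (rule mon_fam) (use that sI famD[OF c', of q] in \<open>auto split del: if_split\<close>)
  have "lin_comb A F j gens c = (\<Oplus>\<^bsub>fmod A dg I j\<^esub>q\<in>supp A dg j ?c. act F (j - dg q) (dg q) (c (dg q, gen q)) (gen q))"
    unfolding lin_comb_def s using inj
    by (subst cell_mod_simps(1), subst M.finsum_reindex) (auto simp: sm[simplified] mm split del: if_split)
  also have "\<dots> = sumext (fmod A dg I j) A dg j (mon A dg j) ?c"
    unfolding sumext_def
    by (intro M.finsum_cong') (auto simp: sm[simplified] mm split del: if_split)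
  also have "\<dots> = ?c" by (rule mon_sum[OF c'])
  finally show "lin_comb A F j gens c = ?c" .
qed

lemma lin_comb_ex:
  assumes x: "x \<in> fm j"
  obtains c where "c \<in> coeff_families A j gens" "x = lin_comb A F j gens c"
    "coeff_support A j gens c = (\<lambda>q. (dg q, gen q)) ` supp A dg j x"
proof -
  let ?i = "inv_into I (\<lambda>q. (dg q, gen q))"
  have i: "?i (dg q, gen q) = q" if "q \<in> I" for q
    using inv_into_f_f[OF gen_inj that] .
  define c where "c = restrict (\<lambda>p. x (?i p)) gens"
  have cv: "c (dg q, gen q) = x q" if "q \<in> I" for q
    using that i by (simp add: c_def gens_def)
  have xc: "(\<lambda>q. if q \<in> I then c (dg q, gen q) else \<zero>\<^bsub>gr A (j - dg q)\<^esub>) = x"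
    using cv fam_zero_outside[OF x] by auto
  have "coeff_support A j gens c \<subseteq> (\<lambda>q. (dg q, gen q)) ` supp A dg j x"
    using cv by (auto simp: coeff_support_def gens_def supp_def)
  then have "finite (coeff_support A j gens c)" using fam_fin[OF x] finite_surj by blast
  moreover have "c p \<in> carrier (gr A (j - fst p))" if "p \<in> gens" for p
    using that cv famD[OF x] by (auto simp: gens_def)
  ultimately have "c \<in> coeff_families A j gens"
    by (auto simp: coeff_families_def c_def)
  then show ?thesis using that lin_comb_gens[of c j] xc by simp
qed

text \<open>
  The degree, counted from the lower bound \<open>s0\<close>, is a level function: \<open>A\<close> has no negative part, so the cells in \<open>del q\<close>
  have smaller degree than \<open>q\<close>.
\<close>

lemma cell_semibasis: "semibasis A F gens"
  unfolding semibasis_def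
proof (intro conjI)
  show "\<forall>(i, e)\<in>gens. e \<in> carrier (gr F i)" by (auto simp: gens_def gen_fam)
  show "\<forall>j. \<forall>x\<in>carrier (gr F j). \<exists>!c. c \<in> coeff_families A j gens \<and> x = lin_comb A F j gens c"
  proof (intro allI ballI)
    fix j x assume "x \<in> carrier (gr F j)"
    then have x: "x \<in> fm j" by simp
    obtain c where c: "c \<in> coeff_families A j gens" "x = lin_comb A F j gens c" by (rule lin_comb_ex[OF x])
    show "\<exists>!c. c \<in> coeff_families A j gens \<and> x = lin_comb A F j gens c"
    proof (rule ex1I[of _ c])
      fix d assume d: "d \<in> coeff_families A j gens \<and> x = lin_comb A F j gens d"
      have "c (dg q, gen q) = d (dg q, gen q)" if "q \<in> I" for q
        using c(2) d lin_comb_gens(2)[OF c(1)] lin_comb_gens(2)[of d j] that by (metis (mono_tags, lifting))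
      then have "c p = d p" if "p \<in> gens" for p using that by (auto simp: gens_def)
      then show "d = c" using c(1) d by (auto simp: coeff_families_def intro!: PiE_ext[of _ gens])
    qed (use c in simp)
  qed
  show "\<exists>l :: int \<times> ('i \<Rightarrow> 'a) \<Rightarrow> nat. \<forall>(i, e)\<in>gens. \<exists>c\<in>coeff_families A (i - 1) gens.
        dd F i e = lin_comb A F (i - 1) gens c \<and> (\<forall>p\<in>coeff_support A (i - 1) gens c. l p < l (i, e))"
  proof (intro exI[of _ "\<lambda>p. nat (fst p - s0)"] ballI)
    fix p assume "p \<in> gens"
    then obtain q where q: "q \<in> I" "p = (dg q, gen q)" by (auto simp: gens_def)
    obtain c where c: "c \<in> coeff_families A (dg q - 1) gens" "del q = lin_comb A F (dg q - 1) gens c"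
      "coeff_support A (dg q - 1) gens c = (\<lambda>q. (dg q, gen q)) ` supp A dg (dg q - 1) (del q)"
      by (rule lin_comb_ex[OF del_fam[OF q(1)]])
    have "nat (dg r - s0) < nat (dg q - s0)" if "r \<in> supp A dg (dg q - 1) (del q)" for r
      using degree_supp[OF del_fam[OF q(1)] that] s0[of r] that fam_supp[OF del_fam[OF q(1)]] by auto
    then show "case p of (i, e) \<Rightarrow> \<exists>c\<in>coeff_families A (i - 1) gens.
        dd F i e = lin_comb A F (i - 1) gens c \<and> (\<forall>p'\<in>coeff_support A (i - 1) gens c. nat (fst p' - s0) < nat (fst (i, e) - s0))"
      using q c d_gen[OF q(1)] by (auto intro!: bexI[of _ c])
  qed
qed

lemma cell_semifree_module: "semifree_module R A F gens"
  by (intro semifree_module.intro F.dg_module_axioms semifree_module_axioms.intro cell_semibasis)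

end

end

definition cellf :: "('r, 'a, 'm) dg_alg_scheme \<Rightarrow> ('i \<Rightarrow> int) \<Rightarrow> ('r, 'a, 'x, 'n) dg_mod_scheme \<Rightarrow> ('i \<Rightarrow> 'x) \<Rightarrow>
    int \<Rightarrow> ('i \<Rightarrow> 'a) \<Rightarrow> 'x" where
  "cellf A dg X fq j c = sumext (gr X j) A dg j (\<lambda>q a. act X (j - dg q) (dg q) a (fq q)) c"

locale cells_map = cells R A dg del I + X: dg_module R A X
  for R :: "('r, 's) ring_scheme" (structure) and A :: "('r, 'a, 'm) dg_alg_scheme"
    and dg :: "'i \<Rightarrow> int" and del and I and X :: "('r, 'a, 'x, 'n) dg_mod_scheme" +
  fixes fq :: "'i \<Rightarrow> 'x"
  assumes fq_cl: "q \<in> I \<Longrightarrow> fq q \<in> carrier (gr X (dg q))"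
    and fq_d: "q \<in> I \<Longrightarrow> cellf A dg X fq (dg q - 1) (del q) = dd X (dg q) (fq q)"
begin

abbreviation "f \<equiv> cellf A dg X fq"

lemma fq_act_cl: "q \<in> I \<Longrightarrow> a \<in> carrier (gr A (j - dg q)) \<Longrightarrow> act X (j - dg q) (dg q) a (fq q) \<in> carrier (gr X j)"
  by (rule X.act_cl[OF _ fq_cl]) auto

lemma fq_act_add: "q \<in> I \<Longrightarrow> a \<in> carrier (gr A (j - dg q)) \<Longrightarrow> b \<in> carrier (gr A (j - dg q)) \<Longrightarrow>
  act X (j - dg q) (dg q) (a \<oplus>\<^bsub>gr A (j - dg q)\<^esub> b) (fq q) =
  act X (j - dg q) (dg q) a (fq q) \<oplus>\<^bsub>gr X j\<^esub> act X (j - dg q) (dg q) b (fq q)"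
  by (rule X.act_add_left'[OF _ _ fq_cl]) auto

lemma f_closed: "c \<in> fm j \<Longrightarrow> f j c \<in> carrier (gr X j)"
  unfolding cellf_def
  by (rule sumext_closed[where I = I, OF X.cplx.grp.abelian_group_axioms]) (assumption | rule fq_act_cl fq_act_add)+

lemma f_fadd: "c \<in> fm j \<Longrightarrow> c' \<in> fm j \<Longrightarrow> f j (fadd A dg j c c') = f j c \<oplus>\<^bsub>gr X j\<^esub> f j c'"
  unfolding cellf_def
  by (rule sumext_add[where I = I, OF X.cplx.grp.abelian_group_axioms]) (assumption | rule fq_act_cl fq_act_add)+

lemma f_mon: "q \<in> I \<Longrightarrow> a \<in> carrier (gr A (j - dg q)) \<Longrightarrow> f j (mon A dg j q a) = act X (j - dg q) (dg q) a (fq q)"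
  unfolding cellf_def
  by (rule sumext_mon[where I = I, OF X.cplx.grp.abelian_group_axioms]) (assumption | rule fq_act_cl fq_act_add)+

lemma f_fzero: "f j (fzero A dg j) = \<zero>\<^bsub>gr X j\<^esub>"
  by (simp add: cellf_def sumext_def supp_def fzero_def)

lemma f_famact:
  assumes a: "a \<in> carrier (gr A l)" and c: "c \<in> fm j" and m: "m = l + j"
  shows "f m (famact A dg l j a c) = act X l j a (f j c)"
  using c
proof (induction rule: fam_induct)
  case zero
  show ?case using famact_zero[OF a m, of dg] a m by (simp add: f_fzero)
next
  case (mon q b)
  have "mul A l (j - dg q) a b \<in> carrier (gr A (m - dg q))" using a mon m by (intro mul_cl) auto
  then show ?case unfolding famact_mon[where dg = dg and j = j and q = q, OF a mon(2) m] using mon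
    by (simp add: f_mon) (rule X.act_assoc', use a mon m fq_cl in auto)
next
  case (add c c')
  then show ?case unfolding famact_add[OF a add(1,2) m]
    using X.act_add_right'[OF a f_closed[OF add(1)] f_closed[OF add(2)] m]
      f_fadd[OF famact_fam[OF a add(1) m] famact_fam[OF a add(2) m]] add
    by (simp add: f_fadd)
qed

lemma f_fsign:
  assumes "c \<in> fm j" shows "f j (fsign A dg j k c) = ksign (gr X j) k (f j c)"
proof -
  interpret M: abelian_group "fmod A dg I j" by (rule fmod_abelian_group)
  have "f j (\<ominus>\<^bsub>fmod A dg I j\<^esub> c) = \<ominus>\<^bsub>gr X j\<^esub> f j c"
    by (rule additive_map_neg[OF M.abelian_group_axioms X.cplx.grp.abelian_group_axioms]) (use assms in \<open>auto simp: f_closed f_fadd\<close>)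
  then show ?thesis using fmod_ksign[OF assms, of k] by (auto simp: ksign_def)
qed

lemma f_d: "c \<in> fm j \<Longrightarrow> f (j - 1) (cd j c) = dd X j (f j c)"
proof (induction rule: fam_induct)
  case zero show ?case by (simp add: cd_zero f_fzero)
next
  case (add c c')
  then show ?case by (simp add: cd_add f_fadd cd_fam X.cplx.d_add f_closed)
next
  case (mon q a)
  have da: "dd A (j - dg q) a \<in> carrier (gr A (j - 1 - dg q))" using mon by (intro d_cl) auto
  have e: "j - 1 - dg q = j - dg q - 1" by simp
  have g: "famact A dg (j - dg q) (dg q - 1) a (del q) \<in> fm (j - 1)"
    using mon del_fam[OF mon(1)] by (intro famact_fam) auto
  have "f (j - 1) (cd j (mon A dg j q a)) = f (j - 1) (mon A dg (j - 1) q (dd A (j - dg q) a)) \<oplus>\<^bsub>gr X (j - 1)\<^esub>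
     ksign (gr X (j - 1)) (j - dg q) (f (j - 1) (famact A dg (j - dg q) (dg q - 1) a (del q)))"
    unfolding cd_mon[OF mon] dmon_def
    by (subst f_fadd) (use mon_fam[where j = "j - 1" and dg = dg, OF mon(1) da] fsign_fam[OF g] f_fsign[OF g] in auto)
  also have "f (j - 1) (mon A dg (j - 1) q (dd A (j - dg q) a)) = act X (j - dg q - 1) (dg q) (dd A (j - dg q) a) (fq q)"
    unfolding f_mon[OF mon(1) da] by (simp add: e)
  also have "f (j - 1) (famact A dg (j - dg q) (dg q - 1) a (del q)) = act X (j - dg q) (dg q - 1) a (dd X (dg q) (fq q))"
    using f_famact[OF mon(2) del_fam[OF mon(1)], of "j - 1"] fq_d[OF mon(1)] by simp
  also have "act X (j - dg q - 1) (dg q) (dd A (j - dg q) a) (fq q) \<oplus>\<^bsub>gr X (j - 1)\<^esub>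
     ksign (gr X (j - 1)) (j - dg q) (act X (j - dg q) (dg q - 1) a (dd X (dg q) (fq q))) =
     dd X j (act X (j - dg q) (dg q) a (fq q))"
    by (rule X.act_leibniz'[OF mon(2) fq_cl[OF mon(1)], symmetric]) auto
  finally show ?case using mon by (simp add: f_mon)
qed

lemma f_hom: "f \<in> dg_hom A F X"
  unfolding dg_hom_def using f_closed f_fadd f_d f_famact by auto

sublocale f: dg_morphism R A F X f
  by unfold_locales (rule f_hom)

end

section \<open>Codes for cells\<close>

text \<open>
  A cell will be coded by its degree, by an element of \<open>X\<close> and by a family of coefficients, written as a list.
  An infinite type is equipotent to its square, so these data embed into the index type of the resolutions over which the
  projective dimension is defined.
\<close>

lemma ex_coding:
  "\<exists>\<iota> :: nat \<times> 'x \<times> ((nat \<times> 'a \<times> 'x) \<times> 'a) list \<Rightarrow> nat \<times> 'a \<times> 'x. inj \<iota>"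
proof -
  have "infinite (UNIV :: (nat \<times> 'a \<times> 'x) set)"
    by (simp add: finite_prod)
  then have "|UNIV \<times> UNIV :: ((nat \<times> 'a \<times> 'x) \<times> (nat \<times> 'a \<times> 'x)) set| \<le>o |UNIV :: (nat \<times> 'a \<times> 'x) set|"
    using card_of_Times_same_infinite ordIso_imp_ordLeq by blast
  then obtain \<pi> :: "(nat \<times> 'a \<times> 'x) \<times> (nat \<times> 'a \<times> 'x) \<Rightarrow> nat \<times> 'a \<times> 'x" where \<pi>: "inj \<pi>"
    unfolding card_of_ordLeq[symmetric] by (auto simp: UNIV_Times_UNIV)
  define g where "g l = foldr (\<lambda>(p, a) r. \<pi> (\<pi> (p, (0, a, undefined)), r)) l undefined" for l :: "((nat \<times> 'a \<times> 'x) \<times> 'a) list"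
  have g: "l = l'" if "length l = length l'" "g l = g l'" for l l'
    using that
  proof (induction l l' rule: list_induct2)
    case (Cons x xs y ys)
    obtain p a q b where "x = (p, a)" "y = (q, b)" by (cases x, cases y)
    then show ?case using Cons \<pi> by (auto simp: g_def dest!: injD[OF \<pi>])
  qed simp
  define \<iota> where "\<iota> = (\<lambda>(n :: nat, x, l). \<pi> ((n, undefined, x), \<pi> ((length l, undefined, undefined), g l)))"
  have "inj \<iota>"
    by (rule injI) (auto simp: \<iota>_def split: prod.splits dest!: injD[OF \<pi>] intro: g)
  then show ?thesis by blast
qed

section \<open>Linear algebra over the degree zero part\<close>

text \<open>
  A DG algebra whose degree zero part is a field. Modules over it have minimal resolutions that are built as in linear
  algebra.
\<close>

locale field_dga = dg_algebra R A for R :: "('r, 's) ring_scheme" (structure) and A :: "('r, 'a, 'm) dg_alg_scheme" +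
  assumes nontrivial: "unt A \<noteq> \<zero>\<^bsub>gr A 0\<^esub>"
    and invertible: "a \<in> carrier (gr A 0) \<Longrightarrow> a \<noteq> \<zero>\<^bsub>gr A 0\<^esub> \<Longrightarrow> \<exists>b\<in>carrier (gr A 0). mul A 0 0 b a = unt A"

lemma (in dg_algebra) d_degree_zero: "a \<in> carrier (gr A 0) \<Longrightarrow> dd A 0 a = \<zero>\<^bsub>gr A (- 1)\<^esub>"
  using neg_degree[of "-1" "dd A 0 a"] d_closed[of a 0] by simp

inductive_set lspan :: "('r, 'a, 'm) dg_alg_scheme \<Rightarrow> ('r, 'a, 'x, 'n) dg_mod_scheme \<Rightarrow> int \<Rightarrow> 'x set \<Rightarrow> 'x set"
  for A X k T where
  zero: "\<zero>\<^bsub>gr X k\<^esub> \<in> lspan A X k T"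
| gen: "t \<in> T \<Longrightarrow> t \<in> lspan A X k T"
| add: "x \<in> lspan A X k T \<Longrightarrow> y \<in> lspan A X k T \<Longrightarrow> x \<oplus>\<^bsub>gr X k\<^esub> y \<in> lspan A X k T"
| smul: "x \<in> lspan A X k T \<Longrightarrow> a \<in> carrier (gr A 0) \<Longrightarrow> act X 0 k a x \<in> lspan A X k T"

context dg_module
begin

lemma boundaries_act0:
  assumes a: "a \<in> carrier (gr A 0)" and b: "b \<in> boundaries X k"
  shows "act X 0 k a b \<in> boundaries X k"
proof -
  obtain y where y: "y \<in> carrier (gr X (k + 1))" "b = dd X (k + 1) y" using b by (auto simp: boundaries_def)
  have by': "act X 0 k a (dd X (k + 1) y) \<in> carrier (gr X k)"
    using a y by (auto intro!: act_cl cplx.d_cl)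
  have "dd X (k + 1) (act X 0 (k + 1) a y) = act X (0 - 1) (k + 1) (dd A 0 a) y \<oplus>\<^bsub>gr X k\<^esub> ksign (gr X k) 0 (act X 0 (k + 1 - 1) a (dd X (k + 1) y))"
    by (rule act_leibniz'[OF a y(1)]) auto
  also have "act X (0 - 1) (k + 1) (dd A 0 a) y = \<zero>\<^bsub>gr X k\<^esub>"
    using act_zero_left[OF y(1), of "-1"] d_degree_zero[OF a] by simp
  finally have "act X 0 k a b = dd X (k + 1) (act X 0 (k + 1) a y)" using by' y by (simp add: ksign_def)
  then show ?thesis using a y act_cl[OF a y(1), of "k + 1"] by (auto simp: boundaries_def)
qed

lemma lspan_carrier: "x \<in> lspan A X k T \<Longrightarrow> T \<subseteq> carrier (gr X k) \<Longrightarrow> x \<in> carrier (gr X k)"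
  by (induction rule: lspan.induct) (auto intro: act_cl)

lemma lspan_mono: "x \<in> lspan A X k T \<Longrightarrow> T \<subseteq> T' \<Longrightarrow> x \<in> lspan A X k T'"
  by (induction rule: lspan.induct) (auto intro: lspan.intros)

lemma lspan_neg:
  assumes "x \<in> lspan A X k T" "T \<subseteq> carrier (gr X k)"
  shows "\<ominus>\<^bsub>gr X k\<^esub> x \<in> lspan A X k T"
proof -
  have "act X 0 k (\<ominus>\<^bsub>gr A 0\<^esub> unt A) x = \<ominus>\<^bsub>gr X k\<^esub> x"
    using act_neg_left[OF unt_closed lspan_carrier[OF assms]] act_unt[OF lspan_carrier[OF assms]] by simp
  then show ?thesis using lspan.smul[OF assms(1), of "\<ominus>\<^bsub>gr A 0\<^esub> unt A"] unt_closed by simp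
qed

lemma lspan_insert:
  assumes "y \<in> lspan A X k (insert x T)" "insert x T \<subseteq> carrier (gr X k)"
  shows "\<exists>a\<in>carrier (gr A 0). \<exists>z\<in>lspan A X k T. y = z \<oplus>\<^bsub>gr X k\<^esub> act X 0 k a x"
  using assms(1)
proof (induction rule: lspan.induct)
  case zero
  show ?case using assms(2) act_zero_left[of x k 0]
    by (auto intro!: bexI[of _ "\<zero>\<^bsub>gr A 0\<^esub>"] bexI[of _ "\<zero>\<^bsub>gr X k\<^esub>"] lspan.zero)
next
  case (gen t)
  show ?case
  proof (cases "t = x")
    case True
    then show ?thesis using assms(2) act_unt[of x k] unt_closed
      by (auto intro!: bexI[of _ "unt A"] bexI[of _ "\<zero>\<^bsub>gr X k\<^esub>"] lspan.zero)
  next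
    case False
    then show ?thesis using assms(2) act_zero_left[of x k 0] gen
      by (auto intro!: bexI[of _ "\<zero>\<^bsub>gr A 0\<^esub>"] bexI[of _ t] lspan.gen)
  qed
next
  case (add u v)
  then obtain a z b w where *: "a \<in> carrier (gr A 0)" "z \<in> lspan A X k T" "u = z \<oplus>\<^bsub>gr X k\<^esub> act X 0 k a x"
    "b \<in> carrier (gr A 0)" "w \<in> lspan A X k T" "v = w \<oplus>\<^bsub>gr X k\<^esub> act X 0 k b x" by blast
  have c: "z \<in> carrier (gr X k)" "w \<in> carrier (gr X k)" "x \<in> carrier (gr X k)" using * assms(2) lspan_carrier by blast+
  have ac: "act X 0 k a x \<in> carrier (gr X k)" "act X 0 k b x \<in> carrier (gr X k)" using * c by (auto intro: act_cl)
  have "act X 0 k (a \<oplus>\<^bsub>gr A 0\<^esub> b) x = act X 0 k a x \<oplus>\<^bsub>gr X k\<^esub> act X 0 k b x"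
    by (rule act_add_left') (use * c in auto)
  then have "u \<oplus>\<^bsub>gr X k\<^esub> v = (z \<oplus>\<^bsub>gr X k\<^esub> w) \<oplus>\<^bsub>gr X k\<^esub> act X 0 k (a \<oplus>\<^bsub>gr A 0\<^esub> b) x"
    using * c ac by (simp add: cplx.grp.a_ac)
  then show ?case using * by (meson algebra.grp.a_closed lspan.add)
next
  case (smul u b)
  then obtain a z where *: "a \<in> carrier (gr A 0)" "z \<in> lspan A X k T" "u = z \<oplus>\<^bsub>gr X k\<^esub> act X 0 k a x" by blast
  have c: "z \<in> carrier (gr X k)" "x \<in> carrier (gr X k)" using * assms(2) lspan_carrier by blast+
  have "act X 0 k b u = act X 0 k b z \<oplus>\<^bsub>gr X k\<^esub> act X 0 k b (act X 0 k a x)"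
    unfolding * by (rule act_add_right') (use * c smul in \<open>auto intro: act_cl\<close>)
  also have "act X 0 k b (act X 0 k a x) = act X 0 k (mul A 0 0 b a) x"
    by (rule act_assoc'[symmetric]) (use * c smul in auto)
  finally have e: "act X 0 k b u = act X 0 k b z \<oplus>\<^bsub>gr X k\<^esub> act X 0 k (mul A 0 0 b a) x" .
  have "mul A 0 0 b a \<in> carrier (gr A 0)" using * smul by (auto intro: mul_cl)
  moreover have "act X 0 k b z \<in> lspan A X k T" by (rule lspan.smul[OF *(2) smul(2)])
  ultimately show ?case using e by blast
qed

text \<open>
  A maximal subset of \<open>Z\<close> that is linearly independent modulo \<open>N\<close> exists by Zorn's lemma, and spans \<open>Z\<close> modulo \<open>N\<close>
  because coefficients in degree zero can be inverted.
\<close>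

lemma relative_basis:
  assumes K: "field_dga R A" and Z: "Z \<subseteq> carrier (gr X k)" and N: "N \<subseteq> carrier (gr X k)"
  shows "\<exists>S. S \<subseteq> Z \<and> (\<forall>s\<in>S. s \<notin> lspan A X k (N \<union> (S - {s}))) \<and> Z \<subseteq> lspan A X k (N \<union> S)"
proof -
  interpret K: field_dga R A by fact
  let ?ind = "\<lambda>S. S \<subseteq> Z \<and> (\<forall>s\<in>S. s \<notin> lspan A X k (N \<union> (S - {s})))"
  have "\<exists>M\<in>{S. ?ind S}. \<forall>S\<in>{S. ?ind S}. M \<subseteq> S \<longrightarrow> S = M"
  proof (rule subset_Zorn_nonempty)
    show "{S. ?ind S} \<noteq> {}" by blast
  next
    fix C assume C: "C \<noteq> {}" "subset.chain {S. ?ind S} C"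
    have fin: "\<exists>S\<in>C. x \<in> lspan A X k (N \<union> (S - {s}))" if "x \<in> lspan A X k (N \<union> (\<Union>C - {s}))" for x s
      using that
    proof (induction rule: lspan.induct)
      case zero
      obtain S where "S \<in> C" using C(1) by blast
      then show ?case by (intro bexI[of _ S] lspan.zero)
    next
      case (gen t)
      then obtain S where "S \<in> C" "t \<in> N \<union> (S - {s})" using C(1) by blast
      then show ?case by (intro bexI[of _ S] lspan.gen)
    next
      case (add x y)
      then obtain S S' where S: "S \<in> C" "x \<in> lspan A X k (N \<union> (S - {s}))" "S' \<in> C" "y \<in> lspan A X k (N \<union> (S' - {s}))" by blast
      then have "S \<subseteq> S' \<or> S' \<subseteq> S" using C(2) by (simp add: subset_chain_def)
      then show ?case
      proof
        assume "S \<subseteq> S'"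
        then have "x \<in> lspan A X k (N \<union> (S' - {s}))" by (intro lspan_mono[OF S(2)]) blast
        then show ?thesis using S by (intro bexI[of _ S'] lspan.add)
      next
        assume "S' \<subseteq> S"
        then have "y \<in> lspan A X k (N \<union> (S - {s}))" by (intro lspan_mono[OF S(4)]) blast
        then show ?thesis using S by (intro bexI[of _ S] lspan.add)
      qed
    next
      case (smul x a)
      then obtain S where "S \<in> C" "x \<in> lspan A X k (N \<union> (S - {s}))" by blast
      then show ?case using smul(2) by (intro bexI[of _ S] lspan.smul)
    qed
    have "s \<notin> lspan A X k (N \<union> (\<Union>C - {s}))" if s: "s \<in> \<Union>C" for s
    proof
      assume "s \<in> lspan A X k (N \<union> (\<Union>C - {s}))"
      then obtain S where S: "S \<in> C" "s \<in> lspan A X k (N \<union> (S - {s}))" using fin by blast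
      obtain S' where S': "S' \<in> C" "s \<in> S'" using s by blast
      have "S \<subseteq> S' \<or> S' \<subseteq> S" using C(2) S S' by (simp add: subset_chain_def)
      then obtain S'' where "S'' \<in> C" "S \<subseteq> S''" "s \<in> S''" using S S' by blast
      moreover then have "s \<in> lspan A X k (N \<union> (S'' - {s}))" by (intro lspan_mono[OF S(2)]) blast
      ultimately show False using C(2) by (auto simp: subset_chain_def)
    qed
    then show "\<Union>C \<in> {S. ?ind S}" using C(2) by (auto simp: subset_chain_def)
  qed
  then obtain S where S: "S \<subseteq> Z" "\<And>s. s \<in> S \<Longrightarrow> s \<notin> lspan A X k (N \<union> (S - {s}))"
    and max: "\<And>S'. ?ind S' \<Longrightarrow> S \<subseteq> S' \<Longrightarrow> S' = S" by auto
  have "x \<in> lspan A X k (N \<union> S)" if x: "x \<in> Z" for x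
  proof (rule ccontr)
    assume nx: "x \<notin> lspan A X k (N \<union> S)"
    then have xS: "x \<notin> S" using lspan.gen[of x "N \<union> S" A X k] by blast
    have "s \<notin> lspan A X k (N \<union> (insert x S - {s}))" if s: "s \<in> insert x S" for s
    proof
      assume sp: "s \<in> lspan A X k (N \<union> (insert x S - {s}))"
      show False
      proof (cases "s = x")
        case True
        then show ?thesis using sp nx xS by simp
      next
        case False
        then have sS: "s \<in> S" using s by simp
        have e: "N \<union> (insert x S - {s}) = insert x (N \<union> (S - {s}))" using False by blast
        have sub: "insert x (N \<union> (S - {s})) \<subseteq> carrier (gr X k)" using Z N S x by auto
        obtain a z where az: "a \<in> carrier (gr A 0)" "z \<in> lspan A X k (N \<union> (S - {s}))" "s = z \<oplus>\<^bsub>gr X k\<^esub> act X 0 k a x"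
          using lspan_insert[OF sp[unfolded e] sub] by blast
        have c: "z \<in> carrier (gr X k)" "x \<in> carrier (gr X k)" "s \<in> carrier (gr X k)"
          using lspan_carrier[OF az(2)] sub S(1) Z sS x by auto
        show False
        proof (cases "a = \<zero>\<^bsub>gr A 0\<^esub>")
          case True
          then have "s = z" using az c act_zero_left[of x k 0] by simp
          then show ?thesis using S(2)[OF sS] az by simp
        next
          case False
          then obtain b where b: "b \<in> carrier (gr A 0)" "mul A 0 0 b a = unt A" using K.invertible az by blast
          have ax: "act X 0 k a x \<in> carrier (gr X k)" using az c by (auto intro: act_cl)
          have "act X 0 k a x = s \<oplus>\<^bsub>gr X k\<^esub> \<ominus>\<^bsub>gr X k\<^esub> z"
            using az(3) c ax by (simp add: cplx.grp.a_ac cplx.grp.r_neg1 cplx.grp.r_neg2)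
          moreover have "z \<in> lspan A X k (N \<union> S)" by (intro lspan_mono[OF az(2)]) blast
          moreover have "N \<union> S \<subseteq> carrier (gr X k)" using Z N S by blast
          ultimately have "act X 0 k a x \<in> lspan A X k (N \<union> S)"
            using lspan_neg[of z k "N \<union> S"] lspan.add[OF lspan.gen[of s "N \<union> S" A X k], of "\<ominus>\<^bsub>gr X k\<^esub> z"] sS by simp
          then have "act X 0 k b (act X 0 k a x) \<in> lspan A X k (N \<union> S)" using b(1) by (rule lspan.smul)
          moreover have "act X 0 k b (act X 0 k a x) = x"
            using act_assoc'[OF b(1) az(1) c(2), of 0 k] b act_unt[OF c(2)] by simp
          ultimately show ?thesis using nx by simp
        qed
      qed
    qed
    then have "?ind (insert x S)" using S x by auto
    then show False using max[of "insert x S"] xS by blast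
  qed
  then show ?thesis using S by blast
qed

end

section \<open>Minimal resolutions\<close>

lemma (in abelian_group) solve_for_neg:
  assumes "x = \<ominus> a \<oplus> d" "a \<in> carrier G" "d \<in> carrier G"
  shows "d \<oplus> \<ominus> x = a"
  by (rule character_eqI) (use assms in \<open>auto simp: character_simps\<close>)

lemma (in cells_map) cone_dd:
  assumes "z \<in> fm (k - 1)"
  shows "dd (cone_mod F X f) k (x, z) = (dd X k x \<oplus>\<^bsub>gr X (k - 1)\<^esub> f (k - 1) z, fsign A dg (k - 1 - 1) 1 (cd (k - 1) z))"
  using fmod_neg[OF cd_fam[OF assms]] by simp

text \<open>
  Stage \<open>m + 1\<close> of the construction attaches cells of degree \<open>s0 + m\<close>, one for each element of a basis of the cycles
  modulo boundaries of degree \<open>s0 + m\<close> in the cone of the map that has been constructed so far. This makes the cone exact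
  in that degree, without changing it below, and in the end everywhere. The code \<open>\<iota> (m, x, l)\<close> stands for the cell of
  degree \<open>s0 + m\<close> that kills the cycle \<open>(x, z)\<close>, where the list \<open>l\<close> describes the family \<open>z\<close>.
\<close>

locale resolution = field_dga R A + X: dg_module R A X
  for R :: "('r, 's) ring_scheme" (structure) and A :: "('r, 'a, 'm) dg_alg_scheme"
    and X :: "('r, 'a, 'x, 'n) dg_mod_scheme" +
  fixes \<iota> :: "nat \<times> 'x \<times> ((nat \<times> 'a \<times> 'x) \<times> 'a) list \<Rightarrow> nat \<times> 'a \<times> 'x" and s0 :: int
  assumes inj_\<iota>: "inj \<iota>" and exact_below: "i < s0 \<Longrightarrow> exact_at X i"
begin

definition dg :: "nat \<times> 'a \<times> 'x \<Rightarrow> int" where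
  "dg q = s0 + int (fst (inv_into UNIV \<iota> q))"

text \<open>
  The boundary of a cell \<open>(0, e)\<close> in the cone is \<open>(f e, - d e)\<close>. With \<open>f e = - x\<close> and \<open>d e = z\<close> this is the negative
  of the cycle \<open>(x, z)\<close> that is to be killed.
\<close>

definition fq :: "nat \<times> 'a \<times> 'x \<Rightarrow> 'x" where
  "fq q = \<ominus>\<^bsub>gr X (dg q)\<^esub> fst (snd (inv_into UNIV \<iota> q))"

definition dec :: "int \<Rightarrow> ((nat \<times> 'a \<times> 'x) \<times> 'a) list \<Rightarrow> (nat \<times> 'a \<times> 'x \<Rightarrow> 'a)" where
  "dec j l = (\<lambda>p. case map_of l p of Some a \<Rightarrow> a | None \<Rightarrow> \<zero>\<^bsub>gr A (j - dg p)\<^esub>)"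

definition del :: "nat \<times> 'a \<times> 'x \<Rightarrow> (nat \<times> 'a \<times> 'x \<Rightarrow> 'a)" where
  "del q = dec (dg q - 1) (snd (snd (inv_into UNIV \<iota> q)))"

definition enc :: "int \<Rightarrow> (nat \<times> 'a \<times> 'x \<Rightarrow> 'a) \<Rightarrow> ((nat \<times> 'a \<times> 'x) \<times> 'a) list" where
  "enc j z = (SOME l. dec j l = z)"

definition code :: "nat \<Rightarrow> 'x \<times> (nat \<times> 'a \<times> 'x \<Rightarrow> 'a) \<Rightarrow> nat \<times> 'a \<times> 'x" where
  "code m s = \<iota> (m, fst s, enc (s0 + int m - 1) (snd s))"

lemma dec_enc:
  assumes "z \<in> fam A dg J j" shows "dec j (enc j z) = z"
  unfolding enc_def
proof (rule someI_ex)
  obtain ps where ps: "set ps = supp A dg j z" using finite_list[OF fam_fin[OF assms]] by blast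
  have "dec j (map (\<lambda>p. (p, z p)) ps) p = z p" for p
  proof (cases "p \<in> set ps")
    case True
    then show ?thesis by (simp add: dec_def map_of_map_restrict restrict_map_def)
  next
    case False
    then show ?thesis using ps by (simp add: dec_def map_of_map_restrict restrict_map_def supp_def)
  qed
  then show "\<exists>l. dec j l = z" by blast
qed

lemma code_simps:
  "dg (code m s) = s0 + int m"
  "fq (code m s) = \<ominus>\<^bsub>gr X (s0 + int m)\<^esub> fst s"
  "snd s \<in> fam A dg J (s0 + int m - 1) \<Longrightarrow> del (code m s) = snd s"
  by (simp_all add: dg_def fq_def del_def code_def inv_f_f[OF inj_\<iota>] dec_enc)

abbreviation "FF J \<equiv> cell_mod A dg del J"
abbreviation "ff \<equiv> cellf A dg X fq"
abbreviation "C J \<equiv> cone_mod (FF J) X ff"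
abbreviation "cdd \<equiv> celld A dg del"

abbreviation "ok J \<equiv> cells_map R A dg del J X fq"

definition is_base where
  "is_base m J S \<longleftrightarrow> S \<subseteq> cycles (C J) (s0 + int m) \<and>
     (\<forall>s\<in>S. s \<notin> lspan A (C J) (s0 + int m) (boundaries (C J) (s0 + int m) \<union> (S - {s}))) \<and>
     cycles (C J) (s0 + int m) \<subseteq> lspan A (C J) (s0 + int m) (boundaries (C J) (s0 + int m) \<union> S)"

definition base where "base m J = (SOME S. is_base m J S)"

primrec stage where
  "stage 0 = {}"
| "stage (Suc m) = stage m \<union> code m ` base m (stage m)"

lemma cone_module: "ok J \<Longrightarrow> dg_module R A (C J)"
proof -
  assume "ok J"
  then interpret cells_map R A dg del J X fq .
  show ?thesis by (rule f.cone_is_dg_module)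
qed

lemma base_is_base:
  assumes "ok J" shows "is_base m J (base m J)"
proof -
  interpret C: dg_module R A "C J" by (rule cone_module[OF assms])
  have "\<exists>S. is_base m J S" unfolding is_base_def
    by (rule C.relative_basis[OF field_dga_axioms]) (auto simp: cycles_def C.cplx.boundaries_closed simp del: cone_simps)
  then show ?thesis unfolding base_def by (rule someI_ex)
qed

lemma cone_dd:
  assumes "ok J" "z \<in> fam A dg J (k - 1)"
  shows "dd (C J) k (x, z) = (dd X k x \<oplus>\<^bsub>gr X (k - 1)\<^esub> ff (k - 1) z, fsign A dg (k - 1 - 1) 1 (cdd (k - 1) z))"
  using cells_map.cone_dd[OF assms] .

lemma cone_boundary_mono:
  assumes "ok J" "ok J'" "J \<subseteq> J'" "b \<in> boundaries (C J) k"
  shows "b \<in> boundaries (C J') k"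
proof -
  obtain x z where xz: "x \<in> carrier (gr X (k + 1))" "z \<in> fam A dg J (k + 1 - 1)" "b = dd (C J) (k + 1) (x, z)"
    using assms(4) by (auto simp: boundaries_def)
  have z': "z \<in> fam A dg J' (k + 1 - 1)" using xz(2) fam_mono[OF assms(3)] by blast
  have "b = dd (C J') (k + 1) (x, z)"
    using xz(3) unfolding cone_dd[OF assms(1) xz(2)] cone_dd[OF assms(2) z'] .
  then show ?thesis unfolding boundaries_def by (rule image_eqI) (use xz(1) z' in simp)
qed

lemma cone_cycle_iff:
  assumes "ok J"
  shows "(x, z) \<in> cycles (C J) k \<longleftrightarrow> x \<in> carrier (gr X k) \<and> z \<in> fam A dg J (k - 1) \<and>
    dd X k x \<oplus>\<^bsub>gr X (k - 1)\<^esub> ff (k - 1) z = \<zero>\<^bsub>gr X (k - 1)\<^esub> \<and> cdd (k - 1) z = fzero A dg (k - 1 - 1)"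
proof -
  interpret cells_map R A dg del J X fq by fact
  have "fsign A dg (k - 1 - 1) 1 (cd (k - 1) z) = fzero A dg (k - 1 - 1) \<longleftrightarrow> cd (k - 1) z = fzero A dg (k - 1 - 1)"
    if "z \<in> fam A dg J (k - 1)"
  proof
    interpret M: abelian_group "fmod A dg J (k - 1 - 1)" by (rule fmod_abelian_group)
    note c = cd_fam[OF that]
    assume "fsign A dg (k - 1 - 1) 1 (cd (k - 1) z) = fzero A dg (k - 1 - 1)"
    then have "\<ominus>\<^bsub>fmod A dg J (k - 1 - 1)\<^esub> cd (k - 1) z = \<zero>\<^bsub>fmod A dg J (k - 1 - 1)\<^esub>" using fmod_neg[OF c] by simp
    then show "cd (k - 1) z = fzero A dg (k - 1 - 1)"
      using M.minus_minus[of "cd (k - 1) z"] M.neg_zero c by simp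
  qed (simp add: fsign_zero)
  then show ?thesis
    unfolding cycles_def mem_Collect_eq cone_simps direct_sum_simps cell_mod_simps fmod_simps mem_Times_iff fst_conv snd_conv
    using cone_dd[of z k x] by auto
qed

lemma ok_Un:
  assumes ok: "ok J" and S: "S \<subseteq> cycles (C J) (s0 + int m)"
  shows "ok (J \<union> code m ` S)"
proof -
  interpret cells_map R A dg del J X fq by (rule ok)
  let ?J = "J \<union> code m ` S"
  have new: "x \<in> carrier (gr X (s0 + int m))" "z \<in> fam A dg J (s0 + int m - 1)"
    "dd X (s0 + int m) x \<oplus>\<^bsub>gr X (s0 + int m - 1)\<^esub> f (s0 + int m - 1) z = \<zero>\<^bsub>gr X (s0 + int m - 1)\<^esub>"
    "cd (s0 + int m - 1) z = fzero A dg (s0 + int m - 1 - 1)" if "(x, z) \<in> S" for x z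
    using that S cone_cycle_iff[OF ok, of x z "s0 + int m"] by auto
  have sub: "fam A dg J j \<subseteq> fam A dg ?J j" for j by (rule fam_mono) simp
  have code: "dg (code m (x, z)) = s0 + int m" "fq (code m (x, z)) = \<ominus>\<^bsub>gr X (s0 + int m)\<^esub> x"
    "del (code m (x, z)) = z" if "(x, z) \<in> S" for x z
    using code_simps(1,2)[of m "(x, z)"] code_simps(3)[of "(x, z)" J m] new(2)[OF that] by auto
  have "cells R A dg del ?J"
  proof (intro cells.intro dg_algebra_axioms cells_axioms.intro)
    fix q assume q: "q \<in> ?J"
    show "del q \<in> fam A dg ?J (dg q - 1)"
    proof (cases "q \<in> J")
      case True then show ?thesis using del_fam sub by blast
    next
      case False
      then obtain x z where xz: "(x, z) \<in> S" "q = code m (x, z)" using q by auto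
      show ?thesis unfolding xz(2) code[OF xz(1)] using new(2)[OF xz(1)] sub by blast
    qed
    show "cd (dg q - 1) (del q) = fzero A dg (dg q - 1 - 1)"
    proof (cases "q \<in> J")
      case True then show ?thesis by (rule del_cycle)
    next
      case False
      then obtain x z where xz: "(x, z) \<in> S" "q = code m (x, z)" using q by auto
      show ?thesis unfolding xz(2) code[OF xz(1)] by (rule new(4)[OF xz(1)])
    qed
  qed
  moreover have "cells_map_axioms A dg del ?J X fq"
  proof
    fix q assume q: "q \<in> ?J"
    show "fq q \<in> carrier (gr X (dg q))"
    proof (cases "q \<in> J")
      case True then show ?thesis by (rule fq_cl)
    next
      case False
      then obtain x z where xz: "(x, z) \<in> S" "q = code m (x, z)" using q by auto
      show ?thesis unfolding xz(2) code[OF xz(1)] using new(1)[OF xz(1)] by simp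
    qed
    show "f (dg q - 1) (del q) = dd X (dg q) (fq q)"
    proof (cases "q \<in> J")
      case True then show ?thesis by (rule fq_d)
    next
      case False
      then obtain x z where xz: "(x, z) \<in> S" "q = code m (x, z)" using q by auto
      have "\<ominus>\<^bsub>gr X (s0 + int m - 1)\<^esub> dd X (s0 + int m) x = f (s0 + int m - 1) z"
      proof (rule X.cplx.grp.minus_equality)
        show "f (s0 + int m - 1) z \<oplus>\<^bsub>gr X (s0 + int m - 1)\<^esub> dd X (s0 + int m) x = \<zero>\<^bsub>gr X (s0 + int m - 1)\<^esub>"
          by (subst X.cplx.grp.a_comm) (use new[OF xz(1)] f_closed X.cplx.d_closed in auto)
      qed (use new[OF xz(1)] f_closed X.cplx.d_closed in auto)
      then show ?thesis using code[OF xz(1)] xz(2) X.cplx.d_neg[OF new(1)[OF xz(1)]] by simp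
    qed
  qed
  ultimately show ?thesis by (intro cells_map.intro X.dg_module_axioms)
qed

lemma ok_empty: "ok {}"
  by (intro cells_map.intro cells.intro dg_algebra_axioms X.dg_module_axioms) (unfold_locales, auto)

lemma ok_stage: "ok (stage m)"
proof (induction m)
  case 0 show ?case using ok_empty by simp
next
  case (Suc m)
  then show ?case using ok_Un base_is_base[OF Suc] by (simp add: is_base_def)
qed

lemma stage_dg: "q \<in> stage m \<Longrightarrow> s0 \<le> dg q \<and> dg q < s0 + int m"
  by (induction m) (auto simp: code_simps)

lemma new_cell_boundary:
  assumes ok: "ok J'" and q: "code m (x, z) \<in> J'" and x: "x \<in> carrier (gr X (s0 + int m))" and z: "z \<in> fam A dg J' (s0 + int m - 1)"
  shows "(x, z) \<in> boundaries (C J') (s0 + int m)"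
proof -
  interpret cells_map R A dg del J' X fq by (rule ok)
  interpret C: dg_module R A "C J'" by (rule cone_module[OF ok])
  let ?q = "code m (x, z)" and ?k = "s0 + int m"
  have dq: "dg ?q = ?k" and dl: "del ?q = z" and fqq: "fq ?q = \<ominus>\<^bsub>gr X ?k\<^esub> x"
    using code_simps(1,2)[of m "(x, z)"] code_simps(3)[of "(x, z)" J' m] z by auto
  have g: "gen ?q \<in> fm ?k" using gen_fam[OF q] dq by simp
  have fg: "f ?k (gen ?q) = \<ominus>\<^bsub>gr X ?k\<^esub> x"
  proof -
    have u: "unt A \<in> carrier (gr A (?k - dg ?q))" using dq unt_closed by simp
    have "f ?k (gen ?q) = act X 0 ?k (unt A) (fq ?q)" using f_mon[OF q u] dq by (simp add: gen_def)
    then show ?thesis using fqq x X.act_unt by simp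
  qed
  have cg: "cd ?k (gen ?q) = z" using d_gen[OF q] dq dl by simp
  have g': "gen ?q \<in> fm (?k + 1 - 1)" using g by simp
  have "dd (C J') (?k + 1) (\<zero>\<^bsub>gr X (?k + 1)\<^esub>, gen ?q) = (\<ominus>\<^bsub>gr X ?k\<^esub> x, fsign A dg (?k - 1) 1 z)"
    using cone_dd[OF g', of "\<zero>\<^bsub>gr X (?k + 1)\<^esub>"] X.cplx.d_zero[of "?k + 1"] fg cg x by simp
  then have b: "(\<ominus>\<^bsub>gr X ?k\<^esub> x, fsign A dg (?k - 1) 1 z) \<in> boundaries (C J') ?k"
    using g by (auto simp: boundaries_def intro!: image_eqI[of _ _ "(\<zero>\<^bsub>gr X (?k + 1)\<^esub>, gen ?q)"])
  have "\<ominus>\<^bsub>gr (C J') ?k\<^esub> (\<ominus>\<^bsub>gr X ?k\<^esub> x, fsign A dg (?k - 1) 1 z) = (x, z)"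
  proof -
    have "\<ominus>\<^bsub>gr (C J') ?k\<^esub> (x, z) = (\<ominus>\<^bsub>gr X ?k\<^esub> x, fsign A dg (?k - 1) 1 z)"
      using x z by (simp add: direct_sum_neg X.cplx.grp.abelian_group_axioms fmod_abelian_group fmod_neg)
    then show ?thesis using C.cplx.grp.minus_minus[of "(x, z)" ?k] x z by simp
  qed
  then show ?thesis using C.cplx.boundaries_neg[OF b] by simp
qed

text \<open>
  The cycles of the new degree were made boundaries by the new cells. In smaller degrees the new cells change
  neither cycles nor boundaries.
\<close>

lemma stage_exact: "k < s0 + int m \<Longrightarrow> exact_at (C (stage m)) k"
proof (induction m arbitrary: k)
  case 0
  have "p \<in> boundaries (C {}) k" if "p \<in> cycles (C {}) k" for p
  proof -
    interpret cells_map R A dg del "{}" X fq by (rule ok_empty)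
    obtain x z where p: "p = (x, z)" by (cases p)
    then have *: "x \<in> carrier (gr X k)" "z \<in> fam A dg {} (k - 1)" "dd X k x \<oplus>\<^bsub>gr X (k - 1)\<^esub> f (k - 1) z = \<zero>\<^bsub>gr X (k - 1)\<^esub>"
      using that cone_cycle_iff[OF ok_empty, of x z k] by auto
    have z: "z = fzero A dg (k - 1)" using fam_zero_outside[OF *(2)] by (auto simp: fzero_def)
    then have "dd X k x = \<zero>\<^bsub>gr X (k - 1)\<^esub>" using * by (simp add: f_fzero X.cplx.d_closed)
    then obtain y where y: "y \<in> carrier (gr X (k + 1))" "x = dd X (k + 1) y"
      using exact_atD[OF exact_below *(1)] 0 by auto
    have zz: "fzero A dg k \<in> fm (k + 1 - 1)" by (simp add: fzero_fam)
    have "dd (C {}) (k + 1) (y, fzero A dg k) = p"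
      using cone_dd[OF zz, of y] y p z f_fzero[of k] cd_zero[of k] fsign_zero[of dg "k - 1" 1] X.cplx.d_closed[OF y(1)]
      by simp
    then show ?thesis using y zz by (auto simp: boundaries_def intro!: image_eqI[of _ _ "(y, fzero A dg k)"])
  qed
  then show ?case by (auto simp: exact_at_def)
next
  case (Suc m)
  let ?J = "stage m" and ?J' = "stage (Suc m)"
  interpret cells_map R A dg del ?J X fq by (rule ok_stage)
  interpret C': dg_module R A "C ?J'" by (rule cone_module[OF ok_stage])
  have sub: "?J \<subseteq> ?J'" by auto
  have "p \<in> boundaries (C ?J') k" if pc: "p \<in> cycles (C ?J') k" for p
  proof -
    obtain x z where p: "p = (x, z)" by (cases p)
    have *: "x \<in> carrier (gr X k)" "z \<in> fam A dg ?J' (k - 1)" "dd X k x \<oplus>\<^bsub>gr X (k - 1)\<^esub> f (k - 1) z = \<zero>\<^bsub>gr X (k - 1)\<^esub>"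
      "cd (k - 1) z = fzero A dg (k - 1 - 1)"
      using pc cone_cycle_iff[OF ok_stage[of "Suc m"], of x z k] p by auto
    have "supp A dg (k - 1) z \<subseteq> ?J"
    proof
      fix q assume q: "q \<in> supp A dg (k - 1) z"
      then have "dg q < s0 + int m" using degree_supp[OF *(2) q] Suc.prems by simp
      then show "q \<in> ?J" using q fam_supp[OF *(2)] by (auto simp: code_simps)
    qed
    then have z: "z \<in> fam A dg ?J (k - 1)" using fam_restrict[OF *(2)] by simp
    then have pcJ: "p \<in> cycles (C ?J) k" using * cone_cycle_iff[OF ok_stage, of x z m k] p by simp
    show ?thesis
    proof (cases "k < s0 + int m")
      case True
      then have "p \<in> boundaries (C ?J) k" using Suc.IH pcJ by (auto simp: exact_at_def)
      then show ?thesis using cone_boundary_mono[OF ok_stage ok_stage sub] by simp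
    next
      case False
      then have k: "k = s0 + int m" using Suc.prems by simp
      let ?S = "base m ?J"
      have S: "is_base m ?J ?S" by (rule base_is_base[OF ok_stage])
      have "p \<in> lspan A (C ?J) k (boundaries (C ?J) k \<union> ?S)" using S pcJ k by (auto simp: is_base_def)
      then show ?thesis
      proof (induction rule: lspan.induct)
        case zero
        then show ?case using C'.cplx.boundaries_zero[of k] by simp
      next
        case (gen t)
        then show ?case
        proof
          assume "t \<in> boundaries (C ?J) k"
          then show ?thesis using cone_boundary_mono[OF ok_stage ok_stage sub] by simp
        next
          assume t: "t \<in> ?S"
          obtain x' z' where t': "t = (x', z')" by (cases t)
          have "t \<in> cycles (C ?J) k" using t S k by (auto simp: is_base_def)
          then have c: "x' \<in> carrier (gr X (s0 + int m))" "z' \<in> fam A dg ?J (s0 + int m - 1)"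
            using cone_cycle_iff[OF ok_stage, of x' z' m k] t' k by auto
          have "z' \<in> fam A dg ?J' (s0 + int m - 1)" using c(2) fam_mono[OF sub] by blast
          moreover have "code m (x', z') \<in> ?J'" using t t' by auto
          ultimately have "(x', z') \<in> boundaries (C ?J') (s0 + int m)" by (intro new_cell_boundary[OF ok_stage _ c(1)])
          then show ?thesis using t' k by simp
        qed
      next
        case (add u v)
        have "u \<oplus>\<^bsub>gr (C ?J) k\<^esub> v = u \<oplus>\<^bsub>gr (C ?J') k\<^esub> v" by (cases u; cases v) simp
        then show ?case using C'.cplx.boundaries_add[OF add(3,4)] by metis
      next
        case (smul u a)
        obtain x' z' where u: "u = (x', z')" by (cases u)
        have "act (C ?J') 0 k a u = act (C ?J) 0 k a u" by (simp add: u ksign_def)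
        then show ?case using C'.boundaries_act0[OF smul(2) smul(3)] by simp
      qed
    qed
  qed
  then show ?case by (auto simp: exact_at_def)
qed

lemma stage_mono: "m \<le> m' \<Longrightarrow> stage m \<subseteq> stage m'"
  by (rule lift_Suc_mono_le[of stage]) auto

definition I where "I = (\<Union>m. stage m)"

lemma stage_I: "stage m \<subseteq> I" by (auto simp: I_def)

lemma fam_I:
  assumes "c \<in> fam A dg I j"
  obtains m where "m \<ge> m0" "c \<in> fam A dg (stage m) j"
proof -
  have "\<exists>m\<ge>m0. T \<subseteq> stage m" if "finite T" "T \<subseteq> I" for T
    using that
  proof (induction rule: finite_induct)
    case empty then show ?case by auto
  next
    case (insert x T)
    then obtain m m' where "m \<ge> m0" "T \<subseteq> stage m" "x \<in> stage m'" by (auto simp: I_def)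
    then show ?case using stage_mono[of m "max m m'"] stage_mono[of m' "max m m'"]
      by (intro exI[of _ "max m m'"]) auto
  qed
  then show ?thesis using that fam_fin[OF assms] fam_supp[OF assms] fam_restrict[OF assms] by blast
qed

lemma ok_I: "ok I"
proof -
  have "cells R A dg del I"
  proof (intro cells.intro dg_algebra_axioms cells_axioms.intro)
    fix q assume "q \<in> I"
    then obtain m where m: "q \<in> stage m" by (auto simp: I_def)
    interpret cells_map R A dg del "stage m" X fq by (rule ok_stage)
    show "del q \<in> fam A dg I (dg q - 1)" using del_fam[OF m] fam_mono[OF stage_I] by blast
    show "cd (dg q - 1) (del q) = fzero A dg (dg q - 1 - 1)" by (rule del_cycle[OF m])
  qed
  moreover have "cells_map_axioms A dg del I X fq"
  proof
    fix q assume "q \<in> I"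
    then obtain m where m: "q \<in> stage m" by (auto simp: I_def)
    interpret cells_map R A dg del "stage m" X fq by (rule ok_stage)
    show "fq q \<in> carrier (gr X (dg q))" by (rule fq_cl[OF m])
    show "f (dg q - 1) (del q) = dd X (dg q) (fq q)" by (rule fq_d[OF m])
  qed
  ultimately show ?thesis by (intro cells_map.intro X.dg_module_axioms)
qed

lemma dg_I: "q \<in> I \<Longrightarrow> s0 \<le> dg q"
  using stage_dg[of q] unfolding I_def by blast

lemma exact_I: "exact_at (C I) k"
proof -
  have "p \<in> boundaries (C I) k" if pc: "p \<in> cycles (C I) k" for p
  proof -
    obtain x z where p: "p = (x, z)" by (cases p)
    have z: "z \<in> fam A dg I (k - 1)" using pc p cone_cycle_iff[OF ok_I, of x z k] by simp
    obtain m where m: "m \<ge> nat (k - s0 + 1)" "z \<in> fam A dg (stage m) (k - 1)" by (rule fam_I[OF z])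
    have "p \<in> cycles (C (stage m)) k" using pc p m cone_cycle_iff[OF ok_I, of x z k] cone_cycle_iff[OF ok_stage, of x z m k] by simp
    moreover have "k < s0 + int m" using m(1) by linarith
    ultimately have "p \<in> boundaries (C (stage m)) k" using stage_exact by (auto simp: exact_at_def)
    then show ?thesis using cone_boundary_mono[OF ok_stage ok_I stage_I] by simp
  qed
  then show ?thesis by (auto simp: exact_at_def)
qed

lemma I_cases:
  assumes "q \<in> I"
  obtains m s where "q = code m s" "s \<in> base m (stage m)"
proof -
  obtain m where "q \<in> stage m" using assms by (auto simp: I_def)
  then have "\<exists>m s. q = code m s \<and> s \<in> base m (stage m)" by (induction m) auto
  then show ?thesis using that by blast
qed

text \<open>
  Suppose that the cell \<open>p\<close> has the coefficient \<open>a \<noteq> 0\<close> in the differential of a cell \<open>q\<close> that is attached one stage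
  later to kill \<open>(x, z)\<close>. Since \<open>(x, z)\<close> is a cycle, \<open>D z = (f z, - d z)\<close> is the boundary \<open>- d(x, 0)\<close>. Each cell of
  the same degree as \<open>p\<close> contributes to \<open>D z\<close> a multiple of the basis element that it kills, and all other cells contribute a
  boundary. So the multiple by \<open>a\<close> of the basis element for \<open>p\<close> is a combination of boundaries and of the
  other basis elements, which contradicts independence as \<open>a\<close> is invertible.
\<close>

theorem minimal:
  assumes q: "q \<in> I" and p: "p \<in> I" and qp: "dg p = dg q - 1"
  shows "del q p = \<zero>\<^bsub>gr A 0\<^esub>"
proof (rule ccontr)
  assume nz: "del q p \<noteq> \<zero>\<^bsub>gr A 0\<^esub>"
  obtain m x z where m: "q = code m (x, z)" "(x, z) \<in> base m (stage m)" using I_cases[OF q] by (metis surj_pair)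
  obtain m' x1 z1 where m': "p = code m' (x1, z1)" "(x1, z1) \<in> base m' (stage m')" using I_cases[OF p] by (metis surj_pair)
  have mm: "m = Suc m'" using qp m m' code_simps(1)[of m "(x, z)"] code_simps(1)[of m' "(x1, z1)"] by simp
  let ?k = "s0 + int m'" and ?J = "stage m'" and ?J' = "stage m"
  have k1: "s0 + int m = ?k + 1" using mm by simp
  interpret cells_map R A dg del ?J' X fq by (rule ok_stage)
  interpret C: dg_module R A "C ?J" by (rule cone_module[OF ok_stage])
  have sub: "?J \<subseteq> ?J'" using stage_mono[of m' m] mm by simp
  have S: "is_base m' ?J (base m' ?J)" by (rule base_is_base[OF ok_stage])
  have "(x, z) \<in> cycles (C ?J') (?k + 1)" using m(2) base_is_base[OF ok_stage, of m m] k1 by (auto simp: is_base_def)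
  then have xz: "x \<in> carrier (gr X (?k + 1))" "z \<in> fm ?k"
    "dd X (?k + 1) x \<oplus>\<^bsub>gr X ?k\<^esub> f ?k z = \<zero>\<^bsub>gr X ?k\<^esub>" "cd ?k z = fzero A dg (?k - 1)"
    using cone_cycle_iff[OF ok_stage, of x z m "?k + 1"] by auto
  have bc: "x' \<in> carrier (gr X ?k) \<and> z' \<in> fam A dg ?J (?k - 1)" if "(x', z') \<in> base m' ?J" for x' z'
    using that S cone_cycle_iff[OF ok_stage, of x' z' m' ?k] by (auto simp: is_base_def)
  have dlq: "del q = z" using m code_simps(3)[of "(x, z)" ?J' m] xz(2) k1 by simp
  have dp: "dg p = ?k" using m' code_simps(1)[of m' "(x1, z1)"] by simp
  define T where "T = boundaries (C ?J) ?k \<union> (base m' ?J - {(x1, z1)})"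
  have Tc: "T \<subseteq> carrier (gr (C ?J) ?k)"
    using S C.cplx.boundaries_closed by (auto simp: T_def is_base_def cycles_def simp del: cone_simps)
  define D where "D c = (f ?k c, fsign A dg (?k - 1) 1 (cd ?k c))" for c
  have D_add: "D (fadd A dg ?k c c') = D c \<oplus>\<^bsub>gr (C ?J) ?k\<^esub> D c'" if "c \<in> fm ?k" "c' \<in> fm ?k" for c c'
    using that fsign_add[OF cd_fam[OF that(1)] cd_fam[OF that(2)], of 1] by (simp add: D_def f_fadd cd_add)
  have D_new: "D (mon A dg ?k (code m' (x2, z2)) b) = \<ominus>\<^bsub>gr (C ?J) ?k\<^esub> act (C ?J) 0 ?k b (x2, z2)"
    if s: "(x2, z2) \<in> base m' ?J" and b: "b \<in> carrier (gr A 0)" for x2 z2 b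
  proof -
    let ?r = "code m' (x2, z2)"
    have r: "?r \<in> ?J'" using s mm by auto
    have dr: "dg ?r = ?k" "fq ?r = \<ominus>\<^bsub>gr X ?k\<^esub> x2" "del ?r = z2"
      using code_simps(1,2)[of m' "(x2, z2)"] code_simps(3)[of "(x2, z2)" ?J m'] bc[OF s] by auto
    have b': "b \<in> carrier (gr A (?k - dg ?r))" using b dr by simp
    have fz: "famact A dg 0 (?k - 1) b z2 \<in> fam A dg ?J (?k - 1)" using b bc[OF s] by (auto intro: famact_fam)
    have 1: "f ?k (mon A dg ?k ?r b) = \<ominus>\<^bsub>gr X ?k\<^esub> act X 0 ?k b x2"
      using f_mon[OF r b'] dr X.act_neg_right[OF b, of x2 ?k] bc[OF s] by simp
    have "mon A dg (?k - 1) ?r (dd A 0 b) = fzero A dg (?k - 1)"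
      using d_degree_zero[OF b] mon_zero[of dg "?k - 1" ?r] dr by simp
    then have "cd ?k (mon A dg ?k ?r b) = famact A dg 0 (?k - 1) b z2"
      using cd_mon[OF r b'] dr famD[OF fz] by (simp add: dmon_def) (simp add: fadd_def fzero_def fsign_def ksign_def)
    then show ?thesis using 1 fz b bc[OF s] X.act_cl[OF b, of x2 ?k ?k]
      by (simp add: D_def direct_sum_neg X.cplx.grp.abelian_group_axioms fmod_abelian_group fmod_neg ksign_def)
  qed
  have D_rest: "D c \<in> lspan A (C ?J) ?k T" if "c \<in> fam A dg (?J' - {p}) ?k" for c
    using that
  proof (induction rule: fam_induct)
    case zero
    have "D (fzero A dg ?k) = \<zero>\<^bsub>gr (C ?J) ?k\<^esub>" using f_fzero[of ?k] cd_zero[of ?k] fsign_zero[of dg "?k - 1" 1] by (simp add: D_def)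
    then show ?case using lspan.zero[of "C ?J" ?k A T] by simp
  next
    case (mon r b)
    show ?case
    proof (cases "r \<in> ?J")
      case True
      have c: "mon A dg ?k r b \<in> fam A dg ?J (?k + 1 - 1)" using mon_fam[where j = ?k and dg = dg, OF True mon(2)] by simp
      have "dd (C ?J) (?k + 1) (\<zero>\<^bsub>gr X (?k + 1)\<^esub>, mon A dg ?k r b) = D (mon A dg ?k r b)"
        unfolding resolution.cone_dd[OF resolution_axioms ok_stage c]
        using X.cplx.d_zero[of "?k + 1"] f_closed[of "mon A dg ?k r b" ?k] mon_fam[where j = ?k and dg = dg, of r ?J' b] mon by (simp add: D_def)
      then have "D (mon A dg ?k r b) \<in> boundaries (C ?J) ?k"
        using c unfolding boundaries_def by (intro image_eqI[of _ _ "(\<zero>\<^bsub>gr X (?k + 1)\<^esub>, mon A dg ?k r b)"]) auto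
      then show ?thesis by (simp add: T_def lspan.gen)
    next
      case False
      then obtain x2 z2 where s: "(x2, z2) \<in> base m' ?J" "r = code m' (x2, z2)" using mon(1) mm by auto
      have b: "b \<in> carrier (gr A 0)" using mon(2) s code_simps(1)[of m' "(x2, z2)"] by simp
      have "(x2, z2) \<in> T" using s mon(1) m' by (auto simp: T_def)
      then have "act (C ?J) 0 ?k b (x2, z2) \<in> lspan A (C ?J) ?k T" by (rule lspan.smul[OF lspan.gen b])
      then show ?thesis unfolding s(2) D_new[OF s(1) b] by (rule C.lspan_neg[OF _ Tc])
    qed
  next
    case (add c c')
    then have "c \<in> fm ?k" "c' \<in> fm ?k" using fam_mono[of "?J' - {p}" ?J' A dg ?k] by auto
    then have "D (fadd A dg ?k c c') = D c \<oplus>\<^bsub>gr (C ?J) ?k\<^esub> D c'" by (rule D_add)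
    then show ?case using lspan.add[OF add(3,4)] by simp
  qed
  let ?a = "z p"
  have a: "?a \<in> carrier (gr A 0)" using famD[OF xz(2), of p] dp by simp
  have ad: "?a \<in> carrier (gr A (?k - dg p))" using a dp by simp
  have pJ: "p \<in> ?J'" using m' mm by auto
  let ?z = "z(p := \<zero>\<^bsub>gr A (?k - dg p)\<^esub>)"
  have sz: "supp A dg ?k ?z \<subseteq> supp A dg ?k z - {p}" by (auto simp: supp_def)
  have z': "?z \<in> fam A dg (?J' - {p}) ?k"
    using xz(2) sz finite_subset[OF sz] by (auto simp: fam_def)
  have z'': "?z \<in> fm ?k" using z' fam_mono[of "?J' - {p}" ?J' A dg ?k] by auto
  have "z = fadd A dg ?k (mon A dg ?k p ?a) ?z"
    using famD[OF xz(2)] by (auto simp: fadd_def mon_def fun_eq_iff)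
  then have Dz: "D z = D (mon A dg ?k p ?a) \<oplus>\<^bsub>gr (C ?J) ?k\<^esub> D ?z"
    using D_add[OF mon_fam[where j = ?k and dg = dg, OF pJ ad] z''] by simp
  have "D z \<in> boundaries (C ?J) ?k"
  proof -
    have "(x, fzero A dg ?k) \<in> carrier (gr (C ?J) (?k + 1))" using xz(1) by (simp add: fzero_fam)
    moreover have zf: "fzero A dg ?k \<in> fam A dg ?J (?k + 1 - 1)" by (simp add: fzero_fam)
    have "dd (C ?J) (?k + 1) (x, fzero A dg ?k) = (dd X (?k + 1) x, fzero A dg (?k - 1))"
      unfolding resolution.cone_dd[OF resolution_axioms ok_stage zf]
      using f_fzero[of ?k] cd_zero[of ?k] fsign_zero[of dg "?k - 1" 1] X.cplx.d_cl[OF xz(1), of ?k] by simp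
    ultimately have b: "(dd X (?k + 1) x, fzero A dg (?k - 1)) \<in> boundaries (C ?J) ?k"
      unfolding boundaries_def by (metis image_eqI)
    have "\<ominus>\<^bsub>gr X ?k\<^esub> dd X (?k + 1) x = f ?k z"
    proof (rule X.cplx.grp.minus_equality)
      show "f ?k z \<oplus>\<^bsub>gr X ?k\<^esub> dd X (?k + 1) x = \<zero>\<^bsub>gr X ?k\<^esub>"
        by (subst X.cplx.grp.a_comm) (use xz f_closed X.cplx.d_cl[OF xz(1), of ?k] in auto)
    qed (use xz f_closed X.cplx.d_cl[OF xz(1), of ?k] in auto)
    then have "\<ominus>\<^bsub>gr (C ?J) ?k\<^esub> (dd X (?k + 1) x, fzero A dg (?k - 1)) = D z"
      using X.cplx.d_cl[OF xz(1), of ?k] xz(4) fsign_zero[of dg "?k - 1" 1]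
      by (simp add: D_def direct_sum_neg X.cplx.grp.abelian_group_axioms fmod_abelian_group fmod_neg fzero_fam)
    then show ?thesis using C.cplx.boundaries_neg[OF b] by simp
  qed
  then have DzT: "D z \<in> lspan A (C ?J) ?k T" by (simp add: T_def lspan.gen)
  let ?s = "(x1, z1)"
  have sc: "?s \<in> carrier (gr (C ?J) ?k)" using bc[OF m'(2)] by simp
  have as: "act (C ?J) 0 ?k ?a ?s \<in> carrier (gr (C ?J) ?k)" by (rule C.act_cl[OF a sc]) simp
  have zc: "D ?z \<in> carrier (gr (C ?J) ?k)" by (rule C.lspan_carrier[OF D_rest[OF z'] Tc])
  have "D z = \<ominus>\<^bsub>gr (C ?J) ?k\<^esub> act (C ?J) 0 ?k ?a ?s \<oplus>\<^bsub>gr (C ?J) ?k\<^esub> D ?z"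
    using Dz D_new[OF m'(2) a] m'(1) by simp
  then have "D ?z \<oplus>\<^bsub>gr (C ?J) ?k\<^esub> \<ominus>\<^bsub>gr (C ?J) ?k\<^esub> D z = act (C ?J) 0 ?k ?a ?s"
    by (rule C.cplx.grp.solve_for_neg[OF _ as zc])
  then have asT: "act (C ?J) 0 ?k ?a ?s \<in> lspan A (C ?J) ?k T"
    using lspan.add[OF D_rest[OF z'] C.lspan_neg[OF DzT Tc]] by metis
  have "?a \<noteq> \<zero>\<^bsub>gr A 0\<^esub>" using nz dlq by simp
  then obtain b where b: "b \<in> carrier (gr A 0)" "mul A 0 0 b ?a = unt A" using invertible[OF a] by blast
  have "act (C ?J) 0 ?k b (act (C ?J) 0 ?k ?a ?s) = ?s"
    using C.act_assoc'[OF b(1) a sc, of 0 ?k] b C.act_unt[OF sc] by (simp del: cone_simps)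
  then have "?s \<in> lspan A (C ?J) ?k T" using lspan.smul[OF asT b(1)] by metis
  then show False using S m'(2) by (auto simp: is_base_def T_def)
qed

end

theorem (in field_dga) ex_minimal_resolution:
  fixes X :: "('r, 'a, 'x, 'n) dg_mod_scheme"
  assumes X: "dg_module R A X" and ex: "\<And>i. i < s0 \<Longrightarrow> exact_at X i"
  obtains dg and del :: "nat \<times> 'a \<times> 'x \<Rightarrow> nat \<times> 'a \<times> 'x \<Rightarrow> 'a" and I fq
  where "cells_map R A dg del I X fq" "\<And>q. q \<in> I \<Longrightarrow> s0 \<le> dg q"
    "\<And>q p. q \<in> I \<Longrightarrow> p \<in> I \<Longrightarrow> dg p = dg q - 1 \<Longrightarrow> del q p = \<zero>\<^bsub>gr A 0\<^esub>"
    "quasi_iso A (cell_mod A dg del I) X (cellf A dg X fq)"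
proof -
  obtain \<iota> :: "nat \<times> 'x \<times> ((nat \<times> 'a \<times> 'x) \<times> 'a) list \<Rightarrow> nat \<times> 'a \<times> 'x" where \<iota>: "inj \<iota>"
    using ex_coding by blast
  interpret r: resolution R A X \<iota> s0
    by (intro resolution.intro X field_dga_axioms resolution_axioms.intro \<iota> ex)
  interpret c: cells_map R A r.dg r.del r.I X r.fq by (rule r.ok_I)
  have "quasi_iso A (r.FF r.I) X r.ff"
    unfolding c.f.quasi_iso_iff by (rule c.f.qi_if_cone_exact) (rule r.exact_I)
  then show ?thesis using that r.ok_I r.dg_I r.minimal by blast
qed

text \<open>Only the carriers shrink; forms on \<open>X\<close> and their coboundaries are forms on the submodule as they stand.\<close>

definition sub_dg :: "('r, 'a, 'x) dg_mod \<Rightarrow> (int \<Rightarrow> 'x set) \<Rightarrow> ('r, 'a, 'x) dg_mod" where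
  "sub_dg X S = X\<lparr>gr := \<lambda>k. (gr X k)\<lparr>carrier := S k\<rparr>\<rparr>"

lemma sub_dg_simps [simp]:
  "carrier (gr (sub_dg X S) k) = S k" "\<zero>\<^bsub>gr (sub_dg X S) k\<^esub> = \<zero>\<^bsub>gr X k\<^esub>"
  "add (gr (sub_dg X S) k) = add (gr X k)" "smult (gr (sub_dg X S) k) = smult (gr X k)"
  "dd (sub_dg X S) = dd X" "act (sub_dg X S) = act X"
  by (simp_all add: sub_dg_def)

lemma sub_dg_module:
  assumes X: "dg_module R A X"
    and S: "\<And>k. S k \<subseteq> carrier (gr X k)" and S_zero: "\<And>k. \<zero>\<^bsub>gr X k\<^esub> \<in> S k"
    and S_add: "\<And>k x y. x \<in> S k \<Longrightarrow> y \<in> S k \<Longrightarrow> x \<oplus>\<^bsub>gr X k\<^esub> y \<in> S k"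
    and S_neg: "\<And>k x. x \<in> S k \<Longrightarrow> \<ominus>\<^bsub>gr X k\<^esub> x \<in> S k"
    and S_act: "\<And>l k a x. a \<in> carrier (gr A l) \<Longrightarrow> x \<in> S k \<Longrightarrow> act X l k a x \<in> S (l + k)"
    and S_d: "\<And>k x. x \<in> S k \<Longrightarrow> dd X k x \<in> S (k - 1)"
  shows "dg_module R A (sub_dg X S)"
proof -
  interpret X: dg_module R A X by fact
  let ?Y = "sub_dg X S"
  have Sc: "x \<in> carrier (gr X k)" if "x \<in> S k" for x k using S that by blast
  have ab: "abelian_group (gr ?Y k)" for k
    by (rule abelian_groupI)
      (use S_zero S_add S_neg Sc in \<open>auto simp: X.cplx.grp.a_assoc X.cplx.grp.r_neg
        intro: X.cplx.grp.a_comm intro!: bexI[of _ "\<ominus>\<^bsub>gr X k\<^esub> _"] X.cplx.grp.l_neg\<close>)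
  have S_smult: "r \<odot>\<^bsub>gr X k\<^esub> x \<in> S k" if "r \<in> carrier R" "x \<in> S k" for r x k
  proof -
    have "act X 0 k (r \<odot>\<^bsub>gr A 0\<^esub> unt A) x = r \<odot>\<^bsub>gr X k\<^esub> x"
      using X.act_smult_left[OF that(1) X.unt_closed Sc[OF that(2)]] X.act_unt[OF Sc[OF that(2)]] by simp
    then show ?thesis
      using S_act[OF module.smult_closed[OF X.algebra.component that(1) X.unt_closed] that(2)] by simp
  qed
  have neg: "\<ominus>\<^bsub>gr ?Y k\<^esub> x = \<ominus>\<^bsub>gr X k\<^esub> x" if "x \<in> S k" for x k
  proof -
    interpret Y: abelian_group "gr ?Y k" by (rule ab)
    show ?thesis by (rule Y.minus_equality) (use that S_neg Sc in \<open>auto intro: X.cplx.grp.l_neg\<close>)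
  qed
  have ks: "ksign (gr ?Y k) i x = ksign (gr X k) i x" if "x \<in> S k" for x k i
    using neg[OF that] by (simp add: ksign_def)
  have "dg_complex R ?Y"
  proof (intro dg_complex.intro X.is_cring dg_complex_axioms.intro)
    fix k
    show "module R (gr ?Y k)"
      by (rule moduleI[OF X.is_cring ab])
        (use S_smult Sc in \<open>auto simp: module.smult_l_distr[OF X.cplx.component] module.smult_r_distr[OF X.cplx.component]
          module.smult_assoc1[OF X.cplx.component] module.smult_one[OF X.cplx.component]\<close>)
  qed (use Sc S_d in \<open>auto simp: X.cplx.d_add X.cplx.d_smult X.cplx.d_d\<close>)
  moreover have "dg_module_axioms R A ?Y"
  proof (intro dg_module_axioms.intro; unfold sub_dg_simps)
    fix a i x j assume a: "a \<in> carrier (gr A i)" and x: "x \<in> S j"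
    have "act X i (j - 1) a (dd X j x) \<in> S (i + j - 1)" using S_act[OF a S_d[OF x]] by (simp add: add_diff_eq)
    then show "dd X (i + j) (act X i j a x) =
       act X (i - 1) j (dd A i a) x \<oplus>\<^bsub>gr X (i + j - 1)\<^esub> ksign (gr ?Y (i + j - 1)) i (act X i (j - 1) a (dd X j x))"
      using X.act_leibniz[OF a Sc[OF x]] by (simp add: ks)
  qed (use S_act Sc X.act_add_left X.act_add_right X.act_smult_left X.act_smult_right X.act_assoc X.act_unt in auto)
  ultimately show ?thesis by (intro dg_module.intro X.dg_algebra_axioms)
qed

lemma form_restrict:
  assumes "form A P U t \<beta>" "\<And>k. carrier (gr U' k) \<subseteq> carrier (gr U k)" "\<And>k. add (gr U' k) = add (gr U k)" "act U' = act U"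
  shows "form A P U' t \<beta>"
proof (rule formI)
  fix p i j m q a x u
  assume *: "i + q = t" "m + j = t" "m = p + i" "q = p + j" "a \<in> carrier (gr A p)" "x \<in> carrier (gr P i)" "u \<in> carrier (gr U' j)"
  then have "u \<in> carrier (gr U j)" using assms(2) by blast
  then have "\<beta> m j (act P p i a x) u = psign (i * p) (\<beta> i q x (act U p j a u))"
    using * by (intro form_balanced[OF assms(1)])
  then show "psign (i * p) (\<beta> m j (act P p i a x) u) = \<beta> i q x (act U' p j a u)"
    by (simp add: assms(4) psign_def)
qed (use assms(2) in \<open>auto simp: assms(3) intro!: form_add_left[OF assms(1)] form_add_right[OF assms(1)]\<close>)

lemma cobd_dd_cong: "dd U' = dd U \<Longrightarrow> cobd P U' \<beta> = cobd P U \<beta>"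
  by (intro ext) (simp add: cobd_def)

text \<open>Since \<open>A\<close> is non-negatively graded, this says that the differential of each cell has coefficients in \<open>A\<^sub>+\<close>.\<close>

definition minimal_cells :: "('r, 'a, 'm) dg_alg_scheme \<Rightarrow> ('i \<Rightarrow> int) \<Rightarrow> ('i \<Rightarrow> 'i \<Rightarrow> 'a) \<Rightarrow> 'i set \<Rightarrow> bool" where
  "minimal_cells A dg del I \<longleftrightarrow> (\<forall>q\<in>I. \<forall>p\<in>I. dg p = dg q - 1 \<longrightarrow> del q p = \<zero>\<^bsub>gr A 0\<^esub>)"

lemma (in cells) minimal_del:
  assumes "minimal_cells A dg del I" "q \<in> I" "dg q - 1 \<le> dg p"
  shows "del q p = \<zero>\<^bsub>gr A (dg q - 1 - dg p)\<^esub>"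
proof (cases "p \<in> I")
  case False then show ?thesis using fam_zero_outside[OF del_fam[OF assms(2)]] by simp
next
  case True
  show ?thesis
  proof (cases "dg p = dg q - 1")
    case eq: True
    then show ?thesis using assms True by (simp add: minimal_cells_def)
  next
    case False
    then show ?thesis using neg_degree[OF _ famD[OF del_fam[OF assms(2)], of p]] assms(3) by simp
  qed
qed

lemma (in cells) minimal_del_fam:
  assumes "minimal_cells A dg del I" "q \<in> I"
  shows "del q \<in> fam A dg {p \<in> I. dg p < dg q - 1} (dg q - 1)"
proof (rule fam_restrict[OF del_fam[OF assms(2)]])
  show "supp A dg (dg q - 1) (del q) \<subseteq> {p \<in> I. dg p < dg q - 1}"
    using fam_supp[OF del_fam[OF assms(2)]] minimal_del[OF assms] by (force simp: supp_def)
qed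

lemma (in cells) mon_is_act: "a \<in> carrier (gr A (j - dg r)) \<Longrightarrow> mon A dg j r a = act F (j - dg r) (dg r) a (gen r)"
  using act_gen[of a "j - dg r" j r] by simp

text \<open>
  The element \<open>j0\<close> spans a copy of \<open>\<Sigma>\<^sup>n k\<close> in \<open>A\<^sub>+\<close>: it is a cycle and \<open>A\<^sub>+\<close> annihilates it. The character \<open>lam\<close>,
  which vanishes on products of elements of positive degree and on boundaries, is non-zero on it. So \<open>\<Sigma>\<^sup>n k\<close> is a
  direct summand of \<open>A\<^sub>+\<close>, which is the property of \<open>A\<close> on which the theorem rests.
\<close>

locale socle_dga = field_dga R A for R :: "('r, 's) ring_scheme" (structure) and A :: "('r, 'a, 'm) dg_alg_scheme" +
  fixes n N :: int and j0 :: 'a and lam :: "'a \<Rightarrow> qz"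
  assumes n_pos: "n \<ge> 1" and bounded: "i > N \<Longrightarrow> carrier (gr A i) = {\<zero>\<^bsub>gr A i\<^esub>}"
    and j0: "j0 \<in> carrier (gr A n)" and lam: "character (gr A n) lam" and lam_j0: "lam j0 \<noteq> 0"
    and lam_mul: "p \<ge> 1 \<Longrightarrow> q \<ge> 1 \<Longrightarrow> p + q = n \<Longrightarrow> a \<in> carrier (gr A p) \<Longrightarrow> b \<in> carrier (gr A q) \<Longrightarrow> lam (mul A p q a b) = 0"
    and lam_d: "a \<in> carrier (gr A (n + 1)) \<Longrightarrow> lam (dd A (n + 1) a) = 0"
    and j0_mul: "l \<ge> 1 \<Longrightarrow> a \<in> carrier (gr A l) \<Longrightarrow> mul A l n a j0 = \<zero>\<^bsub>gr A (l + n)\<^esub>"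
    and d_j0: "dd A n j0 = \<zero>\<^bsub>gr A (n - 1)\<^esub>"
begin

lemma mul_j0: "l \<ge> 1 \<Longrightarrow> a \<in> carrier (gr A l) \<Longrightarrow> m = n + l \<Longrightarrow> mul A n l j0 a = \<zero>\<^bsub>gr A m\<^esub>"
  using graded_commutative[OF j0, of a l] j0_mul[of l a] by (simp add: add.commute)

lemma lam_zero: "lam \<zero>\<^bsub>gr A n\<^esub> = 0"
  by (rule grp.character_zero[OF lam])

text \<open>
  Let \<open>F\<close> and \<open>G\<close> be the minimal modules on the cells \<open>I\<close> and \<open>I'\<close>. Write \<open>i = |v|\<close> and \<open>p = i + 1\<close>, let \<open>L\<close> be the
  submodule of \<open>F\<close> on the cells of degree at most \<open>p\<close>, and let \<open>M\<close> be the exact submodule of \<open>F\<close> that is zero below degree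
  \<open>p\<close>, consists of the cycles in degree \<open>p\<close> and is \<open>F\<close> above. The map \<open>L \<rightarrow> F/M\<close> is onto with kernel
  \<open>K = L \<inter> M\<close>, and \<open>F \<rightarrow> F/M\<close> is a quasi-isomorphism. In high degrees \<open>G\<close> is orthogonal to \<open>F\<close> by assumption,
  and to \<open>L\<close> because its cells have bounded degree and \<open>G\<close> has bounded homology. So \<open>G\<close> is orthogonal to \<open>K\<close> in
  high degrees.
  
  By minimality the element \<open>y = j0 v\<close> of \<open>K\<close> spans a copy of \<open>\<Sigma>\<^sup>n\<^sup>+\<^sup>i k\<close>, and \<open>x \<mapsto> lam (x v)\<close>, the \<open>v\<close>-coefficient
  followed by \<open>lam\<close>, splits it off \<open>K\<close>. Hence \<open>G\<close> is orthogonal to \<open>k\<close> in high degrees, and as \<open>G\<close> is minimal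
  it has no cells there. The proof carries this out for the form that belongs to a cell \<open>w\<close> of \<open>G\<close>; the connecting
  map from \<open>K\<close> to \<open>F/M\<close> is the passage from \<open>b\<close> to its coboundary \<open>D\<close>.
\<close>

theorem cells_bounded:
  fixes dg :: "'i \<Rightarrow> int" and dg' :: "'k \<Rightarrow> int"
  assumes F: "cells R A dg del I" and F_min: "minimal_cells A dg del I" and F_low: "\<And>q. q \<in> I \<Longrightarrow> s0 \<le> dg q"
    and G: "cells R A dg' del' I'" and G_min: "minimal_cells A dg' del' I'" and G_low: "\<And>q. q \<in> I' \<Longrightarrow> s0' \<le> dg' q"
    and v: "v \<in> I" and F_exact: "\<And>k. k > dg v \<Longrightarrow> exact_at (cell_mod A dg del I) k"
    and G_exact: "\<And>k. k > sG \<Longrightarrow> exact_at (cell_mod A dg' del' I') k"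
    and GF: "\<And>t. t > T0 \<Longrightarrow> perp A (cell_mod A dg' del' I') (cell_mod A dg del I) t"
    and w: "w \<in> I'"
  shows "dg' w \<le> max T0 (sG + dg v + 1) - n - dg v"
proof (rule ccontr)
  assume "\<not> ?thesis"
  then have large: "dg' w + n + dg v > T0" "dg' w + n + dg v > sG + dg v + 1" by auto
  define i p t t' where "i = dg v" and "p = dg v + 1" and "t = dg' w" and "t' = dg' w + n + dg v"
  interpret cF: cells R A dg del I by (rule F)
  interpret cG: cells R A dg' del' I' by (rule G)
  define L where "L = {q \<in> I. dg q \<le> p}"
  have LI: "L \<subseteq> I" by (auto simp: L_def)
  interpret cL: cells R A dg del L
  proof (intro cells.intro dg_algebra_axioms cells_axioms.intro)
    fix q assume q: "q \<in> L"
    then have qI: "q \<in> I" "dg q \<le> p" by (auto simp: L_def)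
    show "del q \<in> fam A dg L (dg q - 1)"
    proof (rule fam_restrict[OF cF.del_fam[OF qI(1)]])
      show "supp A dg (dg q - 1) (del q) \<subseteq> L"
        using cF.degree_supp[OF cF.del_fam[OF qI(1)]] fam_supp[OF cF.del_fam[OF qI(1)]] qI(2) by (force simp: L_def)
    qed
    show "celld A dg del (dg q - 1) (del q) = fzero A dg (dg q - 1 - 1)" by (rule cF.del_cycle[OF qI(1)])
  qed
  have famL: "c \<in> fam A dg L k \<longleftrightarrow> c \<in> fam A dg I k" if "k \<le> p" for c k
  proof
    show "c \<in> fam A dg I k" if "c \<in> fam A dg L k" using that fam_mono[OF LI] by blast
    assume c: "c \<in> fam A dg I k"
    then show "c \<in> fam A dg L k"
      using fam_supp[OF c] cF.degree_supp[OF c] \<open>k \<le> p\<close> by (intro fam_restrict[OF c]) (force simp: L_def)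
  qed
  have famLI: "c \<in> fam A dg I k" if "c \<in> fam A dg L k" for c k using that fam_mono[OF LI] by blast
  define Mc where "Mc k = (if k < p then {fzero A dg k} else if k = p then cycles cF.F p else fam A dg I k)" for k
  have McI: "Mc k \<subseteq> fam A dg I k" for k by (auto simp: Mc_def fzero_fam cycles_def)
  have Mc_act: "famact A dg l k a x \<in> Mc (l + k)" if a: "a \<in> carrier (gr A l)" and x: "x \<in> Mc k" for l k a x
  proof (cases "l < 0")
    case True
    then have "famact A dg l k a x = fzero A dg (l + k)"
      using neg_degree[OF True a] famact_zero_left[of x dg I k "l + k" l] x McI by auto
    then show ?thesis using fzero_fam by (auto simp: Mc_def cycles_def cF.cd_zero)
  next
    case False
    consider "k < p" | "k = p" | "k > p" by linarith
    then show ?thesis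
    proof cases
      case 1
      then have "famact A dg l k a x = fzero A dg (l + k)" using x famact_zero[OF a] by (auto simp: Mc_def)
      then show ?thesis using fzero_fam by (auto simp: Mc_def cycles_def cF.cd_zero)
    next
      case 2
      then have xc: "x \<in> fam A dg I p" "celld A dg del p x = fzero A dg (p - 1)" using x by (auto simp: Mc_def cycles_def)
      have fx: "famact A dg l p a x \<in> fam A dg I (l + p)" using famact_fam[OF a xc(1)] by simp
      show ?thesis
      proof (cases "l = 0")
        case True
        have "celld A dg del p (famact A dg l p a x) = fadd A dg (p - 1) (famact A dg (l - 1) p (dd A l a) x)
            (fsign A dg (p - 1) l (famact A dg l (p - 1) a (celld A dg del p x)))"
          by (rule cF.cd_famact[OF a xc(1)]) (use True in simp)
        also have "famact A dg (l - 1) p (dd A l a) x = fzero A dg (p - 1)"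
          using d_degree_zero[of a] a True famact_zero_left[OF xc(1), of "p - 1" "-1"] by simp
        also have "famact A dg l (p - 1) a (celld A dg del p x) = fzero A dg (p - 1)"
          unfolding xc(2) by (rule famact_zero[OF a]) (use True in simp)
        finally show ?thesis using fx True 2 by (simp add: Mc_def cycles_def fsign_zero fadd_zero)
      next
        case lz: False
        then show ?thesis using fx 2 False by (simp add: Mc_def)
      qed
    next
      case 3
      then show ?thesis using x False famact_fam[OF a, of x dg I k "l + k"] by (simp add: Mc_def)
    qed
  qed
  have p_le: "Mc k = fam A dg I k" if "k > p" for k using that by (simp add: Mc_def)
  define M where "M = sub_dg cF.F Mc"
  have M_mod: "dg_module R A M" unfolding M_def
  proof (rule sub_dg_module[OF cF.F.dg_module_axioms]; unfold cell_mod_simps fmod_simps)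
    show "Mc k \<subseteq> fam A dg I k" for k by (rule McI)
    show "fzero A dg k \<in> Mc k" for k using fzero_fam by (auto simp: Mc_def cycles_def cF.cd_zero)
    show "fadd A dg k x y \<in> Mc k" if "x \<in> Mc k" "y \<in> Mc k" for k x y
      using that by (auto simp: Mc_def cycles_def fadd_zero fadd_fam cF.cd_add split: if_splits)
    show "\<ominus>\<^bsub>fmod A dg I k\<^esub> x \<in> Mc k" if x: "x \<in> Mc k" for k x
    proof -
      interpret Fk: abelian_group "fmod A dg I k" by (rule fmod_abelian_group)
      have xI: "x \<in> fam A dg I k" using x McI by blast
      show ?thesis using x xI Fk.a_inv_closed[of x] Fk.neg_zero cF.F.cplx.d_neg[of x k] cF.F.cplx.grp.neg_zero[of "k - 1"]
        by (auto simp: Mc_def cycles_def split: if_splits)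
    qed
    show "famact A dg l k a x \<in> Mc (l + k)" if "a \<in> carrier (gr A l)" "x \<in> Mc k" for l k a x
      by (rule Mc_act[OF that])
    show "celld A dg del k x \<in> Mc (k - 1)" if x: "x \<in> Mc k" for k x
    proof -
      have xI: "x \<in> fam A dg I k" using x McI by blast
      show ?thesis using x cF.cd_fam[OF xI] cF.cd_cd[OF xI] cF.cd_zero[of k] fzero_fam[of dg "k - 1" I]
        by (auto simp: Mc_def cycles_def cF.cd_zero split: if_splits)
    qed
  qed
  interpret M: dg_module R A M by (rule M_mod)
  have M_exact: "exact_at M k" for k
  proof -
    have "z \<in> boundaries M k" if z: "z \<in> cycles M k" for z
    proof (cases "k < p")
      case True
      then have "z = \<zero>\<^bsub>gr M k\<^esub>" using z by (simp add: cycles_def M_def Mc_def)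
      then show ?thesis using M.cplx.boundaries_zero by simp
    next
      case False
      have zF: "z \<in> fam A dg I k" "celld A dg del k z = fzero A dg (k - 1)" using z McI by (auto simp: cycles_def M_def)
      have "exact_at cF.F k" by (rule F_exact) (use False in \<open>simp add: p_def\<close>)
      then obtain y where "y \<in> fam A dg I (k + 1)" "z = celld A dg del (k + 1) y"
        using exact_atD[of cF.F k z] zF by auto
      then show ?thesis using False by (auto simp: boundaries_def M_def Mc_def)
    qed
    then show ?thesis by (auto simp: exact_at_def)
  qed
  have G_semifree: "semifree_module R A cG.F cG.gens"
    by (rule cG.cell_semifree_module[OF nontrivial G_low])
  interpret GF: semifree_pair R A cG.F cG.gens cF.F
    by (intro semifree_pair.intro G_semifree cF.F.dg_module_axioms)
  interpret GL: semifree_pair R A cG.F cG.gens cL.F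
    by (intro semifree_pair.intro G_semifree cL.F.dg_module_axioms)
  interpret GM: semifree_pair R A cG.F cG.gens M
    by (intro semifree_pair.intro G_semifree M_mod)
  \<comment> \<open>the form that is dual to the cell \<open>w\<close> and to the summand spanned by \<open>j0 v\<close>\<close>
  define g where "g e x = (if e = (dg' w, cG.gen w) then lam (x v) else 0)" for e :: "int \<times> ('k \<Rightarrow> 'a)" and x :: "'i \<Rightarrow> 'a"
  have g: "character (gr cL.F (t' - fst e)) (g e)" if "e \<in> cG.gens" for e
  proof (cases "e = (dg' w, cG.gen w)")
    case True
    have "c v \<in> carrier (gr A n)" if "c \<in> fam A dg L (n + i)" for c using famD[OF that, of v] by (simp add: i_def)
    then show ?thesis using True grp.character_add[OF lam]
      by (auto simp: character_def g_def t'_def t_def i_def fadd_def)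
  next
    case False then show ?thesis by (simp add: character_def g_def[abs_def])
  qed
  define b where "b = GL.ext_form g"
  have b: "form A cG.F cL.F t' b" unfolding b_def by (rule GL.ext_form_form[OF g])
  have b_basis: "b (fst e) k (snd e) x = g e x" if "e \<in> cG.gens" "fst e + k = t'" "x \<in> fam A dg L k" for e k x
    unfolding b_def using GL.ext_form_basis[OF g, of "fst e" k x "snd e"] that by simp
  define D where "D = cobd cG.F cL.F b"
  have D: "form A cG.F cL.F (t' + 1) D" unfolding D_def by (rule GL.PU.cobd_form[OF b])
  \<comment> \<open>On \<open>L \<inter> M\<close> the form \<open>b\<close> is a cocycle: minimality and the properties of \<open>lam\<close> say that \<open>x \<mapsto> lam (x v)\<close>
    annihilates multiples by \<open>A\<^sub>+\<close> and boundaries.\<close>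
  have D_basis: "D (dg' r) k (cG.gen r) x = 0"
    if r: "r \<in> I'" and x: "x \<in> fam A dg L k" and k: "k \<ge> p" and deg: "dg' r + k = t' + 1" for r k x
  proof -
    have "b (dg' r - 1) k c x = 0" if "c \<in> fam A dg' {s \<in> I'. dg' s < dg' r - 1} (dg' r - 1)" for c
      using that
    proof (induction rule: fam_induct)
      case zero
      then show ?case using GL.PU.form_zero_left[OF b, of "dg' r - 1" k x] deg x by simp
    next
      case (mon s a)
      let ?l = "dg' r - 1 - dg' s"
      have s: "s \<in> I'" "?l \<ge> 1" using mon(1) by auto
      have ax: "famact A dg ?l k a x \<in> fam A dg L (?l + k)" by (rule famact_fam[OF mon(2) x]) simp
      have "b (dg' r - 1) k (act cG.F ?l (dg' s) a (cG.gen s)) x = psign (dg' s * ?l) (b (dg' s) (?l + k) (cG.gen s) (act cL.F ?l k a x))"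
        by (rule form_balanced[OF b mon(2)]) (use s x deg cG.gen_fam[OF s(1)] in auto)
      also have "b (dg' s) (?l + k) (cG.gen s) (act cL.F ?l k a x) = g (dg' s, cG.gen s) (famact A dg ?l k a x)"
        using b_basis[of "(dg' s, cG.gen s)" "?l + k" "famact A dg ?l k a x"] s ax deg by (auto simp: cG.gens_def)
      also have "\<dots> = 0"
      proof (cases "(dg' s, cG.gen s) = (dg' w, cG.gen w)")
        case True
        have xv: "x v \<in> carrier (gr A (k - i))" using famD[OF x, of v] by (simp add: i_def)
        have "lam (mul A ?l (k - i) a (x v)) = 0"
          by (rule lam_mul[OF s(2) _ _ mon(2) xv]) (use k deg True in \<open>auto simp: p_def i_def t'_def\<close>)
        then show ?thesis using True by (simp add: g_def famact_def i_def)
      qed (auto simp: g_def)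
      finally show ?case using cG.mon_is_act[OF mon(2)] by simp
    next
      case (add c c')
      have "c \<in> fam A dg' I' (dg' r - 1)" "c' \<in> fam A dg' I' (dg' r - 1)"
        using add(1,2) fam_mono[of "{s \<in> I'. dg' s < dg' r - 1}" I' A dg' "dg' r - 1"] by auto
      then show ?case using form_add_left[OF b, of "dg' r - 1" k c c' x] add deg x by simp
    qed
    then have 1: "b (dg' r - 1) k (celld A dg' del' (dg' r) (cG.gen r)) x = 0"
      using cG.minimal_del_fam[OF G_min r] cG.d_gen[OF r] by simp
    have "g (dg' r, cG.gen r) (celld A dg del k x) = 0"
    proof (cases "(dg' r, cG.gen r) = (dg' w, cG.gen w)")
      case True
      then have k': "k = n + 1 + i" using deg by (simp add: t'_def i_def)
      have "lam (celld A dg del k x v) = 0" using x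
      proof (induction rule: fam_induct)
        case zero
        have "\<zero>\<^bsub>gr A (k - 1 - dg v)\<^esub> = \<zero>\<^bsub>gr A n\<^esub>" using k' by (simp add: i_def)
        then show ?case unfolding cL.cd_zero using lam_zero by (simp only: fzero_def)
      next
        case (mon q a)
        have qI: "q \<in> I" "dg q - 1 \<le> dg v" using mon(1) by (auto simp: L_def p_def)
        have dz: "del q v = \<zero>\<^bsub>gr A (dg q - 1 - dg v)\<^esub>" by (rule cF.minimal_del[OF F_min qI])
        have az: "mul A (k - dg q) (dg q - 1 - dg v) a \<zero>\<^bsub>gr A (dg q - 1 - dg v)\<^esub> = \<zero>\<^bsub>gr A n\<^esub>"
          by (rule mul_zero_right'[OF mon(2)]) (use k' in \<open>simp add: i_def\<close>)
        have kv: "k - 1 - dg v = n" using k' by (simp add: i_def)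
        have da: "dd A (k - dg q) a \<in> carrier (gr A n)" if "v = q" using mon(2) that kv by (intro d_cl) auto
        have "lam (dd A (k - dg q) a) = 0" if "v = q"
          using lam_d[of a] mon(2) that k' by (simp add: i_def add.commute)
        then show ?case unfolding cL.cd_mon[OF mon]
          using da lam_zero by (simp add: dmon_def fadd_def mon_def fsign_def famact_def dz az kv)
      next
        case (add c c')
        have "celld A dg del k c v \<in> carrier (gr A n)" "celld A dg del k c' v \<in> carrier (gr A n)"
          using famD[OF cL.cd_fam[OF add(1)], of v] famD[OF cL.cd_fam[OF add(2)], of v] k' by (simp_all add: i_def)
        moreover have "celld A dg del k (fadd A dg k c c') v = celld A dg del k c v \<oplus>\<^bsub>gr A n\<^esub> celld A dg del k c' v"
          unfolding cL.cd_add[OF add(1,2)] using k' by (simp add: fadd_def i_def)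
        ultimately show ?case using add grp.character_add[OF lam] by simp
      qed
      then show ?thesis by (simp add: g_def)
    qed (auto simp: g_def)
    moreover have "b (dg' r) (k - 1) (cG.gen r) (celld A dg del k x) = g (dg' r, cG.gen r) (celld A dg del k x)"
      using b_basis[of "(dg' r, cG.gen r)" "k - 1" "celld A dg del k x"] r deg cL.cd_fam[OF x] by (auto simp: cG.gens_def)
    ultimately show ?thesis using 1 by (simp add: D_def cobd_def)
  qed
  have D_zero: "D j k x' x = 0"
    if x': "x' \<in> fam A dg' I' j" and x: "x \<in> fam A dg L k" "x \<in> Mc k" and k: "k \<ge> p" and deg: "j + k = t' + 1" for j k x' x
    using x'
  proof (induction rule: fam_induct)
    case zero
    then show ?case using GL.PU.form_zero_left[OF D deg, of x] x by simp
  next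
    case (mon r a)
    let ?l = "j - dg' r"
    have ax: "famact A dg ?l k a x \<in> fam A dg L (?l + k)" by (rule famact_fam[OF mon(2) x(1)]) simp
    have e: "D j k (act cG.F ?l (dg' r) a (cG.gen r)) x = psign (dg' r * ?l) (D (dg' r) (?l + k) (cG.gen r) (act cL.F ?l k a x))"
      by (rule form_balanced[OF D mon(2)]) (use mon x deg cG.gen_fam[OF mon(1)] in auto)
    have "D (dg' r) (?l + k) (cG.gen r) (act cL.F ?l k a x) = 0"
    proof (cases "?l < 0")
      case True
      then have "act cL.F ?l k a x = \<zero>\<^bsub>gr cL.F (?l + k)\<^esub>"
        using neg_degree[OF True mon(2)] famact_zero_left[OF x(1), of "?l + k" ?l] by simp
      then show ?thesis using GL.PU.form_zero_right[OF D, of "dg' r" "?l + k" "cG.gen r"] cG.gen_fam[OF mon(1)] deg by simp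
    next
      case False
      then show ?thesis using D_basis[OF mon(1) ax] k deg by simp
    qed
    then show ?case using e cG.mon_is_act[OF mon(2)] by simp
  next
    case (add c c')
    then show ?case using form_add_left[OF D deg, of c c' x] x by simp
  qed
  \<comment> \<open>As \<open>D\<close> vanishes on \<open>L \<inter> M\<close>, it descends to \<open>F/M\<close>. In degrees up to \<open>p\<close> the modules \<open>L\<close> and \<open>F\<close> coincide, so extending by zero to \<open>F\<close>
    defines the induced form.\<close>
  define b' where "b' j k x' x = (if k \<le> p then D j k x' x else 0)" for j k x' x
  have b': "form A cG.F cF.F (t' + 1) b'"
  proof (rule formI)
    fix j k x x' u assume "j + k = t' + 1" "x \<in> carrier (gr cG.F j)" "x' \<in> carrier (gr cG.F j)" "u \<in> carrier (gr cF.F k)"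
    then show "b' j k (x \<oplus>\<^bsub>gr cG.F j\<^esub> x') u = b' j k x u + b' j k x' u"
      using form_add_left[OF D, of j k x x' u] famL[of k u] by (simp add: b'_def)
  next
    fix j k x u u' assume "j + k = t' + 1" "x \<in> carrier (gr cG.F j)" "u \<in> carrier (gr cF.F k)" "u' \<in> carrier (gr cF.F k)"
    then show "b' j k x (u \<oplus>\<^bsub>gr cF.F k\<^esub> u') = b' j k x u + b' j k x u'"
      using form_add_right[OF D, of j k x u u'] famL[of k u] famL[of k u'] by (simp add: b'_def)
  next
    fix l j k m q a x u assume deg: "j + q = t' + 1" "m + k = t' + 1" "m = l + j" "q = l + k"
      and a: "a \<in> carrier (gr A l)" and x: "x \<in> carrier (gr cG.F j)" and u: "u \<in> carrier (gr cF.F k)"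
    have au: "famact A dg l k a u \<in> fam A dg I q" using famact_fam[OF a, of u dg I k q] u deg by simp
    have bal: "D m k (act cG.F l j a x) u = psign (j * l) (D j q x (act cL.F l k a u))" if "u \<in> fam A dg L k"
      by (rule form_balanced[OF D a x]) (use that deg in auto)
    consider "l < 0" | "k > p" "l \<ge> 0" | "k \<le> p" "q \<le> p" "l \<ge> 0" | "k \<le> p" "q > p" "l \<ge> 0" by linarith
    then show "psign (j * l) (b' m k (act cG.F l j a x) u) = b' j q x (act cF.F l k a u)"
    proof cases
      case 1
      have a0: "a = \<zero>\<^bsub>gr A l\<^esub>" by (rule neg_degree[OF 1 a])
      have "act cG.F l j a x = \<zero>\<^bsub>gr cG.F m\<^esub>" "act cF.F l k a u = \<zero>\<^bsub>gr cF.F q\<^esub>"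
        using cG.F.act_zero_left[OF x, of l] cF.F.act_zero_left[OF u, of l] deg a0 by simp_all
      then show ?thesis
        using GL.PU.form_zero_left[OF D deg(2), of u] GL.PU.form_zero_right[OF D deg(1), of x] u x famL[of k u]
        by (simp add: b'_def)
    next
      case 2 then show ?thesis using deg by (simp add: b'_def)
    next
      case 3
      then show ?thesis using bal u famL[of k u] by (simp add: b'_def psign_def)
    next
      case 4
      have uL: "u \<in> fam A dg L k" using u famL[of k u] 4 by simp
      have auL: "famact A dg l k a u \<in> fam A dg L q" using famact_fam[OF a uL] deg by simp
      have "D j q x (act cL.F l k a u) = 0"
        using D_zero[of x j "famact A dg l k a u" q] x auL au p_le[OF 4(2)] 4 deg by simp
      then show ?thesis using bal[OF uL] 4 by (simp add: b'_def)
    qed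
  qed
  have b'_M: "b' j k x' x = 0" if "x' \<in> fam A dg' I' j" "x \<in> Mc k" "j + k = t' + 1" for j k x' x
  proof -
    consider "k < p" | "k = p" | "k > p" by linarith
    then show ?thesis
    proof cases
      case 1
      then show ?thesis using GL.PU.form_zero_right[OF D that(3), of x'] that by (simp add: b'_def Mc_def)
    next
      case 2
      have "x \<in> fam A dg L k" using that(2) McI famL[of k x] 2 by auto
      then show ?thesis using D_zero[OF that(1) _ that(2) _ that(3)] 2 by (simp add: b'_def)
    qed (simp add: b'_def)
  qed
  have "cocycle_form A cG.F cF.F (t' + 1) b'"
    unfolding cocycle_form_def
  proof (intro conjI b' agreeI)
    fix j k x' x assume deg: "j + k = t' + 1 + 1" and x': "x' \<in> carrier (gr cG.F j)" and x: "x \<in> carrier (gr cF.F k)"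
    have dx: "celld A dg del k x \<in> fam A dg I (k - 1)" using cF.cd_fam x by simp
    consider "k \<le> p" | "k = p + 1" | "k > p + 1" by linarith
    then show "cobd cG.F cF.F b' j k x' x = 0"
    proof cases
      case 1
      have "cobd cG.F cF.F b' j k x' x = cobd cG.F cL.F D j k x' x" using 1 by (simp add: cobd_def b'_def)
      also have "\<dots> = 0" unfolding D_def
        by (rule GL.PU.cobd_cobd[OF b]) (use deg x' x 1 famL[of k x] in auto)
      finally show ?thesis .
    next
      case 2
      have "celld A dg del k x \<in> Mc (k - 1)" using dx cF.cd_cd[of x k] x 2 by (simp add: Mc_def cycles_def)
      then have "b' j (k - 1) x' (celld A dg del k x) = 0" using b'_M[of x' j _ "k - 1"] x' deg by simp
      then show ?thesis using 2 by (simp add: cobd_def b'_def)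
    next
      case 3 then show ?thesis by (simp add: cobd_def b'_def)
    qed
  qed
  moreover have "perp A cG.F cF.F (t' + 1)" by (rule GF) (use large in \<open>simp add: t'_def\<close>)
  ultimately obtain \<delta> where \<delta>: "form A cG.F cF.F t' \<delta>" "agree cG.F cF.F (t' + 1) b' (cobd cG.F cF.F \<delta>)"
    by (auto simp: perp_def)
  have \<delta>M: "form A cG.F M t' \<delta>"
    by (rule form_restrict[OF \<delta>(1)]) (use McI in \<open>auto simp: M_def\<close>)
  have cMF: "cobd cG.F M \<beta> = cobd cG.F cF.F \<beta>" for \<beta> by (rule cobd_dd_cong) (simp add: M_def)
  have cLF: "cobd cG.F cL.F \<beta> = cobd cG.F cF.F \<beta>" for \<beta> by (rule cobd_dd_cong) simp
  have "cocycle_form A cG.F M t' \<delta>"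
    unfolding cocycle_form_def cMF
  proof (intro conjI \<delta>M agreeI)
    fix j k x' x assume deg: "j + k = t' + 1" and x': "x' \<in> carrier (gr cG.F j)" and x: "x \<in> carrier (gr M k)"
    have xM: "x \<in> Mc k" using x by (simp add: M_def)
    have "b' j k x' x = cobd cG.F cF.F \<delta> j k x' x" using agreeD[OF \<delta>(2) deg x'] xM McI by auto
    then show "cobd cG.F cF.F \<delta> j k x' x = 0" using b'_M[OF _ xM deg] x' by simp
  qed
  moreover have "perp A cG.F M t'" by (rule GM.perp_if_exact) (rule M_exact)
  ultimately obtain \<eta> where \<eta>: "form A cG.F M (t' - 1) \<eta>" "agree cG.F M t' \<delta> (cobd cG.F M \<eta>)"
    by (auto simp: perp_def)
  \<comment> \<open>Next \<open>\<eta>\<close> is extended from \<open>M\<close> to \<open>F\<close>: its values on the basis of \<open>G\<close> are characters of \<open>M\<close>, which extend.\<close>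
  have "\<exists>h. character (gr cF.F (t' - 1 - fst e)) h \<and> (\<forall>x\<in>Mc (t' - 1 - fst e). h x = \<eta> (fst e) (t' - 1 - fst e) (snd e) x)"
    if e: "e \<in> cG.gens" for e
  proof -
    let ?k = "t' - 1 - fst e"
    have ec: "snd e \<in> carrier (gr cG.F (fst e))" using GF.basis_cl[of "fst e" "snd e"] e by simp
    have ch: "character (gr M ?k) (\<eta> (fst e) ?k (snd e))" by (rule GM.PU.form_char_right[OF \<eta>(1) _ ec]) simp
    obtain h where "character (gr cF.F ?k) h" "\<And>x. x \<in> carrier (gr M ?k) \<Longrightarrow> h x = \<eta> (fst e) ?k (snd e) x"
      by (rule character_factors[OF M.cplx.grp.abelian_group_axioms cF.F.cplx.grp.abelian_group_axioms, of ?k "\<lambda>x. x" ?k "\<eta> (fst e) ?k (snd e)"])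
        (use McI ch M.cplx.grp.character_zero[OF ch] in \<open>auto simp: M_def\<close>)
    then show ?thesis by (auto simp: M_def)
  qed
  then obtain h where h: "\<And>e. e \<in> cG.gens \<Longrightarrow> character (gr cF.F (t' - 1 - fst e)) (h e)"
    "\<And>e x. e \<in> cG.gens \<Longrightarrow> x \<in> Mc (t' - 1 - fst e) \<Longrightarrow> h e x = \<eta> (fst e) (t' - 1 - fst e) (snd e) x"
    by metis
  define \<eta>' where "\<eta>' = GF.ext_form h"
  have \<eta>': "form A cG.F cF.F (t' - 1) \<eta>'" unfolding \<eta>'_def by (rule GF.ext_form_form[OF h(1)])
  have \<eta>'M: "agree cG.F M (t' - 1) \<eta>' \<eta>"
  proof (rule GM.form_eq_on_basis[OF _ \<eta>(1)])
    show "form A cG.F M (t' - 1) \<eta>'"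
      by (rule form_restrict[OF \<eta>']) (use McI in \<open>auto simp: M_def\<close>)
    fix k e x assume e: "(k, e) \<in> cG.gens" and x: "x \<in> carrier (gr M (t' - 1 - k))"
    have xM: "x \<in> Mc (t' - 1 - k)" using x by (simp add: M_def)
    have "\<eta>' k (t' - 1 - k) e x = h (k, e) x"
      unfolding \<eta>'_def by (rule GF.ext_form_basis[OF h(1) _ _ e]) (use xM McI in auto)
    then show "\<eta>' k (t' - 1 - k) e x = \<eta> k (t' - 1 - k) e x" using h(2)[OF e, of x] xM by simp
  qed
  \<comment> \<open>Now \<open>\<gamma>\<close> has the coboundary \<open>b'\<close> and vanishes on \<open>M\<close>, so it is a bounding form on \<open>F/M\<close>.\<close>
  define \<gamma> where "\<gamma> j k x' x = \<delta> j k x' x - cobd cG.F cF.F \<eta>' j k x' x" for j k x' x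
  have c\<eta>': "form A cG.F cF.F t' (cobd cG.F cF.F \<eta>')" using GF.PU.cobd_form[OF \<eta>'] by simp
  have \<gamma>: "form A cG.F cF.F t' \<gamma>" unfolding \<gamma>_def by (rule GF.PU.form_diff[OF \<delta>(1) c\<eta>'])
  have \<gamma>_M: "\<gamma> j k x' x = 0" if x': "x' \<in> fam A dg' I' j" and x: "x \<in> Mc k" and deg: "j + k = t'" for j k x' x
  proof -
    have xM: "x \<in> carrier (gr M k)" using x by (simp add: M_def)
    have dxM: "celld A dg del k x \<in> carrier (gr M (k - 1))" using M.cplx.d_closed[OF xM] by (simp add: M_def)
    have "\<delta> j k x' x = cobd cG.F M \<eta> j k x' x" by (rule agreeD[OF \<eta>(2) deg _ xM]) (use x' in simp)
    also have "\<dots> = cobd cG.F cF.F \<eta>' j k x' x"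
      using agreeD[OF \<eta>'M, of "j - 1" k "celld A dg' del' j x'" x] agreeD[OF \<eta>'M, of j "k - 1" x' "celld A dg del k x"]
        cG.cd_fam[OF x'] x' xM dxM deg by (simp add: cobd_def M_def)
    finally show ?thesis by (simp add: \<gamma>_def)
  qed
  have \<gamma>L: "form A cG.F cL.F t' \<gamma>" by (rule form_restrict[OF \<gamma>]) (use famLI in \<open>auto simp: fmod_def\<close>)
  \<comment> \<open>The difference is a cocycle on \<open>L\<close>, where every cocycle of this degree is a coboundary.\<close>
  define \<epsilon>0 where "\<epsilon>0 j k x' x = b j k x' x - \<gamma> j k x' x" for j k x' x
  have "cocycle_form A cG.F cL.F t' \<epsilon>0"
    unfolding cocycle_form_def
  proof (intro conjI agreeI)
    show "form A cG.F cL.F t' \<epsilon>0" unfolding \<epsilon>0_def by (rule GL.PU.form_diff[OF b \<gamma>L])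
    fix j k x' x assume deg: "j + k = t' + 1" and x': "x' \<in> carrier (gr cG.F j)" and x: "x \<in> carrier (gr cL.F k)"
    have xI: "x \<in> fam A dg I k" using x famLI by simp
    have "cobd cG.F cF.F \<gamma> j k x' x = cobd cG.F cF.F \<delta> j k x' x - cobd cG.F cF.F (cobd cG.F cF.F \<eta>') j k x' x"
      by (simp add: cobd_def \<gamma>_def psign_def)
    also have "cobd cG.F cF.F (cobd cG.F cF.F \<eta>') j k x' x = 0"
      by (rule GF.PU.cobd_cobd[OF \<eta>']) (use deg x' xI in auto)
    also have "cobd cG.F cF.F \<delta> j k x' x = b' j k x' x" using agreeD[OF \<delta>(2) deg x'] xI by simp
    finally have c\<gamma>: "cobd cG.F cF.F \<gamma> j k x' x = b' j k x' x" by simp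
    have "b' j k x' x = D j k x' x"
    proof (cases "k \<le> p")
      case True then show ?thesis by (simp add: b'_def)
    next
      case False
      then show ?thesis using D_zero[of x' j x k] x' x xI p_le[of k] deg by (simp add: b'_def)
    qed
    moreover have "cobd cG.F cL.F \<epsilon>0 j k x' x = D j k x' x - cobd cG.F cF.F \<gamma> j k x' x"
      unfolding D_def cLF by (simp add: cobd_def \<epsilon>0_def psign_def)
    ultimately show "cobd cG.F cL.F \<epsilon>0 j k x' x = 0" using c\<gamma> by simp
  qed
  moreover have "perp A cG.F cL.F t'"
  proof (rule perp_swap[OF cL.F.dg_module_axioms cG.F.dg_module_axioms])
    have LL: "semifree_module R A cL.F cL.gens"
      by (rule cL.cell_semifree_module[OF nontrivial, of s0]) (use F_low LI in auto)
    interpret LG: semifree_pair R A cL.F cL.gens cG.F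
      by (intro semifree_pair.intro LL cG.F.dg_module_axioms)
    show "perp A cL.F cG.F t'"
    proof (rule LG.perp_if_exact)
      fix k e assume "(k, e) \<in> cL.gens"
      then have "k \<le> p" unfolding cL.gens_def by (auto simp: L_def)
      then show "exact_at cG.F (t' - k)" using large by (intro G_exact) (simp add: t'_def p_def)
    qed
  qed
  ultimately obtain \<epsilon> where \<epsilon>: "form A cG.F cL.F (t' - 1) \<epsilon>" "agree cG.F cL.F t' \<epsilon>0 (cobd cG.F cL.F \<epsilon>)"
    by (auto simp: perp_def)
  \<comment> \<open>Evaluation at \<open>(w, y)\<close>: the cocycle has the value \<open>lam j0\<close>, as \<open>y\<close> lies in \<open>M\<close>. The coboundary that it equals is zero there, because
    \<open>y\<close> is a cycle and \<open>d w\<close> has coefficients in \<open>A\<^sub>+\<close>, which annihilate \<open>y\<close>.\<close>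
  define y where "y = mon A dg (n + i) v j0"
  have j0': "j0 \<in> carrier (gr A (n + i - dg v))" using j0 by (simp add: i_def)
  have vL: "v \<in> L" using v by (simp add: L_def p_def)
  have yL: "y \<in> fam A dg L (n + i)" unfolding y_def by (rule mon_fam[where dg = dg, OF vL j0'])
  have dy: "celld A dg del (n + i) y = fzero A dg (n + i - 1)"
  proof -
    have z1: "mon A dg (n + i - 1) v (dd A (n + i - dg v) j0) = fzero A dg (n + i - 1)"
      using mon_zero[of dg "n + i - 1" v] d_j0 by (simp add: i_def)
    have "mul A n (dg v - 1 - dg r) j0 (del v r) = \<zero>\<^bsub>gr A (n + i - 1 - dg r)\<^esub>" for r
    proof (cases "dg v - 1 \<le> dg r")
      case True
      show ?thesis unfolding cF.minimal_del[OF F_min v True] by (rule mul_zero_right'[OF j0]) (simp add: i_def)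
    next
      case False
      then show ?thesis using famD[OF cF.del_fam[OF v], of r] by (intro mul_j0) (auto simp: i_def)
    qed
    then have z2: "famact A dg (n + i - dg v) (dg v - 1) j0 (del v) = fzero A dg (n + i - 1)"
      by (simp add: famact_def fzero_def i_def)
    show ?thesis unfolding y_def cL.cd_mon[OF vL j0'] dmon_def z1 z2 by (simp add: fsign_zero fadd_zero)
  qed
  have yM: "y \<in> Mc (n + i)"
    using famLI[OF yL] dy n_pos by (auto simp: Mc_def cycles_def p_def i_def add.commute)
  have gw: "cG.gen w \<in> fam A dg' I' t" using cG.gen_fam[OF w] by (simp add: t_def)
  have wE: "(dg' w, cG.gen w) \<in> cG.gens" using w by (auto simp: cG.gens_def)
  have deg: "t + (n + i) = t'" by (simp add: t_def t'_def i_def)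
  have "b t (n + i) (cG.gen w) y = lam j0"
    using b_basis[OF wE, of "n + i" y] yL deg by (simp add: g_def t_def y_def mon_def)
  moreover have "\<gamma> t (n + i) (cG.gen w) y = 0" by (rule \<gamma>_M[OF gw yM deg])
  ultimately have "\<epsilon>0 t (n + i) (cG.gen w) y = lam j0" by (simp add: \<epsilon>0_def)
  moreover have "\<epsilon>0 t (n + i) (cG.gen w) y = cobd cG.F cL.F \<epsilon> t (n + i) (cG.gen w) y"
    by (rule agreeD[OF \<epsilon>(2) deg]) (use gw yL in auto)
  moreover have "\<epsilon> t (n + i - 1) (cG.gen w) (fzero A dg (n + i - 1)) = 0"
    using GL.PU.form_zero_right[OF \<epsilon>(1), of t "n + i - 1" "cG.gen w"] gw deg by simp
  moreover have "\<epsilon> (t - 1) (n + i) c y = 0" if "c \<in> fam A dg' {s \<in> I'. dg' s < t - 1} (t - 1)" for c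
    using that
  proof (induction rule: fam_induct)
    case zero
    then show ?case using GL.PU.form_zero_left[OF \<epsilon>(1), of "t - 1" "n + i" y] yL deg by simp
  next
    case (mon s a)
    let ?l = "t - 1 - dg' s"
    have s: "s \<in> I'" "?l \<ge> 1" using mon(1) by auto
    have "\<epsilon> (t - 1) (n + i) (act cG.F ?l (dg' s) a (cG.gen s)) y = psign (dg' s * ?l) (\<epsilon> (dg' s) (?l + (n + i)) (cG.gen s) (act cL.F ?l (n + i) a y))"
      by (rule form_balanced[OF \<epsilon>(1) mon(2)]) (use s yL deg cG.gen_fam[OF s(1)] in auto)
    also have "act cL.F ?l (n + i) a y = fzero A dg (?l + (n + i))"
    proof -
      have "act cL.F ?l (n + i) a y = mon A dg (?l + (n + i)) v (mul A ?l (n + i - dg v) a j0)"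
        unfolding y_def cell_mod_simps by (rule famact_mon[where dg = dg and q = v, OF mon(2) j0']) simp
      also have "mul A ?l (n + i - dg v) a j0 = \<zero>\<^bsub>gr A (?l + (n + i) - dg v)\<^esub>"
        using j0_mul[OF s(2) mon(2)] by (simp add: i_def algebra_simps)
      finally show ?thesis by (simp only: mon_zero)
    qed
    also have "\<epsilon> (dg' s) (?l + (n + i)) (cG.gen s) (fzero A dg (?l + (n + i))) = 0"
      using GL.PU.form_zero_right[OF \<epsilon>(1), of "dg' s" "?l + (n + i)" "cG.gen s"] cG.gen_fam[OF s(1)] deg by simp
    finally show ?case using cG.mon_is_act[OF mon(2)] by simp
  next
    case (add c c')
    have "c \<in> fam A dg' I' (t - 1)" "c' \<in> fam A dg' I' (t - 1)"
      using add(1,2) fam_mono[of "{s \<in> I'. dg' s < t - 1}" I' A dg' "t - 1"] by auto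
    then show ?case using form_add_left[OF \<epsilon>(1), of "t - 1" "n + i" c c' y] add deg yL by simp
  qed
  then have "\<epsilon> (t - 1) (n + i) (celld A dg' del' t (cG.gen w)) y = 0"
    using cG.minimal_del_fam[OF G_min w] cG.d_gen[OF w] by (simp add: t_def)
  ultimately show False using lam_j0 dy by (simp add: cobd_def)
qed

end

lemma (in cells) bounded_cell_mod:
  assumes A_bounded: "\<And>i. i > N \<Longrightarrow> carrier (gr A i) = {\<zero>\<^bsub>gr A i\<^esub>}"
    and dg: "\<And>q. q \<in> I \<Longrightarrow> s0 \<le> dg q" "\<And>q. q \<in> I \<Longrightarrow> dg q \<le> D"
  shows "bounded_dg_module (cell_mod A dg del I)"
  unfolding bounded_dg_module_def
proof (intro exI allI impI)
  fix i assume i: "\<bar>i\<bar> > max \<bar>s0\<bar> \<bar>D + N\<bar>"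
  have "c = fzero A dg i" if c: "c \<in> fam A dg I i" for c
  proof
    fix q show "c q = fzero A dg i q"
    proof (cases "q \<in> I")
      case False then show ?thesis using fam_zero_outside[OF c] by (simp add: fzero_def)
    next
      case True
      have "i - dg q < 0 \<or> i - dg q > N" using dg[OF True] i by linarith
      then show ?thesis using famD[OF c, of q] neg_degree[of "i - dg q" "c q"] A_bounded[of "i - dg q"] by (auto simp: fzero_def)
    qed
  qed
  then show "zero_module (gr (cell_mod A dg del I) i)" using fzero_fam by (auto simp: zero_module_def)
qed

text \<open>Bounds on the homology of a module become bounds on the homology of its resolutions.\<close>

lemma (in dg_morphism) exact_at_source:
  assumes "elementwise_qi" "exact_at V k" shows "exact_at U k"
  using assms f_d f_cl unfolding elementwise_qi_def exact_at_def cycles_def by fastforce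

lemma (in cells_map) semifree_resolution_cells:
  assumes "unt A \<noteq> \<zero>\<^bsub>gr A 0\<^esub>" "\<And>q. q \<in> I \<Longrightarrow> s0 \<le> dg q" "quasi_iso A (cell_mod A dg del I) X (cellf A dg X fq)"
  shows "semifree_resolution R A X (cell_mod A dg del I)"
  unfolding semifree_resolution_def semifree_def
  using F.dg_module_axioms cell_semibasis[OF assms(1,2)] assms(3) by blast

text \<open>
  If the minimal resolution of \<open>X\<close> has cells in bounded degrees then it is bounded, because \<open>A\<close> is. Otherwise it has
  a cell \<open>v\<close> above the homology of \<open>X\<close>, and this bounds the cells of the minimal resolution of \<open>Y\<close>.
\<close>

theorem (in socle_dga) pd_finite_if_Tor_vanishes:
  fixes X :: "('r, 'a, 'x) dg_mod" and Y :: "('r, 'a, 'y) dg_mod"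
  assumes X: "dg_module R A X" and X_low: "\<And>i. i < sX \<Longrightarrow> exact_at X i" and X_high: "\<And>i. i > bX \<Longrightarrow> exact_at X i"
    and Y: "dg_module R A Y" and Y_low: "\<And>i. i < sY \<Longrightarrow> exact_at Y i" and Y_high: "\<And>i. i > bY \<Longrightarrow> exact_at Y i"
    and Tor: "\<And>t. t > T0 \<Longrightarrow> zero_module (Tor R A t X Y)"
  shows "pd_finite R A X \<or> pd_finite R A Y"
proof -
  obtain dg and del :: "nat \<times> 'a \<times> 'x \<Rightarrow> nat \<times> 'a \<times> 'x \<Rightarrow> 'a" and I fq
    where cX: "cells_map R A dg del I X fq" and dgX: "\<And>q. q \<in> I \<Longrightarrow> sX \<le> dg q"
      and minX: "\<And>q p. q \<in> I \<Longrightarrow> p \<in> I \<Longrightarrow> dg p = dg q - 1 \<Longrightarrow> del q p = \<zero>\<^bsub>gr A 0\<^esub>"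
      and qX: "quasi_iso A (cell_mod A dg del I) X (cellf A dg X fq)"
    using ex_minimal_resolution[OF X X_low] by blast
  obtain dg' and del' :: "nat \<times> 'a \<times> 'y \<Rightarrow> nat \<times> 'a \<times> 'y \<Rightarrow> 'a" and I' fq'
    where cY: "cells_map R A dg' del' I' Y fq'" and dgY: "\<And>q. q \<in> I' \<Longrightarrow> sY \<le> dg' q"
      and minY: "\<And>q p. q \<in> I' \<Longrightarrow> p \<in> I' \<Longrightarrow> dg' p = dg' q - 1 \<Longrightarrow> del' q p = \<zero>\<^bsub>gr A 0\<^esub>"
      and qY: "quasi_iso A (cell_mod A dg' del' I') Y (cellf A dg' Y fq')"
    using ex_minimal_resolution[OF Y Y_low] by blast
  interpret cX: cells_map R A dg del I X fq by (rule cX)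
  interpret cY: cells_map R A dg' del' I' Y fq' by (rule cY)
  have resX: "semifree_resolution R A X cX.F" by (rule cX.semifree_resolution_cells[OF nontrivial dgX qX])
  have resY: "semifree_resolution R A Y cY.F" by (rule cY.semifree_resolution_cells[OF nontrivial dgY qY])
  have eqX: "cX.f.elementwise_qi" using qX cX.f.quasi_iso_iff by blast
  have eqY: "cY.f.elementwise_qi" using qY cY.f.quasi_iso_iff by blast
  define P where "P = (SOME F :: ('r, 'a, 'x) resolution. semifree_resolution R A X F)"
  have P: "semifree_resolution R A X P" unfolding P_def using resX by (rule someI)
  obtain E f where E: "dg_module R A P" "semibasis A P E" and f: "quasi_iso A P X f"
    using P by (auto simp: semifree_resolution_def semifree_def)
  interpret P: semifree_module R A P E by (intro semifree_module.intro semifree_module_axioms.intro E)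
  interpret PX: dg_morphism R A P X f
    using f by (intro dg_morphism.intro E(1) X dg_morphism_axioms.intro) (simp add: quasi_iso_def)
  have eqP: "PX.elementwise_qi" using f PX.quasi_iso_iff by blast
  \<comment> \<open>\<open>Tor\<close> is computed by the chosen resolution \<open>P\<close>, which need not be minimal; the quasi-isomorphisms to \<open>X\<close> and
    \<open>Y\<close> lead from it to the minimal resolutions.\<close>
  have GF: "perp A cY.F cX.F t" if t: "t > T0" for t
  proof -
    interpret PY: dg_pair R A P Y by (intro dg_pair.intro E(1) Y)
    have sG: "semifree_module R A cY.F cY.gens" by (rule cY.cell_semifree_module[OF nontrivial dgY])
    have "perp A P Y t"
      by (rule PY.perp_if_tensor_zero) (use Tor[OF t] in \<open>simp add: Tor_def derived_tensor_product_def P_def\<close>)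
    then have "perp A P cY.F t"
      using perp_quasi_iso[OF P.semifree_module_axioms cY.f.dg_morphism_axioms eqY] by blast
    then have "perp A cY.F P t" by (rule perp_swap[OF E(1) cY.F.dg_module_axioms])
    then have "perp A cY.F X t" using perp_quasi_iso[OF sG PX.dg_morphism_axioms eqP] by blast
    then show ?thesis using perp_quasi_iso[OF sG cX.f.dg_morphism_axioms eqX] by blast
  qed
  show ?thesis
  proof (cases "\<exists>v\<in>I. dg v > bX")
    case False
    then have "bounded_dg_module cX.F" by (intro cX.bounded_cell_mod[where D = bX, OF bounded dgX]) (auto simp: not_less)
    then show ?thesis using resX by (auto simp: pd_finite_def)
  next
    case True
    then obtain v where v: "v \<in> I" "dg v > bX" by blast
    have "dg' w \<le> max T0 (bY + dg v + 1) - n - dg v" if w: "w \<in> I'" for w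
    proof (rule cells_bounded[OF cX.cells_axioms _ dgX cY.cells_axioms _ dgY v(1) _ _ GF w])
      show "minimal_cells A dg del I" "minimal_cells A dg' del' I'" using minX minY by (auto simp: minimal_cells_def)
      show "exact_at cX.F k" if "k > dg v" for k
        by (rule cX.f.exact_at_source[OF eqX X_high]) (use that v in simp)
      show "exact_at cY.F k" if "k > bY" for k
        by (rule cY.f.exact_at_source[OF eqY Y_high]) (use that in simp)
    qed
    then have "bounded_dg_module cY.F" by (intro cY.bounded_cell_mod[OF bounded dgY]) auto
    then show ?thesis using resY by (auto simp: pd_finite_def)
  qed
qed

section \<open>Trivial extensions by a shifted residue field\<close>

text \<open>
  Boundaries have the class zero in \<open>H\<^sub>0(B)\<close>, which lies in the maximal ideal, so they belong to the augmentation ideal,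
  whose part in degree zero vanishes. Thus \<open>H\<^sub>0(B)\<close> is \<open>B\<^sub>0\<close>, and its maximal ideal is zero.
\<close>

lemma local_plus_field:
  assumes "local_dg_algebra_plus R \<mm> B"
  shows "field_dga R B"
proof -
  have loc: "dg_algebra R B" "cring (H0 B)" "maximalideal (max_ideal (H0 B)) (H0 B)"
    and uniq: "\<And>J. maximalideal J (H0 B) \<Longrightarrow> J = max_ideal (H0 B)"
    and aug: "augmentation_ideal B 0 = {\<zero>\<^bsub>gr B 0\<^esub>}"
    using assms fun_cong[of "augmentation_ideal B" "positive_part B" 0]
    unfolding local_dg_algebra_plus_def local_dg_algebra_def local_ring_def positive_part_def by auto
  interpret B: dg_algebra R B by (rule loc)
  interpret H: cring "H0 B" by (rule loc)
  interpret M: maximalideal "max_ideal (H0 B)" "H0 B" by (rule loc)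
  let ?c = "\<lambda>a. boundaries B 0 +>\<^bsub>gr B 0\<^esub> a"
  have bc: "b \<in> carrier (gr B 0)" if "b \<in> boundaries B 0" for b using that B.boundaries_closed by blast
  have coset: "?c b = boundaries B 0" if "b \<in> boundaries B 0" for b
    using B.boundary_coset_eq_iff[OF bc[OF that] B.grp.zero_closed] that bc[OF that] B.boundaries_coset_zero by simp
  have r0: "a_r_coset (ring0 B) (boundaries B 0) x = ?c x" for x
    by (simp add: a_r_coset_def' ring0_def)
  have Hc: "carrier (H0 B) = ?c ` carrier (gr B 0)"
    by (auto simp: H0_def FactRing_def A_RCOSETS_def' r0) (auto simp: ring0_def)
  have H_zero: "\<zero>\<^bsub>H0 B\<^esub> = boundaries B 0" and H_one: "\<one>\<^bsub>H0 B\<^esub> = ?c (unt B)"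
    by (simp_all add: H0_def FactRing_def r0) (simp add: ring0_def)
  have Max_zero: "max_ideal (H0 B) = {\<zero>\<^bsub>H0 B\<^esub>}"
  proof -
    have "C = \<zero>\<^bsub>H0 B\<^esub>" if C: "C \<in> max_ideal (H0 B)" for C
    proof -
      have "C \<in> ?c ` carrier (gr B 0)" using M.Icarr[OF C] Hc by simp
      then obtain a where a: "a \<in> carrier (gr B 0)" "C = ?c a" by blast
      then have "a \<in> augmentation_ideal B 0" using C by (simp add: augmentation_ideal_def)
      then have "a = \<zero>\<^bsub>gr B 0\<^esub>" using aug by simp
      then show ?thesis using a B.boundaries_coset_zero H_zero by simp
    qed
    then show ?thesis using M.zero_closed by blast
  qed
  have boundaries_trivial: "b = \<zero>\<^bsub>gr B 0\<^esub>" if b: "b \<in> boundaries B 0" for b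
  proof -
    have "b \<in> augmentation_ideal B 0"
      using bc[OF b] coset[OF b] H_zero Max_zero by (simp add: augmentation_ideal_def)
    then show ?thesis using aug by simp
  qed
  have bd: "boundaries B 0 = {\<zero>\<^bsub>gr B 0\<^esub>}" using boundaries_trivial B.boundaries_zero by blast
  have c1: "?c x = {x}" if "x \<in> carrier (gr B 0)" for x unfolding bd using that by (simp add: a_r_coset_def')
  have c_inj: "a = a'" if "?c a = ?c a'" "a \<in> carrier (gr B 0)" "a' \<in> carrier (gr B 0)" for a a'
    using that c1 by simp
  have H_one_zero: "\<one>\<^bsub>H0 B\<^esub> \<noteq> \<zero>\<^bsub>H0 B\<^esub>"
    using M.I_notcarr Max_zero H.one_zeroD by metis
  have H_mult: "?c a \<otimes>\<^bsub>H0 B\<^esub> ?c b = ?c (mul B 0 0 a b)" if "a \<in> carrier (gr B 0)" "b \<in> carrier (gr B 0)" for a b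
  proof -
    have cl: "mul B 0 0 a b \<in> carrier (gr B 0)" using that by (intro B.mul_cl) auto
    have "?c a \<otimes>\<^bsub>H0 B\<^esub> ?c b = ?c (mul B 0 0 a b)"
      unfolding H0_def FactRing_def using that cl
      by (simp add: rcoset_mult_def r0 c1) (simp add: ring0_def c1)
    then show ?thesis .
  qed
  have H_field: "field (H0 B)"
  proof (rule H.trivialideals_fieldI)
    show "carrier (H0 B) \<noteq> {\<zero>\<^bsub>H0 B\<^esub>}" using H_one_zero H.one_closed by blast
    show "{I. ideal I (H0 B)} = {{\<zero>\<^bsub>H0 B\<^esub>}, carrier (H0 B)}"
    proof
      show "{I. ideal I (H0 B)} \<subseteq> {{\<zero>\<^bsub>H0 B\<^esub>}, carrier (H0 B)}"
      proof
        fix I assume "I \<in> {I. ideal I (H0 B)}"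
        then interpret I: ideal I "H0 B" by simp
        have "I = max_ideal (H0 B) \<or> I = carrier (H0 B)"
          using M.I_maximal[OF I.is_ideal] I.a_subset I.zero_closed Max_zero by auto
        then show "I \<in> {{\<zero>\<^bsub>H0 B\<^esub>}, carrier (H0 B)}" using Max_zero by auto
      qed
    qed (use H.zeroideal H.oneideal in auto)
  qed
  show ?thesis
  proof (intro field_dga.intro loc(1) field_dga_axioms.intro)
    show "unt B \<noteq> \<zero>\<^bsub>gr B 0\<^esub>" using H_one_zero H_one H_zero B.boundaries_coset_zero by auto
    fix a assume a: "a \<in> carrier (gr B 0)" "a \<noteq> \<zero>\<^bsub>gr B 0\<^esub>"
    interpret Hf: field "H0 B" by (rule H_field)
    have "?c a \<noteq> \<zero>\<^bsub>H0 B\<^esub>" using c_inj[of a "\<zero>\<^bsub>gr B 0\<^esub>"] a H_zero B.boundaries_coset_zero by auto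
    then have "?c a \<in> Units (H0 B)" using a Hc Hf.field_Units by auto
    then obtain C where C: "C \<in> carrier (H0 B)" "C \<otimes>\<^bsub>H0 B\<^esub> ?c a = \<one>\<^bsub>H0 B\<^esub>" by (auto simp: Units_def)
    then obtain b where b: "b \<in> carrier (gr B 0)" "C = ?c b" using Hc by auto
    have "?c (mul B 0 0 b a) = ?c (unt B)" using C b a H_mult H_one by simp
    then have "mul B 0 0 b a = unt B" by (rule c_inj) (use a b B.unt_closed in \<open>auto intro: B.mul_cl\<close>)
    then show "\<exists>b\<in>carrier (gr B 0). mul B 0 0 b a = unt B" using b by blast
  qed
qed

context
  fixes R :: "('r, 's) ring_scheme" and B :: "('r, 'b) dg_alg" and n :: int and A :: "('r, 'b \<times> 'b) dg_alg"
  assumes B: "field_dga R B" and n: "n \<ge> 1" and A_def: "A = B \<ltimes> shift n (residue_module B)"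
    and A_alg: "dg_algebra R A"
begin

interpretation B: field_dga R B by (rule B)
interpretation A: dg_algebra R A by (rule A_alg)

lemma trivial_extension_simps:
  "carrier (gr A i) = carrier (gr B i) \<times> (if i = n then carrier (gr B 0) else {\<zero>\<^bsub>gr B (i - n)\<^esub>})"
  "\<zero>\<^bsub>gr A i\<^esub> = (\<zero>\<^bsub>gr B i\<^esub>, \<zero>\<^bsub>gr B (i - n)\<^esub>)"
  "(a, x) \<oplus>\<^bsub>gr A i\<^esub> (b, y) = (a \<oplus>\<^bsub>gr B i\<^esub> b, x \<oplus>\<^bsub>gr B (i - n)\<^esub> y)"
  "unt A = (unt B, \<zero>\<^bsub>gr B (- n)\<^esub>)"
  by (simp_all add: A_def trivial_extension_def direct_sum_module_def shift_def residue_module_def)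

text \<open>
  The negative in a component of the residue module refers to the carrier of that component, which is a
  singleton outside degree zero; it is not the negative of \<open>B\<close>.
\<close>

lemma ksign_residue_zero: "ksign (if i = 0 then gr B 0 else (gr B i)\<lparr>carrier := {\<zero>\<^bsub>gr B i\<^esub>}\<rparr>) j \<zero>\<^bsub>gr B i\<^esub> = \<zero>\<^bsub>gr B i\<^esub>"
proof -
  have "\<ominus>\<^bsub>(gr B i)\<lparr>carrier := {\<zero>\<^bsub>gr B i\<^esub>}\<rparr>\<^esub> \<zero>\<^bsub>gr B i\<^esub> = \<zero>\<^bsub>gr B i\<^esub>"
  proof -
    let ?M = "(gr B i)\<lparr>carrier := {\<zero>\<^bsub>gr B i\<^esub>}\<rparr>"
    interpret M: abelian_group ?M by (rule abelian_groupI) auto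
    show ?thesis using M.neg_zero by simp
  qed
  then show ?thesis by (simp add: ksign_def)
qed

lemma trivial_extension_d: "dd A i (b, m) = (dd B i b, \<zero>\<^bsub>gr B (i - n - 1)\<^esub>)"
  using ksign_residue_zero[of "i - n - 1" n]
  by (simp add: A_def trivial_extension_def shift_def residue_module_def)

text \<open>In positive degrees both actions on \<open>\<Sigma>\<^sup>n k\<close> are zero.\<close>

lemma trivial_extension_mul_high:
  assumes "i \<ge> 1" "j \<ge> 1"
  shows "mul A i j (b, m) (b', m') = (mul B i j b b', \<zero>\<^bsub>gr B (i + j - n)\<^esub>)"
  using assms ksign_residue_zero[of "i + j - n"]
  by (auto simp: A_def trivial_extension_def shift_def residue_module_def add_diff_eq add.commute)

lemma trivial_extension_mul_zero:
  assumes "b \<in> carrier (gr B 0)" "b' \<in> carrier (gr B 0)"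
  shows "mul A 0 0 (b, \<zero>\<^bsub>gr B (- n)\<^esub>) (b', \<zero>\<^bsub>gr B (- n)\<^esub>) = (mul B 0 0 b b', \<zero>\<^bsub>gr B (- n)\<^esub>)"
  using assms n ksign_residue_zero[of "- n"]
  by (auto simp: A_def trivial_extension_def shift_def residue_module_def)

text \<open>
  The socle element is the generator \<open>(0, 1)\<close> of the summand \<open>\<Sigma>\<^sup>n k\<close>, and \<open>lam\<close> is a character of \<open>k\<close> on the
  second component. Products of elements of positive degree and boundaries have second component zero.
\<close>

lemma trivial_extension_socle_dga:
  assumes bdd: "bounded_dg_algebra B"
  obtains N j0 lam where "socle_dga R A n N j0 lam"
proof -
  obtain N where N: "\<And>i. i > N \<Longrightarrow> carrier (gr B i) = {\<zero>\<^bsub>gr B i\<^esub>}"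
    using bdd by (auto simp: bounded_dg_algebra_def zero_module_def)
  obtain \<chi> where \<chi>: "character (gr B 0) \<chi>" "\<chi> (unt B) \<noteq> 0"
    by (rule B.grp.character_neq_zero[of "{\<zero>\<^bsub>gr B 0\<^esub>}" 0 "unt B"])
      (use B.nontrivial B.unt_closed in \<open>auto intro!: subgroup.intro simp: a_inv_def[symmetric]\<close>)
  have field: "field_dga R A"
  proof (intro field_dga.intro A_alg field_dga_axioms.intro)
    show "unt A \<noteq> \<zero>\<^bsub>gr A 0\<^esub>" using B.nontrivial by (simp add: trivial_extension_simps)
    fix a assume a: "a \<in> carrier (gr A 0)" "a \<noteq> \<zero>\<^bsub>gr A 0\<^esub>"
    then obtain b where b: "a = (b, \<zero>\<^bsub>gr B (- n)\<^esub>)" "b \<in> carrier (gr B 0)" "b \<noteq> \<zero>\<^bsub>gr B 0\<^esub>"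
      using n by (auto simp: trivial_extension_simps)
    obtain b' where "b' \<in> carrier (gr B 0)" "mul B 0 0 b' b = unt B" using B.invertible[OF b(2,3)] by blast
    then show "\<exists>b\<in>carrier (gr A 0). mul A 0 0 b a = unt A"
      using b n by (intro bexI[of _ "(b', \<zero>\<^bsub>gr B (- n)\<^esub>)"]) (auto simp: trivial_extension_simps trivial_extension_mul_zero)
  qed
  have "socle_dga R A n (max N n) (\<zero>\<^bsub>gr B n\<^esub>, unt B) (\<lambda>(b, m). \<chi> m)"
  proof (intro socle_dga.intro field socle_dga_axioms.intro n)
    show "carrier (gr A i) = {\<zero>\<^bsub>gr A i\<^esub>}" if "i > max N n" for i
      using that N by (auto simp: trivial_extension_simps)
    show "(\<zero>\<^bsub>gr B n\<^esub>, unt B) \<in> carrier (gr A n)" using B.unt_closed by (simp add: trivial_extension_simps)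
    show "character (gr A n) (\<lambda>(b, m). \<chi> m)"
      using B.grp.character_add[OF \<chi>(1)] by (auto simp: character_def trivial_extension_simps)
    show "(case (\<zero>\<^bsub>gr B n\<^esub>, unt B) of (b, m) \<Rightarrow> \<chi> m) \<noteq> 0" using \<chi>(2) by simp
    show "(case mul A p q a b of (b, m) \<Rightarrow> \<chi> m) = 0" if "p \<ge> 1" "q \<ge> 1" "p + q = n" for p q a b
      using trivial_extension_mul_high[OF that(1,2), of "fst a" "snd a" "fst b" "snd b"] that(3) B.grp.character_zero[OF \<chi>(1)] by simp
    show "(case dd A (n + 1) a of (b, m) \<Rightarrow> \<chi> m) = 0" for a
      using trivial_extension_d[of "n + 1" "fst a" "snd a"] B.grp.character_zero[OF \<chi>(1)] by simp
    show "mul A l n a (\<zero>\<^bsub>gr B n\<^esub>, unt B) = \<zero>\<^bsub>gr A (l + n)\<^esub>" if "l \<ge> 1" "a \<in> carrier (gr A l)" for l a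
      using trivial_extension_mul_high[OF that(1) n, of "fst a" "snd a" "\<zero>\<^bsub>gr B n\<^esub>" "unt B"] that(2)
        B.mul_zero_right[of "fst a" l n] by (auto simp: trivial_extension_simps)
    show "dd A n (\<zero>\<^bsub>gr B n\<^esub>, unt B) = \<zero>\<^bsub>gr A (n - 1)\<^esub>"
      using trivial_extension_d[of n "\<zero>\<^bsub>gr B n\<^esub>" "unt B"] by (simp add: trivial_extension_simps)
  qed
  then show ?thesis by (rule that)
qed

end

lemma homologically_finite_exact:
  assumes "dg_module R A X" "homologically_finite A X"
  obtains s b :: int where "\<And>i. i < s \<Longrightarrow> exact_at X i" "\<And>i. i > b \<Longrightarrow> exact_at X i"
proof -
  interpret X: dg_module R A X by fact
  let ?S = "{i. \<not> exact_at X i}"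
  have fin: "finite ?S" using assms(2) by (simp add: homologically_finite_def zero_homology_iff[OF X.cplx.dg_complex_axioms])
  have "exact_at X i" if "i < Min (insert 0 ?S)" for i
    using Min_le[of "insert 0 ?S" i] fin that by auto
  moreover have "exact_at X i" if "i > Max (insert 0 ?S)" for i
    using Max_ge[of "insert 0 ?S" i] fin that by auto
  ultimately show ?thesis by (rule that)
qed

theorem theorem3p4:
  fixes R :: "('r, 's) ring_scheme" and \<mm> :: "'r set"
    and B :: "('r, 'b) dg_alg" and n :: nat
    and A :: "('r, 'b \<times> 'b) dg_alg"
    and X :: "('r, 'b \<times> 'b, 'x) dg_mod" and Y :: "('r, 'b \<times> 'b, 'y) dg_mod"
  assumes "noetherian_ring R" and "local_ring R \<mm>"
    and "local_dg_algebra_plus R \<mm> B" and "bounded_dg_algebra B"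
    and "n \<ge> 1"
    and "A = B \<ltimes> shift (int n) (residue_module B)"
    and "dg_module R A X" and "nonzero_dg_module X" and "homologically_finite A X"
    and "dg_module R A Y" and "nonzero_dg_module Y" and "homologically_finite A Y"
    and "\<exists>N. \<forall>i > N. zero_module (Tor R A i X Y)"
  shows "pd_finite R A X \<or> pd_finite R A Y"
proof -
  interpret X: dg_module R A X by fact
  have n: "int n \<ge> 1" using assms(5) by simp
  obtain N j0 lam where "socle_dga R A (int n) N j0 lam"
    by (rule trivial_extension_socle_dga[OF local_plus_field[OF assms(3)] n assms(6) X.dg_algebra_axioms assms(4)])
  then interpret socle_dga R A "int n" N j0 lam .
  obtain sX bX :: int where X_exact: "\<And>i. i < sX \<Longrightarrow> exact_at X i" "\<And>i. i > bX \<Longrightarrow> exact_at X i"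
    using homologically_finite_exact[OF assms(7,9)] by blast
  obtain sY bY :: int where Y_exact: "\<And>i. i < sY \<Longrightarrow> exact_at Y i" "\<And>i. i > bY \<Longrightarrow> exact_at Y i"
    using homologically_finite_exact[OF assms(10,12)] by blast
  obtain T0 where T0: "\<forall>t > T0. zero_module (Tor R A t X Y)" using assms(13) by blast
  show ?thesis
    by (rule pd_finite_if_Tor_vanishes[OF assms(7) X_exact assms(10) Y_exact T0[rule_format]])
qed

end
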